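(* Assume Assumption 1 and Assumption 2 below. Then there exist $\kappa_{\min},\beta_{\min}>0$ (depending on $X$, $\Phi_0$, $\mathcal{P}$) such that whenever $\kappa\ge\kappa_{\min}$, $\beta\ge\beta_{\min}$ and $\|\Upsilon\|_\kappa\le1$, the classical restriction $\mu^{\beta,X}$ of the (unique) equilibrium state at inverse temperature $\beta$ of $\Phi=\Phi_0+\Upsilon$ is Gibbsian. The same holds for the classical restriction of the (unique) ground state, i.e. for $\beta=\infty$.
   Context: Quantum spin system on $\mathbb{Z}^d$ with $\mathcal{H}_i\cong\mathcal{H}=\mathbb{C}^m$; interactions are translation invariant families of self-adjoint $\Phi(A)\in\mathcal{B}(\mathcal{H}_A)$, vanishing for non-connected $A$; $\|\Phi\|_\kappa=\sum_{A\ni0}e^{\kappa|A|}\|\Phi(A)\|$; $H^\Phi_\Lambda=\sum_{A\subset\Lambda}\Phi(A)$. The equilibrium state $\omega^\beta$ is the thermodynamic limit of $\omega^\beta_\Lambda(\cdot)=\mathrm{Tr}(e^{-\beta H^\Phi_\Lambda}\cdot)/\mathrm{Tr}(e^{-\beta H^\Phi_\Lambda})$ (unique in this regime), the ground state its $\beta\to\infty$ limit; $\mu^{\beta,X}=\lim_\Lambda\mu_\Lambda^{\beta,X}$ with $\mu^{\beta,X}_\Lambda(x_\Lambda)=\omega^\beta_\Lambda(Q_\Lambda(x_\Lambda))$. Assumption 1: $\Phi=\Phi_0+\Upsilon$ with $\Phi_0$ of finite range $r$, and there is a one-dimensional orthogonal projection $\mathcal{P}\in\mathcal{B}(\mathcal{H})$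 such that, with $\mathcal{P}_\Lambda(S)=(\bigotimes_{i\in S}\mathcal{P}_i^\perp)\otimes(\bigotimes_{i\in\Lambda\setminus S}\mathcal{P}_i)$, for all finite $\Lambda$ and $S\subset\Lambda$: (1) $H^{\Phi_0}_\Lambda$ commutes with $\mathcal{P}_\Lambda(S)$; (2) $H^{\Phi_0}_\Lambda\mathcal{P}_\Lambda(\emptyset)=0$; (3) there is a $\Lambda$-independent $g>0$ with $H^{\Phi_0}_\Lambda\mathcal{P}_\Lambda(S)\ge g|S|\mathcal{P}_\Lambda(S)$. Assumption 2: $X\in\mathcal{B}(\mathcal{H})$ is self-adjoint with spectral decomposition $X=\sum_xxQ(x)$ and $\mathrm{Tr}(Q(x)\mathcal{P})>0$ for all $x\in\mathrm{sp}(X)$. Classical restriction and Gibbsianness: $\mu^X(x_\Lambda)=\omega(\prod_{i\in\Lambda}Q_i(x_i))$ defines a measure on $\Omega=\mathrm{sp}(X)^{\mathbb{Z}^d}$; $\mu$ is Gibbsian if there is a translation-invariant classical potential $\Psi=\{\Psi_A:\Omega_A\to\mathbb{R}\}$ with $\sum_{A\ni0}\sup|\Psi_A|<\infty$ and $\mu(x_\Lambda\mid x_{\Lambda^c})=\mathcal{Z}_\Lambda(x_{\Lambda^c})^{-1}\exp[-\sum_{A\cap\Lambda\ne\emptyset}\Psi_A(x)]$ for all finite $\Lambda$ and $\mu$-a.e. $x_{\Lambda^c}$. *)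

theory Defs
  imports "HOL-Probability.Probability"
begin

section \<open>Lattice, configurations and operators\<close>

type_synonym 'd site = "'d \<Rightarrow> int"
type_synonym 'd cfg = "'d site \<Rightarrow> nat"
type_synonym 'd op = "'d cfg \<Rightarrow> 'd cfg \<Rightarrow> complex"
type_synonym smat = "nat \<Rightarrow> nat \<Rightarrow> complex"

definition origin :: "'d site" where "origin = (\<lambda>_. 0)"

definition shift :: "'d site \<Rightarrow> 'd site \<Rightarrow> 'd site" where
  "shift a i = (\<lambda>k. i k + a k)"

definition l1dist :: "'d::finite site \<Rightarrow> 'd site \<Rightarrow> int" where
  "l1dist x y = (\<Sum>k\<in>UNIV. \<bar>x k - y k\<bar>)"

text \<open>Connectedness w.r.t. nearest-neighbour adjacency on Z^d.\<close>
definition connected_Zd :: "'d::finite site set \<Rightarrow> bool" where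
  "connected_Zd A \<longleftrightarrow> A \<noteq> {} \<and>
     (\<forall>x\<in>A. \<forall>y\<in>A. (x, y) \<in> {(u, v). u \<in> A \<and> v \<in> A \<and> l1dist u v = 1}\<^sup>*)"

text \<open>Basis configurations of H_Lambda = tensor of C^m over Lambda.\<close>
definition confs :: "nat \<Rightarrow> 'd site set \<Rightarrow> 'd cfg set" where
  "confs m L = {\<sigma>. (\<forall>i\<in>L. \<sigma> i < m) \<and> (\<forall>i. i \<notin> L \<longrightarrow> \<sigma> i = 0)}"

definition restr :: "'d cfg \<Rightarrow> 'd site set \<Rightarrow> 'd cfg" where
  "restr \<sigma> A = (\<lambda>i. if i \<in> A then \<sigma> i else 0)"

definition mmul :: "'a set \<Rightarrow> ('a \<Rightarrow> 'a \<Rightarrow> complex) \<Rightarrow> ('a \<Rightarrow> 'a \<Rightarrow> complex) \<Rightarrow> ('a \<Rightarrow> 'a \<Rightarrow> complex)" where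
  "mmul S A B = (\<lambda>x y. \<Sum>z\<in>S. A x z * B z y)"

definition mapply :: "'a set \<Rightarrow> ('a \<Rightarrow> 'a \<Rightarrow> complex) \<Rightarrow> ('a \<Rightarrow> complex) \<Rightarrow> ('a \<Rightarrow> complex)" where
  "mapply S A v = (\<lambda>x. \<Sum>y\<in>S. A x y * v y)"

definition vnorm :: "'a set \<Rightarrow> ('a \<Rightarrow> complex) \<Rightarrow> real" where
  "vnorm S v = sqrt (\<Sum>x\<in>S. (cmod (v x))\<^sup>2)"

text \<open>Operator norm of the operator A on l^2(S).\<close>
definition opnorm :: "'a set \<Rightarrow> ('a \<Rightarrow> 'a \<Rightarrow> complex) \<Rightarrow> real" where
  "opnorm S A = Sup ((\<lambda>v. vnorm S (mapply S A v)) ` {v. vnorm S v \<le> 1})"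

definition mtrace :: "'a set \<Rightarrow> ('a \<Rightarrow> 'a \<Rightarrow> complex) \<Rightarrow> complex" where
  "mtrace S A = (\<Sum>x\<in>S. A x x)"

fun mpow :: "'a set \<Rightarrow> ('a \<Rightarrow> 'a \<Rightarrow> complex) \<Rightarrow> nat \<Rightarrow> ('a \<Rightarrow> 'a \<Rightarrow> complex)" where
  "mpow S A 0 = (\<lambda>x y. if x = y then 1 else 0)"
| "mpow S A (Suc k) = mmul S A (mpow S A k)"

text \<open>Matrix exponential exp(c A) on the finite index set S (power series).\<close>
definition mexp :: "'a set \<Rightarrow> complex \<Rightarrow> ('a \<Rightarrow> 'a \<Rightarrow> complex) \<Rightarrow> ('a \<Rightarrow> 'a \<Rightarrow> complex)" where
  "mexp S c A = (\<lambda>x y. \<Sum>k. c ^ k / of_nat (fact k) * mpow S A k x y)"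

text \<open>Positive semidefiniteness: the quadratic form is real and nonnegative.\<close>
definition psd :: "'a set \<Rightarrow> ('a \<Rightarrow> 'a \<Rightarrow> complex) \<Rightarrow> bool" where
  "psd S A \<longleftrightarrow> (\<forall>v. let q = (\<Sum>x\<in>S. \<Sum>y\<in>S. cnj (v x) * A x y * v y) in Im q = 0 \<and> Re q \<ge> 0)"

text \<open>Embedding of an operator on H_A into H_L (tensoring with the identity on L - A).\<close>
definition embed :: "'d site set \<Rightarrow> 'd site set \<Rightarrow> 'd op \<Rightarrow> 'd op" where
  "embed L A M = (\<lambda>\<sigma> \<tau>. if (\<forall>i\<in>L - A. \<sigma> i = \<tau> i) then M (restr \<sigma> A) (restr \<tau> A) else 0)"

section \<open>Interactions\<close>

text \<open>Interaction: Phi A is an operator on H_A; self-adjoint, translation invariant,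
  vanishing unless A is finite and connected.\<close>
definition interaction :: "nat \<Rightarrow> ('d::finite site set \<Rightarrow> 'd op) \<Rightarrow> bool" where
  "interaction m \<Phi> \<longleftrightarrow>
     (\<forall>A. \<forall>\<sigma>\<in>confs m A. \<forall>\<tau>\<in>confs m A. \<Phi> A \<sigma> \<tau> = cnj (\<Phi> A \<tau> \<sigma>)) \<and>
     (\<forall>A a. \<forall>\<sigma>\<in>confs m (shift a ` A). \<forall>\<tau>\<in>confs m (shift a ` A).
         \<Phi> (shift a ` A) \<sigma> \<tau> = \<Phi> A (\<sigma> \<circ> shift a) (\<tau> \<circ> shift a)) \<and>
     (\<forall>A. \<not> (finite A \<and> connected_Zd A) \<longrightarrow> \<Phi> A = (\<lambda>_ _. 0))"

definition int_norm :: "nat \<Rightarrow> real \<Rightarrow> ('d::finite site set \<Rightarrow> 'd op) \<Rightarrow> ennreal" where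
  "int_norm m \<kappa> \<Phi> =
     (\<Sum>\<^sub>\<infinity>A\<in>{A. finite A \<and> origin \<in> A}. ennreal (exp (\<kappa> * real (card A)) * opnorm (confs m A) (\<Phi> A)))"

definition finite_range :: "real \<Rightarrow> ('d::finite site set \<Rightarrow> 'd op) \<Rightarrow> bool" where
  "finite_range r \<Phi> \<longleftrightarrow> (\<forall>A. (\<exists>x\<in>A. \<exists>y\<in>A. real_of_int (l1dist x y) > r) \<longrightarrow> \<Phi> A = (\<lambda>_ _. 0))"

definition ham :: "('d site set \<Rightarrow> 'd op) \<Rightarrow> 'd site set \<Rightarrow> 'd op" where
  "ham \<Phi> L = (\<lambda>\<sigma> \<tau>. \<Sum>A\<in>Pow L. embed L A (\<Phi> A) \<sigma> \<tau>)"

section \<open>Single-site projections\<close>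

text \<open>One-dimensional orthogonal projection on C^m, i.e. |u><u| for a unit vector u.\<close>
definition proj1 :: "nat \<Rightarrow> smat \<Rightarrow> bool" where
  "proj1 m P \<longleftrightarrow> (\<exists>u. (\<Sum>i<m. (cmod (u i))\<^sup>2) = 1 \<and> (\<forall>i<m. \<forall>j<m. P i j = u i * cnj (u j)))"

definition perp :: "smat \<Rightarrow> smat" where
  "perp P = (\<lambda>i j. (if i = j then 1 else 0) - P i j)"

text \<open>P_L(S) = (tensor over S of P^perp) tensor (tensor over L - S of P).\<close>
definition PL :: "smat \<Rightarrow> 'd site set \<Rightarrow> 'd site set \<Rightarrow> 'd op" where
  "PL P L S = (\<lambda>\<sigma> \<tau>. (\<Prod>i\<in>S. perp P (\<sigma> i) (\<tau> i)) * (\<Prod>i\<in>L - S. P (\<sigma> i) (\<tau> i)))"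

text \<open>Assumption 1 for Phi0 and P.\<close>
definition assumption1 :: "nat \<Rightarrow> ('d::finite site set \<Rightarrow> 'd op) \<Rightarrow> smat \<Rightarrow> bool" where
  "assumption1 m \<Phi>0 P \<longleftrightarrow>
     interaction m \<Phi>0 \<and> (\<exists>r. finite_range r \<Phi>0) \<and> proj1 m P \<and>
     (\<forall>L S. finite L \<longrightarrow> S \<subseteq> L \<longrightarrow>
        (\<forall>\<sigma>\<in>confs m L. \<forall>\<tau>\<in>confs m L.
           mmul (confs m L) (ham \<Phi>0 L) (PL P L S) \<sigma> \<tau> = mmul (confs m L) (PL P L S) (ham \<Phi>0 L) \<sigma> \<tau>)) \<and>
     (\<forall>L. finite L \<longrightarrow>
        (\<forall>\<sigma>\<in>confs m L. \<forall>\<tau>\<in>confs m L. mmul (confs m L) (ham \<Phi>0 L) (PL P L {}) \<sigma> \<tau> = 0)) \<and>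
     (\<exists>g>0. \<forall>L S. finite L \<longrightarrow> S \<subseteq> L \<longrightarrow>
        psd (confs m L) (\<lambda>\<sigma> \<tau>. mmul (confs m L) (ham \<Phi>0 L) (PL P L S) \<sigma> \<tau>
                               - complex_of_real (g * real (card S)) * PL P L S \<sigma> \<tau>))"

text \<open>X self-adjoint on C^m with spectral decomposition X = sum over x in spX of x Q(x).\<close>
definition spectral_decomp :: "nat \<Rightarrow> smat \<Rightarrow> real set \<Rightarrow> (real \<Rightarrow> smat) \<Rightarrow> bool" where
  "spectral_decomp m X spX Q \<longleftrightarrow>
     finite spX \<and> spX \<noteq> {} \<and>
     (\<forall>x\<in>spX. (\<forall>i<m. \<forall>j<m. Q x i j = cnj (Q x j i)) \<and>
               (\<forall>i<m. \<forall>j<m. (\<Sum>k<m. Q x i k * Q x k j) = Q x i j) \<and>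
               (\<exists>i<m. \<exists>j<m. Q x i j \<noteq> 0)) \<and>
     (\<forall>x\<in>spX. \<forall>y\<in>spX. x \<noteq> y \<longrightarrow> (\<forall>i<m. \<forall>j<m. (\<Sum>k<m. Q x i k * Q y k j) = 0)) \<and>
     (\<forall>i<m. \<forall>j<m. (\<Sum>x\<in>spX. Q x i j) = (if i = j then 1 else 0)) \<and>
     (\<forall>i<m. \<forall>j<m. X i j = (\<Sum>x\<in>spX. complex_of_real x * Q x i j))"

definition assumption2 :: "nat \<Rightarrow> smat \<Rightarrow> real set \<Rightarrow> (real \<Rightarrow> smat) \<Rightarrow> smat \<Rightarrow> bool" where
  "assumption2 m X spX Q P \<longleftrightarrow>
     spectral_decomp m X spX Q \<and>
     (\<forall>x\<in>spX. Re (\<Sum>i<m. \<Sum>j<m. Q x i j * P j i) > 0)"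

section \<open>Finite-volume states and classical restriction\<close>

definition gibbs_state :: "nat \<Rightarrow> ('d site set \<Rightarrow> 'd op) \<Rightarrow> real \<Rightarrow> 'd site set \<Rightarrow> 'd op \<Rightarrow> complex" where
  "gibbs_state m \<Phi> \<beta> L A =
     (let E = mexp (confs m L) (- complex_of_real \<beta>) (ham \<Phi> L)
      in mtrace (confs m L) (mmul (confs m L) E A) / mtrace (confs m L) E)"

text \<open>Q_V(eta) tensored with the identity, as an operator on H_L.\<close>
definition QV :: "(real \<Rightarrow> smat) \<Rightarrow> 'd site set \<Rightarrow> ('d site \<Rightarrow> real) \<Rightarrow> 'd site set \<Rightarrow> 'd op" where
  "QV Q V \<eta> L = (\<lambda>\<sigma> \<tau>. (\<Prod>i\<in>V. Q (\<eta> i) (\<sigma> i) (\<tau> i)) * (if \<forall>i\<in>L - V. \<sigma> i = \<tau> i then 1 else 0))"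

text \<open>mu_L^{beta,X}(eta_V) = omega_L^beta(Q_V(eta_V))\<close>
definition mu_fin :: "nat \<Rightarrow> ('d site set \<Rightarrow> 'd op) \<Rightarrow> (real \<Rightarrow> smat) \<Rightarrow> real \<Rightarrow> 'd site set \<Rightarrow> 'd site set \<Rightarrow> ('d site \<Rightarrow> real) \<Rightarrow> real" where
  "mu_fin m \<Phi> Q \<beta> L V \<eta> = Re (gibbs_state m \<Phi> \<beta> L (QV Q V \<eta> L))"

text \<open>Thermodynamic limit along the net of finite subsets of Z^d.\<close>
definition mu_lim :: "nat \<Rightarrow> ('d site set \<Rightarrow> 'd op) \<Rightarrow> (real \<Rightarrow> smat) \<Rightarrow> real \<Rightarrow> 'd site set \<Rightarrow> ('d site \<Rightarrow> real) \<Rightarrow> real" where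
  "mu_lim m \<Phi> Q \<beta> V \<eta> = Lim (finite_subsets_at_top UNIV) (\<lambda>L. mu_fin m \<Phi> Q \<beta> L V \<eta>)"

section \<open>Classical configurations and Gibbs measures\<close>

definition Omega_space :: "real set \<Rightarrow> ('d site \<Rightarrow> real) measure" where
  "Omega_space spX = PiM UNIV (\<lambda>_. count_space spX)"

definition cyl :: "real set \<Rightarrow> 'd site set \<Rightarrow> ('d site \<Rightarrow> real) \<Rightarrow> ('d site \<Rightarrow> real) set" where
  "cyl spX V \<eta> = {x \<in> space (Omega_space spX). \<forall>i\<in>V. x i = \<eta> i}"

definition is_prob_on_Omega :: "real set \<Rightarrow> ('d site \<Rightarrow> real) measure \<Rightarrow> bool" where
  "is_prob_on_Omega spX \<mu> \<longleftrightarrow> prob_space \<mu> \<and> sets \<mu> = sets (Omega_space spX) \<and> space \<mu> = space (Omega_space spX)"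

text \<open>Sigma-algebra generated by the coordinates outside L.\<close>
definition outside_alg :: "('d site \<Rightarrow> real) measure \<Rightarrow> 'd site set \<Rightarrow> ('d site \<Rightarrow> real) measure" where
  "outside_alg \<mu> L = sigma (space \<mu>) {{x \<in> space \<mu>. x i = a} | i a. i \<notin> L}"

definition glue :: "'d site set \<Rightarrow> ('d site \<Rightarrow> real) \<Rightarrow> ('d site \<Rightarrow> real) \<Rightarrow> ('d site \<Rightarrow> real)" where
  "glue L \<xi> x = (\<lambda>i. if i \<in> L then \<xi> i else x i)"

definition energy :: "('d site set \<Rightarrow> ('d site \<Rightarrow> real) \<Rightarrow> real) \<Rightarrow> 'd site set \<Rightarrow> ('d site \<Rightarrow> real) \<Rightarrow> real" where
  "energy \<Psi> L x = (\<Sum>\<^sub>\<infinity>A\<in>{A. finite A \<and> A \<inter> L \<noteq> {}}. \<Psi> A x)"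

definition partition_fn :: "real set \<Rightarrow> ('d site set \<Rightarrow> ('d site \<Rightarrow> real) \<Rightarrow> real) \<Rightarrow> 'd site set \<Rightarrow> ('d site \<Rightarrow> real) \<Rightarrow> real" where
  "partition_fn spX \<Psi> L x = (\<Sum>\<xi>\<in>PiE L (\<lambda>_. spX). exp (- energy \<Psi> L (glue L \<xi> x)))"

text \<open>Translation invariant classical potential with sum over A containing 0 of sup|Psi_A| finite.\<close>
definition potential :: "real set \<Rightarrow> ('d::finite site set \<Rightarrow> ('d site \<Rightarrow> real) \<Rightarrow> real) \<Rightarrow> bool" where
  "potential spX \<Psi> \<longleftrightarrow>
     (\<forall>A x y. (\<forall>i\<in>A. x i = y i) \<longrightarrow> \<Psi> A x = \<Psi> A y) \<and>
     (\<forall>A a x. \<Psi> (shift a ` A) x = \<Psi> A (x \<circ> shift a)) \<and>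
     (\<lambda>A. Sup ((\<lambda>x. \<bar>\<Psi> A x\<bar>) ` space (Omega_space spX))) summable_on {A. finite A \<and> origin \<in> A}"

definition gibbsian :: "real set \<Rightarrow> ('d::finite site \<Rightarrow> real) measure \<Rightarrow> bool" where
  "gibbsian spX \<mu> \<longleftrightarrow>
     (\<exists>\<Psi>. potential spX \<Psi> \<and>
        (\<forall>L. finite L \<longrightarrow> (\<forall>\<eta>\<in>PiE L (\<lambda>_. spX).
           AE x in \<mu>. real_cond_exp \<mu> (outside_alg \<mu> L) (indicator (cyl spX L \<eta>)) x
                     = exp (- energy \<Psi> L (glue L \<eta> x)) / partition_fn spX \<Psi> L x)))"

text \<open>mu is the classical restriction (w.r.t. the spectral projections Q of X) of the
  thermodynamic-limit equilibrium state at inverse temperature beta.\<close>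
definition classical_restriction_eq :: "nat \<Rightarrow> ('d::finite site set \<Rightarrow> 'd op) \<Rightarrow> real set \<Rightarrow> (real \<Rightarrow> smat) \<Rightarrow> real \<Rightarrow> ('d site \<Rightarrow> real) measure \<Rightarrow> bool" where
  "classical_restriction_eq m \<Phi> spX Q \<beta> \<mu> \<longleftrightarrow>
     is_prob_on_Omega spX \<mu> \<and>
     (\<forall>V. finite V \<longrightarrow> (\<forall>\<eta>\<in>PiE V (\<lambda>_. spX).
        ((\<lambda>L. mu_fin m \<Phi> Q \<beta> L V \<eta>) \<longlongrightarrow> measure \<mu> (cyl spX V \<eta>)) (finite_subsets_at_top UNIV)))"

text \<open>Classical restriction of the ground state = beta \<rightarrow> infinity limit of the equilibrium states.\<close>
definition classical_restriction_gs :: "nat \<Rightarrow> ('d::finite site set \<Rightarrow> 'd op) \<Rightarrow> real set \<Rightarrow> (real \<Rightarrow> smat) \<Rightarrow> ('d site \<Rightarrow> real) measure \<Rightarrow> bool" where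
  "classical_restriction_gs m \<Phi> spX Q \<mu> \<longleftrightarrow>
     is_prob_on_Omega spX \<mu> \<and>
     (\<forall>V. finite V \<longrightarrow> (\<forall>\<eta>\<in>PiE V (\<lambda>_. spX).
        ((\<lambda>\<beta>. mu_lim m \<Phi> Q \<beta> V \<eta>) \<longlongrightarrow> measure \<mu> (cyl spX V \<eta>)) at_top))"

end

theory Submission
 imports Defs
begin

text \<open>Cut the inverse temperature into n slabs of thickness t of order \<beta>min. On a finite set A the slab operator
exp(-tH) is the sum over subsets of kernels, each the alternating sum over B of exp(-tH) on B times the projection P
on A - B. Expand such a kernel in \<Upsilon> and in the projections onto the sets of excited sites. If some site of A is far
from all excited sites and all supports of \<Upsilon>, then toggling it in B leaves the term unchanged and the alternating
sum vanishes; otherwise the gap g and the decay rate \<kappa> make the term exponentially small in the size of A. Hence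
Tr(exp(-\<beta>H) Q(x)), divided by the product of the positive numbers Tr(Q(x i) P), is the partition function of a dilute
polymer gas in space-time. The Moebius transform of its logarithm is summable, uniformly in x, in \<beta> and in the
volume. It depends on x only through clusters that meet the time boundary, so summing these over time gives the
potential. In finite volume the limit of infinite \<beta> exists by diagonalisation, and the bounds survive it.\<close>

section \<open>Moebius transforms and weighted norms\<close>

text \<open>A potential must be bounded uniformly in the configuration, so a supremum is taken for
  every cluster separately. Therefore the logarithm is estimated in a weighted algebra of set
  functions, normed by the suprema of Moebius coefficients; its product rule and an induction on the
  volume take the place of tree graph estimates. An extra outcome \<open>None\<close>, for a site
  that is not measured, makes every marginal a partition function of the same kind and normalises
  the potential, so that conditional probabilities follow from marginals alone. Activities factorise
  although a rank-one projection is not a scalar: exchanging the paths of two replicas separates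
  distant excitations. The trace closes time into a circle, so the two boundary layers have to count
  as neighbours. Two bounds must not see the number of slabs. Slabs of thickness between the least
  inverse temperature and its double keep all constants fixed, and boundary clusters are translated
  to one site before they are counted, which avoids a sum over times. The constants are fixed in the
  order: smallness of the gas, slab thickness from the gap, decay rate from both.\<close>

definition mob :: "('v set => 'b::comm_ring_1) => 'v set => 'b" where
 "mob f A = (\<Sum>B\<in>Pow A. (-1) ^ card (A - B) * f B)"

lemma mob_cong: "(!!B. B \<subseteq> A ==> f B = g B) ==> mob f A = mob g A"
 unfolding mob_def by (intro sum.cong) auto

text \<open>Moebius inversion as a recognition principle: a function whose subset sums reproduce
  \<open>f\<close> below \<open>A\<close> must be the transform. The rules for products, deletions
  and indicators come from it by exhibiting such a function.\<close>

lemma mob_unique: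
 assumes A: "finite A" and f: "!!D. D \<subseteq> A ==> f D = sum g (Pow D)"
 shows "mob f A = g A"
proof -
 have "g A = (\<Sum>T\<in>Pow A. (-1) ^ (card A - card T) * sum g (Pow T))"
  by (rule inclusion_exclusion_mobius[OF refl A])
 also have "... = mob f A"
  unfolding mob_def
  by (intro sum.cong) (use f A in "auto simp: card_Diff_subset finite_subset")
 finally show ?thesis by simp
qed

lemma sum_mob:
 assumes "finite A"
 shows "sum (mob f) (Pow A) = f A"
proof -
 have g: "(-1) ^ card S * mob f S = (\<Sum>T\<in>Pow S. (-1) ^ card T * f T)" if "finite S" for S
 proof -
  have "(-1::'b) ^ card S * (-1) ^ card (S - T) = (-1) ^ card T" if "T \<subseteq> S" for T
  proof -
   have "card S = card T + card (S - T)"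
    using that \<open>finite S\<close> by (metis card_Diff_subset card_mono finite_subset le_add_diff_inverse)
   then show ?thesis by (simp add: power_add mult.assoc flip: power_mult_distrib)
  qed
  then show ?thesis
   unfolding mob_def sum_distrib_left
   by (intro sum.cong) (auto simp: mult.assoc[symmetric])
 qed
 have "f A = (\<Sum>T\<in>Pow A. (-1) ^ card T * ((-1) ^ card T * mob f T))"
  by (rule inclusion_exclusion_symmetric[OF _ assms]) (use g in auto)
 also have "... = sum (mob f) (Pow A)"
  by (simp add: mult.assoc[symmetric] flip: power_mult_distrib)
 finally show ?thesis by simp
qed

text \<open>Splitting the subsets by membership of \<open>x\<close> turns the transform into one of
  a discrete derivative in \<open>x\<close>. For a logarithm this derivative is the log of a ratio
  of partition functions, which is what the expansion controls.\<close>

lemma mob_insert: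
 assumes "finite A" "x ~: A"
 shows "mob f (insert x A) = mob (%D. f (insert x D) - f D) A"
proof -
 have fin: "finite (Pow A)" using assms by simp
 have dis: "Pow A Int insert x ` Pow A = {}" using assms by auto
 have inj: "inj_on (insert x) (Pow A)" using assms by (auto simp: inj_on_def)
 have c1: "card (insert x A - B) = Suc (card (A - B))" if "B \<subseteq> A" for B
  using that assms by (subst insert_Diff_if) (auto simp: finite_Diff)
 have c2: "insert x A - insert x B = A - B" if "B \<subseteq> A" for B
  using that assms by auto
 have c3: "A - insert x B = A - B" for B
  using assms by auto
 have "mob f (insert x A) = (\<Sum>B\<in>Pow A. (-1) ^ card (insert x A - B) * f B)
   + (\<Sum>B\<in>Pow A. (-1) ^ card (insert x A - insert x B) * f (insert x B))"
  unfolding mob_def Pow_insert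
  by (subst sum.union_disjoint) (use fin dis inj in "auto simp: sum.reindex")
 also have "... = (\<Sum>B\<in>Pow A. - ((-1) ^ card (A - B) * f B))
   + (\<Sum>B\<in>Pow A. (-1) ^ card (A - B) * f (insert x B))"
  by (intro arg_cong2[where f = "(+)"] sum.cong) (auto simp: c1 c2 c3)
 also have "... = mob (%D. f (insert x D) - f D) A"
  unfolding mob_def by (simp add: sum_negf algebra_simps sum_subtractf)
 finally show ?thesis .
qed

lemma mob_add: "mob (%D. f D + g D) A = mob f A + mob g A"
 unfolding mob_def by (simp add: algebra_simps sum.distrib)

text \<open>When both factors are expanded into coefficients, a pair of sets \<open>A\<close>,
  \<open>B\<close> contributes to \<open>D\<close> as soon as \<open>A Un B\<close> lies in
  \<open>D\<close>: a pointwise product becomes a convolution over unions. This is what makes the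
  norm below submultiplicative.\<close>

lemma mob_mult:
 assumes "finite C"
 shows "mob (%D. f D * g D) C
  = (\<Sum>(A, B)\<in>{(A, B)\<in>Pow C \<times> Pow C. A Un B = C}. mob f A * mob g B)"
proof (rule mob_unique[OF assms])
 fix D assume D: "D \<subseteq> C"
 then have fD: "finite D" using assms finite_subset by blast
 have "f D * g D = sum (mob f) (Pow D) * sum (mob g) (Pow D)"
  by (simp add: sum_mob fD)
 also have "... = (\<Sum>(A, B)\<in>Pow D \<times> Pow D. mob f A * mob g B)"
  by (simp add: sum_product sum.cartesian_product)
 also have "... = (\<Sum>E\<in>Pow D. \<Sum>(A, B)\<in>{p : Pow D \<times> Pow D. fst p Un snd p = E}. mob f A * mob g B)"
  by (rule sum.group[symmetric]) (use fD in auto)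
 also have "... = (\<Sum>E\<in>Pow D. \<Sum>(A, B)\<in>{(A, B)\<in>Pow E \<times> Pow E. A Un B = E}. mob f A * mob g B)"
  by (intro sum.cong) auto
 finally show "f D * g D = (\<Sum>E\<in>Pow D. \<Sum>(A, B)\<in>{(A, B)\<in>Pow E \<times> Pow E. A Un B = E}. mob f A * mob g B)" .
qed

text \<open>A function of \<open>D - T\<close> does not see the points of \<open>T\<close>, hence
  has no coefficient on a set meeting \<open>T\<close>; the other coefficients are
  unchanged.\<close>

lemma mob_Diff:
 assumes "finite A"
 shows "mob (%D. f (D - T)) A = (if A Int T = {} then mob f A else 0)"
proof (rule mob_unique[OF assms, where g = "%A. if A Int T = {} then mob f A else 0"])
 fix D assume "D \<subseteq> A"
 then have fD: "finite D" using assms finite_subset by blast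
 have "f (D - T) = sum (mob f) (Pow (D - T))" by (simp add: sum_mob fD)
 also have "... = (\<Sum>A\<in>Pow D. if A Int T = {} then mob f A else 0)"
  by (rule sum.mono_neutral_cong_left) (use fD in auto)
 finally show "f (D - T) = (\<Sum>A\<in>Pow D. if A Int T = {} then mob f A else 0)" .
qed

lemma mob_indicator:
 assumes "finite A"
 shows "mob (%D. if C \<subseteq> D then c else 0) A = (if A = C then c else 0)"
proof (rule mob_unique[OF assms, where g = "%A. if A = C then c else 0"])
 fix D assume "D \<subseteq> A"
 then have fD: "finite D" using assms finite_subset by blast
 show "(if C \<subseteq> D then c else 0) = (\<Sum>A\<in>Pow D. if A = C then c else 0)"
  using fD by (simp add: sum.delta)
qed

section \<open>A weighted algebra norm on set functions\<close>

locale wiener =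
 fixes \<theta> :: real and Y :: "'y set"
 assumes \<theta>: "\<theta> \<ge> 1" and Y: "finite Y" "Y ~= {}"
begin

definition supn :: "('y => complex) => real" where
 "supn g = Max ((%y. cmod (g y)) ` Y)"

lemma supn_ge: "y : Y ==> cmod (g y) <= supn g"
 unfolding supn_def using Y by (intro Max_ge) auto

lemma supn_le: "(!!y. y : Y ==> cmod (g y) <= c) ==> supn g <= c"
 unfolding supn_def using Y by (subst Max_le_iff) auto

lemma supn_nonneg: "0 <= supn g"
 using supn_ge[of _ g] Y(2) norm_ge_zero order_trans by blast

text \<open>An l1 norm of Moebius coefficients with weight \<open>\<theta>\<close> per point. The
  supremum over the parameters \<open>Y\<close> stands inside the sum, so a bound on
  \<open>nm\<close> remains valid when a different parameter is chosen for every set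
  \<open>A\<close>.\<close>

definition nm :: "'v set => ('v set => 'y => complex) => real" where
 "nm N f = (\<Sum>A\<in>Pow N. \<theta> ^ card A * supn (%y. mob (%D. f D y) A))"

lemma nm_nonneg: "0 <= nm N f"
 unfolding nm_def using \<theta> supn_nonneg by (intro sum_nonneg) auto

lemma nm_cong:
 "(!!D y. D \<subseteq> N ==> y : Y ==> f D y = g D y) ==> nm N f = nm N g"
 unfolding nm_def supn_def
 by (intro sum.cong refl arg_cong2[where f = times] arg_cong[where f = Max] image_cong
    arg_cong[where f = cmod] mob_cong) auto

lemma nm_mono:
 assumes "!!A y. A \<subseteq> N ==> y : Y ==> cmod (mob (%D. f D y) A) <= cmod (mob (%D. g D y) A)"
 shows "nm N f <= nm N g"
 unfolding nm_def using \<theta>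
 by (intro sum_mono mult_left_mono supn_le order_trans[OF assms supn_ge]) auto

lemma nm_add: "nm N (%D y. f D y + g D y) <= nm N f + nm N g"
proof -
 have "supn (%y. mob (%D. f D y + g D y) A)
   <= supn (%y. mob (%D. f D y) A) + supn (%y. mob (%D. g D y) A)" for A
  unfolding mob_add by (intro supn_le order_trans[OF norm_triangle_ineq] add_mono supn_ge)
 then have "nm N (%D y. f D y + g D y) <= (\<Sum>A\<in>Pow N. \<theta> ^ card A *
   (supn (%y. mob (%D. f D y) A) + supn (%y. mob (%D. g D y) A)))"
  unfolding nm_def using \<theta> by (intro sum_mono mult_left_mono) auto
 then show ?thesis unfolding nm_def by (simp add: algebra_simps sum.distrib)
qed

lemma nm_zero: "nm N (%D y. 0) = 0"
 unfolding nm_def supn_def mob_def using Y by (simp add: image_constant_conv)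

lemma nm_sum:
 assumes "finite I"
 shows "nm N (%D y. \<Sum>i\<in>I. f i D y) <= (\<Sum>i\<in>I. nm N (f i))"
 using assms
proof (induction I rule: finite_induct)
 case empty
 then show ?case by (simp add: nm_zero)
next
 case (insert i I)
 then show ?case using nm_add[of N "f i" "%D y. \<Sum>i\<in>I. f i D y"] by simp
qed

text \<open>Union convolution together with
  \<open>\<theta> ^ card (A Un B) <= \<theta> ^ (card A + card B)\<close>, valid because
  \<open>\<theta>\<close> is at least 1. Suprema of products are bounded by products of
  suprema.\<close>

lemma nm_mult:
 assumes N: "finite N"
 shows "nm N (%D y. f D y * g D y) <= nm N f * nm N g"
proof -
 let ?a = "%A. supn (%y. mob (%D. f D y) A)" and ?b = "%A. supn (%y. mob (%D. g D y) A)"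
 have "\<theta> ^ card C * supn (%y. mob (%D. f D y * g D y) C)
  <= (\<Sum>(A, B)\<in>{p : Pow N \<times> Pow N. fst p Un snd p = C}. (\<theta> ^ card A * ?a A) * (\<theta> ^ card B * ?b B))"
  if C: "C : Pow N" for C
 proof -
  have fC: "finite C" using C N finite_subset by auto
  let ?P = "{(A, B)\<in>Pow C \<times> Pow C. A Un B = C}"
  have eq: "{p : Pow N \<times> Pow N. fst p Un snd p = C} = ?P"
   using C by auto
  have "supn (%y. mob (%D. f D y * g D y) C)
   <= (\<Sum>(A, B)\<in>?P. ?a A * ?b B)"
  proof (rule supn_le)
   fix y assume y: "y : Y"
   show "cmod (mob (%D. f D y * g D y) C)
    <= (\<Sum>(A, B)\<in>?P. ?a A * ?b B)"
    unfolding mob_mult[OF fC]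
    by (rule order_trans[OF norm_sum], rule sum_mono)
     (auto simp: norm_mult intro!: mult_mono supn_ge[OF y] supn_nonneg)
  qed
  then have "\<theta> ^ card C * supn (%y. mob (%D. f D y * g D y) C)
   <= (\<Sum>(A, B)\<in>?P. \<theta> ^ card C * (?a A * ?b B))"
   using \<theta> by (simp add: sum_distrib_left[symmetric] case_prod_beta' mult_left_mono)
  also have "... <= (\<Sum>(A, B)\<in>?P. (\<theta> ^ card A * ?a A) * (\<theta> ^ card B * ?b B))"
  proof (rule sum_mono, clarify)
   fix A B assume "A \<subseteq> A Un B" "C = A Un B"
   have "\<theta> ^ card (A Un B) <= \<theta> ^ (card A + card B)"
    using \<theta> by (intro power_increasing card_Un_le) auto
   then have "\<theta> ^ card (A Un B) * (?a A * ?b B) <= \<theta> ^ (card A + card B) * (?a A * ?b B)"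
    by (intro mult_right_mono mult_nonneg_nonneg supn_nonneg) auto
   then show "\<theta> ^ card (A Un B) * (?a A * ?b B) <= \<theta> ^ card A * ?a A * (\<theta> ^ card B * ?b B)"
    by (simp add: power_add mult_ac)
  qed
  finally show ?thesis unfolding eq .
 qed
 then have "nm N (%D y. f D y * g D y) <= (\<Sum>C\<in>Pow N.
  (\<Sum>(A, B)\<in>{p : Pow N \<times> Pow N. fst p Un snd p = C}. (\<theta> ^ card A * ?a A) * (\<theta> ^ card B * ?b B)))"
  unfolding nm_def by (rule sum_mono)
 also have "... = (\<Sum>(A, B)\<in>Pow N \<times> Pow N. (\<theta> ^ card A * ?a A) * (\<theta> ^ card B * ?b B))"
  by (rule sum.group) (use N in auto)
 also have "... = nm N f * nm N g"
  unfolding nm_def by (simp add: sum_product sum.cartesian_product)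
 finally show ?thesis .
qed

lemma nm_single:
 assumes "finite N"
 shows "nm N (%D y. if C \<subseteq> D then g y else 0) <= \<theta> ^ card C * supn g"
proof -
 have "nm N (%D y. if C \<subseteq> D then g y else 0)
  = (\<Sum>A\<in>Pow N. if A = C then \<theta> ^ card C * supn g else 0)"
  unfolding nm_def
 proof (intro sum.cong refl)
  fix A assume "A : Pow N"
  then have "finite A" using assms finite_subset by auto
  then show "\<theta> ^ card A * supn (%y. mob (%D. if C \<subseteq> D then g y else 0) A)
   = (if A = C then \<theta> ^ card C * supn g else 0)"
   unfolding mob_indicator[OF \<open>finite A\<close>] using Y by (auto simp: supn_def image_constant_conv)
 qed
 also have "... <= \<theta> ^ card C * supn g"
  using assms \<theta> supn_nonneg[of g] by (simp add: sum.delta)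
 finally show ?thesis .
qed

lemma supn_const: "supn (%y. c) = cmod c"
 unfolding supn_def using Y by (simp add: image_constant_conv)

lemma nm_const: "finite N ==> nm N (%D y. c) <= cmod c"
 using nm_single[of N "{}" "%y. c"] by (simp add: supn_const)

lemma nm_scale: "finite N ==> nm N (%D y. c * f D y) <= cmod c * nm N f"
 using nm_mult[of N "%D y. c" f] nm_const[of N c] nm_nonneg[of N f]
 by (meson mult_right_mono order_trans)

lemma nm_power: "finite N ==> nm N (%D y. h D y ^ k) <= nm N h ^ k"
proof (induction k)
 case 0
 then show ?case using nm_const[of N 1] by simp
next
 case (Suc k)
 then have "nm N (%D y. h D y * h D y ^ k) <= nm N h * nm N h ^ k"
  by (intro order_trans[OF nm_mult] mult_left_mono nm_nonneg) auto
 then show ?case by simp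
qed

lemma nm_ge:
 assumes "finite N" "D \<subseteq> N" "y : Y"
 shows "cmod (f D y) <= nm N f"
proof -
 have fD: "finite D" using assms finite_subset by blast
 have "f D y = (\<Sum>A\<in>Pow D. mob (%D. f D y) A)" by (simp add: sum_mob fD)
 also have "cmod ... <= (\<Sum>A\<in>Pow D. supn (%y. mob (%D. f D y) A))"
  by (intro order_trans[OF norm_sum] sum_mono supn_ge assms)
 also have "... <= (\<Sum>A\<in>Pow N. supn (%y. mob (%D. f D y) A))"
  using assms supn_nonneg by (intro sum_mono2) auto
 also have "... <= nm N f" unfolding nm_def
 proof (rule sum_mono)
  fix A
  show "supn (%y. mob (%D. f D y) A) <= \<theta> ^ card A * supn (%y. mob (%D. f D y) A)"
   using mult_right_mono[OF one_le_power[OF \<theta>] supn_nonneg] by simp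
 qed
 finally show ?thesis .
qed

text \<open>Coefficients meeting \<open>T\<close> drop out, and what remains is the norm over the
  smaller set \<open>N - T\<close>. An induction on the ambient set can so reuse bounds obtained for
  smaller sets.\<close>

lemma nm_Diff:
 assumes "finite N"
 shows "nm N (%D. f (D - T)) <= nm (N - T) f"
proof -
 have "nm N (%D. f (D - T)) = (\<Sum>A\<in>Pow N. if A Int T = {} then \<theta> ^ card A * supn (%y. mob (%D. f D y) A) else 0)"
  unfolding nm_def
 proof (intro sum.cong refl)
  fix A assume "A : Pow N"
  then have "finite A" using assms finite_subset by auto
  then show "\<theta> ^ card A * supn (%y. mob (%D. f (D - T) y) A)
   = (if A Int T = {} then \<theta> ^ card A * supn (%y. mob (%D. f D y) A) else 0)"
   by (simp add: mob_Diff[where f = "%D. f D _"] supn_const)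
 qed
 also have "... = nm (N - T) f"
  unfolding nm_def by (rule sum.mono_neutral_cong_right) (use assms in auto)
 finally show ?thesis by simp
qed

lemma nm_subset: "finite N ==> M \<subseteq> N ==> nm M f <= nm N f"
 unfolding nm_def using \<theta> supn_nonneg by (intro sum_mono2) auto

text \<open>No Neumann series is summed: \<open>f = 1 - h * f\<close> for the inverse
  \<open>f\<close> gives \<open>nm N f <= 1 + nm N f / 2\<close>, which can be solved because
  \<open>nm\<close> is a finite sum. Pointwise invertibility comes from
  \<open>nm_ge\<close>.\<close>

lemma nm_inverse:
 assumes N: "finite N" and h: "nm N h <= 1/2"
 shows "nm N (%D y. 1 / (1 + h D y)) <= 2"
proof -
 let ?f = "%D y. 1 / (1 + h D y)"
 have nz: "1 + h D y ~= 0" if "D \<subseteq> N" "y : Y" for D y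
 proof
  assume "1 + h D y = 0"
  then have "h D y = -1" by (metis add_eq_0_iff)
  then have "cmod (h D y) = 1" by simp
  then show False using nm_ge[OF N that, of h] h by simp
 qed
 have "nm N ?f = nm N (%D y. 1 + (-1) * (h D y * ?f D y))"
  by (intro nm_cong) (use nz in "auto simp: field_simps")
 also have "... <= nm N (%D y. 1) + nm N (%D y. (-1) * (h D y * ?f D y))" by (rule nm_add)
 also have "... <= 1 + 1 * (nm N h * nm N ?f)"
  using N nm_const[of N 1] nm_scale[of N "-1" "%D y. h D y * ?f D y"] nm_mult[of N h ?f] by simp
 also have "nm N h * nm N ?f <= 1/2 * nm N ?f" using h nm_nonneg by (intro mult_right_mono)
 finally show ?thesis by simp
qed

text \<open>On a finite ambient set the norm is dominated by finitely many pointwise values; this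
  makes bounds on it stable under pointwise limits.\<close>

lemma nm_crude:
 "nm N g <= (\<Sum>A\<in>Pow N. \<theta> ^ card A * (\<Sum>B\<in>Pow A. \<Sum>y\<in>Y. cmod (g B y)))"
 unfolding nm_def
proof (intro sum_mono mult_left_mono supn_le)
 fix A y assume y: "y : Y"
 have "cmod (mob (%D. g D y) A) <= (\<Sum>B\<in>Pow A. cmod (g B y))"
  unfolding mob_def by (rule order_trans[OF norm_sum]) (simp add: norm_mult norm_power)
 also have "... <= (\<Sum>B\<in>Pow A. \<Sum>y\<in>Y. cmod (g B y))"
  using y Y by (intro sum_mono member_le_sum) auto
 finally show "cmod (mob (%D. g D y) A) <= (\<Sum>B\<in>Pow A. \<Sum>y\<in>Y. cmod (g B y))" .
qed (use \<theta> in auto)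

lemma nm_lim:
 assumes N: "finite N" and lim: "!!D y. D \<subseteq> N ==> y : Y ==> (%k. f k D y) \<longlonglongrightarrow> g D y"
  and c: "!!k::nat. nm N (f k) <= c"
 shows "nm N g <= c"
proof -
 have "(%k. \<Sum>A\<in>Pow N. \<theta> ^ card A * (\<Sum>B\<in>Pow A. \<Sum>y\<in>Y. cmod (g B y - f k B y)))
  \<longlonglongrightarrow> (\<Sum>A\<in>Pow N. \<theta> ^ card A * (\<Sum>B\<in>Pow A. \<Sum>y\<in>Y. cmod (g B y - g B y)))"
  by (intro tendsto_sum tendsto_mult tendsto_norm tendsto_diff tendsto_const lim) auto
 then have "(%k. c + (\<Sum>A\<in>Pow N. \<theta> ^ card A * (\<Sum>B\<in>Pow A. \<Sum>y\<in>Y. cmod (g B y - f k B y)))) \<longlonglongrightarrow> c + 0"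
  by (intro tendsto_add tendsto_const) simp
 moreover have "nm N g <= c + (\<Sum>A\<in>Pow N. \<theta> ^ card A * (\<Sum>B\<in>Pow A. \<Sum>y\<in>Y. cmod (g B y - f k B y)))" for k
  using nm_add[of N "f k" "%D y. g D y - f k D y"] c[of k] nm_crude[of N "%D y. g D y - f k D y"] by simp
 ultimately show ?thesis using LIMSEQ_le_const by (metis (no_types, lifting) add.right_neutral)
qed

text \<open>The logarithm series has coefficients of modulus at most 1, so the powers of
  \<open>h\<close> are dominated by a geometric series of ratio 1/2. Passing from the complex
  logarithm to \<open>ln (cmod _)\<close> takes a real part, which commutes with the real signs of
  the transform and cannot increase coefficients.\<close>

lemma nm_ln:
 assumes N: "finite N" and h: "nm N h <= 1/2"
 shows "nm N (%D y. of_real (ln (cmod (1 + h D y)))) <= 2 * nm N h"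
proof -
 \<comment> \<open>The coefficient for \<open>k = 0\<close> is a division by zero, hence 0, in
   accordance with the missing constant term of the series.\<close>
 let ?c = "%k. (-1) ^ Suc k / of_nat k :: complex"
 let ?s = "%K D y. \<Sum>k<K. ?c k * h D y ^ k"
 let ?r = "%k. if k = 0 then 0 else (1/2) ^ (k - 1) :: real"
 have small: "cmod (h D y) < 1" if "D \<subseteq> N" "y : Y" for D y
  using nm_ge[OF N that, of h] h by simp
 have "nm N (%D y. ln (1 + h D y)) <= 2 * nm N h"
 proof (rule nm_lim[OF N, where f = ?s])
  show "(%K. ?s K D y) \<longlonglongrightarrow> ln (1 + h D y)" if "D \<subseteq> N" "y : Y" for D y
   using Ln_series[OF small[OF that]] by (simp add: sums_def)
  fix K
  have "nm N (?s K) <= (\<Sum>k<K. nm N (%D y. ?c k * h D y ^ k))" by (rule nm_sum) simp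
  also have "... <= (\<Sum>k<K. nm N h * ?r k)"
  proof (rule sum_mono)
   fix k
   show "nm N (%D y. ?c k * h D y ^ k) <= nm N h * ?r k"
   proof (cases k)
    case 0
    then show ?thesis by (simp add: nm_zero)
   next
    case (Suc j)
    have "nm N (%D y. ?c k * h D y ^ k) <= cmod (?c k) * nm N h ^ k"
     using nm_scale[OF N] nm_power[OF N] by (meson mult_left_mono norm_ge_zero order_trans)
    also have "... <= 1 * nm N h ^ k"
     using Suc by (intro mult_right_mono zero_le_power nm_nonneg) (auto simp: norm_divide norm_power norm_mult field_simps simp del: of_nat_Suc)
    also have "... <= nm N h * (1/2) ^ j"
     using Suc h nm_nonneg[of N h] by (simp add: mult_left_mono power_mono)
    finally show ?thesis using Suc by simp
   qed
  qed
  also have "... = nm N h * (\<Sum>k<K. ?r k)" by (simp add: sum_distrib_left)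
  also have "(\<Sum>k<K. ?r k) <= 2"
  proof (cases K)
   case (Suc J)
   have "(\<Sum>k<K. ?r k) = (\<Sum>k<J. (1/2::real) ^ k)"
    unfolding Suc by (subst sum.lessThan_Suc_shift) simp
   also have "... <= 2" by (subst sum_gp_strict) simp
   finally show ?thesis .
  qed simp
  finally show "nm N (?s K) <= 2 * nm N h" by (simp add: mult_left_mono mult_right_mono nm_nonneg mult.commute)
 qed
 moreover have "nm N (%D y. of_real (ln (cmod (1 + h D y)))) = nm N (%D y. of_real (Re (ln (1 + h D y))))"
 proof (rule nm_cong)
  fix D y assume "D \<subseteq> N" "y : Y"
  then have "1 + h D y ~= 0" using small[of D y] by (auto simp: add_eq_0_iff)
  then show "complex_of_real (ln (cmod (1 + h D y))) = of_real (Re (ln (1 + h D y)))" by simp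
 qed
 moreover have "nm N (%D y. of_real (Re (ln (1 + h D y)))) <= nm N (%D y. ln (1 + h D y))"
 proof (rule nm_mono)
  fix A y
  have "mob (%D. complex_of_real (Re (ln (1 + h D y)))) A = of_real (Re (mob (%D. ln (1 + h D y)) A))"
  proof -
   have "Re ((- 1) ^ k * z) = (- 1) ^ k * Re z" for k z
    by (cases "even k") auto
   then show ?thesis unfolding mob_def by simp
  qed
  then show "cmod (mob (%D. complex_of_real (Re (ln (1 + h D y)))) A) <= cmod (mob (%D. ln (1 + h D y)) A)"
   by (simp add: abs_Re_le_cmod)
 qed
 ultimately show ?thesis by linarith
qed

end

section \<open>The logarithm of a polymer partition function\<close>

definition edges_in :: "('v => 'v set) => 'v set => ('v \<times> 'v) set" where
 "edges_in nb C = {(a, b). a : C & b : C & b : nb a}"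

text \<open>Several roots, possibly outside \<open>C\<close>, are allowed so that the notion
  survives deleting a point: the neighbours of that point become roots in its place. Reachability is
  directed and stays inside \<open>C\<close>; \<open>nb\<close> may be asymmetric.\<close>

definition rooted :: "('v => 'v set) => 'v set => 'v set => bool" where
 "rooted nb R C \<longleftrightarrow> (ALL c:C. EX r:R Int C. (r, c) : (edges_in nb C)\<^sup>*)"

definition comp :: "('v => 'v set) => 'v => 'v set => 'v set" where
 "comp nb x E = {c : E. (x, c) : (edges_in nb E)\<^sup>*}"

definition halo :: "('v => 'v set) => 'v set => 'v set" where
 "halo nb C = C Un \<Union> (nb ` C)"

lemma rooted_remove:
 assumes "rooted nb R C" "y ~: C"
 shows "rooted nb (R - {y}) C"
 using assms unfolding rooted_def by blast

text \<open>On a path inside \<open>C\<close>, the part after the last visit to \<open>y\<close>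
  starts at a neighbour of \<open>y\<close>; a path that avoids \<open>y\<close> starts at one of
  the other roots.\<close>

lemma rooted_step:
 assumes "rooted nb R C" "y : C"
 shows "rooted nb ((R - {y}) Un nb y) (C - {y})"
 unfolding rooted_def
proof
 fix c assume c: "c : C - {y}"
 obtain r where r: "r : R Int C" "(r, c) : (edges_in nb C)\<^sup>*"
  using assms c unfolding rooted_def by blast
 let ?E = "(edges_in nb (C - {y}))\<^sup>*"
 from r(2) have "(c = y) \<or> (EX r':((R - {y}) Un nb y) Int (C - {y}). (r', c) : ?E)"
 proof (induction rule: rtrancl_induct)
  case base
  then show ?case using r by blast
 next
  case (step a b)
  then have ab: "a : C" "b : C" "b : nb a" by (auto simp: edges_in_def)
  show ?case
  proof (cases "b = y")
   case False
   show ?thesis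
   proof (cases "a = y")
    case True
    then show ?thesis using ab False by blast
   next
    case False
    then obtain r' where "r' : ((R - {y}) Un nb y) Int (C - {y})" "(r', a) : ?E" using step by blast
    moreover have "(a, b) : edges_in nb (C - {y})" using ab False \<open>b ~= y\<close> by (simp add: edges_in_def)
    ultimately show ?thesis by (meson rtrancl.rtrancl_into_rtrancl)
   qed
  qed simp
 qed
 then show "EX r':((R - {y}) Un nb y) Int (C - {y}). (r', c) : ?E" using c by blast
qed

text \<open>Induction on the ambient set. Sets that avoid a root \<open>y\<close> are rooted in the
  remaining roots; sets that contain it become, after removal of \<open>y\<close>, rooted with at
  most \<open>\<Delta>\<close> new roots, and cost a factor \<open>\<delta>\<close>. Both cases
  together give a factor \<open>1 + \<delta> * 2 ^ \<Delta> <= 2\<close> per root.\<close>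

lemma sum_rooted_le:
 fixes \<delta> :: real
 assumes "finite D" and nb: "!!x. finite (nb x)" "!!x. card (nb x) <= \<Delta>"
  and \<delta>: "0 <= \<delta>" "\<delta> * 2 ^ \<Delta> <= 1"
 shows "(\<Sum>C | C \<subseteq> D & rooted nb R C. \<delta> ^ card C) <= 2 ^ card (R Int D)"
 using assms(1)
proof (induction "card D" arbitrary: D R rule: less_induct)
 case less
 show ?case
 proof (cases "R Int D = {}")
  case True
  then have "{C. C \<subseteq> D & rooted nb R C} = {{}}"
   unfolding rooted_def by blast
  then show ?thesis using True by simp
 next
  case False
  then obtain y where y: "y : R" "y : D" by blast
  let ?D = "D - {y}" and ?R = "R - {y}"
  let ?A = "{C. C \<subseteq> ?D & rooted nb ?R C}" and ?B = "{C. C \<subseteq> ?D & rooted nb (?R Un nb y) C}"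
  have fA: "finite ?A" "finite ?B" using less.prems by auto
  have lt: "card ?D < card D" using y less.prems by (intro card_Diff1_less)
  have sub: "{C. C \<subseteq> D & rooted nb R C} \<subseteq> ?A Un insert y ` ?B"
  proof
   fix C assume C: "C : {C. C \<subseteq> D & rooted nb R C}"
   show "C : ?A Un insert y ` ?B"
   proof (cases "y : C")
    case True
    then have "C - {y} : ?B" "C = insert y (C - {y})" using C rooted_step[of nb R C y] by auto
    then show ?thesis by blast
   next
    case False
    then show ?thesis using C rooted_remove[of nb R C y] by auto
   qed
  qed
  have cR: "card (R Int D) = Suc (card (?R Int ?D))"
  proof -
   have "R Int D = insert y (?R Int ?D)" using y by auto
   then show ?thesis using less.prems by simp
  qed
  have cR2: "card ((?R Un nb y) Int ?D) <= card (?R Int ?D) + \<Delta>"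
  proof -
   have "card ((?R Un nb y) Int ?D) <= card (?R Int ?D Un nb y)"
    using nb less.prems by (intro card_mono) auto
   also have "... <= card (?R Int ?D) + card (nb y)" by (rule card_Un_le)
   finally show ?thesis using nb(2)[of y] by linarith
  qed
  have "(\<Sum>C | C \<subseteq> D & rooted nb R C. \<delta> ^ card C) <= (\<Sum>C\<in>?A Un insert y ` ?B. \<delta> ^ card C)"
   using sub fA \<delta> by (intro sum_mono2) auto
  also have "... = (\<Sum>C\<in>?A. \<delta> ^ card C) + (\<Sum>C\<in>insert y ` ?B. \<delta> ^ card C)"
   using fA by (intro sum.union_disjoint) auto
  also have "(\<Sum>C\<in>insert y ` ?B. \<delta> ^ card C) = (\<Sum>C\<in>?B. \<delta> ^ card (insert y C))"
   by (subst sum.reindex) (auto simp: inj_on_def)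
  also have "... = \<delta> * (\<Sum>C\<in>?B. \<delta> ^ card C)"
   unfolding sum_distrib_left
   using less.prems by (intro sum.cong refl, subst card_insert_disjoint) (auto intro: finite_subset)
  also have "(\<Sum>C\<in>?A. \<delta> ^ card C) <= 2 ^ card (?R Int ?D)"
   using less.hyps[OF lt] less.prems by auto
  also have "(\<Sum>C\<in>?B. \<delta> ^ card C) <= 2 ^ card ((?R Un nb y) Int ?D)"
   using less.hyps[OF lt] less.prems by auto
  also have "(2::real) ^ card ((?R Un nb y) Int ?D) <= 2 ^ (card (?R Int ?D) + \<Delta>)"
   by (intro power_increasing cR2) auto
  also have "2 ^ card (?R Int ?D) + \<delta> * 2 ^ (card (?R Int ?D) + \<Delta>) = 2 ^ card (?R Int ?D) * (1 + \<delta> * 2 ^ \<Delta>)"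
   by (simp add: power_add algebra_simps)
  also have "... <= 2 ^ card (?R Int ?D) * 2" using \<delta> by (intro mult_left_mono) auto
  also have "... = 2 ^ card (R Int D)" using cR by simp
  finally show ?thesis using \<delta> by (simp add: mult_left_mono)
 qed
qed

text \<open>The single root is forced to belong to \<open>C\<close>, so stripping it leaves an
  explicit factor \<open>\<delta>\<close>. The general count would include the empty set and give
  only the constant 2, which is not small.\<close>

lemma sum_rooted_singleton_le:
 fixes \<delta> :: real
 assumes "finite D" and nb: "!!x. finite (nb x)" "!!x. card (nb x) <= \<Delta>"
  and \<delta>: "0 <= \<delta>" "\<delta> * 2 ^ \<Delta> <= 1"
 shows "(\<Sum>C | C \<subseteq> D & x : C & rooted nb {x} C. \<delta> ^ card C) <= \<delta> * 2 ^ \<Delta>"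
proof -
 let ?B = "{C. C \<subseteq> D - {x} & rooted nb (nb x) C}"
 have fB: "finite ?B" using assms(1) by auto
 have sub: "{C. C \<subseteq> D & x : C & rooted nb {x} C} \<subseteq> insert x ` ?B"
 proof
  fix C assume C: "C : {C. C \<subseteq> D & x : C & rooted nb {x} C}"
  then have "C - {x} : ?B" "C = insert x (C - {x})" using rooted_step[of nb "{x}" C x] by auto
  then show "C : insert x ` ?B" by blast
 qed
 have "(\<Sum>C | C \<subseteq> D & x : C & rooted nb {x} C. \<delta> ^ card C) <= (\<Sum>C\<in>insert x ` ?B. \<delta> ^ card C)"
  using sub fB \<delta> by (intro sum_mono2) auto
 also have "... = (\<Sum>C\<in>?B. \<delta> ^ card (insert x C))"
  by (subst sum.reindex) (auto simp: inj_on_def)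
 also have "... = \<delta> * (\<Sum>C\<in>?B. \<delta> ^ card C)"
  unfolding sum_distrib_left
  using assms(1) by (intro sum.cong refl, subst card_insert_disjoint) (auto intro: finite_subset)
 also have "... <= \<delta> * 2 ^ card (nb x Int (D - {x}))"
  using sum_rooted_le[where D = "D - {x}" and R = "nb x", OF _ nb \<delta>] assms(1) \<delta> by (intro mult_left_mono) auto
 also have "... <= \<delta> * 2 ^ \<Delta>"
  using \<delta> card_mono[of "nb x" "nb x Int (D - {x})"] nb[of x]
  by (intro mult_left_mono power_increasing) auto
 finally show ?thesis .
qed

lemma comp_self: "x : E ==> x : comp nb x E"
 by (simp add: comp_def)

lemma rooted_comp:
 assumes "x : E"
 shows "rooted nb {x} (comp nb x E)"
 unfolding rooted_def
proof
 fix c assume "c : comp nb x E"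
 then have "(x, c) : (edges_in nb E)\<^sup>*" by (simp add: comp_def)
 then have "c : comp nb x E & (x, c) : (edges_in nb (comp nb x E))\<^sup>*"
 proof (induction rule: rtrancl_induct)
  case base
  then show ?case using assms by (simp add: comp_def)
 next
  case (step a b)
  then have "b : comp nb x E" by (auto simp: comp_def edges_in_def intro: rtrancl_into_rtrancl)
  moreover have "(a, b) : edges_in nb (comp nb x E)" using step calculation by (auto simp: edges_in_def)
  ultimately show ?case using step by (meson rtrancl.rtrancl_into_rtrancl)
 qed
 then show "EX r:{x} Int comp nb x E. (r, c) : (edges_in nb (comp nb x E))\<^sup>*"
  using comp_self[OF assms] by auto
qed

lemma comp_separated: "(E - comp nb x E) Int halo nb (comp nb x E) = {}"
 by (auto simp: comp_def halo_def edges_in_def intro: rtrancl_into_rtrancl)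

text \<open>Together with \<open>comp_separated\<close> this makes the splitting of a set into the
  component of \<open>x\<close> and the rest a bijection onto pairs whose second set avoids the halo
  of the first.\<close>

lemma comp_Un:
 assumes C: "x : C" "rooted nb {x} C" and F: "F Int halo nb C = {}"
 shows "comp nb x (C Un F) = C"
proof
 show "C \<subseteq> comp nb x (C Un F)"
 proof
  fix c assume "c : C"
  then have "(x, c) : (edges_in nb C)\<^sup>*" using C unfolding rooted_def by auto
  moreover have "edges_in nb C \<subseteq> edges_in nb (C Un F)" by (auto simp: edges_in_def)
  ultimately have "(x, c) : (edges_in nb (C Un F))\<^sup>*" by (meson rtrancl_mono subsetD)
  then show "c : comp nb x (C Un F)" using \<open>c : C\<close> by (simp add: comp_def)
 qed
 show "comp nb x (C Un F) \<subseteq> C"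
 proof
  fix c assume "c : comp nb x (C Un F)"
  then have "(x, c) : (edges_in nb (C Un F))\<^sup>*" by (simp add: comp_def)
  then show "c : C"
   by (induction rule: rtrancl_induct) (use C F in "auto simp: edges_in_def halo_def")
 qed
qed

section \<open>Convergence of the polymer expansion\<close>

locale polymer_gas = wiener \<theta> Y for \<theta> :: real and Y :: "'y set" +
 fixes nb :: "'v => 'v set" and \<Delta> :: nat and \<rho> :: "'v set => 'y => complex" and \<epsilon> :: real
 assumes nb: "!!x. finite (nb x)" "!!x. card (nb x) <= \<Delta>"
  and \<rho>_empty: "!!y. y : Y ==> \<rho> {} y = 1"
  and \<rho>_Un: "!!E F y. finite E ==> finite F ==> F Int halo nb E = {} ==> y : Y ==> \<rho> (E Un F) y = \<rho> E y * \<rho> F y"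
  and \<rho>_bound: "!!E y. finite E ==> y : Y ==> cmod (\<rho> E y) <= \<epsilon> ^ card E"
  and \<epsilon>: "0 <= \<epsilon>" "\<epsilon> * \<theta> ^ 2 * 2 ^ (2 * \<Delta> + 2) <= 1"
begin

definition Z :: "'v set => 'y => complex" where
 "Z D y = (\<Sum>E\<in>Pow D. \<rho> E y)"

definition polymers :: "'v set => 'v => 'v set set" where
 "polymers D x = {C. C \<subseteq> insert x D & x : C & rooted nb {x} C}"

text \<open>Sets containing \<open>x\<close> are sorted by the component \<open>C\<close> of
  \<open>x\<close>. The rest is an arbitrary set off the halo of \<open>C\<close>, so it sums to a
  partition function of a smaller volume. The recursion avoids any sum over families of compatible
  polymers.\<close>

lemma Z_insert:
 assumes D: "finite D" "x ~: D" and y: "y : Y"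
 shows "Z (insert x D) y = Z D y + (\<Sum>C\<in>polymers D x. \<rho> C y * Z (D - halo nb C) y)"
proof -
 have "Z (insert x D) y = Z D y + (\<Sum>E\<in>insert x ` Pow D. \<rho> E y)"
  unfolding Z_def Pow_insert using D by (intro sum.union_disjoint) auto
 also have "(\<Sum>E\<in>insert x ` Pow D. \<rho> E y) = (\<Sum>(C, F)\<in>Sigma (polymers D x) (%C. Pow (D - halo nb C)). \<rho> C y * \<rho> F y)"
 proof (rule sum.reindex_bij_witness[where i = "%(C, F). C Un F" and j = "%E. (comp nb x E, E - comp nb x E)"])
  fix E assume "E : insert x ` Pow D"
  then have E: "x : E" "E \<subseteq> insert x D" by auto
  have c: "comp nb x E \<subseteq> E" by (auto simp: comp_def)
  show "(case (comp nb x E, E - comp nb x E) of (C, F) => C Un F) = E" using c by auto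
  show "(comp nb x E, E - comp nb x E) : Sigma (polymers D x) (%C. Pow (D - halo nb C))"
   using E c comp_self[OF E(1), of nb] rooted_comp[OF E(1), of nb] comp_separated[of E nb x]
   by (auto simp: polymers_def)
  have fin: "finite E" using E D finite_subset by blast
  have "\<rho> (comp nb x E Un (E - comp nb x E)) y = \<rho> (comp nb x E) y * \<rho> (E - comp nb x E) y"
   by (intro \<rho>_Un comp_separated y) (use fin c finite_subset in auto)
  moreover have "comp nb x E Un (E - comp nb x E) = E" using c by blast
  ultimately show "(case (comp nb x E, E - comp nb x E) of (C, F) => \<rho> C y * \<rho> F y) = \<rho> E y" by simp
 next
  fix p assume "p : Sigma (polymers D x) (%C. Pow (D - halo nb C))"
  then obtain C F where p: "p = (C, F)" "C \<subseteq> insert x D" "x : C" "rooted nb {x} C" "F \<subseteq> D" "F Int halo nb C = {}"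
   by (auto simp: polymers_def)
  have "C Int F = {}" using p(6) by (auto simp: halo_def)
  then show "(comp nb x (case p of (C, F) => C Un F), (case p of (C, F) => C Un F) - comp nb x (case p of (C, F) => C Un F)) = p"
   using comp_Un[OF p(3,4,6)] p(1) by auto
  have "C Un F = insert x ((C Un F) - {x})" "(C Un F) - {x} \<subseteq> D" using p by auto
  then show "(case p of (C, F) => C Un F) : insert x ` Pow D" unfolding p(1) by blast
 qed
 also have "... = (\<Sum>C\<in>polymers D x. \<rho> C y * Z (D - halo nb C) y)"
  unfolding Z_def sum_distrib_left
  by (rule sum.Sigma[symmetric]) (use D in "auto simp: polymers_def")
 finally show ?thesis .
qed

text \<open>The bound for the relative increments \<open>h\<close>. Quotients over a halo cost
  \<open>2 ^ (\<Delta> + 1)\<close> per point of a polymer, the count of polymers another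
  \<open>2 ^ \<Delta>\<close>, and the norm one \<open>\<theta>\<close> per point. The remaining
  factor \<open>2 * \<theta>\<close> in the assumption on \<open>\<epsilon>\<close> ensures
  \<open>\<theta> * e <= 1/2\<close>.\<close>

definition e :: real where "e = \<epsilon> * \<theta> * 2 ^ (2 * \<Delta> + 1)"

lemma e: "0 <= e" "\<theta> * e <= 1/2" "e <= 1/2"
proof -
 show *: "0 <= e" "\<theta> * e <= 1/2"
  unfolding e_def using \<epsilon> \<theta> by (auto simp: power2_eq_square algebra_simps)
 show "e <= 1/2" using mult_right_mono[OF \<theta> *(1)] *(2) by simp
qed

text \<open>The relative change of the partition function when \<open>x\<close> is added to
  \<open>D\<close>. The sum runs over the polymers of the fixed set \<open>N\<close>, and
  containment in \<open>D\<close> is an indicator; so each term is a function with a single Moebius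
  coefficient times a quotient of partition functions.\<close>

definition h :: "'v set => 'v => 'v set => 'y => complex" where
 "h N x D y = (\<Sum>C\<in>polymers N x. (if C - {x} \<subseteq> D then \<rho> C y else 0) * (Z (D - halo nb C) y / Z D y))"

lemma finite_polymers: "finite D ==> finite (polymers D x)"
 unfolding polymers_def by auto

lemma Z_insert_h:
 assumes N: "finite N" "x ~: N" and D: "D \<subseteq> N" and y: "y : Y" and Z: "Z D y ~= 0"
 shows "Z (insert x D) y = Z D y * (1 + h N x D y)"
proof -
 have fD: "finite D" "x ~: D" using N D finite_subset by auto
 have "(\<Sum>C\<in>polymers D x. \<rho> C y * Z (D - halo nb C) y)
  = (\<Sum>C\<in>polymers N x. (if C - {x} \<subseteq> D then \<rho> C y else 0) * Z (D - halo nb C) y)"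
  by (rule sum.mono_neutral_cong_left) (use N D finite_polymers in "auto simp: polymers_def")
 also have "... = Z D y * h N x D y"
  unfolding h_def sum_distrib_left using Z by (intro sum.cong) auto
 finally show ?thesis using Z_insert[OF fD y] by (simp add: algebra_simps)
qed

definition good :: "'v set => bool" where
 "good N \<longleftrightarrow> (\<forall>D\<subseteq>N. ALL y:Y. Z D y ~= 0) \<and>
  (ALL U. U \<subseteq> N --> nm N (%D y. Z (D - U) y / Z D y) <= 2 ^ card U)"

lemma card_halo: "finite C ==> card (halo nb C) <= (\<Delta> + 1) * card C"
proof -
 assume C: "finite C"
 have "card (halo nb C) <= card C + card (\<Union> (nb ` C))" unfolding halo_def by (rule card_Un_le)
 also have "card (\<Union> (nb ` C)) <= (\<Sum>x\<in>C. card (nb x))" by (rule card_UN_le[OF C])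
 also have "... <= (\<Sum>x\<in>C. \<Delta>)" by (intro sum_mono nb)
 finally show ?thesis by (simp add: mult.commute)
qed

lemma nm_h:
 assumes N: "finite N" "x ~: N" and g: "good N"
 shows "nm N (h N x) <= e"
proof -
 let ?\<delta> = "\<epsilon> * \<theta> * 2 ^ (\<Delta> + 1)"
 have eq: "?\<delta> * 2 ^ \<Delta> = e"
 proof -
  have "2 * \<Delta> + 1 = (\<Delta> + 1) + \<Delta>" by simp
  then show ?thesis unfolding e_def by (simp only: power_add mult.assoc)
 qed
 have "nm N (h N x) <= (\<Sum>C\<in>polymers N x. nm N (%D y. (if C - {x} \<subseteq> D then \<rho> C y else 0) * (Z (D - halo nb C) y / Z D y)))"
  unfolding h_def by (rule nm_sum[OF finite_polymers[OF N(1)]])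
 also have "... <= (\<Sum>C\<in>polymers N x. ?\<delta> ^ card C)"
 proof (rule sum_mono)
  fix C assume "C : polymers N x"
  then have C: "C \<subseteq> insert x N" "x : C" by (auto simp: polymers_def)
  then have fC: "finite C" using N finite_subset by blast
  have "nm N (%D y. (if C - {x} \<subseteq> D then \<rho> C y else 0) * (Z (D - halo nb C) y / Z D y))
   <= nm N (%D y. if C - {x} \<subseteq> D then \<rho> C y else 0) * nm N (%D y. Z (D - halo nb C) y / Z D y)"
   by (rule nm_mult[OF N(1)])
  also have "nm N (%D y. if C - {x} \<subseteq> D then \<rho> C y else 0) <= \<theta> ^ card (C - {x}) * supn (\<rho> C)"
   by (rule nm_single[OF N(1)])
  also have "\<theta> ^ card (C - {x}) * supn (\<rho> C) <= \<theta> ^ card C * \<epsilon> ^ card C"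
   using \<theta> \<rho>_bound[OF fC] supn_nonneg fC
   by (intro mult_mono power_increasing supn_le) (auto intro: card_mono)
  also have "nm N (%D y. Z (D - halo nb C) y / Z D y) = nm N (%D y. Z (D - (halo nb C Int N)) y / Z D y)"
   by (intro nm_cong arg_cong2[where f = "(/)"] arg_cong2[where f = Z]) auto
  also have "... <= 2 ^ card (halo nb C Int N)" using g unfolding good_def by auto
  also have "... <= (2::real) ^ ((\<Delta> + 1) * card C)"
  proof (intro power_increasing order_trans[OF card_mono card_halo[OF fC]])
   show "finite (halo nb C)" using fC nb by (auto simp: halo_def)
  qed auto
  finally have "nm N (%D y. (if C - {x} \<subseteq> D then \<rho> C y else 0) * (Z (D - halo nb C) y / Z D y))
   <= \<theta> ^ card C * \<epsilon> ^ card C * 2 ^ ((\<Delta> + 1) * card C)"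
   using \<theta> \<epsilon> by (simp add: mult_left_mono mult_right_mono nm_nonneg)
  also have "... = ?\<delta> ^ card C" by (simp only: power_mult power_mult_distrib) (simp add: mult_ac)
  finally show "nm N (%D y. (if C - {x} \<subseteq> D then \<rho> C y else 0) * (Z (D - halo nb C) y / Z D y)) <= ?\<delta> ^ card C" .
 qed
 also have "... <= ?\<delta> * 2 ^ \<Delta>"
 proof -
  show ?thesis
   using sum_rooted_singleton_le[where D = "insert x N" and \<delta> = ?\<delta> and x = x and nb = nb and \<Delta> = \<Delta>, OF _ nb]
    N \<epsilon> \<theta> e unfolding polymers_def eq by simp
 qed
 also have "... = e" by (rule eq)
 finally show ?thesis .
qed

text \<open>Induction on the size of \<open>N\<close>. For \<open>u\<close> in \<open>N\<close> the
  smaller set \<open>N - {u}\<close> has increments of norm at most \<open>e\<close>, so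
  \<open>1 + h\<close> is invertible; this excludes zeros and bounds the quotient for deleting one
  point by 2. Deleting \<open>U\<close> telescopes into single deletions.\<close>

lemma good: "finite N ==> good N"
proof (induction "card N" arbitrary: N rule: less_induct)
 case less
 have IH: "good (N - {u})" "nm (N - {u}) (h (N - {u}) u) <= e" if "u : N" for u
 proof -
  show *: "good (N - {u})" using less that by (metis card_Diff1_less finite_Diff)
  show "nm (N - {u}) (h (N - {u}) u) <= e" using less.prems by (intro nm_h[OF _ _ *]) auto
 qed
 have step: "Z (insert u D) y = Z D y * (1 + h (N - {u}) u D y)" "1 + h (N - {u}) u D y ~= 0"
  if "u : N" "D \<subseteq> N - {u}" "y : Y" for u D y
 proof -
  show "Z (insert u D) y = Z D y * (1 + h (N - {u}) u D y)"
   using IH(1)[OF that(1)] less.prems that by (intro Z_insert_h) (auto simp: good_def)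
  have "cmod (h (N - {u}) u D y) <= e"
   using nm_ge[of "N - {u}" D y "h (N - {u}) u"] IH(2)[OF that(1)] that less.prems by simp
  then have "cmod (h (N - {u}) u D y) < 1" using e by simp
  then show "1 + h (N - {u}) u D y ~= 0" by (auto simp: add_eq_0_iff)
 qed
 have nz: "Z D y ~= 0" if "D \<subseteq> N" "y : Y" for D y
 proof (cases "D = {}")
  case True
  then show ?thesis using \<rho>_empty[OF that(2)] by (simp add: Z_def)
 next
  case False
  then obtain u where u: "u : D" by blast
  then have uN: "u : N" "D - {u} \<subseteq> N - {u}" using that by auto
  have "Z (D - {u}) y ~= 0" using IH(1)[OF uN(1)] uN that by (auto simp: good_def)
  then show ?thesis using step[OF uN that(2)] u by (simp add: insert_absorb)
 qed
 have q: "nm N (%D y. Z (D - {u}) y / Z D y) <= 2" if u: "u : N" for u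
 proof -
  \<comment> \<open>The increment is switched off when \<open>u\<close> is not in \<open>D\<close>,
    where the quotient is 1. The indicator has norm at most \<open>\<theta>\<close>, which is the
    second \<open>\<theta>\<close> in the smallness assumption.\<close>
  let ?h = "%D y. (if {u} \<subseteq> D then 1 else 0) * h (N - {u}) u (D - {u}) y"
  have "nm N ?h <= nm N (%D y. if {u} \<subseteq> D then 1 else 0) * nm N (%D. h (N - {u}) u (D - {u}))"
   by (rule nm_mult[OF less.prems])
  also have "... <= \<theta> * e"
   using nm_single[OF less.prems, of "{u}" "%_. 1"] nm_Diff[OF less.prems, of "h (N - {u}) u" "{u}"] IH(2)[OF u] \<theta>
   by (intro mult_mono nm_nonneg) (auto simp: supn_const)
  finally have "nm N ?h <= 1/2" using e by simp
  then have "nm N (%D y. 1 / (1 + ?h D y)) <= 2" by (rule nm_inverse[OF less.prems])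
  moreover have "nm N (%D y. 1 / (1 + ?h D y)) = nm N (%D y. Z (D - {u}) y / Z D y)"
  proof (rule nm_cong)
   fix D y assume D: "D \<subseteq> N" "y : Y"
   show "1 / (1 + ?h D y) = Z (D - {u}) y / Z D y"
   proof (cases "u : D")
    case True
    then have "Z D y = Z (D - {u}) y * (1 + h (N - {u}) u (D - {u}) y)"
     using step(1)[OF u, of "D - {u}" y] D by (auto simp: insert_absorb)
    then show ?thesis using True nz[of "D - {u}" y] D by auto
   next
    case False
    then show ?thesis using nz[OF D] by simp
   qed
  qed
  ultimately show ?thesis by simp
 qed
 have "nm N (%D y. Z (D - U) y / Z D y) <= 2 ^ card U" if "U \<subseteq> N" for U
 proof -
  have "finite U" using that less.prems finite_subset by blast
  then show ?thesis using that
  proof (induction U rule: finite_induct)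
   case empty
   have "nm N (%D y. Z (D - {}) y / Z D y) = nm N (%D y. 1)"
    by (rule nm_cong) (use nz in auto)
   then show ?case using nm_const[OF less.prems, of 1] by simp
  next
   case (insert u U)
   have "nm N (%D y. Z (D - insert u U) y / Z D y)
    = nm N (%D y. (Z ((D - U) - {u}) y / Z (D - U) y) * (Z (D - U) y / Z D y))"
   proof (rule nm_cong)
    fix D y assume "D \<subseteq> N" "y : Y"
    then have "Z (D - U) y ~= 0" using nz[of "D - U" y] by auto
    moreover have "D - insert u U = D - U - {u}" by auto
    ultimately show "Z (D - insert u U) y / Z D y = (Z ((D - U) - {u}) y / Z (D - U) y) * (Z (D - U) y / Z D y)"
     by simp
   qed
   also have "... <= nm N (%D y. Z ((D - U) - {u}) y / Z (D - U) y) * nm N (%D y. Z (D - U) y / Z D y)"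
    by (rule nm_mult[OF less.prems])
   also have "nm N (%D y. Z ((D - U) - {u}) y / Z (D - U) y) <= 2"
   proof -
    have "nm N (%D y. Z ((D - U) - {u}) y / Z (D - U) y) <= nm (N - U) (%D y. Z (D - {u}) y / Z D y)"
     by (rule nm_Diff[OF less.prems, where f = "%D y. Z (D - {u}) y / Z D y"])
    also have "... <= nm N (%D y. Z (D - {u}) y / Z D y)" by (rule nm_subset[OF less.prems]) auto
    also have "... <= 2" using q insert by auto
    finally show ?thesis .
   qed
   also have "nm N (%D y. Z (D - U) y / Z D y) <= 2 ^ card U" using insert by auto
   finally show ?case using insert by (simp add: nm_nonneg mult_right_mono)
  qed
 qed
 then show ?case using nz unfolding good_def by auto
qed

lemma Z_nonzero: "finite D ==> y : Y ==> Z D y ~= 0"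
 using good[of D] unfolding good_def by blast

text \<open>Adding \<open>u\<close> makes the coefficient at \<open>insert u A\<close> a coefficient
  of the logarithm of \<open>cmod (1 + h)\<close>, to which \<open>nm_ln\<close> applies. The
  parameter \<open>yy A\<close> may vary with \<open>A\<close> because the supremum stands inside
  the norm.\<close>

theorem log_bound:
 assumes N: "finite N" "u ~: N" and yy: "!!A. yy A : Y"
 shows "(\<Sum>A\<in>Pow N. \<theta> ^ card A * \<bar>mob (%D. ln (cmod (Z D (yy A)))) (insert u A)\<bar>) <= 1"
proof -
 have hb: "nm N (h N u) <= e" using nm_h[OF N good[OF N(1)]] .
 have "\<bar>mob (%D. ln (cmod (Z D (yy A)))) (insert u A)\<bar>
  <= supn (%y. mob (%D. of_real (ln (cmod (1 + h N u D y)))) A)" if A: "A \<subseteq> N" for A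
 proof -
  have fA: "finite A" "u ~: A" using A N finite_subset by auto
  have "mob (%D. ln (cmod (Z D (yy A)))) (insert u A) = mob (%D. ln (cmod (1 + h N u D (yy A)))) A"
   unfolding mob_insert[OF fA]
  proof (rule mob_cong)
   fix D assume D: "D \<subseteq> A"
   then have fD: "finite D" "D \<subseteq> N" using fA A finite_subset by auto
   have nz: "Z D (yy A) ~= 0" "Z (insert u D) (yy A) ~= 0" using Z_nonzero yy fD by auto
   have eq: "Z (insert u D) (yy A) = Z D (yy A) * (1 + h N u D (yy A))"
    using Z_insert_h[OF N fD(2) yy nz(1)] .
   then have "1 + h N u D (yy A) ~= 0" using nz by auto
   then show "ln (cmod (Z (insert u D) (yy A))) - ln (cmod (Z D (yy A))) = ln (cmod (1 + h N u D (yy A)))"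
    unfolding eq norm_mult using nz by (subst ln_mult) auto
  qed
  also have "\<bar>...\<bar> = cmod (mob (%D. of_real (ln (cmod (1 + h N u D (yy A))))) A)"
  proof -
   have "mob (%D. complex_of_real (f D)) A = of_real (mob f A)" for f
    unfolding mob_def by simp
   then show ?thesis by simp
  qed
  also have "... <= supn (%y. mob (%D. of_real (ln (cmod (1 + h N u D y)))) A)"
   by (rule supn_ge[OF yy, where g = "%y. mob (%D. of_real (ln (cmod (1 + h N u D y)))) A"])
  finally show ?thesis .
 qed
 then have "(\<Sum>A\<in>Pow N. \<theta> ^ card A * \<bar>mob (%D. ln (cmod (Z D (yy A)))) (insert u A)\<bar>)
  <= nm N (%D y. of_real (ln (cmod (1 + h N u D y))))"
  unfolding nm_def using \<theta> by (intro sum_mono mult_left_mono) auto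
 also have "... <= 2 * nm N (h N u)" by (rule nm_ln) (use N hb e in auto)
 also have "... <= 1" using hb e by simp
 finally show ?thesis .
qed

end

section \<open>Sums over discrete paths\<close>

lemmas if_mult = if_distrib[where f = "%c. c * _"] if_distrib[where f = "%c. _ * c"]

lemma sum_PiE_insert:
 assumes "i ~: I"
 shows "(\<Sum>x\<in>PiE (insert i I) F. f x) = (\<Sum>z\<in>F i. \<Sum>x\<in>PiE I F. f (x(i := z)))"
proof -
 have "(\<Sum>x\<in>PiE (insert i I) F. f x) = (\<Sum>(z, x)\<in>F i \<times> PiE I F. f (x(i := z)))"
  unfolding PiE_insert_eq
  by (subst sum.reindex[OF inj_combinator[OF assms]]) (simp add: case_prod_beta' comp_def)
 then show ?thesis by (simp add: sum.cartesian_product)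
qed

lemma mpow_Suc_right:
 assumes "finite S" "x : S" "y : S"
 shows "mpow S A (Suc k) x y = mmul S (mpow S A k) A x y"
 using assms(2,3)
proof (induction k arbitrary: x y)
 case 0
 have "(\<Sum>z\<in>S. A x z * (if z = y then 1 else 0)) = A x y"
  using 0 assms(1) by (simp add: if_mult cong: if_cong)
 moreover have "(\<Sum>z\<in>S. (if x = z then 1 else 0) * A z y) = A x y"
  using 0 assms(1) by (simp add: if_mult cong: if_cong)
 ultimately show ?case by (simp add: mmul_def)
next
 case (Suc k)
 have "mpow S A (Suc (Suc k)) x y = (\<Sum>z\<in>S. A x z * mpow S A (Suc k) z y)"
  by (simp add: mmul_def)
 also have "... = (\<Sum>z\<in>S. A x z * mmul S (mpow S A k) A z y)"
  using Suc by (intro sum.cong) auto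
 also have "... = (\<Sum>z\<in>S. \<Sum>w\<in>S. A x z * (mpow S A k z w * A w y))"
  by (simp add: mmul_def sum_distrib_left)
 also have "... = (\<Sum>w\<in>S. \<Sum>z\<in>S. A x z * (mpow S A k z w * A w y))"
  by (rule sum.swap)
 also have "... = mmul S (mpow S A (Suc k)) A x y"
  by (simp add: mmul_def sum_distrib_right mult.assoc)
 finally show ?case .
qed

text \<open>The transfer matrix formula: paths between fixed end points sum to a matrix power, and
  \<open>G\<close> couples the end of the path to its beginning, as the observable in a trace
  does.\<close>

lemma path_sum:
 assumes S: "finite S"
 shows "(\<Sum>X\<in>PiE {..n} (%_. S). (\<Prod>t<n. T (X t) (X (Suc t))) * G (X n) (X 0))
  = (\<Sum>s\<in>S. \<Sum>q\<in>S. mpow S T n s q * G q s)"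
proof (induction n arbitrary: G)
 case 0
 have "{..0::nat} = insert 0 {}" by auto
 then have "(\<Sum>X\<in>PiE {..0} (%_. S). (\<Prod>t<0. T (X t) (X (Suc t))) * G (X 0) (X 0)) = (\<Sum>z\<in>S. G z z)"
  by (simp add: sum_PiE_insert del: atMost_0)
 also have "... = (\<Sum>s\<in>S. \<Sum>q\<in>S. mpow S T 0 s q * G q s)"
  using S by (simp add: if_mult cong: if_cong)
 finally show ?case .
next
 case (Suc n)
 have "(\<Sum>X\<in>PiE {..Suc n} (%_. S). (\<Prod>t<Suc n. T (X t) (X (Suc t))) * G (X (Suc n)) (X 0))
  = (\<Sum>w\<in>S. \<Sum>X\<in>PiE {..n} (%_. S). (\<Prod>t<n. T (X t) (X (Suc t))) * (T (X n) w * G w (X 0)))"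
  unfolding atMost_Suc by (subst sum_PiE_insert) (auto intro!: sum.cong prod.cong)
 also have "... = (\<Sum>X\<in>PiE {..n} (%_. S). (\<Prod>t<n. T (X t) (X (Suc t))) * (\<Sum>w\<in>S. T (X n) w * G w (X 0)))"
  by (subst sum.swap) (simp add: sum_distrib_left)
 also have "... = (\<Sum>s\<in>S. \<Sum>q\<in>S. mpow S T n s q * (\<Sum>w\<in>S. T q w * G w s))"
  by (rule Suc.IH)
 also have "... = (\<Sum>s\<in>S. \<Sum>w\<in>S. \<Sum>q\<in>S. mpow S T n s q * (T q w * G w s))"
  unfolding sum_distrib_left by (intro sum.cong refl sum.swap)
 also have "... = (\<Sum>s\<in>S. \<Sum>w\<in>S. mmul S (mpow S T n) T s w * G w s)"
  by (simp add: mmul_def sum_distrib_right mult.assoc)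
 also have "... = (\<Sum>s\<in>S. \<Sum>w\<in>S. mpow S T (Suc n) s w * G w s)"
  using mpow_Suc_right[OF S] by (intro sum.cong) auto
 finally show ?case .
qed

section \<open>Space-time polymers\<close>

definition lay :: "('a \<times> nat) set => nat => 'a set" where
 "lay E t = {i. (i, t) : E}"

text \<open>The value outside \<open>A\<close> is 0 because the basis configurations in
  \<open>confs\<close> are normalised that way.\<close>

definition sl :: "'d site set => ('d site => nat => nat) => nat => 'd cfg" where
 "sl A x t = (%j. if j : A then x j t else 0)"

lemma sl_cong: "(!!j. j : A ==> x j t = x' j t) ==> sl A x t = sl A x' t"
 by (auto simp: sl_def)

lemma finite_confs:
 assumes "finite L"
 shows "finite (confs m L)"
 by (rule finite_subset[OF _ finite_set_of_finite_funs[OF assms, of "{..<m}" 0]]) (auto simp: confs_def)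

text \<open>An abstract system of \<open>n\<close> time slabs over the lattice. A slab at a site is
  either excited, and carried by the kernel \<open>K\<close> of its layer, or replaced by the
  rank-one projection onto \<open>u\<close>. The label of a site selects the operator that closes
  its path in the trace, and \<open>c\<close> is the expectation of that operator in
  \<open>u\<close>; the label \<open>None\<close> is meant for sites that are not measured.\<close>

locale spacetime =
 fixes m :: nat and u :: "nat => complex" and n :: nat
  and K :: "'d::finite site set => 'd op" and \<epsilon> :: real
  and Ob :: "real option => smat" and c :: "real option => real" and alph :: "real option set"
  and CO :: real
 assumes u: "(\<Sum>i<m. (cmod (u i))\<^sup>2) = 1" and n: "n \<ge> 1"
  and alph: "finite alph" "None : alph"
  and c: "!!y. y : alph ==> c y > 0"
  and Ob_u: "!!y. y : alph ==> (\<Sum>a<m. \<Sum>b<m. cnj (u a) * Ob y a b * u b) = of_real (c y)"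
  and Ob_bound: "!!y a b. y : alph ==> a < m ==> b < m ==> cmod (Ob y a b) <= CO * c y" and CO: "CO \<ge> 1"
  and K_empty: "K {} (%_. 0) (%_. 0) = 1"
  and K_Un: "!!A B s t. finite A ==> finite B ==> A Int B = {} ==> (!!a b. a : A ==> b : B ==> l1dist a b ~= 1) ==>
   s : confs m (A Un B) ==> t : confs m (A Un B) ==>
   K (A Un B) s t = K A (restr s A) (restr t A) * K B (restr s B) (restr t B)"
  and K_bound: "!!A s t. finite A ==> s : confs m A ==> t : confs m A ==> cmod (K A s t) <= \<epsilon> ^ card A"
  and \<epsilon>: "\<epsilon> \<ge> 0"
  and K_shift: "!!a A s t. finite A ==> s : confs m (shift a ` A) ==> t : confs m (shift a ` A) ==>
   K (shift a ` A) s t = K A (s o shift a) (t o shift a)"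
begin

lemma m: "m \<ge> 1"
 using u by (cases m) auto

definition spaths :: "(nat => nat) set" where
 "spaths = PiE {..n} (%_. {..<m})"

definition paths :: "'d site set => ('d site => nat => nat) set" where
 "paths L = PiE L (%_. spaths)"

definition kw :: "('d site \<times> nat) set => ('d site => nat => nat) => complex" where
 "kw E x = (\<Prod>t<n. K (lay E t) (sl (lay E t) x t) (sl (lay E t) x (Suc t)))"

text \<open>Division by \<open>c\<close> makes the weights of a site without excited slabs sum to 1,
  so the partition function is taken relative to the product state built from
  \<open>u\<close>.\<close>

definition sw :: "('d site \<times> nat) set => ('d site => real option) => 'd site => (nat => nat) => complex" where
 "sw E y i z = (\<Prod>t<n. if (i, t) : E then 1 else u (z t) * cnj (u (z (Suc t)))) *
  (Ob (y i) (z n) (z 0) / of_real (c (y i)))"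

definition rho :: "'d site set => ('d site \<times> nat) set => ('d site => real option) => complex" where
 "rho L E y = (\<Sum>x\<in>paths L. kw E x * (\<Prod>i\<in>L. sw E y i (x i)))"

lemma finite_spaths: "finite spaths"
 unfolding spaths_def by (intro finite_PiE) auto

lemma spaths_less: "z : spaths ==> t <= n ==> z t < m"
 unfolding spaths_def by (auto simp: PiE_iff)

lemma sum_u: "(\<Sum>a<m. cnj (u a) * u a) = 1"
proof -
 have "(\<Sum>a<m. cnj (u a) * u a) = of_real (\<Sum>i<m. (cmod (u i))\<^sup>2)"
  by (simp only: of_real_sum complex_norm_square) (simp add: mult.commute)
 then show ?thesis using u by simp
qed

text \<open>Each interior summation is \<open><u, u> = 1\<close>, which leaves the expectation of
  \<open>G\<close> in \<open>u\<close>. At least one projection has to be present: for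
  \<open>k = 0\<close> the sum would be the trace of \<open>G\<close>.\<close>

lemma site_path_sum:
 assumes "k \<ge> 1"
 shows "(\<Sum>z\<in>PiE {..k} (%_. {..<m}). (\<Prod>t<k. u (z t) * cnj (u (z (Suc t)))) * G (z k) (z 0))
  = (\<Sum>a<m. \<Sum>b<m. cnj (u a) * G a b * u b)"
 using assms
proof (induction k arbitrary: G rule: nat_induct_at_least)
 case base
 have s: "{..Suc 0} = insert 0 (insert (Suc 0) {})" by auto
 have "(\<Sum>z\<in>PiE {..Suc 0} (%_. {..<m}). (\<Prod>t<Suc 0. u (z t) * cnj (u (z (Suc t)))) * G (z (Suc 0)) (z 0))
  = (\<Sum>b<m. \<Sum>a<m. u b * cnj (u a) * G a b)"
  unfolding s by (simp add: sum_PiE_insert)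
 also have "... = (\<Sum>a<m. \<Sum>b<m. cnj (u a) * G a b * u b)"
  by (subst sum.swap) (simp add: mult_ac)
 finally show ?case by simp
next
 case (Suc k)
 have "(\<Sum>z\<in>PiE {..Suc k} (%_. {..<m}). (\<Prod>t<Suc k. u (z t) * cnj (u (z (Suc t)))) * G (z (Suc k)) (z 0))
  = (\<Sum>w<m. \<Sum>z\<in>PiE {..k} (%_. {..<m}). (\<Prod>t<k. u (z t) * cnj (u (z (Suc t)))) * (u (z k) * cnj (u w) * G w (z 0)))"
  unfolding atMost_Suc by (subst sum_PiE_insert) (auto intro!: sum.cong prod.cong)
 also have "... = (\<Sum>w<m. \<Sum>a<m. \<Sum>b<m. cnj (u a) * (u a * cnj (u w) * G w b) * u b)"
  by (subst Suc.IH[where G = "%a b. u a * cnj (u _) * G _ b"]) simp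
 also have "... = (\<Sum>w<m. (\<Sum>a<m. cnj (u a) * u a) * (\<Sum>b<m. cnj (u w) * G w b * u b))"
  unfolding sum_product by (simp add: mult_ac)
 finally show ?case by (simp add: sum_u)
qed

lemma sum_sw:
 assumes "y i : alph" and "!!t. (i, t) ~: E"
 shows "(\<Sum>z\<in>spaths. sw E y i z) = 1"
proof -
 have "(\<Sum>z\<in>spaths. sw E y i z) = (\<Sum>a<m. \<Sum>b<m. cnj (u a) * (Ob (y i) a b / of_real (c (y i))) * u b)"
  unfolding sw_def spaths_def using assms(2)
  by (simp del: times_divide_eq_right add: site_path_sum[OF n, where G = "%a b. Ob (y i) a b / of_real (c (y i))"])
 also have "... = (\<Sum>a<m. \<Sum>b<m. cnj (u a) * Ob (y i) a b * u b) / of_real (c (y i))"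
  by (simp add: sum_divide_distrib)
 also have "... = 1" using Ob_u[OF assms(1)] c[OF assms(1)] by simp
 finally show ?thesis .
qed

text \<open>A site without excited slabs decouples and contributes a normalised path sum equal to 1.
  Hence the activity does not depend on the box, and \<open>poly\<close> may take the projection of
  \<open>E\<close> as its box.\<close>

lemma rho_insert:
 assumes "finite L" "i ~: L" "fst ` E \<subseteq> L" "y i : alph"
 shows "rho (insert i L) E y = rho L E y"
proof -
 have iE: "(i, t) ~: E" for t using assms(2,3) by force
 have kw: "kw E (x(i := z)) = kw E x" for x z
 proof -
  have "sl (lay E t) (x(i := z)) s = sl (lay E t) x s" for t s
   by (rule sl_cong) (use iE in "auto simp: lay_def")
  then show ?thesis unfolding kw_def by simp
 qed
 have "rho (insert i L) E y = (\<Sum>z\<in>spaths. \<Sum>x\<in>paths L. kw E x * (sw E y i z * (\<Prod>j\<in>L. sw E y j (x j))))"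
  unfolding rho_def paths_def sum_PiE_insert[OF assms(2)] kw
 proof (intro sum.cong refl arg_cong2[where f = times])
  fix z x
  have "(\<Prod>j\<in>L. sw E y j ((x(i := z)) j)) = (\<Prod>j\<in>L. sw E y j (x j))"
   using assms(2) by (intro prod.cong) auto
  then show "(\<Prod>j\<in>insert i L. sw E y j ((x(i := z)) j)) = sw E y i z * (\<Prod>j\<in>L. sw E y j (x j))"
   using assms(1,2) by (simp del: fun_upd_apply add: fun_upd_same)
 qed
 also have "... = (\<Sum>z\<in>spaths. sw E y i z * rho L E y)"
  unfolding rho_def sum_distrib_left by (simp only: mult.left_commute)
 also have "... = (\<Sum>z\<in>spaths. sw E y i z) * rho L E y"
  by (simp only: sum_distrib_right)
 finally show ?thesis using sum_sw[of y i E, OF assms(4)] iE by simp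
qed

lemma rho_superset:
 assumes "finite L'" "fst ` E \<subseteq> L" "L \<subseteq> L'" "!!i. y i : alph"
 shows "rho L' E y = rho L E y"
proof -
 have fL: "finite L" using assms finite_subset by blast
 have "rho (L Un M) E y = rho L E y" if "finite M" for M
  using that
 proof (induction M rule: finite_induct)
  case (insert i M)
  show ?case
  proof (cases "i : L")
   case True
   then show ?thesis using insert by (simp add: insert_absorb)
  next
   case False
   then have "rho (insert i (L Un M)) E y = rho (L Un M) E y"
    using insert fL assms by (intro rho_insert) auto
   then show ?thesis using insert by simp
  qed
 qed simp
 from this[of "L' - L"] show ?thesis using assms by (simp add: Un_absorb1)
qed

lemma kw_empty: "kw {} x = 1"
 unfolding kw_def by (simp add: lay_def sl_def K_empty)

lemma rho_empty:
 assumes "finite L" "!!i. y i : alph"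
 shows "rho L {} y = 1"
proof -
 have "rho L {} y = rho {} {} y" by (rule rho_superset) (use assms in auto)
 also have "... = 1" by (simp add: rho_def paths_def kw_empty)
 finally show ?thesis .
qed

lemma sl_confs: "x : paths L ==> A \<subseteq> L ==> t <= n ==> sl A x t : confs m A"
 by (auto simp: confs_def sl_def paths_def spaths_def PiE_iff)

lemma restr_sl: "restr (sl (A Un B) x t) A = sl A x t" "restr (sl (A Un B) x t) B = sl B x t"
 by (auto simp: restr_def sl_def)

lemma mult4:
 fixes a b e f :: complex
 assumes "a * b = e * f" "a' * b' = e' * f'"
 shows "(a * a') * (b * b') = (e * e') * (f * f')"
proof -
 have "(a * a') * (b * b') = (a * b) * (a' * b')" by (simp only: mult_ac)
 also have "... = (e * e') * (f * f')" unfolding assms by (simp only: mult_ac)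
 finally show ?thesis .
qed

text \<open>Two replicas of the system exchange their paths on a set V of space-time points. The rank-one
 slabs are symmetric under the exchange, which moves the factors carried by E2 to the other replica.\<close>

lemma rho_swap:
 assumes L: "finite L" and E: "E1 \<subseteq> L \<times> {..<n}" "E2 \<subseteq> L \<times> {..<n}"
  and sep: "!!i j t. (i, t) : E1 ==> (j, t) : E2 ==> i ~= j & l1dist i j ~= 1"
  and V1: "!!i t. (i, t) : E1 ==> (i, t) ~: V & (i, Suc t) ~: V"
  and V2: "!!i t. (i, t) : E2 ==> (i, t) : V & (i, Suc t) : V"
  and V0: "!!i. (i, 0) : V \<longleftrightarrow> (i, n) : V"
  and y1: "!!i. y1 i = (if (i, 0) : V then y' i else y i)"
  and y2: "!!i. y2 i = (if (i, 0) : V then y i else y' i)"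
 shows "rho L (E1 Un E2) y * rho L {} y' = rho L E1 y1 * rho L E2 y2"
proof -
 \<comment> \<open>\<open>S x x'\<close> follows \<open>x'\<close> on \<open>V\<close> and
   \<open>x\<close> elsewhere. Formed with both orders of the arguments it is an involution on pairs
   of paths, hence a change of summation variables.\<close>
 define S where "S x x' = (%i t. if (i, t) : V then x' i t else x i t)" for x x' :: "'d site => nat => nat"
 have S_paths: "S x x' : paths L" if "x : paths L" "x' : paths L" for x x'
 proof -
  have "S x x' i = undefined" if "i ~: L" for i
  proof -
   have "x i = undefined" "x' i = undefined"
    using \<open>x : paths L\<close> \<open>x' : paths L\<close> that by (auto simp: paths_def PiE_iff extensional_def)
   then show ?thesis unfolding S_def by auto
  qed
  then show ?thesis using that
   by (auto simp: paths_def spaths_def PiE_iff extensional_def) (auto simp: S_def)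
 qed
 have SS: "S (S x x') (S x' x) = x" for x x' by (auto simp: S_def fun_eq_iff)
 have fin: "finite (lay E1 t)" "finite (lay E2 t)" "lay E1 t \<subseteq> L" "lay E2 t \<subseteq> L" for t
  using E L by (auto simp: lay_def intro: finite_subset[OF _ L])
 have layU: "lay (E1 Un E2) t = lay E1 t Un lay E2 t" for t by (auto simp: lay_def)
 have disj: "lay E1 t Int lay E2 t = {}" for t
  using sep unfolding lay_def by blast
 have kwU: "kw (E1 Un E2) x = kw E1 x * kw E2 x" if x: "x : paths L" for x
  unfolding kw_def prod.distrib[symmetric]
 proof (intro prod.cong refl)
  fix t assume t: "t : {..<n}"
  have "sl (lay (E1 Un E2) t) x t : confs m (lay (E1 Un E2) t)"
    "sl (lay (E1 Un E2) t) x (Suc t) : confs m (lay (E1 Un E2) t)"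
   using sl_confs[OF x] fin t unfolding layU by auto
  then show "K (lay (E1 Un E2) t) (sl (lay (E1 Un E2) t) x t) (sl (lay (E1 Un E2) t) x (Suc t)) =
   K (lay E1 t) (sl (lay E1 t) x t) (sl (lay E1 t) x (Suc t)) *
   K (lay E2 t) (sl (lay E2 t) x t) (sl (lay E2 t) x (Suc t))"
   unfolding layU
   by (subst K_Un) (use fin sep disj in "auto simp: restr_sl", auto simp: lay_def)
 qed
 have kw1: "kw E1 (S x x') = kw E1 x" for x x'
 proof -
  have "sl (lay E1 t) (S x x') t = sl (lay E1 t) x t" "sl (lay E1 t) (S x x') (Suc t) = sl (lay E1 t) x (Suc t)" for t
   by (intro sl_cong; use V1 in "auto simp: S_def lay_def")+
  then show ?thesis unfolding kw_def by simp
 qed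
 have kw2: "kw E2 (S x' x) = kw E2 x" for x x'
 proof -
  have "sl (lay E2 t) (S x' x) t = sl (lay E2 t) x t" "sl (lay E2 t) (S x' x) (Suc t) = sl (lay E2 t) x (Suc t)" for t
   by (intro sl_cong; use V2 in "auto simp: S_def lay_def")+
  then show ?thesis unfolding kw_def by simp
 qed
 have sw: "sw (E1 Un E2) y i (x i) * sw {} y' i (x' i) = sw E1 y1 i (S x x' i) * sw E2 y2 i (S x' x i)" for x x' i
 proof -
  let ?f = "%E (z::nat => nat) t. (if (i, t) : E then 1 else u (z t) * cnj (u (z (Suc t))))"
  have "?f (E1 Un E2) (x i) t * ?f {} (x' i) t = ?f E1 (S x x' i) t * ?f E2 (S x' x i) t" for t
  proof -
   consider "(i, t) : E1" "(i, t) ~: E2" | "(i, t) : E2" "(i, t) ~: E1" | "(i, t) ~: E1" "(i, t) ~: E2"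
    using sep by blast
   then show ?thesis
   proof cases
    case 1
    then show ?thesis using V1[OF 1(1)] by (simp add: S_def)
   next
    case 2
    then show ?thesis using V2[OF 2(1)] by (simp add: S_def)
   next
    case 3
    then show ?thesis by (simp add: S_def)
   qed
  qed
  then have "(\<Prod>t<n. ?f (E1 Un E2) (x i) t) * (\<Prod>t<n. ?f {} (x' i) t) = (\<Prod>t<n. ?f E1 (S x x' i) t) * (\<Prod>t<n. ?f E2 (S x' x i) t)"
   by (simp only: prod.distrib[symmetric])
  \<comment> \<open>Times 0 and \<open>n\<close> of a site lie on the same side of \<open>V\<close>,
    so an observable moves as a whole and takes its label along; \<open>y1\<close> and
    \<open>y2\<close> record where it ends.\<close>
  moreover have "(Ob (y i) (x i n) (x i 0) / of_real (c (y i))) * (Ob (y' i) (x' i n) (x' i 0) / of_real (c (y' i))) =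
   (Ob (y1 i) (S x x' i n) (S x x' i 0) / of_real (c (y1 i))) * (Ob (y2 i) (S x' x i n) (S x' x i 0) / of_real (c (y2 i)))"
   using V0[of i] by (auto simp: y1 y2 S_def mult.commute)
  ultimately show ?thesis unfolding sw_def by (rule mult4)
 qed
 have "rho L (E1 Un E2) y * rho L {} y' =
  (\<Sum>(x, x')\<in>paths L \<times> paths L. (kw (E1 Un E2) x * (\<Prod>i\<in>L. sw (E1 Un E2) y i (x i))) * (kw {} x' * (\<Prod>i\<in>L. sw {} y' i (x' i))))"
  unfolding rho_def sum_product sum.cartesian_product ..
 also have "... = (\<Sum>(x, x')\<in>paths L \<times> paths L. (kw E1 x * (\<Prod>i\<in>L. sw E1 y1 i (x i))) * (kw E2 x' * (\<Prod>i\<in>L. sw E2 y2 i (x' i))))"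
 proof (rule sum.reindex_bij_witness[where i = "%(x, x'). (S x x', S x' x)" and j = "%(x, x'). (S x x', S x' x)"])
  fix p assume "p : paths L \<times> paths L"
  then obtain x x' where p: "p = (x, x')" "x : paths L" "x' : paths L" by auto
  have "(\<Prod>i\<in>L. sw (E1 Un E2) y i (x i)) * (\<Prod>i\<in>L. sw {} y' i (x' i))
   = (\<Prod>i\<in>L. sw E1 y1 i (S x x' i)) * (\<Prod>i\<in>L. sw E2 y2 i (S x' x i))"
   unfolding prod.distrib[symmetric] sw ..
  then show "(case case p of (x, x') => (S x x', S x' x) of (x, x') => (kw E1 x * (\<Prod>i\<in>L. sw E1 y1 i (x i))) * (kw E2 x' * (\<Prod>i\<in>L. sw E2 y2 i (x' i))))
   = (case p of (x, x') => (kw (E1 Un E2) x * (\<Prod>i\<in>L. sw (E1 Un E2) y i (x i))) * (kw {} x' * (\<Prod>i\<in>L. sw {} y' i (x' i))))"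
   unfolding p(1) prod.case kw1 kw2 by (intro mult4[symmetric]) (auto simp: kwU[OF p(2)] kw_empty)
 qed (auto simp: SS S_paths)
 also have "... = rho L E1 y1 * rho L E2 y2"
  unfolding rho_def sum_product sum.cartesian_product ..
 finally show ?thesis .
qed

text \<open>Besides adjacent sites in one layer and adjacent layers at one site, layers 0 and
  \<open>n - 1\<close> are declared neighbours of every layer of the same site. This covers the
  wrap-around in time caused by the trace without a case distinction, and makes the relation
  asymmetric in general.\<close>

definition nbr :: "'d site \<times> nat => ('d site \<times> nat) set" where
 "nbr v = {(j, snd v) | j. l1dist (fst v) j = 1} Un {fst v} \<times> {Suc (snd v), snd v - 1, 0, n - 1}"

text \<open>Extended by 0 beyond the \<open>n\<close> slabs, since the time coordinate of the gas
  runs through all of \<open>nat\<close>.\<close>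

definition poly :: "('d site \<times> nat) set => ('d site => real option) => complex" where
 "poly E y = (if E \<subseteq> UNIV \<times> {..<n} then rho (fst ` E) E y else 0)"

lemma poly_rho:
 assumes "finite L" "E \<subseteq> L \<times> {..<n}" "!!i. y i : alph"
 shows "poly E y = rho L E y"
 unfolding poly_def using assms by (subst rho_superset[of L E "fst ` E"]) auto

lemma poly_empty: "poly {} y = 1"
 unfolding poly_def by (simp add: rho_def paths_def kw_empty)

text \<open>Exchange with a replica that has no excitations and therefore weight 1: the factors of
  \<open>F\<close> move to the replica, and the product of the two systems becomes a product of
  separate activities.\<close>

lemma poly_Un:
 assumes fin: "finite E" "finite F" and sep: "F Int halo nbr E = {}" and y: "!!i. y i : alph"
 shows "poly (E Un F) y = poly E y * poly F y"
proof (cases "E Un F \<subseteq> UNIV \<times> {..<n}")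
 case False
 then show ?thesis by (auto simp: poly_def)
next
 case True
 let ?L = "fst ` (E Un F)"
 have L: "finite ?L" "E \<subseteq> ?L \<times> {..<n}" "F \<subseteq> ?L \<times> {..<n}" using fin True by (auto simp: image_iff) force+
 \<comment> \<open>A slab at time \<open>t\<close> involves the configurations at \<open>t\<close>
   and \<open>Suc t\<close>, so both belong to \<open>V\<close>. Where \<open>F\<close> touches a
   boundary layer of a site, both time ends of that site are added, since the observable links
   them.\<close>
 define V where "V = F Un {(i, Suc t) | i t. (i, t) : F} Un {(i, t). (t = 0 \<or> t = n) & ((i, 0) : F \<or> (i, n - 1) : F)}"
 have nF: "w ~: F" if "v : E" "w : nbr v \<or> w = v" for v w
  using sep that unfolding halo_def by blast
 have n1: "(i, Suc t) ~: F" "(i, t - 1) ~: F" "(i, 0) ~: F" "(i, n - 1) ~: F" "(i, t) ~: F" if "(i, t) : E" for i t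
  using nF[OF that] by (auto simp: nbr_def)
 have lt: "t < n" if "(i, t) : E Un F" for i t using that True by auto
 have "rho ?L (E Un F) y * rho ?L {} y = rho ?L E y * rho ?L F y"
 proof (rule rho_swap[where V = V, OF L])
  fix i j t assume "(i, t) : E" "(j, t) : F"
  then show "i ~= j & l1dist i j ~= 1" using nF[of "(i, t)" "(j, t)"] by (auto simp: nbr_def)
 next
  fix i t assume it: "(i, t) : E"
  show "(i, t) ~: V & (i, Suc t) ~: V"
   using n1[OF it] lt[of i t] it by (auto simp: V_def)
 next
  fix i t assume "(i, t) : F"
  then show "(i, t) : V & (i, Suc t) : V" by (auto simp: V_def)
 next
  fix i
  have "(i, n) ~: F" using lt[of i n] by auto
  moreover have "(i, n) : {(i, Suc t) | i t. (i, t) : F} \<longleftrightarrow> (i, n - 1) : F"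
   using n by (cases n) auto
  ultimately show "(i, 0) : V \<longleftrightarrow> (i, n) : V" using n by (auto simp: V_def)
 qed auto
 then show ?thesis
  using poly_rho[OF L(1) _ y] L rho_empty[OF L(1), of y] y by simp
qed

text \<open>Exchange of the two time ends with a replica that carries the labels \<open>y'\<close>.
  The slabs of a set avoiding layers 0 and \<open>n - 1\<close> involve neither of these times, so
  the labels move to the replica, whose weight is 1 whatever they are.\<close>

lemma poly_indep:
 assumes fin: "finite E" and E: "!!i. (i, 0) ~: E & (i, n - 1) ~: E" and y: "!!i. y i : alph" "!!i. y' i : alph"
 shows "poly E y = poly E y'"
proof (cases "E \<subseteq> UNIV \<times> {..<n}")
 case False
 then show ?thesis by (auto simp: poly_def)
next
 case True
 let ?L = "fst ` E"
 have L: "finite ?L" "E \<subseteq> ?L \<times> {..<n}" using fin True by (auto simp: image_iff) force+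
 have "rho ?L (E Un {}) y * rho ?L {} y' = rho ?L E y' * rho ?L {} y"
 proof (rule rho_swap[where V = "UNIV \<times> {0, n}", OF L])
  fix i t assume it: "(i, t) : E"
  then have "t < n" using True by auto
  moreover have "t ~= 0" "Suc t ~= n" using E[of i] it by (cases "t = 0"; auto)+
  ultimately show "(i, t) ~: UNIV \<times> {0, n} & (i, Suc t) ~: UNIV \<times> {0, n}" by auto
 qed auto
 then show ?thesis using rho_empty[OF L(1)] y True by (simp add: poly_def)
qed

lemma poly_local:
 assumes "!!i. i : fst ` E ==> y i = y' i"
 shows "poly E y = poly E y'"
 using assms unfolding poly_def rho_def sw_def by (auto intro!: sum.cong prod.cong)

lemma norm_u_le: "a < m ==> cmod (u a) <= 1"
proof -
 assume "a < m"
 then have "(cmod (u a))\<^sup>2 <= (\<Sum>i<m. (cmod (u i))\<^sup>2)" by (intro member_le_sum) auto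
 then show ?thesis using u by (simp add: power_le_one_iff abs_square_le_1)
qed

text \<open>At a time between two unexcited slabs the two factors combine to the square of
  \<open>cmod (u a)\<close> and sum to 1, however many such times there are. Only the two ends and
  the times next to an excited slab take the crude bound \<open>m\<close>.\<close>

lemma sum_norm_sw_le:
 assumes y: "y i : alph" and E: "finite E"
 shows "(\<Sum>z\<in>spaths. cmod (sw E y i z)) <= CO * real m ^ (2 + 2 * card {t. (i, t) : E})"
proof -
 \<comment> \<open>\<open>f\<close> is the factor at time \<open>t\<close> from the slab that starts
   there, \<open>b\<close> the factor from the slab that ends there.\<close>
 define f where "f t a = (if t < n & (i, t) ~: E then cmod (u a) else 1)" for t a
 define b where "b t a = (if 0 < t & (i, t - 1) ~: E then cmod (u a) else 1)" for t a
 define bad where "bad = {t. t <= n & ~ (t < n & (i, t) ~: E & 0 < t & (i, t - 1) ~: E)}"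
 let ?Ei = "{t. (i, t) : E}"
 have fEi: "finite ?Ei" using finite_imageI[OF E, of snd] by (rule finite_subset[rotated]) force
 have "cmod (sw E y i z) <= CO * (\<Prod>t\<le>n. f t (z t) * b t (z t))" if z: "z : spaths" for z
 proof -
  have "cmod (\<Prod>t<n. if (i, t) : E then 1 else u (z t) * cnj (u (z (Suc t))))
   = (\<Prod>t<n. f t (z t) * b (Suc t) (z (Suc t)))"
   unfolding prod_norm[symmetric] by (intro prod.cong) (auto simp: f_def b_def norm_mult)
  also have "... = (\<Prod>t<n. f t (z t)) * (\<Prod>t<n. b (Suc t) (z (Suc t)))" by (rule prod.distrib)
  also have "(\<Prod>t<n. f t (z t)) = (\<Prod>t\<le>n. f t (z t))"
   by (simp add: lessThan_Suc_atMost[symmetric] f_def)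
  also have "(\<Prod>t<n. b (Suc t) (z (Suc t))) = (\<Prod>t\<le>n. b t (z t))"
   by (simp add: prod.atMost_shift b_def)
  finally have 1: "cmod (\<Prod>t<n. if (i, t) : E then 1 else u (z t) * cnj (u (z (Suc t)))) = (\<Prod>t\<le>n. f t (z t) * b t (z t))"
   by (simp add: prod.distrib)
  have 2: "cmod (Ob (y i) (z n) (z 0) / of_real (c (y i))) <= CO"
   using Ob_bound[OF y, of "z n" "z 0"] spaths_less[OF z] c[OF y] by (simp add: norm_divide field_simps)
  have "0 <= (\<Prod>t\<le>n. f t (z t) * b t (z t))" by (intro prod_nonneg) (auto simp: f_def b_def)
  then show ?thesis unfolding sw_def norm_mult 1 by (subst mult.commute) (rule mult_right_mono[OF 2])
 qed
 then have "(\<Sum>z\<in>spaths. cmod (sw E y i z)) <= CO * (\<Sum>z\<in>spaths. \<Prod>t\<le>n. f t (z t) * b t (z t))"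
  unfolding sum_distrib_left by (rule sum_mono)
 also have "(\<Sum>z\<in>spaths. \<Prod>t\<le>n. f t (z t) * b t (z t)) = (\<Prod>t\<le>n. \<Sum>a<m. f t a * b t a)"
  unfolding spaths_def by (rule prod_sum_PiE[symmetric]) auto
 also have "... <= (\<Prod>t\<le>n. if t : bad then real m else 1)"
 proof (intro prod_mono conjI)
  fix t assume t: "t : {..n}"
  show "0 <= (\<Sum>a<m. f t a * b t a)" by (intro sum_nonneg) (auto simp: f_def b_def)
  show "(\<Sum>a<m. f t a * b t a) <= (if t : bad then real m else 1)"
  proof (cases "t : bad")
   case True
   have "(\<Sum>a<m. f t a * b t a) <= (\<Sum>a<m. 1)"
    by (intro sum_mono) (auto simp: f_def b_def norm_u_le mult_le_one)
   then show ?thesis using True by simp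
  next
   case False
   then have "f t a * b t a = (cmod (u a))\<^sup>2" for a
    using t by (auto simp: bad_def f_def b_def power2_eq_square)
   then show ?thesis using False u by simp
  qed
 qed
 also have "... = real m ^ card bad"
  by (subst prod.If_cases) (auto simp: bad_def Int_def intro!: arg_cong[where f = card])
 also have "... <= real m ^ (2 + 2 * card ?Ei)"
 proof (intro power_increasing)
  have "bad \<subseteq> {0, n} Un ?Ei Un Suc ` ?Ei"
  proof
   fix t assume "t : bad"
   then show "t : {0, n} Un ?Ei Un Suc ` ?Ei" by (cases t) (auto simp: bad_def)
  qed
  then have "card bad <= card ({0, n} Un ?Ei Un Suc ` ?Ei)" using fEi by (intro card_mono) auto
  also have "... <= card ({0, n} Un ?Ei) + card (Suc ` ?Ei)" by (rule card_Un_le)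
  also have "card ({0, n} Un ?Ei) <= card {0, n} + card ?Ei" by (rule card_Un_le)
  also have "card {0, n} <= 2" by (simp add: card_insert_if)
  also have "card (Suc ` ?Ei) = card ?Ei" by (rule card_image) simp
  finally show "card bad <= 2 + 2 * card ?Ei" by simp
 qed (use m in auto)
 finally show ?thesis using CO by (simp add: mult_left_mono)
qed

lemma card_fibres:
 assumes "finite (E :: ('a \<times> nat) set)"
 shows "(\<Sum>i\<in>fst ` E. card {t. (i, t) : E}) = card E"
proof -
 have "finite {t. (i, t) : E}" for i
  using finite_imageI[OF assms, of snd] by (rule finite_subset[rotated]) force
 then have "(\<Sum>i\<in>fst ` E. card {t. (i, t) : E}) = card (SIGMA i:fst ` E. {t. (i, t) : E})"
  using assms by simp
 also have "(SIGMA i:fst ` E. {t. (i, t) : E}) = E" by force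
 finally show ?thesis .
qed

lemma card_layers:
 assumes "finite E" "E \<subseteq> UNIV \<times> {..<n}"
 shows "(\<Sum>t<n. card (lay E t)) = card E"
proof -
 have f: "finite (lay E t)" for t
  using finite_imageI[OF assms(1), of fst] unfolding lay_def by (rule finite_subset[rotated]) force
 have "(\<Sum>t<n. card (lay E t)) = card (SIGMA t:{..<n}. lay E t)" using f by simp
 also have "(SIGMA t:{..<n}. lay E t) = prod.swap ` E" using assms(2) by (force simp: lay_def image_iff)
 also have "card ... = card E" by (rule card_image) (auto simp: inj_on_def)
 finally show ?thesis .
qed

text \<open>A site in the projection of \<open>E\<close> carries at least one excited slab, so its
  factor \<open>CO\<close> and the two powers of \<open>m\<close> from its time ends can be charged
  to a slab. With the two powers that each slab brings itself this makes
  \<open>real m ^ 4\<close>.\<close>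

lemma poly_bound:
 assumes E: "finite E" and y: "!!i. y i : alph"
 shows "cmod (poly E y) <= (\<epsilon> * CO * real m ^ 4) ^ card E"
proof (cases "E \<subseteq> UNIV \<times> {..<n}")
 case False
 then show ?thesis using \<epsilon> CO by (simp add: poly_def)
next
 case True
 let ?L = "fst ` E"
 have kw: "cmod (kw E x) <= \<epsilon> ^ card E" if x: "x : paths ?L" for x
 proof -
  have "cmod (kw E x) <= (\<Prod>t<n. \<epsilon> ^ card (lay E t))"
   unfolding kw_def prod_norm[symmetric]
  proof (intro prod_mono conjI norm_ge_zero K_bound)
   fix t assume "t : {..<n}"
   have s: "lay E t \<subseteq> ?L" by (force simp: lay_def)
   then show "finite (lay E t)" using E finite_subset by blast
   show "sl (lay E t) x t : confs m (lay E t)" "sl (lay E t) x (Suc t) : confs m (lay E t)"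
    using sl_confs[OF x s] \<open>t : {..<n}\<close> by auto
  qed
  then show ?thesis by (simp add: power_sum[symmetric] card_layers[OF E True])
 qed
 have "cmod (rho ?L E y) <= (\<Sum>x\<in>paths ?L. \<epsilon> ^ card E * (\<Prod>i\<in>?L. cmod (sw E y i (x i))))"
  unfolding rho_def
  by (intro order_trans[OF norm_sum] sum_mono)
   (auto simp: norm_mult prod_norm intro!: mult_right_mono kw prod_nonneg)
 also have "... = \<epsilon> ^ card E * (\<Prod>i\<in>?L. \<Sum>z\<in>spaths. cmod (sw E y i z))"
  unfolding paths_def sum_distrib_left[symmetric]
  by (subst prod_sum_PiE) (use E finite_spaths in auto)
 also have "... <= \<epsilon> ^ card E * (\<Prod>i\<in>?L. CO * real m ^ (2 + 2 * card {t. (i, t) : E}))"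
  using \<epsilon> by (intro mult_left_mono prod_mono conjI sum_nonneg sum_norm_sw_le y E) auto
 also have "(\<Prod>i\<in>?L. CO * real m ^ (2 + 2 * card {t. (i, t) : E})) = CO ^ card ?L * real m ^ (2 * card ?L + 2 * card E)"
 proof -
  have "(\<Sum>i\<in>?L. 2 + 2 * card {t. (i, t) : E}) = 2 * card ?L + 2 * card E"
   by (simp only: sum.distrib sum_distrib_left[symmetric] card_fibres[OF E]) simp
  then show ?thesis by (simp only: prod.distrib power_sum[symmetric] prod_constant)
 qed
 also have "... <= CO ^ card E * real m ^ (4 * card E)"
  using card_image_le[OF E, of fst] CO m by (intro mult_mono power_increasing) auto
 also have "\<epsilon> ^ card E * ... = (\<epsilon> * CO * real m ^ 4) ^ card E"
  by (simp add: power_mult_distrib power_mult)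
 finally show ?thesis using True \<epsilon> by (simp add: poly_def mult_left_mono)
qed

lemma lay_Sigma: "lay (prod.swap ` Sigma I A) t = (if t : I then A t else {})"
 by (force simp: lay_def image_iff)

text \<open>Multiplying out the decomposition of \<open>T\<close> at every time chooses one set of
  excited sites per layer, that is one set \<open>E\<close> of space-time points. Summed over
  \<open>E\<close>, the path weights become those of the full transfer operator, and
  \<open>path_sum\<close> applies.\<close>

lemma sum_poly:
 assumes L: "finite L" and y: "!!i. y i : alph"
  and T: "!!p q. p : confs m L ==> q : confs m L ==>
   T p q = (\<Sum>A\<in>Pow L. K A (restr p A) (restr q A) * (\<Prod>i\<in>L - A. u (p i) * cnj (u (q i))))"
 shows "(\<Sum>E\<in>Pow (L \<times> {..<n}). poly E y) =
  (\<Sum>p\<in>confs m L. \<Sum>q\<in>confs m L. mpow (confs m L) T n p q * (\<Prod>i\<in>L. Ob (y i) (q i) (p i))) / (\<Prod>i\<in>L. of_real (c (y i)))"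
proof -
 let ?O = "%q p. \<Prod>i\<in>L. Ob (y i) (q i) (p i) / of_real (c (y i))"
 have fc: "finite (confs m L)" by (rule finite_confs[OF L])
 have w: "(\<Sum>E\<in>Pow (L \<times> {..<n}). kw E x * (\<Prod>i\<in>L. sw E y i (x i)))
  = (\<Prod>t<n. T (sl L x t) (sl L x (Suc t))) * ?O (sl L x n) (sl L x 0)" if x: "x : paths L" for x
 proof -
  let ?g = "%t A. K A (sl A x t) (sl A x (Suc t)) * (\<Prod>i\<in>L - A. u (x i t) * cnj (u (x i (Suc t))))"
  have "kw E x * (\<Prod>i\<in>L. sw E y i (x i)) = (\<Prod>t<n. ?g t (lay E t)) * ?O (sl L x n) (sl L x 0)"
   if "E : Pow (L \<times> {..<n})" for E
  proof -
   have "(\<Prod>i\<in>L. \<Prod>t<n. if (i, t) : E then 1 else u (x i t) * cnj (u (x i (Suc t))))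
    = (\<Prod>t<n. \<Prod>i\<in>L. if (i, t) : E then 1 else u (x i t) * cnj (u (x i (Suc t))))" by (rule prod.swap)
   also have "... = (\<Prod>t<n. \<Prod>i\<in>L - lay E t. u (x i t) * cnj (u (x i (Suc t))))"
    by (intro prod.cong refl prod.mono_neutral_cong_right) (use L in "auto simp: lay_def")
   finally show ?thesis unfolding kw_def sw_def prod.distrib by (simp add: sl_def mult_ac)
  qed
  then have "(\<Sum>E\<in>Pow (L \<times> {..<n}). kw E x * (\<Prod>i\<in>L. sw E y i (x i)))
   = (\<Sum>E\<in>Pow (L \<times> {..<n}). \<Prod>t<n. ?g t (lay E t)) * ?O (sl L x n) (sl L x 0)"
   unfolding sum_distrib_right by (intro sum.cong refl)
  also have "(\<Sum>E\<in>Pow (L \<times> {..<n}). \<Prod>t<n. ?g t (lay E t)) = (\<Sum>A\<in>PiE {..<n} (%_. Pow L). \<Prod>t<n. ?g t (A t))"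
  proof (rule sum.reindex_bij_witness[where j = "%E. restrict (lay E) {..<n}" and i = "%A. prod.swap ` Sigma {..<n} A"])
   fix E assume "E : Pow (L \<times> {..<n})"
   then show "prod.swap ` Sigma {..<n} (restrict (lay E) {..<n}) = E" "restrict (lay E) {..<n} : PiE {..<n} (%_. Pow L)"
    by (force simp: lay_def image_iff)+
  next
   fix A assume "A : PiE {..<n} (%_. Pow L)"
   then show "restrict (lay (prod.swap ` Sigma {..<n} A)) {..<n} = A"
    by (intro ext) (auto simp: lay_Sigma restrict_def PiE_iff extensional_def)
   show "prod.swap ` Sigma {..<n} A : Pow (L \<times> {..<n})"
    using \<open>A : _\<close> by (fastforce simp: PiE_iff)
  qed (auto intro!: prod.cong)
  also have "... = (\<Prod>t<n. \<Sum>A\<in>Pow L. ?g t A)" by (rule prod_sum_PiE[symmetric]) (use L in auto)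
  also have "... = (\<Prod>t<n. T (sl L x t) (sl L x (Suc t)))"
  proof (intro prod.cong refl)
   fix t assume t: "t : {..<n}"
   have "sl L x t : confs m L" "sl L x (Suc t) : confs m L" using sl_confs[OF x] t by auto
   note T[OF this]
   moreover have "restr (sl L x s) A = sl A x s" if "A : Pow L" for A s
    using that by (auto simp: restr_def sl_def fun_eq_iff)
   moreover have "(\<Prod>i\<in>L - A. u (sl L x t i) * cnj (u (sl L x (Suc t) i))) = (\<Prod>i\<in>L - A. u (x i t) * cnj (u (x i (Suc t))))" for A
    by (intro prod.cong) (auto simp: sl_def)
   ultimately show "(\<Sum>A\<in>Pow L. ?g t A) = T (sl L x t) (sl L x (Suc t))" by simp
  qed
  finally show ?thesis .
 qed
 have "(\<Sum>E\<in>Pow (L \<times> {..<n}). poly E y) = (\<Sum>E\<in>Pow (L \<times> {..<n}). rho L E y)"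
  by (intro sum.cong refl poly_rho L y) auto
 also have "... = (\<Sum>x\<in>paths L. \<Sum>E\<in>Pow (L \<times> {..<n}). kw E x * (\<Prod>i\<in>L. sw E y i (x i)))"
  unfolding rho_def by (rule sum.swap)
 also have "... = (\<Sum>x\<in>paths L. (\<Prod>t<n. T (sl L x t) (sl L x (Suc t))) * ?O (sl L x n) (sl L x 0))"
  by (intro sum.cong refl w)
 also have "... = (\<Sum>X\<in>PiE {..n} (%_. confs m L). (\<Prod>t<n. T (X t) (X (Suc t))) * ?O (X n) (X 0))"
 proof (rule sum.reindex_bij_witness[where j = "%x. restrict (sl L x) {..n}" and i = "%X. restrict (%i. restrict (%t. X t i) {..n}) L"])
  fix x assume x: "x : paths L"
  then show "restrict (%i. restrict (%t. (restrict (sl L x) {..n}) t i) {..n}) L = x"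
   by (auto simp: paths_def spaths_def PiE_iff extensional_def fun_eq_iff sl_def)
  show "restrict (sl L x) {..n} : PiE {..n} (%_. confs m L)" using sl_confs[OF x] by auto
  show "(\<Prod>t<n. T (restrict (sl L x) {..n} t) (restrict (sl L x) {..n} (Suc t))) * ?O (restrict (sl L x) {..n} n) (restrict (sl L x) {..n} 0)
   = (\<Prod>t<n. T (sl L x t) (sl L x (Suc t))) * ?O (sl L x n) (sl L x 0)"
   by (intro arg_cong2[where f = times] prod.cong) auto
 next
  fix X assume X: "X : PiE {..n} (%_. confs m L)"
  then show "restrict (%i. restrict (%t. X t i) {..n}) L : paths L"
   by (auto simp: paths_def spaths_def PiE_iff confs_def)
  show "restrict (sl L (restrict (%i. restrict (%t. X t i) {..n}) L)) {..n} = X"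
   using X by (auto simp: PiE_iff extensional_def fun_eq_iff sl_def confs_def)
 qed
 also have "... = (\<Sum>p\<in>confs m L. \<Sum>q\<in>confs m L. mpow (confs m L) T n p q * ?O q p)"
  by (rule path_sum[OF fc])
 also have "... = (\<Sum>p\<in>confs m L. \<Sum>q\<in>confs m L. mpow (confs m L) T n p q * (\<Prod>i\<in>L. Ob (y i) (q i) (p i))) / (\<Prod>i\<in>L. of_real (c (y i)))"
  by (simp add: sum_divide_distrib prod_dividef)
 finally show ?thesis .
qed

end

section \<open>Translations and cluster weights of the space-time gas\<close>

lemma shift_inverse [simp]: "shift (%k. - a k) (shift a i) = i" "shift a (shift (%k. - a k) i) = i"
 by (auto simp: shift_def)

lemma inj_shift: "inj (shift a)"
 by (rule inj_on_inverseI[where g = "shift (%k. - a k)"]) simp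

lemma l1dist_shift [simp]: "l1dist (shift a i) (shift a j) = l1dist i j"
 by (simp add: l1dist_def shift_def)

lemma finite_l1_ball: "finite {j :: 'd::finite site. l1dist i j <= R}"
proof (rule finite_subset)
 show "{j. l1dist i j <= R} \<subseteq> PiE UNIV (%k. {i k - R..i k + R})"
 proof
  fix j :: "'d site" assume j: "j : {j. l1dist i j <= R}"
  have "\<bar>i k - j k\<bar> <= R" for k
  proof -
   have "\<bar>i k - j k\<bar> <= l1dist i j" unfolding l1dist_def by (rule member_le_sum) auto
   then show ?thesis using j by simp
  qed
  then have "j k : {i k - R..i k + R}" for k by (simp add: abs_le_iff) (smt (verit))
  then show "j : PiE UNIV (%k. {i k - R..i k + R})" by auto
 qed
 show "finite (PiE UNIV (%k. {i k - R..i k + R}))" by (intro finite_PiE) auto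
qed

definition site_degree :: "'d::finite itself => nat" where
 "site_degree _ = card {j :: 'd site. l1dist origin j = 1}"

lemma card_sphere: "card {j :: 'd::finite site. l1dist i j = 1} = site_degree TYPE('d)"
proof -
 have "{j. l1dist i j = 1} = shift i ` {j. l1dist origin j = 1}"
 proof (intro equalityI subsetI)
  fix j assume "j : {j. l1dist i j = 1}"
  then have "l1dist (shift (%k. - i k) i) (shift (%k. - i k) j) = 1" by simp
  moreover have "shift (%k. - i k) i = origin" by (auto simp: shift_def origin_def)
  ultimately show "j : shift i ` {j. l1dist origin j = 1}" by (intro image_eqI[of _ _ "shift (%k. - i k) j"]) auto
 next
  fix j assume "j : shift i ` {j. l1dist origin j = 1}"
  then obtain j' where "j = shift i j'" "l1dist origin j' = 1" by auto
  moreover have "shift i origin = i" by (auto simp: shift_def origin_def)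
  ultimately show "j : {j. l1dist i j = 1}" using l1dist_shift[of i origin j'] by simp
 qed
 then show ?thesis unfolding site_degree_def
  by (simp add: card_image inj_on_subset[OF inj_shift])
qed

lemma subset_Times_iff: "A \<subseteq> D \<times> T \<longleftrightarrow> fst ` A \<subseteq> D & snd ` A \<subseteq> T"
 by force

lemma mob_image:
 assumes "inj f"
 shows "mob g (f ` A) = mob (%B. g (f ` B)) A"
proof -
 have "mob g (f ` A) = (\<Sum>B\<in>(`) f ` Pow A. (-1) ^ card (f ` A - B) * g B)"
  unfolding mob_def image_Pow_surj[OF refl] ..
 also have "... = (\<Sum>B\<in>Pow A. (-1) ^ card (f ` A - f ` B) * g (f ` B))"
  using assms by (subst sum.reindex) (auto simp: inj_on_def inj_image_eq_iff)
 also have "... = mob (%B. g (f ` B)) A"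
  unfolding mob_def by (intro sum.cong refl)
   (simp add: image_set_diff[OF assms, symmetric] card_image inj_on_subset[OF assms])
 finally show ?thesis .
qed

text \<open>Fixing \<open>None\<close> outside \<open>L\<close> keeps the parameter set finite, as
  the maximum in the algebra norm requires.\<close>

definition fields :: "real option set => 'd site set => ('d site => real option) set" where
 "fields S L = {y. (ALL i:L. y i : S) & (ALL i. i ~: L --> y i = None)}"

lemma finite_fields:
 assumes "finite L" "finite S"
 shows "finite (fields S L)"
 by (rule finite_subset[OF _ finite_set_of_finite_funs[OF assms, of None]]) (auto simp: fields_def)

context spacetime
begin

abbreviation vshift :: "'d site => 'd site \<times> nat => 'd site \<times> nat" where
 "vshift a \<equiv> map_prod (shift a) id"

lemma inj_vshift: "inj (vshift a)"
 by (rule prod.inj_map[OF inj_shift inj_on_id])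

lemma lay_vshift: "lay (vshift a ` E) t = shift a ` lay E t"
 by (force simp: lay_def image_iff)

lemma mem_vshift: "(shift a i, t) : vshift a ` E \<longleftrightarrow> (i, t) : E"
 using inj_image_mem_iff[OF inj_vshift[of a], of "(i, t)" E] by simp

lemma rho_vshift:
 assumes L: "finite L" and E: "finite E" "E \<subseteq> L \<times> {..<n}"
 shows "rho (shift a ` L) (vshift a ` E) y = rho L E (y o shift a)"
 unfolding rho_def
proof (rule sum.reindex_bij_witness[where j = "%x. x o shift a" and i = "%x. x o shift (%k. - a k)"])
 fix x assume x: "x : paths (shift a ` L)"
 show "x o shift a o shift (%k. - a k) = x" by (auto simp: fun_eq_iff)
 show "x o shift a : paths L"
  using x inj_image_mem_iff[OF inj_shift[of a]] by (auto simp: paths_def PiE_iff extensional_def)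
 have s: "sl (shift a ` A) x t o shift a = sl A (x o shift a) t" for A t
  using inj_image_mem_iff[OF inj_shift[of a]] by (auto simp: sl_def fun_eq_iff)
 have "kw (vshift a ` E) x = kw E (x o shift a)"
  unfolding kw_def lay_vshift
 proof (intro prod.cong refl)
  fix t assume t: "t : {..<n}"
  have f: "finite (lay E t)" "lay E t \<subseteq> L" using E L by (auto simp: lay_def intro: finite_subset[OF _ L])
  show "K (shift a ` lay E t) (sl (shift a ` lay E t) x t) (sl (shift a ` lay E t) x (Suc t)) =
   K (lay E t) (sl (lay E t) (x o shift a) t) (sl (lay E t) (x o shift a) (Suc t))"
   using t f by (subst K_shift) (auto intro!: sl_confs[OF x] simp: s)
 qed
 moreover have "(\<Prod>i\<in>shift a ` L. sw (vshift a ` E) y i (x i)) = (\<Prod>i\<in>L. sw E (y o shift a) i ((x o shift a) i))"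
  by (subst prod.reindex) (auto simp: sw_def mem_vshift inj_on_subset[OF inj_shift])
 ultimately show "kw E (x o shift a) * (\<Prod>i\<in>L. sw E (y o shift a) i ((x o shift a) i)) =
  kw (vshift a ` E) x * (\<Prod>i\<in>shift a ` L. sw (vshift a ` E) y i (x i))" by simp
next
 fix x assume x: "x : paths L"
 show "x o shift (%k. - a k) o shift a = x" by (auto simp: fun_eq_iff)
 show "x o shift (%k. - a k) : paths (shift a ` L)"
  using x by (auto simp: paths_def PiE_iff extensional_def) (metis image_eqI shift_inverse(2))
qed

lemma poly_vshift:
 assumes "finite E"
 shows "poly (vshift a ` E) y = poly E (y o shift a)"
proof -
 have eq: "fst ` vshift a ` E = shift a ` fst ` E" by (force simp: image_iff)
 have iff: "vshift a ` E \<subseteq> UNIV \<times> {..<n} \<longleftrightarrow> E \<subseteq> UNIV \<times> {..<n}" by (force simp: image_iff)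
 show ?thesis
 proof (cases "E \<subseteq> UNIV \<times> {..<n}")
  case True
  then have "E \<subseteq> fst ` E \<times> {..<n}" by force
  then show ?thesis unfolding poly_def eq iff using rho_vshift[of "fst ` E" E a y] assms True by simp
 next
  case False
  then show ?thesis unfolding poly_def eq iff by simp
 qed
qed

definition ZZ :: "('d site \<times> nat) set => ('d site => real option) => complex" where
 "ZZ D y = (\<Sum>E\<in>Pow D. poly E y)"

text \<open>The cluster weights: Moebius coefficients of the logarithm are the truncated
  contributions of a cluster expansion, one for each space-time support.\<close>

definition F :: "('d site \<times> nat) set => ('d site => real option) => real" where
 "F A y = mob (%D. ln (cmod (ZZ D y))) A"

lemma F_vshift:
 assumes "finite A"
 shows "F (vshift a ` A) y = F A (y o shift a)"
proof -
 have "ZZ (vshift a ` D) y = ZZ D (y o shift a)" if "finite D" for D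
 proof -
  have "ZZ (vshift a ` D) y = (\<Sum>E\<in>(`) (vshift a) ` Pow D. poly E y)"
   unfolding ZZ_def image_Pow_surj[OF refl] ..
  also have "... = (\<Sum>E\<in>Pow D. poly (vshift a ` E) y)"
   by (subst sum.reindex) (auto simp: inj_on_def inj_image_eq_iff[OF inj_vshift])
  also have "... = ZZ D (y o shift a)"
   unfolding ZZ_def by (intro sum.cong refl poly_vshift) (use that finite_subset in auto)
  finally show ?thesis .
 qed
 then show ?thesis unfolding F_def mob_image[OF inj_vshift]
  by (intro mob_cong) (simp add: finite_subset[OF _ assms])
qed

lemma F_local:
 assumes "!!i. i : fst ` A ==> y i = y' i"
 shows "F A y = F A y'"
 unfolding F_def ZZ_def by (intro mob_cong arg_cong[where f = ln] arg_cong[where f = cmod] sum.cong refl poly_local)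
  (use assms in force)

lemma F_indep:
 assumes "finite A" "!!i. (i, 0) ~: A & (i, n - 1) ~: A" "!!i. y i : alph" "!!i. y' i : alph"
 shows "F A y = F A y'"
 unfolding F_def ZZ_def by (intro mob_cong arg_cong[where f = ln] arg_cong[where f = cmod] sum.cong refl poly_indep)
  (use assms(2-) in "auto intro: finite_subset[OF subset_trans assms(1)]")

lemma nbr_finite: "finite (nbr v)" "card (nbr v) <= site_degree TYPE('d) + 4"
proof -
 have eq: "nbr v = (%j. (j, snd v)) ` {j. l1dist (fst v) j = 1} Un {fst v} \<times> {Suc (snd v), snd v - 1, 0, n - 1}"
  unfolding nbr_def by auto
 have f: "finite {j :: 'd site. l1dist (fst v) j = 1}"
  by (rule finite_subset[OF _ finite_l1_ball[of "fst v" 1]]) auto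
 show "finite (nbr v)" unfolding eq using f by auto
 have "card (nbr v) <= card ((%j. (j, snd v)) ` {j. l1dist (fst v) j = 1}) + card ({fst v} \<times> {Suc (snd v), snd v - 1, 0, n - 1})"
  unfolding eq by (rule card_Un_le)
 also have "card ((%j. (j, snd v)) ` {j. l1dist (fst v) j = 1}) <= site_degree TYPE('d)"
  using card_image_le[OF f] card_sphere[of "fst v"] by metis
 also have "card ({fst v} \<times> {Suc (snd v), snd v - 1, 0, n - 1}) <= 4"
  by (simp add: card_cartesian_product card_insert_if)
 finally show "card (nbr v) <= site_degree TYPE('d) + 4" by simp
qed

end

section \<open>The finite-volume potential, uniformly in the number of slabs\<close>

locale spacetime_small = spacetime m u n K \<epsilon> Ob c alph CO
 for m u n and K :: "'d::finite site set => 'd op" and \<epsilon> Ob c alph CO +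
 assumes small: "\<epsilon> * CO * real m ^ 4 * 4 ^ 2 * 2 ^ (2 * (site_degree TYPE('d) + 4) + 2) <= 1"
begin

text \<open>The weight is 4 because \<open>g_bound\<close> spends one factor \<open>2 ^ card\<close>
  on the weight of the potential and another on the choice of a point in a cluster. The degree is
  that of the lattice plus the four neighbours in time.\<close>

lemma polymer_gas_fields:
 assumes "finite L"
 shows "polymer_gas 4 (fields alph L) nbr (site_degree TYPE('d) + 4) poly (\<epsilon> * CO * real m ^ 4)"
proof
 show "finite (fields alph L)" using finite_fields[OF assms alph(1)] .
 show "fields alph L ~= {}" using alph by (auto simp: fields_def intro!: exI[of _ "%_. None"])
 have y: "y i : alph" if "y : fields alph L" for y i using that alph by (cases "i : L") (auto simp: fields_def)
 show "poly {} y = 1" for y by (rule poly_empty)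
 show "poly (E Un E') y = poly E y * poly E' y"
  if "finite E" "finite E'" "E' Int halo nbr E = {}" "y : fields alph L" for E E' y
  by (rule poly_Un[OF that(1-3) y[OF that(4)]])
 show "cmod (poly E y) <= (\<epsilon> * CO * real m ^ 4) ^ card E" if "finite E" "y : fields alph L" for E y
  by (rule poly_bound[OF that(1) y[OF that(2)]])
 show "0 <= \<epsilon> * CO * real m ^ 4" using \<epsilon> CO by (intro mult_nonneg_nonneg) auto
 show "\<epsilon> * CO * real m ^ 4 * 4\<^sup>2 * 2 ^ (2 * (site_degree TYPE('d) + 4) + 2) <= 1" by (rule small)
 show "finite (nbr v)" "card (nbr v) <= site_degree TYPE('d) + 4" for v by (rule nbr_finite)+
qed auto

lemma F_bound:
 assumes "finite L" "finite N" "v ~: N" "!!A. yy A : fields alph L"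
 shows "(\<Sum>A\<in>Pow N. 4 ^ card A * \<bar>F (insert v A) (yy A)\<bar>) <= 1"
proof -
 interpret polymer_gas 4 "fields alph L" nbr "site_degree TYPE('d) + 4" poly "\<epsilon> * CO * real m ^ 4"
  by (rule polymer_gas_fields[OF assms(1)])
 show ?thesis using log_bound[OF assms(2,3), of yy] assms(4)
  unfolding F_def ZZ_def Z_def by simp
qed

lemma ZZ_nonzero:
 assumes "finite D" "finite L" "y : fields alph L"
 shows "ZZ D y ~= 0"
proof -
 interpret polymer_gas 4 "fields alph L" nbr "site_degree TYPE('d) + 4" poly "\<epsilon> * CO * real m ^ 4"
  by (rule polymer_gas_fields[OF assms(2)])
 show ?thesis using Z_nonzero[OF assms(1,3)] unfolding ZZ_def Z_def .
qed

text \<open>Taking the logarithm relative to the unmeasured field lets all clusters that are blind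
  to the labels cancel, and makes the potential vanish where nothing is measured.\<close>

definition g :: "'d site set => ('d site => real option) => real" where
 "g B y = ln (cmod (ZZ (B \<times> {..<n}) y)) - ln (cmod (ZZ (B \<times> {..<n}) (%_. None)))"

text \<open>Grouping space-time clusters by their spatial projection is the sum over times that
  turns cluster weights into a potential on the lattice.\<close>

lemma mob_g:
 assumes "finite B"
 shows "mob (%B. g B y) B = (\<Sum>A | A \<subseteq> B \<times> {..<n} & fst ` A = B. F A y - F A (%_. None))"
proof (rule mob_unique[OF assms])
 fix D assume "D \<subseteq> B"
 then have fD: "finite D" by (rule finite_subset[OF _ assms])
 then have fD2: "finite (D \<times> {..<n})" by simp
 have "g D y = (\<Sum>A\<in>Pow (D \<times> {..<n}). F A y - F A (%_. None))"
  unfolding g_def F_def sum_subtractf by (simp add: sum_mob[OF fD2])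
 also have "... = (\<Sum>B'\<in>Pow D. \<Sum>A | A : Pow (D \<times> {..<n}) & fst ` A = B'. F A y - F A (%_. None))"
  by (rule sum.group[symmetric]) (use fD fD2 in auto)
 also have "... = (\<Sum>B'\<in>Pow D. \<Sum>A | A \<subseteq> B' \<times> {..<n} & fst ` A = B'. F A y - F A (%_. None))"
 proof (intro sum.cong refl)
  fix B' assume "B' : Pow D"
  then have "A \<subseteq> D \<times> {..<n} & fst ` A = B' \<longleftrightarrow> A \<subseteq> B' \<times> {..<n} & fst ` A = B'" for A :: "('d site \<times> nat) set"
   unfolding subset_Times_iff by auto
  then show "{A. A : Pow (D \<times> {..<n}) & fst ` A = B'} = {A. A \<subseteq> B' \<times> {..<n} & fst ` A = B'}" by auto
 qed
 finally show "g D y = (\<Sum>B'\<in>Pow D. \<Sum>A | A \<subseteq> B' \<times> {..<n} & fst ` A = B'. F A y - F A (%_. None))" .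
qed

text \<open>Summing \<open>F_bound\<close> over the roots \<open>(i, t)\<close> for all
  \<open>t\<close> would cost a factor \<open>n\<close>. Instead, only clusters touching layer 0 or
  \<open>n - 1\<close> contribute, and each is translated so that a touching site becomes the
  origin. Two roots, \<open>(origin, 0)\<close> and \<open>(origin, n - 1)\<close>, then control all
  of them, with 4 each; the difference of two fields gives another factor 2.\<close>

theorem g_bound:
 assumes L: "finite L" and y: "!!B i. yB B i : alph"
 shows "(\<Sum>B | B \<subseteq> L & i : B. 2 ^ card B * \<bar>mob (%D. g D (yB B)) B\<bar>) <= 16"
proof -
 define ng :: "'d site => 'd site" where "ng a = (%k. - a k)" for a
 \<comment> \<open>Contains every translate of \<open>L\<close> that moves one of its points to the
   origin, so all translated clusters live in the one finite set \<open>N\<close>.\<close>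
 define R where "R = (%(j, l). shift (ng j) l) ` (L \<times> L)"
 define N where "N = R \<times> {..<n}"
 define M where "M A = Max ((%y. \<bar>F A y\<bar>) ` fields alph R)" for A
 have fin: "finite R" "finite N" unfolding R_def N_def using L by auto
 have ff: "finite (fields alph R)" "fields alph R ~= {}"
  using finite_fields[OF fin(1) alph(1)] alph by (auto simp: fields_def intro!: exI[of _ "%_. None"])
 have M: "\<bar>F A y\<bar> <= M A" if "A \<subseteq> N" "!!i. y i : alph" for A y
 proof -
  have "F A y = F A (%i. if i : R then y i else None)"
   by (rule F_local) (use that in "auto simp: N_def")
  moreover have "(%i. if i : R then y i else None) : fields alph R"
   using that by (auto simp: fields_def)
  ultimately show ?thesis unfolding M_def using ff by (intro Max_ge) auto
 qed
 have M0: "0 <= M A" if "A \<subseteq> N" for A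
  using M[OF that, of "%_. None"] alph by (meson abs_ge_zero order_trans)
 have "EX y. y : fields alph R & \<bar>F A y\<bar> = M A" for A
 proof -
  have "M A : (%y. \<bar>F A y\<bar>) ` fields alph R" unfolding M_def using ff by (intro Max_in) auto
  then show ?thesis by auto
 qed
 then obtain ys where ys: "!!A. ys A : fields alph R" "!!A. \<bar>F A (ys A)\<bar> = M A" by metis
 define \<A> where "\<A> = {A. A \<subseteq> N & ((origin, 0) : A \<or> (origin, n - 1) : A)}"
 have fA: "finite \<A>" unfolding \<A>_def using fin by auto
 have one: "(\<Sum>A | A \<subseteq> N & v : A. 4 ^ card A * M A) <= 4" for v
 proof (cases "v : N")
  case True
  have eq: "{A. A \<subseteq> N & v : A} = insert v ` Pow (N - {v})"
  proof (intro equalityI subsetI)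
   fix A assume "A : {A. A \<subseteq> N & v : A}"
   then show "A : insert v ` Pow (N - {v})" by (intro image_eqI[of _ _ "A - {v}"]) auto
  qed (use True in auto)
  have "(\<Sum>A | A \<subseteq> N & v : A. 4 ^ card A * M A) = (\<Sum>A\<in>Pow (N - {v}). 4 ^ card (insert v A) * M (insert v A))"
   unfolding eq by (subst sum.reindex) (auto simp: inj_on_def)
  also have "... = 4 * (\<Sum>A\<in>Pow (N - {v}). 4 ^ card A * \<bar>F (insert v A) (ys (insert v A))\<bar>)"
   unfolding sum_distrib_left ys(2)
  proof (intro sum.cong refl)
   fix A assume "A : Pow (N - {v})"
   then have "finite A" "v ~: A" using fin finite_subset by auto
   then show "4 ^ card (insert v A) * M (insert v A) = 4 * (4 ^ card A * M (insert v A))" by simp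
  qed
  also have "... <= 4 * 1"
   by (intro mult_left_mono F_bound[OF fin(1)] ys) (use fin in auto)
  finally show ?thesis by simp
 next
  case False
  then have "{A. A \<subseteq> N & v : A} = {}" by auto
  then show ?thesis by (simp only: sum.empty)
 qed
 have sumA: "(\<Sum>A\<in>\<A>. 4 ^ card A * M A) <= 8"
 proof -
  have "(\<Sum>A\<in>\<A>. 4 ^ card A * M A) <= (\<Sum>A\<in>{A. A \<subseteq> N & (origin, 0) : A} Un {A. A \<subseteq> N & (origin, n - 1) : A}. 4 ^ card A * M A)"
   using fin M0 by (intro sum_mono2) (auto simp: \<A>_def)
  also have "... <= (\<Sum>A | A \<subseteq> N & (origin, 0) : A. 4 ^ card A * M A) + (\<Sum>A | A \<subseteq> N & (origin, n - 1) : A. 4 ^ card A * M A)"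
   using fin M0 by (subst sum_Un) (auto intro!: sum_nonneg)
  finally show ?thesis using one[of "(origin, 0)"] one[of "(origin, n - 1)"] by simp
 qed
 define touch where "touch A \<longleftrightarrow> (EX j. (j, 0) : A \<or> (j, n - 1) : A)" for A :: "('d site \<times> nat) set"
 \<comment> \<open>The anchor: a site at which the cluster touches a boundary layer, chosen once for
   each cluster.\<close>
 define p where "p A = (SOME j. (j, 0) : A \<or> (j, n - 1) : A)" for A :: "('d site \<times> nat) set"
 have p: "(p A, 0) : A \<or> (p A, n - 1) : A" if "touch A" for A
  using that unfolding touch_def p_def by (rule someI_ex)
 let ?S = "%A. vshift (ng (p A)) ` A"
 have S: "?S A : \<A>" "A = vshift (p A) ` ?S A" "?S A \<subseteq> N" if A: "A \<subseteq> L \<times> {..<n}" "touch A" for A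
 proof -
  have pL: "p A : L" using p[OF A(2)] A(1) by auto
  show "?S A \<subseteq> N"
  proof
   fix v assume "v : ?S A"
   then obtain l t where "v = (shift (ng (p A)) l, t)" "(l, t) : A" by auto
   then show "v : N" using A(1) pL unfolding N_def R_def by force
  qed
  moreover have "shift (ng (p A)) (p A) = origin" by (auto simp: shift_def ng_def origin_def)
  then have "(origin, 0) : ?S A \<or> (origin, n - 1) : ?S A" using p[OF A(2)] by force
  ultimately show "?S A : \<A>" unfolding \<A>_def by simp
  show "A = vshift (p A) ` ?S A"
   by (simp add: image_image ng_def split_def map_prod_def)
 qed
 have FS: "\<bar>F A y\<bar> <= M (?S A)" if A: "A \<subseteq> L \<times> {..<n}" "touch A" and y: "!!i. y i : alph" for A y
 proof -
  have "finite (?S A)" using S(3)[OF A] fin finite_subset by blast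
  then have "F A y = F (?S A) (y o shift (p A))"
   using F_vshift[of "?S A" "p A" y] S(2)[OF A] by simp
  then show ?thesis using M[OF S(3)[OF A], of "y o shift (p A)"] y by simp
 qed
 define W where "W = {A. A \<subseteq> L \<times> {..<n} & i : fst ` A & touch A}"
 have fW: "finite W" unfolding W_def using L by auto
 let ?T = "%B. {A. A \<subseteq> B \<times> {..<n} & fst ` A = B & touch A}"
 have mg: "\<bar>mob (%D. g D (yB B)) B\<bar> <= (\<Sum>A\<in>?T B. 2 * M (?S A))" if B: "B \<subseteq> L" for B
 proof -
  have fB: "finite B" using B L finite_subset by blast
  have "mob (%D. g D (yB B)) B = (\<Sum>A\<in>?T B. F A (yB B) - F A (%_. None))"
   unfolding mob_g[OF fB]
  proof (rule sum.mono_neutral_right)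
   show "finite {A. A \<subseteq> B \<times> {..<n} & fst ` A = B}" using fB by auto
   show "ALL A:{A. A \<subseteq> B \<times> {..<n} & fst ` A = B} - ?T B. F A (yB B) - F A (%_. None) = 0"
   proof
    fix A assume A: "A : {A. A \<subseteq> B \<times> {..<n} & fst ` A = B} - ?T B"
    then have "finite A" using fB finite_subset[of A "B \<times> {..<n}"] by auto
    moreover have "(j, 0) ~: A & (j, n - 1) ~: A" for j using A unfolding touch_def by auto
    ultimately show "F A (yB B) - F A (%_. None) = 0" using F_indep y alph by fastforce
   qed
  qed auto
  also have "\<bar>...\<bar> <= (\<Sum>A\<in>?T B. 2 * M (?S A))"
  proof (rule order_trans[OF sum_abs], rule sum_mono)
   fix A assume "A : ?T B"
   then have A: "A \<subseteq> L \<times> {..<n}" "touch A" using B by auto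
   show "\<bar>F A (yB B) - F A (%_. None)\<bar> <= 2 * M (?S A)"
    using FS[OF A, of "yB B"] FS[OF A, of "%_. None"] y alph by simp
  qed
  finally show ?thesis .
 qed
 have "(\<Sum>B | B \<subseteq> L & i : B. 2 ^ card B * \<bar>mob (%D. g D (yB B)) B\<bar>)
  <= (\<Sum>B | B \<subseteq> L & i : B. \<Sum>A\<in>?T B. 2 ^ card B * (2 * M (?S A)))"
 proof (rule sum_mono)
  fix B assume "B : {B. B \<subseteq> L & i : B}"
  then have "2 ^ card B * \<bar>mob (%D. g D (yB B)) B\<bar> <= 2 ^ card B * (\<Sum>A\<in>?T B. 2 * M (?S A))"
   by (intro mult_left_mono mg) auto
  then show "2 ^ card B * \<bar>mob (%D. g D (yB B)) B\<bar> <= (\<Sum>A\<in>?T B. 2 ^ card B * (2 * M (?S A)))"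
   by (simp only: sum_distrib_left)
 qed
 also have "... = (\<Sum>B | B \<subseteq> L & i : B. \<Sum>A | A : W & fst ` A = B. 2 ^ card (fst ` A) * (2 * M (?S A)))"
 proof (intro sum.cong refl)
  fix B assume "B : {B. B \<subseteq> L & i : B}"
  then have "A \<subseteq> B \<times> {..<n} & fst ` A = B & touch A \<longleftrightarrow> A : W & fst ` A = B" for A
   unfolding W_def subset_Times_iff by auto
  then show "?T B = {A. A : W & fst ` A = B}" by auto
 qed auto
 also have "... = (\<Sum>A\<in>W. 2 ^ card (fst ` A) * (2 * M (?S A)))"
  by (rule sum.group) (use fW L in "auto simp: W_def")
 also have "... <= (\<Sum>A\<in>W. 2 ^ card (?S A) * (2 * M (?S A)))"
 proof (rule sum_mono)
  fix A assume "A : W"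
  then have A: "A \<subseteq> L \<times> {..<n}" "touch A" by (auto simp: W_def)
  then have "finite A" using L finite_subset[of A "L \<times> {..<n}"] by auto
  have "card (fst ` A) <= card A" by (rule card_image_le[OF \<open>finite A\<close>])
  also have "card A = card (?S A)" by (rule card_image[symmetric]) (rule inj_on_subset[OF inj_vshift], simp)
  finally show "2 ^ card (fst ` A) * (2 * M (?S A)) <= 2 ^ card (?S A) * (2 * M (?S A))"
   using M0[OF S(3)[OF A]] by (intro mult_right_mono power_increasing) auto
 qed
 \<comment> \<open>The translated cluster together with the new place of \<open>i\<close> determines
   the anchor and so the original cluster. A sum over clusters through \<open>i\<close> becomes one
   over anchored clusters and their points.\<close>
 also have "... = (\<Sum>(A, k)\<in>(%A. (?S A, shift (ng (p A)) i)) ` W. 2 ^ card A * (2 * M A))"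
 proof (subst sum.reindex)
  show "inj_on (%A. (?S A, shift (ng (p A)) i)) W"
  proof (rule inj_onI)
   fix A B assume AB: "A : W" "B : W" "(?S A, shift (ng (p A)) i) = (?S B, shift (ng (p B)) i)"
   then have "p A = p B" by (auto simp: shift_def ng_def fun_eq_iff)
   then show "A = B" using S(2)[of A] S(2)[of B] AB by (auto simp: W_def)
  qed
 qed simp
 also have "... <= (\<Sum>(A, k)\<in>Sigma \<A> (%A. fst ` A). 2 ^ card A * (2 * M A))"
 proof (rule sum_mono2)
  show "finite (Sigma \<A> (%A. fst ` A))"
   using fA fin finite_subset by (intro finite_SigmaI) (auto simp: \<A>_def)
  show "(%A. (?S A, shift (ng (p A)) i)) ` W \<subseteq> Sigma \<A> (%A. fst ` A)"
  proof clarify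
   fix A assume "A : W"
   then have A: "A \<subseteq> L \<times> {..<n}" "touch A" and i: "i : fst ` A" by (auto simp: W_def)
   show "?S A : \<A> & shift (ng (p A)) i : fst ` ?S A"
    using S(1)[OF A] i by force
  qed
  show "0 <= (case b of (A, k) => 2 ^ card A * (2 * M A))"
   if "b : Sigma \<A> (%A. fst ` A) - (%A. (?S A, shift (ng (p A)) i)) ` W" for b
   using that M0 by (auto simp: \<A>_def)
 qed
 also have "... = (\<Sum>A\<in>\<A>. \<Sum>k\<in>fst ` A. 2 ^ card A * (2 * M A))"
  by (rule sum.Sigma[symmetric]) (use fA fin finite_subset in "auto simp: \<A>_def")
 also have "... <= (\<Sum>A\<in>\<A>. 2 * (4 ^ card A * M A))"
 proof (rule sum_mono)
  fix A assume "A : \<A>"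
  then have A: "A \<subseteq> N" by (simp add: \<A>_def)
  then have "finite A" using fin finite_subset by blast
  \<comment> \<open>The number of possible places of \<open>i\<close> is absorbed by one of the two
    factors \<open>2 ^ card A\<close> in the weight \<open>4 ^ card A\<close>.\<close>
  have "card (fst ` A) <= 2 ^ card A" using card_image_le[OF \<open>finite A\<close>, of fst] less_exp[of "card A"] by linarith
  then have "real (card (fst ` A)) <= 2 ^ card A" by (metis of_nat_le_iff of_nat_numeral of_nat_power)
  then have "real (card (fst ` A)) * (2 ^ card A * (2 * M A)) <= 2 ^ card A * (2 ^ card A * (2 * M A))"
   using M0[OF A] by (intro mult_right_mono) auto
  also have "... = 2 * (4 ^ card A * M A)" by (simp add: power_mult_distrib[symmetric] mult.assoc[symmetric])
  finally show "(\<Sum>k\<in>fst ` A. 2 ^ card A * (2 * M A)) <= 2 * (4 ^ card A * M A)" by simp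
 qed
 also have "... = 2 * (\<Sum>A\<in>\<A>. 4 ^ card A * M A)" by (simp add: sum_distrib_left)
 also have "... <= 16" using sumA by simp
 finally show ?thesis .
qed

end

section \<open>Gibbs measures from summable potentials\<close>

abbreviation at_volume :: "'a set filter" where "at_volume \<equiv> finite_subsets_at_top UNIV"

lemma sum_PiE_glue:
 fixes p :: "'s set => ('s => real) => real"
 assumes U: "finite U" "finite V" "U Int V = {}" "U Un V \<subseteq> L" and e: "!!j. j : V ==> e j : S"
  and cons: "!!V i e. finite V ==> i ~: V ==> insert i V \<subseteq> L ==> (!!j. j : V ==> e j : S) ==>
   (\<Sum>a\<in>S. p (insert i V) (e(i := a))) = p V e"
 shows "(\<Sum>x\<in>PiE U (%_. S). p (V Un U) (%i. if i : U then x i else e i)) = p V e"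
 using U e
proof (induction U arbitrary: V e rule: finite_induct)
 case empty
 then show ?case by simp
next
 case (insert u U)
 have "(\<Sum>x\<in>PiE (insert u U) (%_. S). p (V Un insert u U) (%i. if i : insert u U then x i else e i))
  = (\<Sum>a\<in>S. \<Sum>x\<in>PiE U (%_. S). p (insert u V Un U) (%i. if i : U then x i else (e(u := a)) i))"
  unfolding sum_PiE_insert[OF insert.hyps(2)]
 proof (intro sum.cong refl arg_cong2[where f = p])
  fix a x
  show "(%i. if i : insert u U then (x(u := a)) i else e i) = (%i. if i : U then x i else (e(u := a)) i)"
   using insert.hyps by (auto simp: fun_eq_iff)
 qed auto
 also have "... = (\<Sum>a\<in>S. p (insert u V) (e(u := a)))"
  using insert.prems insert.hyps by (intro sum.cong refl insert.IH) auto
 also have "... = p V e"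
  using insert.prems by (intro cons) auto
 finally show ?case .
qed

lemma finite_PiE_const: "finite U ==> finite S ==> finite (PiE U (%_. S))"
 by (rule finite_PiE) auto

lemma sets_Omega_cyl:
 assumes "finite V"
 shows "cyl S V e : sets (Omega_space S)"
proof (cases "V = {}")
 case True
 then show ?thesis by (simp add: cyl_def)
next
 case False
 have eq: "cyl S V e = (\<Inter>i\<in>V. {x : space (Omega_space S). x i = e i})" using False by (auto simp: cyl_def)
 have "{x : space (Omega_space S). x i = e i} : sets (Omega_space S)" for i
 proof -
  have "(%x. x i) : measurable (Omega_space S) (count_space S)" unfolding Omega_space_def by measurable
  then have "(%x. x i) -` ({e i} Int S) Int space (Omega_space S) : sets (Omega_space S)"
   by (rule measurable_sets) auto
  moreover have "(%x. x i) -` ({e i} Int S) Int space (Omega_space S) = {x : space (Omega_space S). x i = e i}"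
   by (auto simp: Omega_space_def space_PiM)
  ultimately show ?thesis by simp
 qed
 then show ?thesis unfolding eq using assms False by (intro sets.finite_INT) auto
qed

text \<open>The library version of the Kolmogorov extension works with Borel sets of a Polish
 space, so the measure is built on real sequences and pushed forward by clipping values to S.\<close>

lemma kolmogorov_finite_alphabet:
 fixes p :: "'d site set => ('d site => real) => real"
 assumes S: "finite S" "x0 : S"
  and nonneg: "!!V e. finite V ==> (!!j. j : V ==> e j : S) ==> 0 <= p V e"
  and total: "!!e. p {} e = 1"
  and loc: "!!V e e'. (!!j. j : V ==> e j = e' j) ==> p V e = p V e'"
  and cons: "!!V i e. finite V ==> i ~: V ==> (!!j. j : V ==> e j : S) ==>
   (\<Sum>a\<in>S. p (insert i V) (e(i := a))) = p V e"
 shows "\<exists>\<mu>. is_prob_on_Omega S \<mu> & (ALL V. finite V --> (ALL e:PiE V (%_. S). measure \<mu> (cyl S V e) = p V e))"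
proof -
 let ?E = "%J. PiE J (%_. S)"
 define q where "q J = embed_pmf (%x. if x : ?E J then p J x else 0)" for J
 have fE: "finite (?E J)" if "finite J" for J using finite_PiE_const[OF that S(1)] .
 have tot: "(\<Sum>x\<in>?E J. p J x) = 1" if "finite J" for J
 proof -
  have "(\<Sum>v\<in>?E J. p ({} Un J) (%i. if i : J then v i else undefined)) = p {} (%_. undefined)"
   by (rule sum_PiE_glue[where L = UNIV, OF _ _ _ _ _ cons]) (use that in auto)
  moreover have "p ({} Un J) (%i. if i : J then v i else undefined) = p J v" for v
   using loc[of J "%i. if i : J then v i else undefined" v] by simp
  ultimately show ?thesis using total by simp
 qed
 have pmf_q: "pmf (q J) x = (if x : ?E J then p J x else 0)" if J: "finite J" for J x
  unfolding q_def
 proof (rule pmf_embed_pmf)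
  fix x show "0 <= (if x : ?E J then p J x else 0)" using nonneg[OF J] by (auto simp: PiE_iff)
 next
  have "(\<integral>\<^sup>+ x. ennreal (if x : ?E J then p J x else 0) \<partial>count_space UNIV)
   = (\<Sum>x\<in>?E J. ennreal (p J x))"
   by (subst nn_integral_count_space'[of "?E J"]) (use fE[OF J] nonneg[OF J] in "auto simp: PiE_iff intro!: sum.cong")
  also have "... = ennreal (\<Sum>x\<in>?E J. p J x)"
   by (rule sum_ennreal) (use nonneg[OF J] in "auto simp: PiE_iff")
  finally show "(\<integral>\<^sup>+ x. ennreal (if x : ?E J then p J x else 0) \<partial>count_space UNIV) = 1"
   using tot[OF J] by simp
 qed
 have set_q: "set_pmf (q J) \<subseteq> ?E J" if "finite J" for J
  using pmf_q[OF that] by (auto simp: set_pmf_iff split: if_splits)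
 have prob_q: "measure (measure_pmf (q J)) A = (\<Sum>x\<in>?E J Int A. p J x)" if "finite J" for J A
 proof -
  have "measure (measure_pmf (q J)) A = measure (measure_pmf (q J)) (A Int ?E J)"
   using set_q[OF that] by (intro measure_pmf.finite_measure_eq_AE) (auto simp: AE_measure_pmf_iff)
  also have "... = (\<Sum>x\<in>A Int ?E J. pmf (q J) x)" using fE[OF that] by (intro measure_measure_pmf_finite) auto
  also have "... = (\<Sum>x\<in>?E J Int A. p J x)" by (intro sum.cong) (auto simp: pmf_q[OF that])
  finally show ?thesis .
 qed
 have map_q: "map_pmf (%x. restrict x J) (q H) = q J" if JH: "J \<subseteq> H" "finite H" for J H
 proof (rule pmf_eqI)
  fix e
  have fJ: "finite J" using JH finite_subset by blast
  have "pmf (map_pmf (%x. restrict x J) (q H)) e = (\<Sum>x\<in>?E H Int (%x. restrict x J) -` {e}. p H x)"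
   by (simp add: pmf_map prob_q[OF JH(2)])
  also have "... = (if e : ?E J then p J e else 0)"
  proof (cases "e : ?E J")
   case False
   then have "?E H Int (%x. restrict x J) -` {e} = {}" using JH by auto
   then show ?thesis using False by simp
  next
   case True
   have "(\<Sum>x\<in>?E H Int (%x. restrict x J) -` {e}. p H x)
    = (\<Sum>v\<in>?E (H - J). p (J Un (H - J)) (%i. if i : H - J then v i else e i))"
   proof (rule sum.reindex_bij_witness[where j = "%x. restrict x (H - J)" and i = "%v i. if i : H - J then v i else e i"])
    fix x assume x: "x : ?E H Int (%x. restrict x J) -` {e}"
    then have e: "e = restrict x J" and xH: "x : ?E H" by auto
    show *: "(%i. if i : H - J then restrict x (H - J) i else e i) = x"
     unfolding e using xH JH by (auto simp: fun_eq_iff PiE_iff extensional_def)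
    show "restrict x (H - J) : ?E (H - J)" using x by auto
    show "p (J Un (H - J)) (%i. if i : H - J then restrict x (H - J) i else e i) = p H x"
     unfolding * using JH by (simp add: Un_absorb1)
   next
    fix v assume v: "v : ?E (H - J)"
    show "restrict (%i. if i : H - J then v i else e i) (H - J) = v"
     using v by (auto simp: fun_eq_iff PiE_iff extensional_def)
    have "restrict (%i. if i : H - J then v i else e i) J = e"
     using True by (auto simp: fun_eq_iff PiE_iff extensional_def)
    moreover have "(%i. if i : H - J then v i else e i) : ?E H"
     using v True JH by (auto simp: PiE_iff extensional_def)
    ultimately show "(%i. if i : H - J then v i else e i) : ?E H Int (%x. restrict x J) -` {e}" by simp
   qed
   also have "... = p J e"
    by (rule sum_PiE_glue[where L = UNIV, OF _ _ _ _ _ cons]) (use JH fJ True in "auto simp: PiE_iff")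
   finally show ?thesis using True by simp
  qed
  also have "... = pmf (q J) e" by (simp add: pmf_q[OF fJ])
  finally show "pmf (map_pmf (%x. restrict x J) (q H)) e = pmf (q J) e" .
 qed
 define P where "P J = distr (measure_pmf (q J)) (PiM J (%_. borel :: real measure)) (%x. restrict x J)" for J
 have meas: "(%x. restrict x J) : measurable (measure_pmf (q H)) (PiM J (%_. borel :: real measure))" for J H
  by (auto simp: measurable_def space_PiM)
 interpret P: polish_projective UNIV P
 proof (intro polish_projective.intro projective_family.intro)
  fix J H :: "'d site set" assume JH: "J \<subseteq> H" "finite H"
  have "distr (P H) (PiM J (%_. borel)) (%f. restrict f J)
   = distr (measure_pmf (q H)) (PiM J (%_. borel)) ((%f. restrict f J) o (%x. restrict x H))"
   unfolding P_def by (rule distr_distr) (use JH in "auto intro!: measurable_restrict_subset meas simp: space_PiM")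
  also have "(%f. restrict f J) o (%x. restrict x H) = (%x. restrict x J) o (%x :: 'd site => real. restrict x J)"
   using JH by (auto simp: fun_eq_iff)
  also have "distr (measure_pmf (q H)) (PiM J (%_. borel)) ...
   = distr (distr (measure_pmf (q H)) (count_space UNIV) (%x. restrict x J)) (PiM J (%_. borel)) (%x. restrict x J)"
   by (rule distr_distr[symmetric]) (auto simp: measurable_def space_PiM)
  also have "... = P J"
   unfolding P_def map_q[OF JH, symmetric] map_pmf_rep_eq ..
  finally show "P J = distr (P H) (PiM J (%_. borel)) (%f. restrict f J)" by (rule sym)
 next
  fix J :: "'d site set" assume "finite J"
  show "prob_space (P J)" unfolding P_def by (rule measure_pmf.prob_space_distr[OF meas])
 qed
 let ?cl = "%a. if a : S then a else x0"
 have "?cl : borel_measurable borel"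
  by (rule measurable_If_set) (use S(1) in "auto intro: borel_closed finite_imp_closed")
 then have clB: "?cl -` {a} : sets borel" for a
  using measurable_sets[of ?cl borel borel "{a}"] by simp
 have clm: "(%x i. ?cl (x i)) : measurable P.lim (Omega_space S)"
 proof -
  have "(%x i. ?cl (x i)) : measurable (PiM UNIV (%_. borel :: real measure)) (Omega_space S :: ('d site => real) measure)"
   unfolding Omega_space_def
  proof (rule measurable_PiM_single'[where f = "%i x. ?cl (x i)"])
   fix i :: "'d site"
   have 1: "?cl : measurable borel (count_space S)"
    using S clB by (auto simp: measurable_count_space_eq2)
   show "(%x. ?cl (x i)) : measurable (PiM UNIV (%_. borel :: real measure)) (count_space S)"
    by (rule measurable_compose[OF _ 1]) (rule measurable_component_singleton, simp)
  qed (use S in "auto simp: space_PiM")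
  then show ?thesis by (simp cong: measurable_cong_sets)
 qed
 define \<mu> where "\<mu> = distr P.lim (Omega_space S) (%x i. ?cl (x i))"
 have "measure \<mu> (cyl S V e) = p V e" if V: "finite V" and e: "e : ?E V" for V e
 proof -
  define X where "X = {z : space (PiM V (%_. borel :: real measure)). ALL i:V. ?cl (z i) = e i}"
  have X: "X : sets (PiM V (%_. borel :: real measure))"
  proof -
   have "X = PiE V (%i. ?cl -` {e i})" by (auto simp: X_def space_PiM PiE_iff simp del: if_split) (auto simp: extensional_def)
   then show ?thesis using V clB by (auto intro: sets_PiM_I_finite)
  qed
  have "measure \<mu> (cyl S V e) = measure P.lim ((%x i. ?cl (x i)) -` cyl S V e Int space P.lim)"
   unfolding \<mu>_def by (rule measure_distr[OF clm sets_Omega_cyl[OF V]])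
  also have "(%x i. ?cl (x i)) -` cyl S V e Int space P.lim = P.emb UNIV V X"
   using S by (auto simp: cyl_def X_def prod_emb_def space_PiM Omega_space_def)
  also have "measure P.lim ... = measure (P V) X" by (rule P.measure_lim_emb[OF _ V X]) simp
  also have "... = measure (measure_pmf (q V)) ((%x. restrict x V) -` X)"
   unfolding P_def by (subst measure_distr[OF meas X]) simp
  also have "... = (\<Sum>x\<in>?E V Int (%x. restrict x V) -` X. p V x)" by (rule prob_q[OF V])
  also have "?E V Int (%x. restrict x V) -` X = {e}"
  proof (intro equalityI subsetI)
   fix x assume x: "x : ?E V Int (%x. restrict x V) -` X"
   then have "x i = e i" if "i : V" for i using that by (auto simp: X_def PiE_iff split: if_splits)
   moreover have "x i = e i" if "i ~: V" for i using that x e by (auto simp: PiE_iff extensional_def)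
   ultimately show "x : {e}" by (auto simp: fun_eq_iff)
  qed (use e in "auto simp: X_def space_PiM PiE_iff")
  finally show ?thesis by simp
 qed
 moreover have "is_prob_on_Omega S \<mu>"
  unfolding is_prob_on_Omega_def \<mu>_def by (auto intro: P.P.prob_space_distr[OF clm])
 ultimately show ?thesis by blast
qed

text \<open>A set of nonzero weight meets \<open>V\<close> and is counted at least once when the sum
  is distributed over the sites of \<open>V\<close>. Allowing zero weight in \<open>touch\<close>
  admits the empty set into the family.\<close>

lemma sum_le_by_sites:
 fixes f :: "'v set => real" and C :: real
 assumes V: "finite V" and F: "finite F" and f: "!!B. B : F ==> 0 <= f B"
  and touch: "!!B. B : F ==> B Int V ~= {} \<or> f B = 0" and C: "!!i. i : V ==> (\<Sum>B | B : F & i : B. f B) <= C"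
 shows "sum f F <= card V * C"
proof -
 have "sum f F <= (\<Sum>B\<in>F. \<Sum>i\<in>V. if i : B then f B else 0)"
 proof (rule sum_mono)
  fix B assume B: "B : F"
  show "f B <= (\<Sum>i\<in>V. if i : B then f B else 0)"
  proof (cases "f B = 0")
   case False
   then obtain i where i: "i : V" "i : B" using touch[OF B] by auto
   have "(if i : B then f B else 0) <= (\<Sum>i\<in>V. if i : B then f B else 0)"
    by (rule member_le_sum[OF i(1)]) (use V f[OF B] in auto)
   then show ?thesis using i by simp
  qed (simp add: sum_nonneg)
 qed
 also have "... = (\<Sum>i\<in>V. \<Sum>B | B : F & i : B. f B)"
  unfolding sum.inter_filter[OF F] by (rule sum.swap)
 also have "... <= card V * C" using sum_bounded_above[of V _ C, OF C] by simp
 finally show ?thesis .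
qed

definition fld :: "'d site set => ('d site => real) => 'd site => real option" where
 "fld V e = (%i. if i : V then Some (e i) else None)"

definition touching :: "'d site set => 'd site set set" where
 "touching V = {B. finite B & B Int V ~= {}}"

text \<open>The marginal weight of a configuration on \<open>V\<close> in the volume
  \<open>L\<close>, unmeasured sites being labelled \<open>None\<close>. All marginals share one
  potential, so the thermodynamic limit concerns only a sum over the sets that meet
  \<open>V\<close>.\<close>

definition fvw :: "(real => real) => ('d site set => ('d site => real option) => real) => 'd site set => 'd site set => ('d site => real) => real" where
 "fvw c G L V e = (\<Prod>i\<in>V. c (e i)) * exp (\<Sum>B\<in>Pow L. G B (fld V e))"

text \<open>If unnormalised weights agree up to a factor \<open>q\<close> in both directions, so do
  their sums; the normalised weights then agree up to \<open>q\<^sup>2\<close>, and they are at most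
  1.\<close>

lemma ratio_diff:
 fixes A B :: "'x => real"
 assumes I: "finite I" "e : I" and pos: "!!z. z : I ==> 0 < A z" "!!z. z : I ==> 0 < B z"
  and q: "!!z. z : I ==> A z <= q * B z" "!!z. z : I ==> B z <= q * A z" "1 <= q"
 shows "\<bar>A e / sum A I - B e / sum B I\<bar> <= q\<^sup>2 - 1"
proof -
 have main: "A e / sum A I - B e / sum B I <= q\<^sup>2 - 1"
  if pos: "!!z. z : I ==> 0 < A z" "!!z. z : I ==> 0 < B z"
  and q': "!!z. z : I ==> A z <= q * B z" "!!z. z : I ==> B z <= q * A z" for A B :: "'x => real"
 proof -
  have sA: "0 < sum A I" "0 < sum B I" using I pos by (auto intro!: sum_pos)
  have "sum B I <= q * sum A I" unfolding sum_distrib_left by (intro sum_mono q')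
  then have "A e * sum B I <= A e * (q * sum A I)" using pos(1)[OF I(2)] by (intro mult_left_mono) auto
  also have "... <= (q * B e) * (q * sum A I)" using q'(1)[OF I(2)] sA q by (intro mult_right_mono) auto
  finally have "A e / sum A I <= q\<^sup>2 * (B e / sum B I)"
   using sA by (simp add: field_simps power2_eq_square)
  also have "q\<^sup>2 * (B e / sum B I) - B e / sum B I = (q\<^sup>2 - 1) * (B e / sum B I)" by (simp add: algebra_simps)
  then have "q\<^sup>2 * (B e / sum B I) = (q\<^sup>2 - 1) * (B e / sum B I) + B e / sum B I" by simp
  also have "(q\<^sup>2 - 1) * (B e / sum B I) <= (q\<^sup>2 - 1) * 1"
  proof (intro mult_left_mono)
   have "B e <= sum B I" using I pos by (intro member_le_sum) (auto intro: less_imp_le)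
   then show "B e / sum B I <= 1" using sA by simp
  qed (use q in simp)
  finally show ?thesis by simp
 qed
 have "A e / sum A I - B e / sum B I <= q\<^sup>2 - 1" "B e / sum B I - A e / sum A I <= q\<^sup>2 - 1"
  by (rule main; use pos q in blast)+
 then show ?thesis by (simp add: abs_le_iff)
qed

lemma sum_PiE_split:
 assumes "D \<subseteq> L"
 shows "(\<Sum>x\<in>PiE L (%_. S). f x) = (\<Sum>z\<in>PiE (L - D) (%_. S). \<Sum>v\<in>PiE D (%_. S). f (glue D v z))"
 unfolding sum.cartesian_product
proof (rule sum.reindex_bij_witness[where j = "%x. (restrict x (L - D), restrict x D)" and i = "%(z, v). glue D v z"])
 fix x assume x: "x : PiE L (%_. S)"
 show *: "(case (restrict x (L - D), restrict x D) of (z, v) => glue D v z) = x"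
  using x assms by (auto simp: glue_def fun_eq_iff PiE_iff extensional_def)
 show "(restrict x (L - D), restrict x D) : PiE (L - D) (%_. S) \<times> PiE D (%_. S)" using x assms by auto
 show "(case (restrict x (L - D), restrict x D) of (z, v) => f (glue D v z)) = f x" using * by simp
next
 fix p assume "p : PiE (L - D) (%_. S) \<times> PiE D (%_. S)"
 then obtain z v where p: "p = (z, v)" "z : PiE (L - D) (%_. S)" "v : PiE D (%_. S)" by auto
 have "restrict (glue D v z) (L - D) = z" "restrict (glue D v z) D = v"
  using p by (auto simp: glue_def fun_eq_iff PiE_iff extensional_def)
 then show "(restrict (case p of (z, v) => glue D v z) (L - D), restrict (case p of (z, v) => glue D v z) D) = p"
  using p by simp
 show "(case p of (z, v) => glue D v z) : PiE L (%_. S)"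
  using p assms by (auto simp: glue_def PiE_iff extensional_def)
qed

text \<open>What marginals have to satisfy to come from a Gibbs measure, stated without the quantum
  model so that positive temperature and ground state are two instances. The field in
  \<open>G_bound\<close> may depend on the set, which turns the bound into one on suprema.\<close>

locale gibbs_data =
 fixes S :: "real set" and c :: "real => real"
  and G :: "'d::finite site set => ('d site => real option) => real" and C :: real
 assumes S: "finite S" "S ~= {}" and c: "!!a. a : S ==> 0 < c a"
  and G_local: "!!B y y'. (!!i. i : B ==> y i = y' i) ==> G B y = G B y'"
  and G_None: "!!B. G B (%_. None) = 0"
  and G_shift: "!!a B y. G (shift a ` B) y = G B (y o shift a)"
  and G_bound: "!!L i yB. finite L ==> (!!B j. yB B j : insert None (Some ` S)) ==>
   (\<Sum>B | B \<subseteq> L & i : B. 2 ^ card B * \<bar>G B (yB B)\<bar>) <= C"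
  and cons: "!!L i V e. finite L ==> V \<subseteq> L ==> i : L ==> i ~: V ==> (!!j. j : V ==> e j : S) ==>
   (\<Sum>a\<in>S. fvw c G L (insert i V) (e(i := a))) = fvw c G L V e"
begin

abbreviation alph :: "real option set" where "alph \<equiv> insert None (Some ` S)"

abbreviation w :: "'d site set => 'd site set => ('d site => real) => real" where "w \<equiv> fvw c G"

definition sG :: "'d site set => real" where
 "sG B = Max ((%y. \<bar>G B y\<bar>) ` fields alph B)"

lemma finite_fields_alph: "finite B ==> finite (fields alph B)" "fields alph B ~= {}"
 using finite_fields[of B alph] S by (auto simp: fields_def intro!: exI[of _ "%_. None"])

lemma G_le: "finite B ==> (!!i. y i : alph) ==> \<bar>G B y\<bar> <= sG B"
proof -
 assume B: "finite B" and y: "!!i. y i : alph"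
 have "G B y = G B (%i. if i : B then y i else None)" by (rule G_local) simp
 moreover have "(%i. if i : B then y i else None) : fields alph B" using y by (auto simp: fields_def)
 ultimately show ?thesis unfolding sG_def using finite_fields_alph(1)[OF B] by (intro Max_ge) auto
qed

lemma sG_nonneg: "finite B ==> 0 <= sG B"
 using G_le[of B "%_. None"] by (simp add: G_None)

lemma sG_bound:
 assumes "finite L"
 shows "(\<Sum>B | B \<subseteq> L & i : B. 2 ^ card B * sG B) <= C"
proof -
 have "EX y. (ALL j. y j : alph) & \<bar>G B y\<bar> = sG B" if "finite B" for B
 proof -
  have "sG B : (%y. \<bar>G B y\<bar>) ` fields alph B"
   unfolding sG_def using finite_fields_alph(1)[OF that] finite_fields_alph(2)[of B] by (intro Max_in) auto
  then obtain y where y: "y : fields alph B" "sG B = \<bar>G B y\<bar>" by auto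
  moreover have "y j : alph" for j using y by (cases "j : B") (auto simp: fields_def)
  ultimately show ?thesis by auto
 qed
 then have "EX y. (ALL j. y j : alph) & (finite B --> \<bar>G B y\<bar> = sG B)" for B
  by (cases "finite B") (auto intro!: exI[of _ "%_. None"])
 then obtain yB where yB: "!!B j. yB B j : alph" "!!B. finite B ==> \<bar>G B (yB B)\<bar> = sG B" by metis
 have "(\<Sum>B | B \<subseteq> L & i : B. 2 ^ card B * sG B) = (\<Sum>B | B \<subseteq> L & i : B. 2 ^ card B * \<bar>G B (yB B)\<bar>)"
  by (intro sum.cong refl) (auto simp: yB(2) finite_subset[OF _ assms])
 then show ?thesis using G_bound[OF assms yB(1)] by simp
qed

lemma sum_sG_le:
 assumes V: "finite V" and F: "finite F" "F \<subseteq> touching V"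
 shows "(\<Sum>B\<in>F. 2 ^ card B * sG B) <= card V * C"
proof -
 let ?L = "\<Union>F"
 have L: "finite ?L" using F by (auto simp: touching_def)
 have nn: "0 <= 2 ^ card B * sG B" if "B : F" for B using F that sG_nonneg by (auto simp: touching_def)
 show ?thesis
 proof (rule sum_le_by_sites[OF V F(1) nn])
  fix i assume "i : V"
  have "(\<Sum>B\<in>{B : F. i : B}. 2 ^ card B * sG B) <= (\<Sum>B | B \<subseteq> ?L & i : B. 2 ^ card B * sG B)"
  proof (rule sum_mono2)
   show "finite {B. B \<subseteq> ?L & i : B}" using L by simp
   show "0 <= 2 ^ card b * sG b" if "b : {B. B \<subseteq> ?L & i : B} - {B : F. i : B}" for b
    using that sG_nonneg finite_subset[OF _ L] by auto
  qed auto
  also have "... <= C" by (rule sG_bound[OF L])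
  finally show "(\<Sum>B\<in>{B : F. i : B}. 2 ^ card B * sG B) <= C" .
 qed (use F in "auto simp: touching_def")
qed

lemma summable_sG:
 assumes V: "finite V"
 shows "sG summable_on touching V"
proof (rule nonneg_bdd_above_summable_on)
 show "0 <= sG B" if "B : touching V" for B using that sG_nonneg by (auto simp: touching_def)
 show "bdd_above (sum sG ` {F. F \<subseteq> touching V & finite F})"
 proof (rule bdd_aboveI2)
  fix F assume "F : {F. F \<subseteq> touching V & finite F}"
  then have F: "finite F" "F \<subseteq> touching V" by auto
  have "sum sG F <= (\<Sum>B\<in>F. 2 ^ card B * sG B)"
  proof (rule sum_mono)
   fix B assume "B : F"
   then have "0 <= sG B" using F sG_nonneg by (auto simp: touching_def)
   then show "sG B <= 2 ^ card B * sG B" using mult_right_mono[of 1 "2 ^ card B" "sG B"] by simp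
  qed
  then show "sum sG F <= card V * C" using sum_sG_le[OF V F] by simp
 qed
qed

lemma abs_summable_G:
 assumes V: "finite V" and y: "!!i. y i : alph"
 shows "(%B. norm (G B y)) summable_on touching V"
proof (rule Infinite_Sum.abs_summable_on_comparison_test'[OF summable_sG[OF V], where f = "%B. G B y"])
 show "norm (G B y) <= sG B" if "B : touching V" for B
  using that G_le[of B y] y by (auto simp: touching_def)
qed

lemma summable_G:
 assumes V: "finite V" and y: "!!i. y i : alph"
 shows "(%B. G B y) summable_on touching V"
 using abs_summable_G[OF assms] by (rule abs_summable_summable)

text \<open>What a volume \<open>L\<close> misses of the interactions that meet \<open>V\<close>,
  uniformly in the field. All approximation errors are expressed through it.\<close>

definition tail :: "'d site set => 'd site set => real" where
 "tail V L = infsum sG (touching V) - sum sG (touching V Int Pow L)"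

lemma filterlim_touching:
 "filterlim (%L. touching V Int Pow L) (finite_subsets_at_top (touching V)) at_volume"
 unfolding filterlim_finite_subsets_at_top
proof safe
 fix X assume X: "finite X" "X \<subseteq> touching V"
 have "eventually (%L. finite L & \<Union>X \<subseteq> L & L \<subseteq> UNIV) at_volume"
  by (rule eventually_finite_subsets_at_top[THEN iffD2], rule exI[of _ "\<Union>X"])
   (use X in "auto simp: touching_def")
 then show "eventually (%L. finite (touching V Int Pow L) & X \<subseteq> touching V Int Pow L & touching V Int Pow L \<subseteq> touching V) at_volume"
  by (rule eventually_mono) (use X in auto)
qed

lemma tail_lim:
 assumes "finite V"
 shows "((%L. tail V L) \<longlongrightarrow> 0) at_volume"
proof -
 have "(sum sG \<longlongrightarrow> infsum sG (touching V)) (finite_subsets_at_top (touching V))"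
  using has_sum_infsum[OF summable_sG[OF assms]] unfolding has_sum_def .
 from filterlim_compose[OF this filterlim_touching]
 have "((%L. sum sG (touching V Int Pow L)) \<longlongrightarrow> infsum sG (touching V)) at_volume" .
 then have "((%L. infsum sG (touching V) - sum sG (touching V Int Pow L)) \<longlongrightarrow> infsum sG (touching V) - infsum sG (touching V)) at_volume"
  by (intro tendsto_diff tendsto_const)
 then show ?thesis unfolding tail_def by simp
qed

lemma G_tail:
 assumes V: "finite V" and L: "finite L" and y: "!!i. y i : alph"
 shows "\<bar>infsum (%B. G B y) (touching V) - (\<Sum>B\<in>touching V Int Pow L. G B y)\<bar> <= tail V L"
proof -
 let ?T = "touching V Int Pow L"
 have fin: "finite ?T" using L by simp
 have d: "infsum f (touching V) - sum f ?T = infsum f (touching V - ?T)" if "f summable_on touching V" for f :: "'d site set => real"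
  using infsum_Diff[OF that, of ?T] fin by (simp add: summable_on_finite)
 have sub: "f summable_on touching V - ?T" if "f summable_on touching V" for f :: "'d site set => real"
  using that by (rule summable_on_subset_banach) auto
 have "\<bar>infsum (%B. G B y) (touching V - ?T)\<bar> <= infsum (%B. norm (G B y)) (touching V - ?T)"
  using norm_infsum_bound[OF sub[OF abs_summable_G[OF V, of y]]] y by simp
 also have "... <= infsum sG (touching V - ?T)"
 proof (rule infsum_mono[OF sub[OF abs_summable_G[OF V, of y]] sub[OF summable_sG[OF V]]])
  show "y i : alph" for i by (rule y)
  show "norm (G B y) <= sG B" if "B : touching V - ?T" for B
   using that G_le[of B y] y by (auto simp: touching_def)
 qed
 finally show ?thesis unfolding tail_def d[OF summable_G[OF V y]] d[OF summable_sG[OF V]] .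
qed

lemma tail_nonneg: "finite V ==> finite L ==> 0 <= tail V L"
 using G_tail[of V L "%_. None"] by (simp add: G_None)

definition ivw :: "'d site set => ('d site => real) => real" where
 "ivw V e = (\<Prod>i\<in>V. c (e i)) * exp (infsum (%B. G B (fld V e)) (touching V))"

lemma fld_alph: "(!!j. j : V ==> e j : S) ==> fld V e i : alph"
 by (auto simp: fld_def)

lemma sum_Pow_touching:
 assumes "finite L" "!!i. i ~: V ==> y i = None"
 shows "(\<Sum>B\<in>Pow L. G B y) = (\<Sum>B\<in>touching V Int Pow L. G B y)"
proof (rule sum.mono_neutral_right)
 show "ALL B:Pow L - touching V Int Pow L. G B y = 0"
 proof
  fix B assume "B : Pow L - touching V Int Pow L"
  then have "B Int V = {}" using assms(1) finite_subset by (auto simp: touching_def)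
  then have "G B y = G B (%_. None)" using assms(2) by (intro G_local) auto
  then show "G B y = 0" by (simp add: G_None)
 qed
qed (use assms in auto)

lemma w_lim:
 assumes V: "finite V" and e: "!!j. j : V ==> e j : S"
 shows "((%L. w L V e) \<longlongrightarrow> ivw V e) at_volume"
proof -
 have "((%L. \<Sum>B\<in>touching V Int Pow L. G B (fld V e)) \<longlongrightarrow> infsum (%B. G B (fld V e)) (touching V)) at_volume"
 proof -
  have "(%B. G B (fld V e)) summable_on touching V"
   by (rule summable_G[OF V]) (use fld_alph e in blast)
  from has_sum_infsum[OF this] show ?thesis
   unfolding has_sum_def by (rule filterlim_compose[OF _ filterlim_touching])
 qed
 moreover have "eventually (%L. (\<Sum>B\<in>touching V Int Pow L. G B (fld V e)) = (\<Sum>B\<in>Pow L. G B (fld V e))) at_volume"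
  by (rule eventually_mono[OF eventually_finite_subsets_at_top_weakI[of UNIV finite]])
   (auto simp: sum_Pow_touching[of _ V] fld_def)
 ultimately have "((%L. \<Sum>B\<in>Pow L. G B (fld V e)) \<longlongrightarrow> infsum (%B. G B (fld V e)) (touching V)) at_volume"
  by (rule Lim_transform_eventually)
 then show ?thesis unfolding fvw_def ivw_def by (intro tendsto_mult tendsto_const tendsto_exp)
qed

lemma ivw_pos: "finite V ==> (!!j. j : V ==> e j : S) ==> 0 < ivw V e"
 unfolding ivw_def by (auto intro!: mult_pos_pos prod_pos c)

lemma fld_cong: "(!!j. j : V ==> e j = e' j) ==> fld V e = fld V e'"
 by (auto simp: fld_def)

lemma w_cong: "(!!j. j : V ==> e j = e' j) ==> w L V e = w L V e'"
 using fld_cong[of V e e'] unfolding fvw_def by (simp cong: prod.cong)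

lemma ivw_cong: "(!!j. j : V ==> e j = e' j) ==> ivw V e = ivw V e'"
 using fld_cong[of V e e'] unfolding ivw_def by (simp cong: prod.cong)

lemma finite_subsets_at_top_superset:
 "finite X ==> eventually (%L. finite L & X \<subseteq> L) at_volume"
 by (auto simp: eventually_finite_subsets_at_top intro!: exI[of _ X])

text \<open>In every volume that contains \<open>V\<close> and \<open>i\<close> the identity is
  exact, so it holds for the limit along the net.\<close>

lemma ivw_cons:
 assumes V: "finite V" "i ~: V" and e: "!!j. j : V ==> e j : S"
 shows "(\<Sum>a\<in>S. ivw (insert i V) (e(i := a))) = ivw V e"
proof (rule tendsto_unique)
 show "((%L. \<Sum>a\<in>S. w L (insert i V) (e(i := a))) \<longlongrightarrow> (\<Sum>a\<in>S. ivw (insert i V) (e(i := a)))) at_volume"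
  by (intro tendsto_sum w_lim) (use V e in auto)
 have "eventually (%L. w L V e = (\<Sum>a\<in>S. w L (insert i V) (e(i := a)))) at_volume"
  by (rule eventually_mono[OF finite_subsets_at_top_superset[of "insert i V"]])
   (use V in "auto intro!: cons[symmetric] e")
 then show "((%L. \<Sum>a\<in>S. w L (insert i V) (e(i := a))) \<longlongrightarrow> ivw V e) at_volume"
  by (rule Lim_transform_eventually[rotated]) (rule w_lim, use V e in auto)
qed simp

lemma ex_measure:
 "\<exists>\<mu>. is_prob_on_Omega S \<mu> & (ALL V. finite V --> (ALL e:PiE V (%_. S). measure \<mu> (cyl S V e) = ivw V e))"
proof -
 obtain x0 where "x0 : S" using S by blast
 show ?thesis
 proof (rule kolmogorov_finite_alphabet[OF S(1) \<open>x0 : S\<close>])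
  show "ivw {} e = 1" for e by (simp add: ivw_def touching_def)
  show "0 <= ivw V e" if "finite V" "!!j. j : V ==> e j : S" for V e
   by (intro less_imp_le ivw_pos that)
  show "ivw V e = ivw V e'" if "!!j. j : V ==> e j = e' j" for V e e'
   using that by (rule ivw_cong)
  show "(\<Sum>a\<in>S. ivw (insert i V) (e(i := a))) = ivw V e"
   if "finite V" "i ~: V" "!!j. j : V ==> e j : S" for V i e
   using that by (rule ivw_cons)
 qed
qed

text \<open>Unnormalised conditional weight: only sets meeting \<open>D\<close> enter, since all
  others cancel in a conditional probability given the outside. \<open>cw\<close> keeps those inside
  \<open>L\<close>, \<open>icw\<close> keeps all.\<close>

definition cw :: "'d site set => 'd site set => ('d site => real) => ('d site => real) => real" where
 "cw L D z x = (\<Prod>i\<in>D. c (z i)) * exp (\<Sum>B\<in>touching D Int Pow L. G B (Some o glue D z x))"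

definition icw :: "'d site set => ('d site => real) => ('d site => real) => real" where
 "icw D z x = (\<Prod>i\<in>D. c (z i)) * exp (infsum (%B. G B (Some o glue D z x)) (touching D))"

definition cp :: "'d site set => 'd site set => ('d site => real) => ('d site => real) => real" where
 "cp L D e x = cw L D e x / (\<Sum>z\<in>PiE D (%_. S). cw L D z x)"

definition icp :: "'d site set => ('d site => real) => ('d site => real) => real" where
 "icp D e x = icw D e x / (\<Sum>z\<in>PiE D (%_. S). icw D z x)"

lemma prod_c_pos: "x : PiE D (%_. S) ==> 0 < (\<Prod>i\<in>D. c (x i))"
 by (intro prod_pos c) auto

lemma cw_pos: "z : PiE D (%_. S) ==> 0 < cw L D z x" "z : PiE D (%_. S) ==> 0 < icw D z x"
 unfolding cw_def icw_def using prod_c_pos[of z D] by auto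

lemma exp_le_ratio:
 fixes k a b t :: real
 assumes "0 < k" "\<bar>a - b\<bar> <= t"
 shows "k * exp a <= exp t * (k * exp b)"
proof -
 have "exp a <= exp (t + b)" using assms by simp
 then show ?thesis using assms by (simp add: exp_add mult.left_commute)
qed

text \<open>The exponents in \<open>L\<close> and in infinite volume differ by at most the tail,
  whatever the outside configuration, so \<open>ratio_diff\<close> applies with
  \<open>q = exp (tail D L)\<close>.\<close>

lemma cp_icp:
 assumes D: "finite D" and L: "finite L" and e: "e : PiE D (%_. S)" and x: "!!i. i ~: D ==> x i : S"
 shows "\<bar>icp D e x - cp L D e x\<bar> <= exp (2 * tail D L) - 1"
proof -
 have y: "(Some o glue D z x) i : alph" if "z : PiE D (%_. S)" for z i
  using that x by (auto simp: glue_def)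
 have "\<bar>icp D e x - cp L D e x\<bar> <= (exp (tail D L))\<^sup>2 - 1"
  unfolding icp_def cp_def
 proof (rule ratio_diff)
  show "finite (PiE D (%_. S))" by (rule finite_PiE_const[OF D S(1)])
  fix z assume z: "z : PiE D (%_. S)"
  note g = G_tail[of D L "Some o glue D z x", OF D L y[OF z]]
  show "icw D z x <= exp (tail D L) * cw L D z x"
   unfolding icw_def cw_def by (rule exp_le_ratio[OF prod_c_pos[OF z] g])
  show "cw L D z x <= exp (tail D L) * icw D z x"
   unfolding icw_def cw_def by (rule exp_le_ratio[OF prod_c_pos[OF z]]) (use g in "simp add: abs_minus_commute")
 qed (use e cw_pos tail_nonneg[OF D L] in auto)
 also have "(exp (tail D L))\<^sup>2 = exp (2 * tail D L)" by (simp add: exp_double)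
 finally show ?thesis .
qed

lemma cp_cong:
 assumes "!!i. i : L - D ==> x i = x' i"
 shows "cp L D e x = cp L D e x'"
proof -
 have "cw L D z x = cw L D z x'" for z
  unfolding cw_def by (intro arg_cong2[where f = times] arg_cong[where f = exp] sum.cong refl G_local)
   (use assms in "auto simp: glue_def")
 then show ?thesis unfolding cp_def by simp
qed

lemma w_factor:
 assumes L: "finite L" "D \<subseteq> L"
 shows "w L L (glue D x z) = cw L D x z * ((\<Prod>i\<in>L - D. c (z i)) * exp (\<Sum>B\<in>Pow (L - D). G B (Some o z)))"
proof -
 have fl: "G B (fld L (glue D x z)) = G B (Some o glue D x z)" if "B : Pow L" for B
  by (rule G_local) (use that in "auto simp: fld_def")
 have "(\<Sum>B\<in>Pow L. G B (fld L (glue D x z))) = (\<Sum>B\<in>Pow L. G B (Some o glue D x z))"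
  by (intro sum.cong refl fl)
 also have "... = (\<Sum>B\<in>(touching D Int Pow L) Un Pow (L - D). G B (Some o glue D x z))"
  by (rule sum.cong[OF _ refl]) (use L finite_subset in "auto simp: touching_def")
 also have "(\<Sum>B\<in>(touching D Int Pow L) Un Pow (L - D). G B (Some o glue D x z))
  = (\<Sum>B\<in>touching D Int Pow L. G B (Some o glue D x z)) + (\<Sum>B\<in>Pow (L - D). G B (Some o glue D x z))"
  using L by (intro sum.union_disjoint) (auto simp: touching_def)
 also have "(\<Sum>B\<in>Pow (L - D). G B (Some o glue D x z)) = (\<Sum>B\<in>Pow (L - D). G B (Some o z))"
  by (intro sum.cong refl G_local) (auto simp: glue_def)
 finally have s: "(\<Sum>B\<in>Pow L. G B (fld L (glue D x z))) =
  (\<Sum>B\<in>touching D Int Pow L. G B (Some o glue D x z)) + (\<Sum>B\<in>Pow (L - D). G B (Some o z))" .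
 have "(\<Prod>i\<in>L. c (glue D x z i)) = (\<Prod>i\<in>D. c (glue D x z i)) * (\<Prod>i\<in>L - D. c (glue D x z i))"
  using L by (metis prod.subset_diff mult.commute)
 also have "... = (\<Prod>i\<in>D. c (x i)) * (\<Prod>i\<in>L - D. c (z i))"
  by (intro arg_cong2[where f = times] prod.cong) (auto simp: glue_def)
 finally show ?thesis unfolding fvw_def cw_def s exp_add by simp
qed

lemma w_sum_glue:
 assumes L: "finite L" "V \<subseteq> L" and e: "!!j. j : V ==> e j : S"
 shows "(\<Sum>x\<in>PiE (L - V) (%_. S). w L L (glue (L - V) x e)) = w L V e"
proof -
 have "(\<Sum>x\<in>PiE (L - V) (%_. S). w L (V Un (L - V)) (%i. if i : L - V then x i else e i)) = w L V e"
  by (rule sum_PiE_glue[where L = L, OF _ _ _ _ _ cons]) (use L finite_subset e in auto)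
 moreover have "V Un (L - V) = L" using L by auto
 ultimately show ?thesis by (simp add: glue_def)
qed

text \<open>\<open>w_factor\<close> separates the weight of the sites in \<open>D\<close> from a
  factor that does not see them, so summing over \<open>D\<close> cancels the normalisation of
  \<open>cp\<close>. The event on \<open>W\<close> does not involve \<open>D\<close> and passes
  through; the remaining sites are summed out by consistency.\<close>

lemma dlr_finite:
 assumes L: "finite L" "D \<subseteq> L" "W \<subseteq> L" "W Int D = {}" and e: "e : PiE D (%_. S)" and y: "!!i. i : W ==> y i : S"
 shows "(\<Sum>x\<in>PiE L (%_. S). (if ALL i:W. x i = y i then cp L D e x else 0) * w L L x) = w L (D Un W) (glue D e y)"
proof -
 have fD: "finite D" "finite (PiE D (%_. S))" using L finite_subset finite_PiE_const S by blast+
 have "(\<Sum>x\<in>PiE L (%_. S). (if ALL i:W. x i = y i then cp L D e x else 0) * w L L x)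
  = (\<Sum>z\<in>PiE (L - D) (%_. S). \<Sum>v\<in>PiE D (%_. S). (if ALL i:W. glue D v z i = y i then cp L D e (glue D v z) else 0) * w L L (glue D v z))"
  by (rule sum_PiE_split[OF L(2)])
 also have "... = (\<Sum>z\<in>PiE (L - D) (%_. S). if ALL i:W. z i = y i then w L L (glue D e z) else 0)"
 proof (intro sum.cong refl)
  fix z assume z: "z : PiE (L - D) (%_. S)"
  have W: "(ALL i:W. glue D v z i = y i) \<longleftrightarrow> (ALL i:W. z i = y i)" for v
   using L(4) by (auto simp: glue_def)
  have cp: "cp L D e (glue D v z) = cp L D e z" for v by (rule cp_cong) (auto simp: glue_def)
  let ?r = "(\<Prod>i\<in>L - D. c (z i)) * exp (\<Sum>B\<in>Pow (L - D). G B (Some o z))"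
  have "(\<Sum>v\<in>PiE D (%_. S). cp L D e z * w L L (glue D v z)) = cp L D e z * ((\<Sum>v\<in>PiE D (%_. S). cw L D v z) * ?r)"
   unfolding w_factor[OF L(1,2)] sum_distrib_left sum_distrib_right ..
  also have "... = w L L (glue D e z)"
  proof -
   have "0 < (\<Sum>v\<in>PiE D (%_. S). cw L D v z)" using e fD cw_pos by (intro sum_pos) auto
   then show ?thesis unfolding w_factor[OF L(1,2)] cp_def by simp
  qed
  finally show "(\<Sum>v\<in>PiE D (%_. S). (if ALL i:W. glue D v z i = y i then cp L D e (glue D v z) else 0) * w L L (glue D v z))
   = (if ALL i:W. z i = y i then w L L (glue D e z) else 0)"
   unfolding W cp by simp
 qed
 also have "... = (\<Sum>z\<in>{z\<in>PiE (L - D) (%_. S). ALL i:W. z i = y i}. w L L (glue D e z))"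
  by (rule sum.inter_filter[symmetric]) (use L S in "auto intro!: finite_PiE_const")
 also have "... = (\<Sum>v\<in>PiE (L - (D Un W)) (%_. S). w L L (glue (L - (D Un W)) v (glue D e y)))"
 proof (rule sum.reindex_bij_witness[where j = "%z. restrict z (L - (D Un W))" and i = "%v. restrict (glue W y v) (L - D)"])
  fix z assume z: "z : {z\<in>PiE (L - D) (%_. S). ALL i:W. z i = y i}"
  then show "restrict (glue W y (restrict z (L - (D Un W)))) (L - D) = z"
   by (auto simp: glue_def fun_eq_iff PiE_iff extensional_def)
  show "restrict z (L - (D Un W)) : PiE (L - (D Un W)) (%_. S)" using z by auto
  show "w L L (glue (L - (D Un W)) (restrict z (L - (D Un W))) (glue D e y)) = w L L (glue D e z)"
   by (rule w_cong) (use z L in "auto simp: glue_def")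
 next
  fix v assume v: "v : PiE (L - (D Un W)) (%_. S)"
  then show "restrict (restrict (glue W y v) (L - D)) (L - (D Un W)) = v"
   by (auto simp: glue_def fun_eq_iff PiE_iff extensional_def)
  show "restrict (glue W y v) (L - D) : {z\<in>PiE (L - D) (%_. S). ALL i:W. z i = y i}"
   using v y L by (auto simp: glue_def PiE_iff)
 qed
 also have "... = w L (D Un W) (glue D e y)"
  by (rule w_sum_glue) (use L e y in "auto simp: glue_def")
 finally show ?thesis .
qed

text \<open>A sequence of volumes is introduced beside the net because measurability passes to
  limits of sequences.\<close>

definition box :: "nat => 'd site set" where "box n = {j. l1dist origin j <= int n}"

lemma finite_box: "finite (box n)"
 unfolding box_def by (rule finite_l1_ball)

lemma box_lim: "filterlim box at_volume sequentially"
 unfolding filterlim_finite_subsets_at_top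
proof safe
 fix X :: "'d site set" assume X: "finite X"
 define n0 where "n0 = (\<Sum>x\<in>X. nat (l1dist origin x))"
 have "X \<subseteq> box n" if "n \<ge> n0" for n
 proof
  fix x assume "x : X"
  then have "nat (l1dist origin x) <= n0" unfolding n0_def using X by (intro member_le_sum) auto
  then show "x : box n" using that by (simp add: box_def)
 qed
 then show "\<forall>\<^sub>F n in sequentially. finite (box n) & X \<subseteq> box n & box n \<subseteq> UNIV"
  using finite_box by (auto simp: eventually_sequentially)
qed

definition err :: "'d site set => 'd site set => real" where
 "err D L = exp (2 * tail D L) - 1"

lemma err_lim: "finite D ==> ((%L. err D L) \<longlongrightarrow> 0) at_volume"
proof -
 assume "finite D"
 then have "((%L. exp (2 * tail D L) - 1) \<longlongrightarrow> exp (2 * 0) - 1) at_volume"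
  by (intro tendsto_diff tendsto_const tendsto_exp tendsto_mult tail_lim)
 then show ?thesis unfolding err_def by simp
qed

lemma err_nonneg: "finite D ==> finite L ==> 0 <= err D L"
 using tail_nonneg by (simp add: err_def)

lemma cp_cp:
 assumes D: "finite D" and L: "finite L" "finite L'" "L \<subseteq> L'" and e: "e : PiE D (%_. S)" and z: "z : PiE L' (%_. S)"
 shows "\<bar>cp L D e z - cp L' D e z\<bar> <= err D L + err D L'"
proof -
 obtain x0 where x0: "x0 : S" using S by blast
 define x where "x = (%i. if i : L' then z i else x0)"
 have "x i : S" for i using z x0 by (auto simp: x_def)
 then have "\<bar>icp D e x - cp L D e x\<bar> <= err D L" "\<bar>icp D e x - cp L' D e x\<bar> <= err D L'"
  unfolding err_def by (intro cp_icp D L e; simp)+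
 moreover have "cp L D e x = cp L D e z" "cp L' D e x = cp L' D e z"
  by (rule cp_cong, use L in "auto simp: x_def")+
 ultimately show ?thesis by linarith
qed

lemma w_marginal:
 assumes L: "finite L'" "L \<subseteq> L'" and f: "!!x x'. (!!i. i : L ==> x i = x' i) ==> f x = f x'"
 shows "(\<Sum>x\<in>PiE L' (%_. S). f x * w L' L' x) = (\<Sum>x\<in>PiE L (%_. S). f x * w L' L x)"
proof -
 have "(\<Sum>x\<in>PiE L' (%_. S). f x * w L' L' x) = (\<Sum>z\<in>PiE (L' - (L' - L)) (%_. S). \<Sum>v\<in>PiE (L' - L) (%_. S).
  f (glue (L' - L) v z) * w L' L' (glue (L' - L) v z))"
  by (rule sum_PiE_split) auto
 also have "L' - (L' - L) = L" using L by auto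
 also have "(\<Sum>z\<in>PiE L (%_. S). \<Sum>v\<in>PiE (L' - L) (%_. S). f (glue (L' - L) v z) * w L' L' (glue (L' - L) v z))
  = (\<Sum>z\<in>PiE L (%_. S). f z * w L' L z)"
 proof (intro sum.cong refl)
  fix z assume z: "z : PiE L (%_. S)"
  have "(\<Sum>v\<in>PiE (L' - L) (%_. S). f (glue (L' - L) v z) * w L' L' (glue (L' - L) v z))
   = (\<Sum>v\<in>PiE (L' - L) (%_. S). f z * w L' L' (glue (L' - L) v z))"
  proof (intro sum.cong refl arg_cong2[where f = times])
   fix v show "f (glue (L' - L) v z) = f z" by (rule f) (simp add: glue_def)
  qed
  also have "... = f z * w L' L z"
   unfolding sum_distrib_left[symmetric] by (subst w_sum_glue) (use L z in auto)
  finally show "(\<Sum>v\<in>PiE (L' - L) (%_. S). f (glue (L' - L) v z) * w L' L' (glue (L' - L) v z)) = f z * w L' L z" .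
 qed
 finally show ?thesis .
qed

lemma w_nonneg: "(!!i. i : V ==> e i : S) ==> 0 <= w L V e"
 unfolding fvw_def by (intro mult_nonneg_nonneg prod_nonneg) (auto intro: less_imp_le c)

lemma sum_w: "finite L ==> (\<Sum>x\<in>PiE L (%_. S). w L L x) = 1"
proof -
 assume L: "finite L"
 have "(\<Sum>x\<in>PiE L (%_. S). 1 * w L L x) = (\<Sum>x\<in>PiE {} (%_. S). 1 * w L {} x)"
  by (rule w_marginal[OF L]) auto
 then show ?thesis by (simp add: fvw_def fld_def G_None)
qed

text \<open>The conditional weight in \<open>L\<close> is local, while the one in a larger
  \<open>L'\<close> satisfies the equation exactly. They differ by at most the two errors, and the
  error of \<open>L'\<close> disappears as \<open>L'\<close> grows.\<close>

lemma dlr_window: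
 assumes D: "finite D" "finite W" "W Int D = {}" and e: "e : PiE D (%_. S)" and z: "!!i. i : W ==> z i : S"
  and L: "finite L" "D Un W \<subseteq> L"
 shows "\<bar>(\<Sum>x\<in>PiE L (%_. S). (if ALL i:W. x i = z i then cp L D e x else 0) * ivw L x) - ivw (D Un W) (glue D e z)\<bar> <= err D L"
proof -
 let ?f = "%L x. if ALL i:W. x i = z i then cp L D e x else 0"
 have f_cong: "?f L x = ?f L x'" if "!!i. i : L ==> x i = x' i" for x x'
  using that L(2) cp_cong[of L D x x' e] by (auto simp: subset_iff)
 have main: "\<bar>(\<Sum>x\<in>PiE L (%_. S). ?f L x * w L' L x) - w L' (D Un W) (glue D e z)\<bar> <= err D L + err D L'"
  if L': "finite L'" "L \<subseteq> L'" for L'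
 proof -
  have a: "(\<Sum>x\<in>PiE L' (%_. S). ?f L x * w L' L' x) = (\<Sum>x\<in>PiE L (%_. S). ?f L x * w L' L x)"
   by (rule w_marginal[OF L']) (rule f_cong)
  have b: "(\<Sum>x\<in>PiE L' (%_. S). ?f L' x * w L' L' x) = w L' (D Un W) (glue D e z)"
   using L(2) L' D(3) by (intro dlr_finite e z) auto
  have "\<bar>\<Sum>x\<in>PiE L' (%_. S). (?f L x - ?f L' x) * w L' L' x\<bar> <= (\<Sum>x\<in>PiE L' (%_. S). (err D L + err D L') * w L' L' x)"
  proof (rule order_trans[OF sum_abs], rule sum_mono)
   fix x assume x: "x : PiE L' (%_. S)"
   have "\<bar>?f L x - ?f L' x\<bar> <= err D L + err D L'"
   proof (cases "ALL i:W. x i = z i")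
    case True
    then show ?thesis using cp_cp[OF D(1) L(1) L' e x] by simp
   next
    case False
    show ?thesis unfolding if_not_P[OF False] using err_nonneg[OF D(1) L(1)] err_nonneg[OF D(1) L'(1)] by simp
   qed
   moreover have "0 <= w L' L' x" by (rule w_nonneg) (use x in auto)
   ultimately show "\<bar>(?f L x - ?f L' x) * w L' L' x\<bar> <= (err D L + err D L') * w L' L' x"
    unfolding abs_mult by (simp only: abs_of_nonneg mult_right_mono)
  qed
  also have "... = err D L + err D L'"
   using sum_w[OF L'(1)] by (metis mult.right_neutral sum_distrib_left)
  finally show ?thesis unfolding left_diff_distrib sum_subtractf a b .
 qed
 show ?thesis
 proof (rule tendsto_le)
  show "finite_subsets_at_top (UNIV :: 'd site set) ~= bot" by simp
  have "((%L'. err D L + err D L') \<longlongrightarrow> err D L + 0) at_volume"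
   by (intro tendsto_add tendsto_const err_lim D)
  then show "((%L'. err D L + err D L') \<longlongrightarrow> err D L) at_volume" by simp
  show "((%L'. \<bar>(\<Sum>x\<in>PiE L (%_. S). ?f L x * w L' L x) - w L' (D Un W) (glue D e z)\<bar>) \<longlongrightarrow>
   \<bar>(\<Sum>x\<in>PiE L (%_. S). ?f L x * ivw L x) - ivw (D Un W) (glue D e z)\<bar>) at_volume"
   by (intro tendsto_rabs tendsto_diff tendsto_sum tendsto_mult tendsto_const w_lim)
    (use L D e z in "auto simp: glue_def")
  show "\<forall>\<^sub>F L' in at_volume. \<bar>(\<Sum>x\<in>PiE L (%_. S). ?f L x * w L' L x) - w L' (D Un W) (glue D e z)\<bar> <= err D L + err D L'"
   by (rule eventually_mono[OF finite_subsets_at_top_superset[OF L(1)]]) (use main in blast)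
 qed
qed

end

section \<open>Conditional probabilities of the infinite-volume measure\<close>

context gibbs_data
begin

context
 fixes \<mu> :: "('d site => real) measure"
 assumes \<mu>: "is_prob_on_Omega S \<mu>"
  and cylm: "!!V e. finite V ==> e : PiE V (%_. S) ==> measure \<mu> (cyl S V e) = ivw V e"
begin

lemma prob_mu: "prob_space \<mu>" and sets_mu: "sets \<mu> = sets (Omega_space S)" and space_mu: "space \<mu> = space (Omega_space S)"
 using \<mu> by (auto simp: is_prob_on_Omega_def)

lemma space_in_S: "x : space \<mu> ==> x i : S"
 by (auto simp: space_mu Omega_space_def space_PiM)

lemma cyl_measure:
 assumes "finite V" "!!i. i : V ==> e i : S"
 shows "measure \<mu> (cyl S V e) = ivw V e"
proof -
 have "cyl S V e = cyl S V (restrict e V)" by (auto simp: cyl_def)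
 then have "measure \<mu> (cyl S V e) = ivw V (restrict e V)" using cylm[of V "restrict e V"] assms by auto
 also have "... = ivw V e" by (rule ivw_cong) simp
 finally show ?thesis .
qed

lemma cyl_sets: "finite V ==> cyl S V e : sets \<mu>"
 using sets_Omega_cyl by (simp add: sets_mu)

lemma local_expansion:
 assumes V: "finite V" and f: "!!x x'. (!!i. i : V ==> x i = x' i) ==> f x = (f x' :: real)"
  and x: "x : space \<mu>"
 shows "f x = (\<Sum>z\<in>PiE V (%_. S). f z * indicator (cyl S V z) x)"
proof -
 let ?r = "restrict x V"
 have r: "?r : PiE V (%_. S)" using space_in_S[OF x] by auto
 have "(\<Sum>z\<in>PiE V (%_. S). f z * indicator (cyl S V z) x) = (\<Sum>z\<in>PiE V (%_. S). if z = ?r then f ?r else 0)"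
 proof (intro sum.cong refl)
  fix z assume z: "z : PiE V (%_. S)"
  have "x : cyl S V z \<longleftrightarrow> z = ?r"
   using z x by (auto simp: cyl_def space_mu fun_eq_iff PiE_iff extensional_def)
  then show "f z * indicator (cyl S V z) x = (if z = ?r then f ?r else 0)" by auto
 qed
 also have "... = f ?r" using r finite_PiE_const[OF V S(1)] by simp
 also have "... = f x" by (rule f) simp
 finally show ?thesis by simp
qed

lemma local_integral:
 assumes V: "finite V" and f: "!!x x'. (!!i. i : V ==> x i = x' i) ==> f x = (f x' :: real)"
 shows "integrable \<mu> f" "integral\<^sup>L \<mu> f = (\<Sum>z\<in>PiE V (%_. S). f z * ivw V z)"
proof -
 interpret prob_space \<mu> by (rule prob_mu)
 let ?g = "%x. \<Sum>z\<in>PiE V (%_. S). f z * indicator (cyl S V z) x"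
 have ind: "integrable \<mu> (indicator (cyl S V z) :: _ => real)" for z
  using cyl_sets[OF V] by (simp add: emeasure_eq_measure)
 have "integrable \<mu> ?g" by (intro Bochner_Integration.integrable_sum integrable_mult_right ind)
 moreover have eq: "f x = ?g x" if "x : space \<mu>" for x using local_expansion[OF V f that] .
 ultimately show "integrable \<mu> f" using Bochner_Integration.integrable_cong[of \<mu> \<mu> f ?g] by simp
 have "integral\<^sup>L \<mu> f = integral\<^sup>L \<mu> ?g" using eq by (intro Bochner_Integration.integral_cong) auto
 also have "... = (\<Sum>z\<in>PiE V (%_. S). f z * measure \<mu> (cyl S V z))"
  using ind cyl_sets[OF V] by (subst Bochner_Integration.integral_sum) auto
 also have "... = (\<Sum>z\<in>PiE V (%_. S). f z * ivw V z)" using cylm[OF V] by simp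
 finally show "integral\<^sup>L \<mu> f = (\<Sum>z\<in>PiE V (%_. S). f z * ivw V z)" .
qed

text \<open>A pi-system for the events outside \<open>D\<close>; the empty set belongs to it because
  cylinders with conflicting prescriptions are disjoint.\<close>

definition cyls_off :: "'d site set => ('d site => real) set set" where
 "cyls_off D = insert {} {cyl S W z | W z. finite W & W Int D = {} & (ALL i:W. z i : S)}"

lemma cyl_outside:
 assumes "finite W" "W Int D = {}"
 shows "cyl S W z : sets (outside_alg \<mu> D)"
proof -
 have sub: "{{x : space \<mu>. x i = a} | i a. i ~: D} \<subseteq> Pow (space \<mu>)" by auto
 have eq: "cyl S W z = space \<mu> Int (\<Inter>i\<in>W. {x : space \<mu>. x i = z i})"
  by (auto simp: cyl_def space_mu)
 have sp: "space (outside_alg \<mu> D) = space \<mu>" unfolding outside_alg_def using sub by simp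
 have "{x : space \<mu>. x i = z i} : sets (outside_alg \<mu> D)" if "i : W" for i
  unfolding outside_alg_def sets_measure_of[OF sub] using that assms by (intro sigma_sets.Basic) auto
 then show ?thesis unfolding eq using sets.top[of "outside_alg \<mu> D"] assms(1)
  by (cases "W = {}") (auto simp: sp intro!: sets.Int sets.finite_INT)
qed

lemma outside_generated: "sets (outside_alg \<mu> D) = sigma_sets (space \<mu>) (cyls_off D)"
proof -
 have sub: "{{x : space \<mu>. x i = a} | i a. i ~: D} \<subseteq> Pow (space \<mu>)" by auto
 have s: "sets (outside_alg \<mu> D) = sigma_sets (space \<mu>) {{x : space \<mu>. x i = a} | i a. i ~: D}"
  unfolding outside_alg_def by (rule sets_measure_of[OF sub])
 show ?thesis
 proof
  show "sets (outside_alg \<mu> D) \<subseteq> sigma_sets (space \<mu>) (cyls_off D)"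
   unfolding s
  proof (rule sigma_sets_mono, safe)
   fix i a assume i: "i ~: D"
   have "{x : space \<mu>. x i = a} : cyls_off D"
   proof (cases "a : S")
    case True
    then have "{x : space \<mu>. x i = a} = cyl S {i} (%_. a)" by (auto simp: cyl_def space_mu)
    then show ?thesis using True i by (auto simp: cyls_off_def intro!: exI[of _ "{i}"])
   next
    case False
    then have "{x : space \<mu>. x i = a} = {}" using space_in_S by auto
    then show ?thesis by (simp add: cyls_off_def)
   qed
   then show "{x : space \<mu>. x i = a} : sigma_sets (space \<mu>) (cyls_off D)" by (rule sigma_sets.Basic)
  qed
  have sp: "space (outside_alg \<mu> D) = space \<mu>" unfolding outside_alg_def using sub by simp
  have "cyls_off D \<subseteq> sets (outside_alg \<mu> D)" unfolding cyls_off_def using cyl_outside by auto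
  then show "sigma_sets (space \<mu>) (cyls_off D) \<subseteq> sets (outside_alg \<mu> D)"
   using sets.sigma_sets_subset[of "cyls_off D" "outside_alg \<mu> D"] sp by simp
 qed
qed

lemma Int_stable_cyls: "Int_stable (cyls_off D)"
proof (rule Int_stableI)
 fix a b assume "a : cyls_off D" "b : cyls_off D"
 then consider "a = {} \<or> b = {}" | W z W' z' where "a = cyl S W z" "b = cyl S W' z'" "finite W" "finite W'"
   "W Int D = {}" "W' Int D = {}" "ALL i:W. z i : S" "ALL i:W'. z' i : S"
  unfolding cyls_off_def by blast
 then show "a Int b : cyls_off D"
 proof cases
  case 1
  then show ?thesis by (auto simp: cyls_off_def)
 next
  case 2
  show ?thesis
  proof (cases "ALL i:W Int W'. z i = z' i")
   case True
   then have "a Int b = cyl S (W Un W') (glue W z z')"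
    unfolding 2 by (auto simp: cyl_def glue_def split: if_splits)
   moreover have "finite (W Un W')" "(W Un W') Int D = {}" "ALL i:W Un W'. glue W z z' i : S"
    using 2 by (auto simp: glue_def)
   ultimately show ?thesis unfolding cyls_off_def by blast
  next
   case False
   then have "a Int b = {}" unfolding 2 by (auto simp: cyl_def)
   then show ?thesis by (simp add: cyls_off_def)
  qed
 qed
qed

lemma subalg: "subalgebra \<mu> (outside_alg \<mu> D)"
 unfolding subalgebra_def
proof
 have sub: "{{x : space \<mu>. x i = a} | i a. i ~: D} \<subseteq> Pow (space \<mu>)" by auto
 show "space (outside_alg \<mu> D) = space \<mu>" unfolding outside_alg_def using sub by simp
 have "cyls_off D \<subseteq> sets \<mu>" unfolding cyls_off_def using cyl_sets by auto
 then show "sets (outside_alg \<mu> D) \<subseteq> sets \<mu>"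
  unfolding outside_generated by (rule sets.sigma_sets_subset)
qed

lemma cp_measurable:
 assumes L: "finite L"
 shows "cp L D e : borel_measurable (outside_alg \<mu> D)"
proof -
 have sp: "space (outside_alg \<mu> D) = space \<mu>" using subalg by (simp add: subalgebra_def)
 have "(%x. \<Sum>z\<in>PiE (L - D) (%_. S). cp L D e z * indicator (cyl S (L - D) z) x) : borel_measurable (outside_alg \<mu> D)"
  by (intro borel_measurable_sum borel_measurable_times borel_measurable_const borel_measurable_indicator cyl_outside)
   (use L in auto)
 moreover have "cp L D e x = (\<Sum>z\<in>PiE (L - D) (%_. S). cp L D e z * indicator (cyl S (L - D) z) x)"
  if "x : space (outside_alg \<mu> D)" for x
  by (rule local_expansion[OF _ cp_cong]) (use L that sp in auto)
 ultimately show ?thesis by (subst measurable_cong)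
qed

lemma cp_icp_lim:
 assumes "finite D" "h : PiE D (%_. S)" "x : space \<mu>"
 shows "(%n. cp (box n) D h x) \<longlonglongrightarrow> icp D h x"
proof (rule LIM_zero_cancel, rule Lim_null_comparison)
 have e: "(%n. err D (box n)) \<longlonglongrightarrow> 0" using filterlim_compose[OF err_lim[OF assms(1)] box_lim] .
 then show "(%n. err D (box n)) \<longlonglongrightarrow> 0" .
 show "\<forall>\<^sub>F n in sequentially. norm (cp (box n) D h x - icp D h x) <= err D (box n)"
 proof (rule always_eventually, rule allI)
  fix n
  have "\<bar>icp D h x - cp (box n) D h x\<bar> <= err D (box n)"
   unfolding err_def by (rule cp_icp[OF assms(1) finite_box assms(2)]) (rule space_in_S[OF assms(3)])
  then show "norm (cp (box n) D h x - icp D h x) <= err D (box n)" by (simp add: abs_minus_commute)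
 qed
qed

text \<open>A pointwise limit along the boxes of functions that depend on finitely many coordinates
  outside \<open>D\<close>.\<close>

lemma icp_measurable:
 assumes "finite D" "e : PiE D (%_. S)"
 shows "icp D e : borel_measurable (outside_alg \<mu> D)"
proof (rule borel_measurable_LIMSEQ_real)
 show "(%n. cp (box n) D e x) \<longlonglongrightarrow> icp D e x" if "x : space (outside_alg \<mu> D)" for x
  using cp_icp_lim[OF assms, of x] subalg[of D] that by (simp only: subalgebra_def)
qed (rule cp_measurable[OF finite_box])

lemma icp_bounds:
 assumes "finite D" "e : PiE D (%_. S)"
 shows "\<bar>icp D e x\<bar> <= 1"
proof -
 have f: "finite (PiE D (%_. S))" by (rule finite_PiE_const[OF assms(1) S(1)])
 have "icw D e x <= (\<Sum>z\<in>PiE D (%_. S). icw D z x)"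
  by (rule member_le_sum[OF assms(2)]) (use f in "auto intro: less_imp_le cw_pos")
 then show ?thesis
  unfolding icp_def using cw_pos(2)[OF assms(2), of x] by (auto simp: divide_le_eq)
qed

lemma icp_integrable:
 assumes "finite D" "e : PiE D (%_. S)"
 shows "integrable \<mu> (icp D e)"
proof -
 interpret prob_space \<mu> by (rule prob_mu)
 show ?thesis
  by (rule integrable_const_bound[where B = 1])
   (use icp_bounds[OF assms] measurable_from_subalg[OF subalg icp_measurable[OF assms]] in auto)
qed

text \<open>The infinite-volume conditional weight is replaced by a local one with a uniform error;
  the integral of the latter is a finite sum, which \<open>dlr_window\<close> compares with the
  cylinder probability. Both errors vanish along the net of volumes.\<close>

lemma dlr_cyl:
 assumes D: "finite D" "finite W" "W Int D = {}" and e: "e : PiE D (%_. S)" and z: "!!i. i : W ==> z i : S"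
 shows "(LINT x:cyl S W z|\<mu>. icp D e x) = measure \<mu> (cyl S (D Un W) (glue D e z))"
proof -
 interpret prob_space \<mu> by (rule prob_mu)
 let ?I = "LINT x:cyl S W z|\<mu>. icp D e x" and ?m = "ivw (D Un W) (glue D e z)"
 have bound: "\<bar>?I - ?m\<bar> <= 2 * err D L" if L: "finite L" "D Un W \<subseteq> L" for L
 proof -
  let ?f = "%x. if ALL i:W. x i = z i then cp L D e x else 0"
  have f_cong: "?f x = ?f x'" if "!!i. i : L ==> x i = x' i" for x x'
  proof -
   have "cp L D e x = cp L D e x'" by (rule cp_cong) (use that in auto)
   moreover have "(ALL i:W. x i = z i) \<longleftrightarrow> (ALL i:W. x' i = z i)" using that L(2) by (metis UnCI subsetD)
   ultimately show ?thesis by simp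
  qed
  have fi: "integrable \<mu> ?f" "integral\<^sup>L \<mu> ?f = (\<Sum>x\<in>PiE L (%_. S). ?f x * ivw L x)"
   by (rule local_integral[OF L(1) f_cong]; assumption)+
  have ii: "integrable \<mu> (%x. indicator (cyl S W z) x *\<^sub>R icp D e x)"
   using integrable_mult_indicator[OF cyl_sets[OF D(2)] icp_integrable[OF D(1) e]] .
  have "\<bar>?I - integral\<^sup>L \<mu> ?f\<bar> = \<bar>integral\<^sup>L \<mu> (%x. indicator (cyl S W z) x *\<^sub>R icp D e x - ?f x)\<bar>"
   unfolding set_lebesgue_integral_def using ii fi(1) by simp
  also have "... <= integral\<^sup>L \<mu> (%x. \<bar>indicator (cyl S W z) x *\<^sub>R icp D e x - ?f x\<bar>)"
   by (rule integral_abs_bound)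
  also have "... <= integral\<^sup>L \<mu> (%x. err D L)"
  proof (rule integral_mono)
   show "integrable \<mu> (%x. \<bar>indicator (cyl S W z) x *\<^sub>R icp D e x - ?f x\<bar>)"
    using ii fi(1) by (intro integrable_abs Bochner_Integration.integrable_diff)
   fix x assume x: "x : space \<mu>"
   have i: "x : cyl S W z \<longleftrightarrow> (ALL i:W. x i = z i)" using x by (simp add: cyl_def space_mu)
   have "\<bar>icp D e x - cp L D e x\<bar> <= err D L"
    unfolding err_def by (rule cp_icp[OF D(1) L(1) e]) (rule space_in_S[OF x])
   then show "\<bar>indicator (cyl S W z) x *\<^sub>R icp D e x - ?f x\<bar> <= err D L"
    unfolding i[symmetric] using err_nonneg[OF D(1) L(1)] by (cases "x : cyl S W z") simp_all
  qed simp
  also have "... = err D L" by (simp add: prob_space)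
  finally have "\<bar>?I - integral\<^sup>L \<mu> ?f\<bar> <= err D L" .
  moreover have "\<bar>integral\<^sup>L \<mu> ?f - ?m\<bar> <= err D L"
   unfolding fi(2) by (rule dlr_window[OF D e z L])
  ultimately show ?thesis by linarith
 qed
 have "\<bar>?I - ?m\<bar> <= 0"
 proof (rule tendsto_le)
  show "finite_subsets_at_top (UNIV :: 'd site set) ~= bot" by simp
  show "((%L. 2 * err D L) \<longlongrightarrow> 0) at_volume"
   using tendsto_mult[OF tendsto_const err_lim[OF D(1)], of 2] by simp
  show "((%L. \<bar>?I - ?m\<bar>) \<longlongrightarrow> \<bar>?I - ?m\<bar>) at_volume" by simp
  show "\<forall>\<^sub>F L in at_volume. \<bar>?I - ?m\<bar> <= 2 * err D L"
   by (rule eventually_mono[OF finite_subsets_at_top_superset[of "D Un W"]]) (use D bound in auto)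
 qed
 moreover have "measure \<mu> (cyl S (D Un W) (glue D e z)) = ?m"
  by (rule cyl_measure) (use D e z in "auto simp: glue_def")
 ultimately show ?thesis by simp
qed

text \<open>Dynkin's argument: the identity is known on the pi-system of cylinders and passes to
  complements and to countable disjoint unions.\<close>

lemma dlr_all:
 assumes D: "finite D" and e: "e : PiE D (%_. S)" and A: "A : sets (outside_alg \<mu> D)"
 shows "(LINT x:A|\<mu>. indicator (cyl S D e) x) = (LINT x:A|\<mu>. icp D e x)"
proof -
 interpret prob_space \<mu> by (rule prob_mu)
 have sub: "cyls_off D \<subseteq> Pow (space \<mu>)" by (auto simp: cyls_off_def cyl_def space_mu)
 have int: "integrable \<mu> (indicator (cyl S D e) :: _ => real)" "integrable \<mu> (icp D e)"
  using cyl_sets[OF D] icp_integrable[OF D e] by (auto simp: emeasure_eq_measure)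
 have si: "set_integrable \<mu> B f" if "integrable \<mu> f" "B : sets \<mu>" for B and f :: "_ => real"
  unfolding set_integrable_def using that by (intro integrable_mult_indicator)
 have inM: "B : sets \<mu>" if "B : sigma_sets (space \<mu>) (cyls_off D)" for B
  using that subalg[of D] unfolding outside_generated[symmetric] by (auto simp: subalgebra_def)
 have base: "(LINT x:cyl S W z|\<mu>. indicator (cyl S D e) x) = (LINT x:cyl S W z|\<mu>. icp D e x)"
  if "finite W" "W Int D = {}" "ALL i:W. z i : S" for W z
 proof -
  have "(LINT x:cyl S W z|\<mu>. indicator (cyl S D e) x) = integral\<^sup>L \<mu> (indicator (cyl S (D Un W) (glue D e z)))"
   unfolding set_lebesgue_integral_def
   by (intro Bochner_Integration.integral_cong refl)
    (use that in "auto simp: indicator_def cyl_def glue_def")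
  also have "... = measure \<mu> (cyl S (D Un W) (glue D e z))"
   using cyl_sets[of "D Un W"] D that by simp
  finally show ?thesis using dlr_cyl[OF D that(1,2) e, of z] that by simp
 qed
 have "A : sigma_sets (space \<mu>) (cyls_off D)" using A outside_generated by simp
 with Int_stable_cyls sub show ?thesis
 proof (induction rule: sigma_sets_induct_disjoint)
  case (basic A)
  then show ?case using base
   by (auto simp: cyls_off_def set_lebesgue_integral_def)
 next
  case empty
  then show ?case by (simp add: set_lebesgue_integral_def)
 next
  case (compl A)
  have tot: "(LINT x:space \<mu>|\<mu>. indicator (cyl S D e) x) = (LINT x:space \<mu>|\<mu>. icp D e x)"
  proof -
   have "space \<mu> = cyl S {} (%_. 0)" by (simp add: cyl_def space_mu)
   then show ?thesis using base[of "{}" "%_. 0"] by simp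
  qed
  have "(LINT x:space \<mu> - A|\<mu>. f x) = (LINT x:space \<mu>|\<mu>. f x) - (LINT x:A|\<mu>. f x)" if "integrable \<mu> f" for f :: "_ => real"
  proof -
   have A: "A : sets \<mu>" using inM compl by auto
   have "(LINT x:space \<mu>|\<mu>. f x) = (LINT x:(space \<mu> - A) Un A|\<mu>. f x)"
    using sets.sets_into_space[OF A] by (simp add: Un_absorb2)
   also have "... = (LINT x:space \<mu> - A|\<mu>. f x) + (LINT x:A|\<mu>. f x)"
    by (rule set_integral_Un) (use A that in "auto intro: si")
   finally show ?thesis by simp
  qed
  then show ?case using int tot compl by simp
 next
  case (union A)
  have AM: "A i : sets \<mu>" for i using union inM by blast
  have "(LINT x:(\<Union>i. A i)|\<mu>. f x) = (\<Sum>i. LINT x:A i|\<mu>. f x)" if "integrable \<mu> f" for f :: "_ => real"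
  proof (rule lebesgue_integral_countable_add)
   show "set_integrable \<mu> (\<Union>i. A i) f" using AM by (intro si that sets.countable_UN) auto
  qed (use AM union in "auto simp: disjoint_family_on_def")
  then show ?case using int union by simp
 qed
qed

lemma cond_exp_cyl:
 assumes D: "finite D" and e: "e : PiE D (%_. S)"
 shows "AE x in \<mu>. real_cond_exp \<mu> (outside_alg \<mu> D) (indicator (cyl S D e)) x = icp D e x"
proof -
 interpret prob_space \<mu> by (rule prob_mu)
 interpret finite_measure_subalgebra \<mu> "outside_alg \<mu> D" by unfold_locales (rule subalg)
 show ?thesis
  by (rule real_cond_exp_charact)
   (use dlr_all[OF D e] icp_integrable[OF D e] icp_measurable[OF D e] cyl_sets[OF D] in "auto simp: emeasure_eq_measure")
qed

end

text \<open>A potential has to be local and translation invariant on arbitrary real configurations,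
  whereas \<open>G\<close> and \<open>c\<close> are controlled on values in \<open>S\<close>.
  Clipping is site by site, so it preserves both properties.\<close>

definition clip :: "real => real" where
 "clip a = (if a : S then a else (SOME b. b : S))"

text \<open>The signs fit the Boltzmann factor \<open>exp (- energy)\<close>, and the one-site
  weights \<open>c\<close> are stored in the potential of singletons.\<close>

definition pot :: "'d site set => ('d site => real) => real" where
 "pot A x = - G A (%i. Some (clip (x i))) - (if card A = 1 then \<Sum>i\<in>A. ln (c (clip (x i))) else 0)"

lemma clip_in: "clip a : S"
 using S(2) some_in_eq[of S] by (auto simp: clip_def)

lemma touching_single: "touching {i} = {A. finite A & i : A}"
 by (auto simp: touching_def)

lemma summable_single:
 fixes h :: "'d site set => real"
 assumes D: "finite D" and h: "!!A. card A ~= 1 ==> h A = 0"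
 shows "h summable_on touching D" "infsum h (touching D) = (\<Sum>i\<in>D. h {i})"
proof -
 have z: "h A = 0" if "A : touching D - (%i. {i}) ` D" for A
 proof (rule h)
  show "card A ~= 1"
  proof
   assume "card A = 1"
   then obtain j where "A = {j}" by (auto simp: card_1_singleton_iff)
   then show False using that by (auto simp: touching_def)
  qed
 qed
 have sub: "(%i. {i}) ` D \<subseteq> touching D" by (auto simp: touching_def)
 have "h summable_on (%i. {i}) ` D" using D by (intro summable_on_finite) auto
 then show "h summable_on touching D"
  by (rule summable_on_cong_neutral[THEN iffD1, rotated -1]) (use z sub in auto)
 have "infsum h (touching D) = infsum h ((%i. {i}) ` D)"
  by (rule infsum_cong_neutral) (use z sub in auto)
 also have "... = (\<Sum>i\<in>D. h {i})" using D by (subst infsum_finite) (auto simp: sum.reindex inj_on_def)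
 finally show "infsum h (touching D) = (\<Sum>i\<in>D. h {i})" .
qed

lemma potential_pot: "potential S pot"
 unfolding potential_def
proof (intro conjI allI impI)
 fix A :: "'d site set" and x y :: "'d site => real" assume e: "ALL i:A. x i = y i"
 then have "G A (%i. Some (clip (x i))) = G A (%i. Some (clip (y i)))" by (intro G_local) auto
 moreover have "(\<Sum>i\<in>A. ln (c (clip (x i)))) = (\<Sum>i\<in>A. ln (c (clip (y i))))" using e by (intro sum.cong) auto
 ultimately show "pot A x = pot A y" unfolding pot_def by simp
next
 fix A :: "'d site set" and a and x :: "'d site => real"
 have inj: "inj_on (shift a) A" by (rule inj_on_subset[OF inj_shift]) simp
 have "G (shift a ` A) (%i. Some (clip (x i))) = G A (%i. Some (clip ((x o shift a) i)))"
  unfolding G_shift by (rule arg_cong[where f = "G A"]) auto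
 then show "pot (shift a ` A) x = pot A (x o shift a)"
  unfolding pot_def by (simp add: card_image[OF inj] sum.reindex[OF inj])
next
 define K where "K = (\<Sum>a\<in>S. \<bar>ln (c a)\<bar>)"
 have sp: "space (Omega_space S :: ('d site => real) measure) ~= {}"
  using S(2) by (auto simp: Omega_space_def space_PiM PiE_eq_empty_iff)
 have le: "\<bar>pot A x\<bar> <= sG A + (if card A = 1 then K else 0)" if "finite A" for A x
 proof -
  have "\<bar>G A (%i. Some (clip (x i)))\<bar> <= sG A" by (rule G_le[OF that]) (use clip_in in auto)
  moreover have "\<bar>\<Sum>i\<in>A. ln (c (clip (x i)))\<bar> <= K" if one: "card A = 1"
  proof -
   obtain j where "A = {j}" using one by (auto simp: card_1_singleton_iff)
   moreover have "\<bar>ln (c (clip (x j)))\<bar> <= K"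
    unfolding K_def by (rule member_le_sum[OF clip_in]) (use S in auto)
   ultimately show ?thesis by simp
  qed
  ultimately show ?thesis unfolding pot_def by (auto split: if_splits)
 qed
 show "(%A. Sup ((%x. \<bar>pot A x\<bar>) ` space (Omega_space S))) summable_on {A. finite A & origin : A}"
 proof (rule summable_on_comparison_test)
  show "(%A. sG A + (if card A = 1 then K else 0)) summable_on {A. finite A & origin : A}"
   unfolding touching_single[symmetric]
   by (intro summable_on_add summable_sG summable_single(1)) auto
  fix A :: "'d site set" assume "A : {A. finite A & origin : A}"
  then have fA: "finite A" by simp
  show "Sup ((%x. \<bar>pot A x\<bar>) ` space (Omega_space S)) <= sG A + (if card A = 1 then K else 0)"
   by (rule cSUP_least[OF sp le[OF fA]])
  obtain x where x: "x : space (Omega_space S :: ('d site => real) measure)" using sp by blast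
  have "\<bar>pot A x\<bar> <= Sup ((%x. \<bar>pot A x\<bar>) ` space (Omega_space S))"
   by (rule cSUP_upper[OF x]) (use le[OF fA] in "auto intro!: bdd_aboveI2")
  then show "0 <= Sup ((%x. \<bar>pot A x\<bar>) ` space (Omega_space S))" by linarith
 qed
qed

lemma exp_energy:
 assumes D: "finite D" and z: "z : PiE D (%_. S)" and x: "!!i. x i : S"
 shows "exp (- energy pot D (glue D z x)) = icw D z x"
proof -
 let ?x = "glue D z x"
 have xS: "?x i : S" for i using z x by (auto simp: glue_def)
 then have cl: "clip (?x i) = ?x i" for i by (simp add: clip_def)
 define h where "h A = (if card A = 1 then \<Sum>i\<in>A. ln (c (?x i)) else 0)" for A :: "'d site set"
 have s1: "(%A. G A (Some o ?x)) summable_on touching D" by (rule summable_G[OF D]) (use xS in auto)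
 have s2: "h summable_on touching D" "infsum h (touching D) = (\<Sum>i\<in>D. h {i})"
  by (rule summable_single[OF D]; simp add: h_def)+
 have "energy pot D ?x = infsum (%A. - (G A (Some o ?x) + h A)) (touching D)"
  unfolding energy_def touching_def pot_def cl h_def by (intro infsum_cong) (auto simp: o_def)
 also have "... = - (infsum (%A. G A (Some o ?x)) (touching D) + infsum h (touching D))"
  unfolding infsum_uminus infsum_add[OF s1 s2(1)] ..
 also have "infsum h (touching D) = (\<Sum>i\<in>D. ln (c (?x i)))" unfolding s2(2) by (simp add: h_def)
 finally have "- energy pot D ?x = (\<Sum>i\<in>D. ln (c (?x i))) + infsum (%A. G A (Some o ?x)) (touching D)" by (simp only: minus_minus add.commute)
 moreover have "exp (\<Sum>i\<in>D. ln (c (?x i))) = (\<Prod>i\<in>D. c (z i))"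
  unfolding exp_sum[OF D] using z by (intro prod.cong) (auto simp: glue_def intro!: exp_ln c)
 ultimately show ?thesis by (simp add: icw_def exp_add)
qed

text \<open>The conditional expectation of a cylinder is the normalised \<open>icw\<close>, which
  \<open>exp_energy\<close> rewrites as a Boltzmann factor over a partition function on
  configurations with values in \<open>S\<close>, hence on the whole space of the measure.\<close>

theorem ex_gibbsian:
 "\<exists>\<mu>. is_prob_on_Omega S \<mu> & gibbsian S \<mu> \<and>
  (ALL V. finite V --> (ALL e:PiE V (%_. S). measure \<mu> (cyl S V e) = ivw V e))"
proof -
 obtain \<mu> where \<mu>: "is_prob_on_Omega S \<mu>" "ALL V. finite V --> (ALL e:PiE V (%_. S). measure \<mu> (cyl S V e) = ivw V e)"
  using ex_measure by blast
 have "gibbsian S \<mu>"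
  unfolding gibbsian_def
 proof (intro exI[of _ pot] conjI potential_pot allI impI ballI)
  fix D and e :: "'d site => real" assume D: "finite D" and e: "e : PiE D (%_. S)"
  have "AE x in \<mu>. real_cond_exp \<mu> (outside_alg \<mu> D) (indicator (cyl S D e)) x = icp D e x"
   by (rule cond_exp_cyl[OF \<mu>(1) _ D e]) (use \<mu>(2) in auto)
  moreover have "exp (- energy pot D (glue D e x)) / partition_fn S pot D x = icp D e x" if "x : space \<mu>" for x
  proof -
   have x: "x i : S" for i by (rule space_in_S[OF \<mu>(1) _ that]) (use \<mu>(2) in auto)
   show ?thesis unfolding partition_fn_def icp_def
    using exp_energy[OF D e, of x] exp_energy[OF D, of _ x] x by simp
  qed
  ultimately show "AE x in \<mu>. real_cond_exp \<mu> (outside_alg \<mu> D) (indicator (cyl S D e)) x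
   = exp (- energy pot D (glue D e x)) / partition_fn S pot D x"
   by (elim AE_mp) (auto intro!: AE_I2)
 qed
 then show ?thesis using \<mu> by blast
qed

end

section \<open>Operators on finite-dimensional spaces\<close>

definition ip :: "'a set => ('a => complex) => ('a => complex) => complex" where
 "ip S v w = (\<Sum>x\<in>S. cnj (v x) * w x)"

text \<open>A predicate for norm bounds in place of the supremum \<open>opnorm\<close>: it composes
  under sums, products and series without a separate boundedness argument.\<close>

definition opb :: "'a set => ('a => 'a => complex) => real => bool" where
 "opb S A c \<longleftrightarrow> 0 <= c & (ALL v. vnorm S (mapply S A v) <= c * vnorm S v)"

definition herm :: "'a set => ('a => 'a => complex) => bool" where
 "herm S A \<longleftrightarrow> (ALL x:S. ALL y:S. A x y = cnj (A y x))"

abbreviation idm :: "'a => 'a => complex" where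
 "idm \<equiv> (%x y. if x = y then 1 else 0)"

lemma vnorm_L2: "vnorm S v = L2_set (%x. cmod (v x)) S"
 by (simp add: vnorm_def L2_set_def)

lemma vnorm_nonneg [simp]: "0 <= vnorm S v"
 by (simp add: vnorm_L2 L2_set_nonneg)

lemma vnorm_cong: "(!!x. x : S ==> v x = w x) ==> vnorm S v = vnorm S w"
 by (simp add: vnorm_def)

lemma vnorm_add: "vnorm S (%x. v x + w x) <= vnorm S v + vnorm S w"
 unfolding vnorm_L2
 by (rule order_trans[OF L2_set_mono L2_set_triangle_ineq]) (auto simp: norm_triangle_ineq)

lemma vnorm_scale: "vnorm S (%x. a * v x) = cmod a * vnorm S v"
 unfolding vnorm_def by (simp add: norm_mult power_mult_distrib sum_distrib_left[symmetric] real_sqrt_mult)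

lemma vnorm_sq: "(vnorm S v)\<^sup>2 = (\<Sum>x\<in>S. (cmod (v x))\<^sup>2)"
 unfolding vnorm_def by (simp add: sum_nonneg)

lemma ip_self: "ip S v v = of_real ((vnorm S v)\<^sup>2)"
 unfolding ip_def vnorm_sq by (simp only: of_real_sum complex_norm_square mult.commute)

lemma cauchy_schwarz: "cmod (ip S v w) <= vnorm S v * vnorm S w"
proof -
 have "cmod (ip S v w) <= (\<Sum>x\<in>S. \<bar>cmod (v x)\<bar> * \<bar>cmod (w x)\<bar>)"
  unfolding ip_def by (rule order_trans[OF norm_sum]) (simp add: norm_mult)
 also have "... <= vnorm S v * vnorm S w" unfolding vnorm_L2 by (rule L2_set_mult_ineq)
 finally show ?thesis .
qed

lemma ip_add_right: "ip S v (%x. w x + w' x) = ip S v w + ip S v w'"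
 by (simp add: ip_def algebra_simps sum.distrib)

lemma ip_add_left: "ip S (%x. v x + v' x) w = ip S v w + ip S v' w"
 by (simp add: ip_def algebra_simps sum.distrib)

lemma ip_scale_right: "ip S v (%x. a * w x) = a * ip S v w"
 by (simp add: ip_def sum_distrib_left mult_ac)

lemma ip_scale_left: "ip S (%x. a * v x) w = cnj a * ip S v w"
 by (simp add: ip_def sum_distrib_left mult_ac)

lemma norm_le_vnorm:
 assumes "finite S" "x : S"
 shows "cmod (v x) <= vnorm S v"
proof -
 have "cmod (v x) <= L2_set (%x. cmod (v x)) S" using member_le_L2_set[OF assms, of "%x. cmod (v x)"] by simp
 then show ?thesis by (simp add: vnorm_L2)
qed

lemma mmul_assoc: "mmul S (mmul S A B) C = mmul S A (mmul S B C)"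
proof (intro ext)
 fix x y
 have "mmul S (mmul S A B) C x y = (\<Sum>z\<in>S. \<Sum>w\<in>S. A x w * B w z * C z y)"
  by (simp add: mmul_def sum_distrib_right)
 also have "... = (\<Sum>w\<in>S. \<Sum>z\<in>S. A x w * B w z * C z y)" by (rule sum.swap)
 also have "... = mmul S A (mmul S B C) x y" by (simp add: mmul_def sum_distrib_left mult.assoc)
 finally show "mmul S (mmul S A B) C x y = mmul S A (mmul S B C) x y" .
qed

lemma mmul_cong:
 assumes "!!z. z : S ==> A x z = A' x z" "!!z. z : S ==> B z y = B' z y"
 shows "mmul S A B x y = mmul S A' B' x y"
 unfolding mmul_def using assms by (intro sum.cong) auto

lemma mmul_add_right: "mmul S A (%x y. B x y + C x y) = (%x y. mmul S A B x y + mmul S A C x y)"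
 by (simp add: mmul_def fun_eq_iff algebra_simps sum.distrib)

lemma mmul_add_left: "mmul S (%x y. B x y + C x y) A = (%x y. mmul S B A x y + mmul S C A x y)"
 by (simp add: mmul_def fun_eq_iff algebra_simps sum.distrib)

lemma mmul_scale_right: "mmul S A (%x y. a * B x y) = (%x y. a * mmul S A B x y)"
 by (simp add: mmul_def fun_eq_iff sum_distrib_left mult_ac)

lemma mmul_divide_right: "mmul S A (%x y. B x y / d) = (%x y. mmul S A B x y / d)"
 by (simp add: mmul_def fun_eq_iff sum_divide_distrib)

lemma mmul_scale_left: "mmul S (%x y. a * A x y) B = (%x y. a * mmul S A B x y)"
 by (simp add: mmul_def fun_eq_iff sum_distrib_left mult_ac)

lemma mmul_sum_right: "mmul S A (%x y. \<Sum>i\<in>I. B i x y) = (%x y. \<Sum>i\<in>I. mmul S A (B i) x y)"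
 unfolding mmul_def sum_distrib_left by (intro ext sum.swap)

lemma mmul_sum_left: "mmul S (%x y. \<Sum>i\<in>I. B i x y) A = (%x y. \<Sum>i\<in>I. mmul S (B i) A x y)"
 unfolding mmul_def sum_distrib_right by (intro ext sum.swap)

lemma mmul_idm_left: "finite S ==> x : S ==> mmul S idm A x y = A x y"
 by (simp add: mmul_def if_mult cong: if_cong)

lemma mmul_idm_right: "finite S ==> y : S ==> mmul S A idm x y = A x y"
 by (simp add: mmul_def if_mult cong: if_cong)

lemma mapply_mmul: "mapply S (mmul S A B) v = mapply S A (mapply S B v)"
proof (intro ext)
 fix x
 have "mapply S (mmul S A B) v x = (\<Sum>y\<in>S. \<Sum>z\<in>S. A x z * B z y * v y)"
  by (simp add: mapply_def mmul_def sum_distrib_right)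
 also have "... = (\<Sum>z\<in>S. \<Sum>y\<in>S. A x z * B z y * v y)" by (rule sum.swap)
 also have "... = mapply S A (mapply S B v) x" by (simp add: mapply_def sum_distrib_left mult.assoc)
 finally show "mapply S (mmul S A B) v x = mapply S A (mapply S B v) x" .
qed

lemma mapply_add: "mapply S (%x y. A x y + B x y) v = (%x. mapply S A v x + mapply S B v x)"
 by (simp add: mapply_def fun_eq_iff algebra_simps sum.distrib)

lemma mapply_scale: "mapply S (%x y. a * A x y) v = (%x. a * mapply S A v x)"
 by (simp add: mapply_def fun_eq_iff sum_distrib_left mult.assoc)

lemma mapply_add_vec: "mapply S A (%x. v x + w x) = (%x. mapply S A v x + mapply S A w x)"
 by (simp add: mapply_def fun_eq_iff algebra_simps sum.distrib)

lemma mapply_scale_vec: "mapply S A (%x. a * v x) = (%x. a * mapply S A v x)"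
 by (simp add: mapply_def fun_eq_iff sum_distrib_left mult_ac)

lemma mapply_idm: "finite S ==> x : S ==> mapply S idm v x = v x"
 by (simp add: mapply_def if_mult cong: if_cong)

lemma mapply_cong: "(!!y. y : S ==> A x y = B x y) ==> (!!y. y : S ==> v y = w y) ==> mapply S A v x = mapply S B w x"
 unfolding mapply_def by (intro sum.cong) auto

lemma ip_cong: "(!!x. x : S ==> v x = v' x) ==> (!!x. x : S ==> w x = w' x) ==> ip S v w = ip S v' w'"
 unfolding ip_def by (intro sum.cong) auto

lemma ip_herm: "herm S A ==> ip S v (mapply S A w) = ip S (mapply S A v) w"
proof -
 assume h: "herm S A"
 have "ip S v (mapply S A w) = (\<Sum>x\<in>S. \<Sum>y\<in>S. cnj (v x) * (A x y * w y))"
  by (simp add: ip_def mapply_def sum_distrib_left)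
 also have "... = (\<Sum>y\<in>S. \<Sum>x\<in>S. cnj (v x) * (A x y * w y))" by (rule sum.swap)
 also have "... = (\<Sum>y\<in>S. \<Sum>x\<in>S. cnj (A y x * v x) * w y)"
 proof (intro sum.cong refl)
  fix x y assume "y : S" "x : S"
  then have "A x y = cnj (A y x)" using h unfolding herm_def by blast
  then show "cnj (v x) * (A x y * w y) = cnj (A y x * v x) * w y" by (simp only: complex_cnj_mult mult_ac)
 qed
 also have "... = ip S (mapply S A v) w" by (simp add: ip_def mapply_def sum_distrib_right)
 finally show ?thesis .
qed

lemma opb_nonneg: "opb S A c ==> 0 <= c"
 by (simp add: opb_def)

lemma opbD: "opb S A c ==> vnorm S (mapply S A v) <= c * vnorm S v"
 by (simp add: opb_def)

lemma opb_mono: "opb S A c ==> c <= d ==> opb S A d"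
 unfolding opb_def by (meson mult_right_mono order_trans vnorm_nonneg)

lemma opb_cong: "opb S A c ==> (!!x y. x : S ==> y : S ==> A x y = B x y) ==> opb S B c"
proof -
 assume A: "opb S A c" and e: "!!x y. x : S ==> y : S ==> A x y = B x y"
 have "vnorm S (mapply S B v) = vnorm S (mapply S A v)" for v
  by (intro vnorm_cong mapply_cong) (use e in auto)
 then show ?thesis using A by (simp add: opb_def)
qed

lemma opb_add: "opb S A a ==> opb S B b ==> opb S (%x y. A x y + B x y) (a + b)"
 unfolding opb_def mapply_add distrib_right
proof (elim conjE, intro conjI allI)
 fix v
 assume "ALL v. vnorm S (mapply S A v) <= a * vnorm S v" "ALL v. vnorm S (mapply S B v) <= b * vnorm S v"
 then have "vnorm S (mapply S A v) + vnorm S (mapply S B v) <= a * vnorm S v + b * vnorm S v"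
  by (intro add_mono) blast+
 then show "vnorm S (%x. mapply S A v x + mapply S B v x) <= a * vnorm S v + b * vnorm S v"
  using vnorm_add order_trans by blast
qed simp

lemma opb_scale: "opb S A a ==> opb S (%x y. z * A x y) (cmod z * a)"
 unfolding opb_def mapply_scale vnorm_scale by (auto simp: mult.assoc mult_left_mono)

lemma opb_zero: "opb S (%x y. 0) 0"
 by (simp add: opb_def mapply_def vnorm_def)

lemma opb_sum: "finite I ==> (!!i. i : I ==> opb S (A i) (a i)) ==> opb S (%x y. \<Sum>i\<in>I. A i x y) (\<Sum>i\<in>I. a i)"
 by (induction I rule: finite_induct) (auto simp: opb_zero intro: opb_add)

lemma opb_mmul: "opb S A a ==> opb S B b ==> opb S (mmul S A B) (a * b)"
proof -
 assume A: "opb S A a" and B: "opb S B b"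
 have "vnorm S (mapply S A (mapply S B v)) <= a * b * vnorm S v" for v
 proof -
  have "vnorm S (mapply S A (mapply S B v)) <= a * vnorm S (mapply S B v)" by (rule opbD[OF A])
  also have "... <= a * (b * vnorm S v)" by (intro mult_left_mono opbD[OF B] opb_nonneg[OF A])
  finally show ?thesis by (simp only: mult.assoc)
 qed
 then show ?thesis using opb_nonneg[OF A] opb_nonneg[OF B] by (simp add: opb_def mapply_mmul)
qed

lemma opb_idm: "finite S ==> opb S idm 1"
proof -
 assume S: "finite S"
 have "vnorm S (mapply S idm v) = vnorm S v" for v by (rule vnorm_cong) (rule mapply_idm[OF S])
 then show ?thesis by (simp add: opb_def)
qed

lemma opb_mpow: "finite S ==> opb S A a ==> opb S (mpow S A k) (a ^ k)"
 by (induction k) (auto intro: opb_mmul opb_idm)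

lemma vnorm_unit: "finite S ==> x : S ==> vnorm S (%z. if z = x then 1 else 0) = 1"
 by (simp add: vnorm_def if_distrib[where f = cmod] if_distrib[where f = "%c. c\<^sup>2"] cong: if_cong)

lemma opb_entry:
 assumes S: "finite S" "x : S" "y : S" and A: "opb S A c"
 shows "cmod (A x y) <= c"
proof -
 let ?v = "%z. if z = y then 1 else 0 :: complex"
 have "mapply S A ?v x = A x y"
  using S by (simp add: mapply_def if_mult cong: if_cong)
 then have "cmod (A x y) <= vnorm S (mapply S A ?v)" using norm_le_vnorm[OF S(1,2), of "mapply S A ?v"] by simp
 also have "... <= c * vnorm S ?v" by (rule opbD[OF A])
 also have "vnorm S ?v = 1"
  using S by (simp add: vnorm_unit)
 finally show ?thesis by simp
qed

lemma opb_exists: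
 assumes S: "finite S"
 shows "EX c. opb S A c"
proof -
 let ?c = "\<Sum>x\<in>S. \<Sum>y\<in>S. cmod (A x y)"
 have "vnorm S (mapply S A v) <= ?c * vnorm S v" for v
 proof -
  have "vnorm S (mapply S A v) <= (\<Sum>x\<in>S. cmod (mapply S A v x))"
   unfolding vnorm_L2 using L2_set_le_sum[of S "%x. cmod (mapply S A v x)"] by simp
  also have "... <= (\<Sum>x\<in>S. (\<Sum>y\<in>S. cmod (A x y)) * vnorm S v)"
   unfolding mapply_def sum_distrib_right
   by (intro sum_mono order_trans[OF norm_sum]) (auto simp: norm_mult intro!: mult_left_mono norm_le_vnorm[OF S])
  finally show ?thesis by (simp add: sum_distrib_right)
 qed
 then show ?thesis unfolding opb_def by (intro exI[of _ ?c] conjI sum_nonneg) auto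
qed

lemma tendsto_vnorm:
 assumes "!!x. x : S ==> ((%n. v n x) \<longlongrightarrow> w x) F"
 shows "((%n. vnorm S (v n)) \<longlongrightarrow> vnorm S w) F"
 unfolding vnorm_def by (intro tendsto_real_sqrt tendsto_sum tendsto_power tendsto_norm assms)

lemma opb_suminf:
 assumes A: "!!k. opb S (A k) (a k)" and s: "a sums c"
  and B: "!!x y. x : S ==> y : S ==> (%k. A k x y) sums B x y"
 shows "opb S B c"
proof -
 have a: "0 <= a k" for k using A opb_nonneg by blast
 have c: "0 <= c" using sums_le[OF _ sums_zero s] a by auto
 have "vnorm S (mapply S B v) <= c * vnorm S v" for v
 proof (rule LIMSEQ_le_const2)
  show "(%K. vnorm S (mapply S (%x y. \<Sum>k<K. A k x y) v)) \<longlonglongrightarrow> vnorm S (mapply S B v)"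
  proof (rule tendsto_vnorm)
   fix x assume x: "x : S"
   show "(%K. mapply S (%x y. \<Sum>k<K. A k x y) v x) \<longlonglongrightarrow> mapply S B v x"
    unfolding mapply_def
   proof (rule tendsto_sum)
    fix y assume "y : S"
    then have "(%K. \<Sum>k<K. A k x y) \<longlonglongrightarrow> B x y" using B[OF x] by (simp add: sums_def)
    then show "(%K. (\<Sum>k<K. A k x y) * v y) \<longlonglongrightarrow> B x y * v y" by (rule tendsto_mult_right)
   qed
  qed
  have "vnorm S (mapply S (%x y. \<Sum>k<K. A k x y) v) <= c * vnorm S v" for K
  proof -
   have "opb S (%x y. \<Sum>k<K. A k x y) (\<Sum>k<K. a k)" by (intro opb_sum A) simp
   moreover have "(\<Sum>k<K. a k) <= c" using sum_le_suminf[of a "{..<K}"] s a by (simp add: sums_iff)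
   ultimately show ?thesis using opb_mono opbD by blast
  qed
  then show "EX N. \<forall>n\<ge>N. vnorm S (mapply S (%x y. \<Sum>k<n. A k x y) v) <= c * vnorm S v" by blast
 qed
 then show ?thesis using c by (simp add: opb_def)
qed

text \<open>Nonnegativity of the form at \<open>v - t * A v\<close>, expanded by self-adjointness,
  and the upper bound on the form at \<open>A v\<close> give a quadratic inequality in
  \<open>t\<close>, used at its minimum \<open>t = 1 / s\<close>. This stands in for the spectral
  theorem wherever an operator norm is derived from a form.\<close>

lemma herm_opb:
 assumes h: "herm S A" and pos: "!!v. 0 <= Re (ip S v (mapply S A v))"
  and le: "!!v. Re (ip S v (mapply S A v)) <= s * (vnorm S v)\<^sup>2" and s: "0 <= s"
 shows "!!v. (vnorm S (mapply S A v))\<^sup>2 <= s * Re (ip S v (mapply S A v))" "opb S A s"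
proof -
 show main: "(vnorm S (mapply S A v))\<^sup>2 <= s * Re (ip S v (mapply S A v))" for v
 proof -
  let ?w = "mapply S A v" and ?N = "(vnorm S (mapply S A v))\<^sup>2" and ?q = "Re (ip S v (mapply S A v))"
  have ineq: "0 <= ?q - 2 * t * ?N + t\<^sup>2 * (s * ?N)" for t :: real
  proof -
   let ?u = "%x. v x + of_real (- t) * ?w x"
   have "ip S ?u (mapply S A ?u) = ip S v ?w + of_real (- t) * ip S v (mapply S A ?w)
    + (of_real (- t) * ip S ?w ?w + of_real (- t) * of_real (- t) * ip S ?w (mapply S A ?w))"
    unfolding mapply_add_vec mapply_scale_vec ip_add_left ip_add_right ip_scale_left ip_scale_right
    by (simp add: algebra_simps)
   also have "ip S v (mapply S A ?w) = ip S ?w ?w" by (rule ip_herm[OF h])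
   finally have "Re (ip S ?u (mapply S A ?u)) = ?q - 2 * t * ?N + t\<^sup>2 * Re (ip S ?w (mapply S A ?w))"
    unfolding ip_self by (simp add: power2_eq_square)
   moreover have "t\<^sup>2 * Re (ip S ?w (mapply S A ?w)) <= t\<^sup>2 * (s * ?N)" by (intro mult_left_mono le) simp
   ultimately show ?thesis using pos[of ?u] by linarith
  qed
  show ?thesis
  \<comment> \<open>For \<open>s = 0\<close> the inequality is linear in \<open>t\<close>, and a
    large \<open>t\<close> violates it unless \<open>A v\<close> vanishes.\<close>
  proof (cases "s = 0")
   case True
   show ?thesis
   proof (rule ccontr)
    assume "~ ?thesis"
    then have N: "0 < ?N" using True by simp
    have "0 <= ?q - 2 * ((?q + 1) / ?N) * ?N" using ineq[of "(?q + 1) / ?N"] True by simp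
    then show False using N pos[of v] by simp
   qed
  next
   case False
   have "0 <= ?q - 2 * (1 / s) * ?N + (1 / s)\<^sup>2 * (s * ?N)" by (rule ineq)
   also have "(1 / s)\<^sup>2 * (s * ?N) = (1 / s) * ?N" using False by (simp add: power2_eq_square)
   finally have "0 <= ?q - (1 / s) * ?N" by linarith
   then show ?thesis using False s by (simp add: field_simps)
  qed
 qed
 show "opb S A s"
  unfolding opb_def
 proof (intro conjI allI s)
  fix v
  have "(vnorm S (mapply S A v))\<^sup>2 <= s * (s * (vnorm S v)\<^sup>2)"
   by (rule order_trans[OF main]) (intro mult_left_mono le s)
  also have "... = (s * vnorm S v)\<^sup>2" by (simp add: power2_eq_square)
  finally show "vnorm S (mapply S A v) <= s * vnorm S v" by (rule power2_le_imp_le) (simp add: s)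
 qed
qed

lemma mpow_scale: "mpow S (%x y. a * A x y) k x y = a ^ k * mpow S A k x y"
proof (induction k arbitrary: x y)
 case (Suc k)
 then show ?case by (simp add: mmul_def sum_distrib_left mult_ac)
qed simp

lemma mpow_cong:
 assumes "!!x y. x : S ==> y : S ==> A x y = B x y" "x : S" "y : S"
 shows "mpow S A k x y = mpow S B k x y"
 using assms(2,3)
proof (induction k arbitrary: x y)
 case (Suc k)
 then show ?case using assms(1) by (auto intro!: mmul_cong)
qed simp

lemma mpow_commute:
 assumes S: "finite S" and c: "!!x y. x : S ==> y : S ==> mmul S A B x y = mmul S B A x y"
  and "x : S" "y : S"
 shows "mmul S (mpow S A k) B x y = mmul S B (mpow S A k) x y"
 using assms(3,4)
proof (induction k arbitrary: x y)
 case 0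
 then show ?case by (simp add: mmul_idm_left mmul_idm_right S)
next
 case (Suc k)
 have "mmul S (mpow S A (Suc k)) B x y = mmul S A (mmul S (mpow S A k) B) x y" by (simp add: mmul_assoc)
 also have "... = mmul S A (mmul S B (mpow S A k)) x y" by (rule mmul_cong) (use Suc in auto)
 also have "... = mmul S (mmul S A B) (mpow S A k) x y" by (simp add: mmul_assoc)
 also have "... = mmul S (mmul S B A) (mpow S A k) x y" by (rule mmul_cong) (use Suc c in auto)
 also have "... = mmul S B (mpow S A (Suc k)) x y" by (simp add: mmul_assoc)
 finally show ?case .
qed

lemma norm_summable_mexp:
 assumes S: "finite S" "x : S" "y : S"
 shows "summable (%k. cmod (c ^ k / of_nat (fact k) * mpow S A k x y))"
proof -
 obtain a where a: "opb S A a" using opb_exists[OF S(1)] by blast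
 have "summable (%k. (cmod c * a) ^ k / fact k)" using summable_exp[of "cmod c * a"] by (simp add: field_simps)
 then show ?thesis
 proof (rule summable_comparison_test'[where N = 0])
  fix k
  have "cmod (mpow S A k x y) <= a ^ k" by (rule opb_entry[OF S opb_mpow[OF S(1) a]])
  then show "norm (cmod (c ^ k / of_nat (fact k) * mpow S A k x y)) <= (cmod c * a) ^ k / fact k"
   by (simp add: norm_mult norm_divide norm_power power_mult_distrib mult_left_mono divide_right_mono)
 qed
qed

lemma mexp_sums:
 assumes S: "finite S" "x : S" "y : S"
 shows "(%k. c ^ k / of_nat (fact k) * mpow S A k x y) sums mexp S c A x y"
 unfolding mexp_def by (rule summable_sums[OF summable_norm_cancel[OF norm_summable_mexp[OF S]]])

lemma mexp_cong:
 assumes "!!x y. x : S ==> y : S ==> A x y = B x y" "x : S" "y : S"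
 shows "mexp S c A x y = mexp S c B x y"
 unfolding mexp_def using mpow_cong[OF assms] by simp

lemma mexp_scale: "mexp S c (%x y. a * A x y) x y = mexp S (c * a) A x y"
 unfolding mexp_def mpow_scale by (simp add: power_mult_distrib mult_ac)

lemma mpow_idm: "finite S ==> x : S ==> y : S ==> mpow S (%x y. if x = y then a else 0) k x y = (if x = y then a ^ k else 0)"
proof (induction k arbitrary: x y)
 case (Suc k)
 have "mpow S (%x y. if x = y then a else 0) (Suc k) x y = (\<Sum>z\<in>S. if x = z then a * mpow S (%x y. if x = y then a else 0) k z y else 0)"
  by (simp add: mmul_def if_mult cong: if_cong)
 also have "... = a * mpow S (%x y. if x = y then a else 0) k x y" using Suc by simp
 finally show ?case using Suc by simp
qed simp

lemma mexp_idm: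
 assumes "finite S" "x : S" "y : S"
 shows "mexp S 1 (%x y. if x = y then a else 0) x y = (if x = y then exp a else 0)"
proof (cases "x = y")
 case True
 have "mexp S 1 (%x y. if x = y then a else 0) x y = (\<Sum>k. a ^ k /\<^sub>R fact k)"
  unfolding mexp_def mpow_idm[OF assms] using True by (simp add: scaleR_conv_of_real field_simps)
 then show ?thesis using True by (simp add: exp_def)
next
 case False
 then show ?thesis unfolding mexp_def mpow_idm[OF assms] by simp
qed

text \<open>The terms of the binomial formula divided by \<open>fact k\<close>. After this division
  Pascal's rule is replaced by the identity \<open>i + (Suc k - i) = Suc k\<close>.\<close>

definition conv :: "'a set => ('a => 'a => complex) => ('a => 'a => complex) => nat => nat => 'a => 'a => complex" where
 "conv S A B k i = (%x y. mmul S (mpow S A i) (mpow S B (k - i)) x y / (fact i * fact (k - i)))"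

lemma mpow_add_commuting:
 assumes S: "finite S" and c: "!!x y. x : S ==> y : S ==> mmul S A B x y = mmul S B A x y"
  and xy: "x : S" "y : S"
 shows "mpow S (%x y. A x y + B x y) k x y / fact k = (\<Sum>i\<le>k. conv S A B k i x y)"
 using xy
proof (induction k arbitrary: x y)
 case 0
 then show ?case by (simp add: conv_def mmul_idm_left S)
next
 case (Suc k)
 let ?AB = "%x y. A x y + B x y"
 have A: "mmul S A (conv S A B k i) x y = of_nat (Suc i) * conv S A B (Suc k) (Suc i) x y" if "i <= k" for i
 proof -
  have "mmul S A (conv S A B k i) x y = mmul S A (mmul S (mpow S A i) (mpow S B (k - i))) x y / (fact i * fact (k - i))"
   unfolding conv_def by (simp only: mmul_divide_right)
  also have "... = mmul S (mpow S A (Suc i)) (mpow S B (k - i)) x y / (fact i * fact (k - i))"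
   by (simp add: mmul_assoc)
  also have "... = of_nat (Suc i) * conv S A B (Suc k) (Suc i) x y"
   unfolding conv_def by (simp add: divide_simps del: of_nat_Suc mpow.simps)
  finally show ?thesis .
 qed
 have B: "mmul S B (conv S A B k i) x y = of_nat (Suc k - i) * conv S A B (Suc k) i x y" if "i <= k" for i
 proof -
  have "mmul S B (conv S A B k i) x y = mmul S B (mmul S (mpow S A i) (mpow S B (k - i))) x y / (fact i * fact (k - i))"
   unfolding conv_def by (simp only: mmul_divide_right)
  also have "mmul S B (mmul S (mpow S A i) (mpow S B (k - i))) x y = mmul S (mmul S B (mpow S A i)) (mpow S B (k - i)) x y"
   by (simp add: mmul_assoc)
  also have "... = mmul S (mmul S (mpow S A i) B) (mpow S B (k - i)) x y"
   by (rule mmul_cong) (use mpow_commute[OF S c] Suc.prems in auto)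
  also have "... = mmul S (mpow S A i) (mpow S B (Suc k - i)) x y"
   using that by (simp add: mmul_assoc Suc_diff_le)
  also have "... / (fact i * fact (k - i)) = of_nat (Suc k - i) * conv S A B (Suc k) i x y"
   unfolding conv_def using that by (simp add: Suc_diff_le divide_simps del: of_nat_Suc mpow.simps)
  finally show ?thesis .
 qed
 have "mpow S ?AB (Suc k) x y / fact k = mmul S ?AB (%x y. mpow S ?AB k x y / fact k) x y"
  by (simp only: mmul_divide_right mpow.simps)
 also have "... = mmul S ?AB (%x y. \<Sum>i\<le>k. conv S A B k i x y) x y"
  by (rule mmul_cong) (use Suc in auto)
 also have "... = (\<Sum>i\<le>k. mmul S A (conv S A B k i) x y) + (\<Sum>i\<le>k. mmul S B (conv S A B k i) x y)"
  by (simp add: mmul_add_left mmul_sum_right)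
 also have "(\<Sum>i\<le>k. mmul S A (conv S A B k i) x y) = (\<Sum>i\<le>k. of_nat (Suc i) * conv S A B (Suc k) (Suc i) x y)"
  by (intro sum.cong refl A) simp
 also have "... = (\<Sum>i\<le>Suc k. of_nat i * conv S A B (Suc k) i x y)"
  by (subst sum.atMost_Suc_shift) simp
 also have "(\<Sum>i\<le>k. mmul S B (conv S A B k i) x y) = (\<Sum>i\<le>Suc k. of_nat (Suc k - i) * conv S A B (Suc k) i x y)"
 proof -
  have "(\<Sum>i\<le>k. mmul S B (conv S A B k i) x y) = (\<Sum>i\<le>k. of_nat (Suc k - i) * conv S A B (Suc k) i x y)"
   by (intro sum.cong refl B) simp
  then show ?thesis by simp
 qed
 also have "(\<Sum>i\<le>Suc k. of_nat i * conv S A B (Suc k) i x y) + (\<Sum>i\<le>Suc k. of_nat (Suc k - i) * conv S A B (Suc k) i x y)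
  = (\<Sum>i\<le>Suc k. of_nat (Suc k) * conv S A B (Suc k) i x y)"
  unfolding sum.distrib[symmetric] distrib_right[symmetric]
  by (intro sum.cong refl arg_cong2[where f = times]) (simp add: of_nat_add[symmetric] del: of_nat_add of_nat_Suc)
 finally have "mpow S ?AB (Suc k) x y / fact k = of_nat (Suc k) * (\<Sum>i\<le>Suc k. conv S A B (Suc k) i x y)"
  by (simp only: sum_distrib_left)
 then show ?case by (simp add: divide_simps mult_ac del: of_nat_Suc mpow.simps sum.atMost_Suc)
qed

lemma mexp_add_commuting:
 assumes S: "finite S" and c: "!!x y. x : S ==> y : S ==> mmul S A B x y = mmul S B A x y"
  and xy: "x : S" "y : S"
 shows "mexp S 1 (%x y. A x y + B x y) x y = mmul S (mexp S 1 A) (mexp S 1 B) x y"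
proof -
 let ?a = "%z k. mpow S A k x z / fact k" and ?b = "%z k. mpow S B k z y / fact k"
 have sa: "summable (%k. norm (?a z k))" if "z : S" for z
  using norm_summable_mexp[OF S xy(1) that, of 1 A] by simp
 have sb: "summable (%k. norm (?b z k))" if "z : S" for z
  using norm_summable_mexp[OF S that xy(2), of 1 B] by simp
 have ea: "mexp S 1 A x z = (\<Sum>k. ?a z k)" "mexp S 1 B z y = (\<Sum>k. ?b z k)" for z by (simp_all add: mexp_def)
 have "(%k. \<Sum>z\<in>S. \<Sum>i\<le>k. ?a z i * ?b z (k - i)) sums (\<Sum>z\<in>S. mexp S 1 A x z * mexp S 1 B z y)"
  unfolding ea by (intro sums_sum Cauchy_product_sums sa sb)
 moreover have "(\<Sum>z\<in>S. \<Sum>i\<le>k. ?a z i * ?b z (k - i)) = mpow S (%x y. A x y + B x y) k x y / fact k" for k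
 proof -
  have "(\<Sum>z\<in>S. \<Sum>i\<le>k. ?a z i * ?b z (k - i)) = (\<Sum>i\<le>k. \<Sum>z\<in>S. ?a z i * ?b z (k - i))" by (rule sum.swap)
  also have "... = (\<Sum>i\<le>k. conv S A B k i x y)" unfolding conv_def by (simp add: mmul_def sum_divide_distrib)
  also have "... = mpow S (%x y. A x y + B x y) k x y / fact k" using mpow_add_commuting[OF S c xy] by simp
  finally show ?thesis .
 qed
 ultimately have "(%k. mpow S (%x y. A x y + B x y) k x y / fact k) sums mmul S (mexp S 1 A) (mexp S 1 B) x y"
  by (simp add: mmul_def)
 then show ?thesis by (simp add: mexp_def sums_iff)
qed

lemma mexp_add:
 assumes S: "finite S" "x : S" "y : S"
 shows "mexp S (a + b) A x y = mmul S (mexp S a A) (mexp S b A) x y"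
proof -
 have "mexp S (a + b) A x y = mexp S 1 (%x y. (a + b) * A x y) x y" by (simp add: mexp_scale)
 also have "... = mexp S 1 (%x y. a * A x y + b * A x y) x y" by (simp add: distrib_right)
 also have "... = mmul S (mexp S 1 (%x y. a * A x y)) (mexp S 1 (%x y. b * A x y)) x y"
  by (rule mexp_add_commuting[OF S(1) _ S(2,3)]) (simp add: mmul_scale_left mmul_scale_right)
 also have "... = mmul S (mexp S a A) (mexp S b A) x y" by (simp add: mmul_def mexp_scale)
 finally show ?thesis .
qed

lemma suminf_single: "(\<Sum>k. if k = (0::nat) then a else 0) = (a :: complex)"
 using suminf_finite[of "{0}" "%k. if k = 0 then a else 0"] by simp

lemma mexp_zero: "mexp S 0 A x y = idm x y"
proof -
 have "(%k. 0 ^ k / of_nat (fact k) * mpow S A k x y) = (%k. if k = 0 then idm x y else 0)"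
 proof
  fix k show "0 ^ k / of_nat (fact k) * mpow S A k x y = (if k = 0 then idm x y else 0)" by (cases k) auto
 qed
 then show ?thesis unfolding mexp_def by (simp only: suminf_single)
qed

lemma mexp_power:
 assumes S: "finite S" "x : S" "y : S"
 shows "mexp S (of_nat n * a) A x y = mpow S (mexp S a A) n x y"
 using S(2,3)
proof (induction n arbitrary: x y)
 case 0
 then show ?case by (simp add: mexp_zero)
next
 case (Suc n)
 have "mexp S (of_nat (Suc n) * a) A x y = mexp S (a + of_nat n * a) A x y" by (simp add: algebra_simps)
 also have "... = mmul S (mexp S a A) (mexp S (of_nat n * a) A) x y" by (rule mexp_add[OF S(1) Suc.prems])
 also have "... = mmul S (mexp S a A) (mpow S (mexp S a A) n) x y" by (rule mmul_cong) (use Suc in auto)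
 finally show ?case by simp
qed

text \<open>A multiple of the identity commutes with \<open>A\<close> and exponentiates to a scalar.
  The shift serves to make exponents positive as forms before their norms are estimated.\<close>

lemma mexp_shift:
 assumes S: "finite S" "x : S" "y : S"
 shows "mexp S 1 A x y = exp (- c) * mexp S 1 (%x y. (if x = y then c else 0) + A x y) x y"
proof -
 have "mexp S 1 A x y = mexp S 1 (%x y. (if x = y then - c else 0) + ((if x = y then c else 0) + A x y)) x y"
  by (rule arg_cong[where f = "%A. mexp S 1 A x y"]) (simp add: fun_eq_iff)
 also have "... = mmul S (mexp S 1 (%x y. if x = y then - c else 0)) (mexp S 1 (%x y. (if x = y then c else 0) + A x y)) x y"
 proof (rule mexp_add_commuting[OF S(1) _ S(2,3)])
  fix x y assume "x : S" "y : S"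
  then show "mmul S (%x y. if x = y then - c else 0) (%x y. (if x = y then c else 0) + A x y) x y
   = mmul S (%x y. (if x = y then c else 0) + A x y) (%x y. if x = y then - c else 0) x y"
   using S(1) by (simp add: mmul_def if_mult cong: if_cong)
 qed
 also have "... = (\<Sum>z\<in>S. if x = z then exp (- c) * mexp S 1 (%x y. (if x = y then c else 0) + A x y) z y else 0)"
  unfolding mmul_def using mexp_idm[OF S(1,2)] by (intro sum.cong) auto
 also have "... = exp (- c) * mexp S 1 (%x y. (if x = y then c else 0) + A x y) x y" using S by simp
 finally show ?thesis .
qed

lemma opb_mexp:
 assumes S: "finite S" and A: "opb S A a"
 shows "opb S (mexp S 1 A) (exp a)"
proof (rule opb_suminf[where A = "%k x y. 1 ^ k / of_nat (fact k) * mpow S A k x y" and a = "%k. a ^ k /\<^sub>R fact k"])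
 show "opb S (%x y. 1 ^ k / of_nat (fact k) * mpow S A k x y) (a ^ k /\<^sub>R fact k)" for k
 proof -
  have "opb S (%x y. 1 / of_nat (fact k) * mpow S A k x y) (cmod (1 / of_nat (fact k)) * a ^ k)"
   by (rule opb_scale[OF opb_mpow[OF S A]])
  moreover have "cmod (1 / of_nat (fact k)) = inverse (fact k)"
   using norm_of_nat[where 'a = complex, of "fact k"] by (simp only: norm_divide norm_one inverse_eq_divide of_nat_fact)
  ultimately show ?thesis by simp
 qed
 show "(%k. a ^ k /\<^sub>R fact k) sums exp a" by (rule exp_converges)
qed (rule mexp_sums[OF S])

lemma herm_mpow: "finite S ==> herm S A ==> x : S ==> y : S ==> mpow S A k x y = cnj (mpow S A k y x)"
proof (induction k arbitrary: x y)
 case (Suc k)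
 have "mpow S A (Suc k) x y = mmul S (mpow S A k) A x y" by (rule mpow_Suc_right) (use Suc in auto)
 also have "... = (\<Sum>z\<in>S. cnj (A y z * mpow S A k z x))"
  unfolding mmul_def
 proof (intro sum.cong refl)
  fix z assume z: "z : S"
  have "A z y = cnj (A y z)" using Suc.prems(2,4) z unfolding herm_def by blast
  moreover have "mpow S A k x z = cnj (mpow S A k z x)" by (rule Suc.IH[OF Suc.prems(1,2,3) z])
  ultimately show "mpow S A k x z * A z y = cnj (A y z * mpow S A k z x)" by (simp only: complex_cnj_mult mult.commute)
 qed
 finally show ?case by (simp add: mmul_def)
qed auto

lemma herm_mexp:
 assumes S: "finite S" and A: "herm S A"
 shows "herm S (mexp S (of_real c) A)"
 unfolding herm_def
proof (intro ballI)
 fix x y assume xy: "x : S" "y : S"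
 have "(%k. cnj (of_real c ^ k / of_nat (fact k) * mpow S A k y x)) sums cnj (mexp S (of_real c) A y x)"
  using mexp_sums[OF S xy(2,1)] by (simp only: sums_cnj)
 moreover have "cnj (of_real c ^ k / of_nat (fact k) * mpow S A k y x) = of_real c ^ k / of_nat (fact k) * mpow S A k x y" for k
  unfolding herm_mpow[OF S A xy, of k] by simp
 ultimately have "(%k. of_real c ^ k / of_nat (fact k) * mpow S A k x y) sums cnj (mexp S (of_real c) A y x)" by (simp only:)
 then show "mexp S (of_real c) A x y = cnj (mexp S (of_real c) A y x)"
  using sums_unique2[OF mexp_sums[OF S xy]] by blast
qed

lemma psd_iff: "psd S A \<longleftrightarrow> (ALL v. Im (ip S v (mapply S A v)) = 0 & 0 <= Re (ip S v (mapply S A v)))"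
 unfolding psd_def ip_def mapply_def by (simp add: Let_def sum_distrib_left mult.assoc)

lemma opb_form:
 assumes "opb S A a"
 shows "\<bar>Re (ip S v (mapply S A v))\<bar> <= a * (vnorm S v)\<^sup>2"
proof -
 have "\<bar>Re (ip S v (mapply S A v))\<bar> <= vnorm S v * vnorm S (mapply S A v)"
  by (rule order_trans[OF abs_Re_le_cmod cauchy_schwarz])
 also have "... <= vnorm S v * (a * vnorm S v)" by (intro mult_left_mono opbD[OF assms]) simp
 finally show ?thesis by (simp add: power2_eq_square mult_ac)
qed

lemma mapply_shift:
 assumes "finite S" "x : S"
 shows "mapply S (%x y. (if x = y then c else 0) + A x y) v x = c * v x + mapply S A v x"
 using assms by (simp add: mapply_add) (simp add: mapply_def if_mult cong: if_cong)

lemma ip_shift: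
 assumes "finite S"
 shows "ip S v (mapply S (%x y. (if x = y then c else 0) + A x y) v) = c * of_real ((vnorm S v)\<^sup>2) + ip S v (mapply S A v)"
proof -
 have "ip S v (mapply S (%x y. (if x = y then c else 0) + A x y) v) = ip S v (%x. c * v x + mapply S A v x)"
  by (rule ip_cong) (simp_all add: mapply_shift assms)
 then show ?thesis by (simp only: ip_add_right ip_scale_right ip_self)
qed

lemma herm_shift: "herm S A ==> herm S (%x y. (if x = y then of_real c else 0) + of_real s * A x y)"
 unfolding herm_def
proof (intro ballI)
 fix x y assume h: "ALL x:S. ALL y:S. A x y = cnj (A y x)" and "x : S" "y : S"
 then have "cnj (A y x) = A x y" by metis
 then show "(if x = y then of_real c else 0) + of_real s * A x y = cnj ((if y = x then of_real c else 0) + of_real s * A y x)"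
  by simp
qed

text \<open>With \<open>a\<close> a norm bound of \<open>H\<close>, the operator
  \<open>s * a - s * H\<close> lies between 0 and \<open>s * a\<close> as a form, hence has norm at
  most \<open>s * a\<close>. Its exponential has norm at most \<open>exp (s * a)\<close>, which the
  scalar from \<open>mexp_shift\<close> cancels.\<close>

lemma contraction:
 assumes S: "finite S" and h: "herm S H" and pos: "!!v. 0 <= Re (ip S v (mapply S H v))" and s: "0 <= s"
 shows "opb S (mexp S (- of_real s) H) 1"
proof -
 obtain a where a: "opb S H a" using opb_exists[OF S] by blast
 let ?M = "%x y. (if x = y then of_real (s * a) else 0) + of_real (- s) * H x y"
 have form: "Re (ip S v (mapply S ?M v)) = s * a * (vnorm S v)\<^sup>2 - s * Re (ip S v (mapply S H v))" for v
  unfolding ip_shift[OF S] mapply_scale ip_scale_right by simp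
 have "opb S ?M (s * a)"
 proof (rule herm_opb(2)[OF herm_shift[OF h]])
  fix v
  have "s * Re (ip S v (mapply S H v)) <= s * (a * (vnorm S v)\<^sup>2)"
   by (intro mult_left_mono s) (use opb_form[OF a, of v] in linarith)
  then show "0 <= Re (ip S v (mapply S ?M v))" unfolding form by (simp add: mult.assoc)
  show "Re (ip S v (mapply S ?M v)) <= s * a * (vnorm S v)\<^sup>2" unfolding form using pos[of v] s by simp
 qed (use s opb_nonneg[OF a] in simp)
 then have "opb S (mexp S 1 ?M) (exp (s * a))" by (rule opb_mexp[OF S])
 then have "opb S (%x y. exp (- of_real (s * a)) * mexp S 1 ?M x y) (cmod (exp (- of_real (s * a))) * exp (s * a))"
  by (rule opb_scale)
 moreover have "cmod (exp (- of_real (s * a))) * exp (s * a) = 1"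
  by (simp add: norm_exp_eq_Re mult_exp_exp)
 moreover have "mexp S (- of_real s) H x y = exp (- of_real (s * a)) * mexp S 1 ?M x y" if "x : S" "y : S" for x y
 proof -
  have "mexp S (- of_real s) H x y = mexp S 1 (%x y. of_real (- s) * H x y) x y" by (simp only: mexp_scale mult_1 of_real_minus)
  also have "... = exp (- of_real (s * a)) * mexp S 1 ?M x y" by (rule mexp_shift[OF S that])
  finally show ?thesis .
 qed
 ultimately show ?thesis by (auto intro: opb_cong)
qed

lemma mexp_half:
 assumes "finite S" "x : S" "y : S"
 shows "mexp S (- of_real b) A x y = mmul S (mexp S (of_real (- (b / 2))) A) (mexp S (of_real (- (b / 2))) A) x y"
proof -
 have "- of_real b = of_real (- (b / 2)) + (of_real (- (b / 2)) :: complex)"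
  unfolding of_real_add[symmetric] by (simp only: of_real_minus[symmetric]) simp
 then show ?thesis using mexp_add[OF assms, of "of_real (- (b / 2))" "of_real (- (b / 2))" A] by (simp only:)
qed

lemma mtrace_cong: "(!!x. x : S ==> A x x = B x x) ==> mtrace S A = mtrace S B"
 unfolding mtrace_def by (rule sum.cong) auto

lemma mtrace_cyclic: "mtrace S (mmul S A B) = mtrace S (mmul S B A)"
 unfolding mtrace_def mmul_def by (subst sum.swap) (simp add: mult.commute)

lemma herm_mmul_cnj:
 assumes "herm S A" "herm S B" "x : S" "y : S"
 shows "mmul S A B x y = cnj (mmul S B A y x)"
 unfolding mmul_def cnj_sum
proof (rule sum.cong[OF refl])
 fix z assume "z : S"
 then have "A x z = cnj (A z x)" "B z y = cnj (B y z)" using assms unfolding herm_def by blast+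
 then show "A x z * B z y = cnj (B y z * A z x)" by simp
qed

text \<open>By cyclicity the trace is the squared Hilbert-Schmidt norm of the product of
  \<open>K\<close> and \<open>O'\<close>. Applied to the root of a Gibbs operator and to a
  projection, it shows that the weights of outcomes are real and nonnegative.\<close>

lemma mtrace_squares:
 assumes K: "herm S K" and O: "herm S O'"
 shows "mtrace S (mmul S (mmul S K K) (mmul S O' O')) = of_real (\<Sum>x\<in>S. \<Sum>y\<in>S. (cmod (mmul S K O' x y))\<^sup>2)"
proof -
 have "mtrace S (mmul S (mmul S K K) (mmul S O' O')) = mtrace S (mmul S K (mmul S (mmul S K O') O'))"
  by (simp only: mmul_assoc)
 also have "... = mtrace S (mmul S (mmul S K O') (mmul S O' K))" by (subst mtrace_cyclic) (simp only: mmul_assoc)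
 also have "... = (\<Sum>x\<in>S. \<Sum>y\<in>S. mmul S K O' x y * cnj (mmul S K O' x y))"
  unfolding mtrace_def mmul_def[of S "mmul S K O'"] using herm_mmul_cnj[OF O K] by simp
 also have "... = of_real (\<Sum>x\<in>S. \<Sum>y\<in>S. (cmod (mmul S K O' x y))\<^sup>2)"
  by (simp only: complex_norm_square of_real_sum)
 finally show ?thesis .
qed

lemma mtrace_square:
 assumes S: "finite S" and K: "herm S K"
 shows "mtrace S (mmul S K K) = of_real (\<Sum>x\<in>S. \<Sum>y\<in>S. (cmod (K x y))\<^sup>2)"
proof -
 have "mtrace S (mmul S K K) = (\<Sum>x\<in>S. \<Sum>y\<in>S. K x y * cnj (K x y))"
  unfolding mtrace_def mmul_def
 proof (intro sum.cong refl)
  fix x y assume "x : S" "y : S"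
  then have "K y x = cnj (K x y)" using K unfolding herm_def by blast
  then show "K x y * K y x = K x y * cnj (K x y)" by simp
 qed
 then show ?thesis by (simp only: complex_norm_square of_real_sum)
qed

text \<open>The trace is the sum of the squared entries of the exponential at half the parameter,
  and these are not all zero because that exponential has an inverse.\<close>

lemma mtrace_mexp_pos:
 assumes S: "finite S" "S ~= {}" and h: "herm S H"
 shows "Re (mtrace S (mexp S (- of_real b) H)) > 0" "Im (mtrace S (mexp S (- of_real b) H)) = 0"
proof -
 let ?K = "mexp S (of_real (- (b / 2))) H" and ?N = "mexp S (of_real (b / 2)) H"
 have eq: "mtrace S (mexp S (- of_real b) H) = of_real (\<Sum>x\<in>S. \<Sum>y\<in>S. (cmod (?K x y))\<^sup>2)"
  unfolding mtrace_square[OF S(1) herm_mexp[OF S(1) h], symmetric]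
  by (rule mtrace_cong) (rule mexp_half[OF S(1)])
 obtain x where x: "x : S" using S by blast
 have "mmul S ?K ?N x x = 1"
  using mexp_add[OF S(1) x x, of "of_real (- (b / 2))" "of_real (b / 2)" H] mexp_zero[of S H x x]
  by (simp only: of_real_add[symmetric]) simp
 moreover have "mmul S ?K ?N x x = 0" if "ALL y:S. ?K x y = 0"
  unfolding mmul_def by (rule sum.neutral) (use that in simp)
 ultimately have "~ (ALL y:S. ?K x y = 0)" by auto
 then obtain y where y: "y : S" "?K x y ~= 0" by blast
 have "0 < (cmod (?K x y))\<^sup>2" using y by simp
 also have "... <= (\<Sum>y\<in>S. (cmod (?K x y))\<^sup>2)" by (rule member_le_sum[OF y(1)]) (use S in auto)
 also have "... <= (\<Sum>x\<in>S. \<Sum>y\<in>S. (cmod (?K x y))\<^sup>2)"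
  by (rule member_le_sum[OF x]) (use S in "auto intro: sum_nonneg")
 finally show "Re (mtrace S (mexp S (- of_real b) H)) > 0" unfolding eq by simp
 show "Im (mtrace S (mexp S (- of_real b) H)) = 0" unfolding eq by simp
qed

section \<open>Existence of the ground state limit\<close>

lemma ip_unit_left: "finite S ==> x : S ==> ip S (%z. if z = x then 1 else 0) w = w x"
 by (simp add: ip_def if_distrib[where f = cnj] if_mult cong: if_cong)

lemma mapply_unit: "finite S ==> y : S ==> mapply S A (%z. if z = y then 1 else 0) = (%x. A x y)"
 by (simp add: mapply_def fun_eq_iff if_mult cong: if_cong)

lemma polarization:
 assumes S: "finite S" "x : S" "y : S"
 shows "ip S (%z. (if z = x then 1 else 0) + c * (if z = y then 1 else 0)) (mapply S A (%z. (if z = x then 1 else 0) + c * (if z = y then 1 else 0)))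
  = A x x + c * A x y + cnj c * (A y x + c * A y y)"
 unfolding mapply_add_vec mapply_scale_vec ip_add_left ip_scale_left ip_add_right ip_scale_right
  mapply_unit[OF S(1,2)] mapply_unit[OF S(1,3)] ip_unit_left[OF S(1,2)] ip_unit_left[OF S(1,3)] by simp

lemma antimono_tendsto_at_top:
 fixes f :: "real => real"
 assumes a: "!!x y. 0 <= x ==> x <= y ==> f y <= f x" and b: "!!x. 0 <= x ==> 0 <= f x"
 shows "EX l. (f \<longlongrightarrow> l) at_top"
proof (intro exI)
 let ?l = "Inf (f ` {0..})"
 have bdd: "bdd_below (f ` {0..})" by (rule bdd_belowI[of _ 0]) (use b in auto)
 show "(f \<longlongrightarrow> ?l) at_top"
 proof (rule order_tendstoI)
  fix c assume c: "c < ?l"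
  show "\<forall>\<^sub>F x in at_top. c < f x"
   using eventually_ge_at_top[of 0]
  proof eventually_elim
   case (elim x)
   then have "?l <= f x" by (intro cInf_lower bdd) auto
   then show ?case using c by simp
  qed
 next
  fix c assume "?l < c"
  then have "EX y:f ` {0..}. y < c" by (subst (asm) cInf_less_iff[OF _ bdd]) auto
  then obtain x where x: "0 <= x" "f x < c" by auto
  show "\<forall>\<^sub>F x in at_top. f x < c"
   using eventually_ge_at_top[of x]
  proof eventually_elim
   case (elim y)
   then show ?case using a[OF x(1) elim] x(2) by simp
  qed
 qed
qed

lemma heat_form:
 assumes S: "finite S" and h: "herm S B"
 shows "ip S v (mapply S (mexp S (- of_real b) B) v) = of_real ((vnorm S (mapply S (mexp S (of_real (- (b / 2))) B) v))\<^sup>2)"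
proof -
 let ?K = "mexp S (of_real (- (b / 2))) B"
 have "ip S v (mapply S (mexp S (- of_real b) B) v) = ip S v (mapply S (mmul S ?K ?K) v)"
  by (intro ip_cong mapply_cong mexp_half[OF S]) auto
 also have "... = ip S (mapply S ?K v) (mapply S ?K v)"
  unfolding mapply_mmul by (rule ip_herm[OF herm_mexp[OF S h]])
 finally show ?thesis by (simp only: ip_self)
qed

lemma heat_antimono:
 assumes S: "finite S" and h: "herm S B" and pos: "!!v. 0 <= Re (ip S v (mapply S B v))" and "s <= t"
 shows "Re (ip S v (mapply S (mexp S (- of_real t) B) v)) <= Re (ip S v (mapply S (mexp S (- of_real s) B) v))"
proof -
 let ?K = "%s. mexp S (of_real (- (s / 2))) B" and ?D = "mexp S (- of_real ((t - s) / 2)) B"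
 have "vnorm S (mapply S (?K t) v) = vnorm S (mapply S (mmul S ?D (?K s)) v)"
 proof (intro vnorm_cong mapply_cong refl)
  fix x y assume xy: "x : S" "y : S"
  have "- of_real ((t - s) / 2) + of_real (- (s / 2)) = (of_real (- (t / 2)) :: complex)"
   by (simp only: of_real_minus[symmetric] of_real_add[symmetric]) (simp add: field_simps)
  then show "?K t x y = mmul S ?D (?K s) x y" using mexp_add[OF S xy, of "- of_real ((t - s) / 2)" "of_real (- (s / 2))" B] by simp
 qed
 also have "... <= 1 * vnorm S (mapply S (?K s) v)"
  unfolding mapply_mmul by (rule opbD[OF contraction[OF S h pos]]) (use assms in simp)
 finally show ?thesis unfolding heat_form[OF S h] by (simp add: power_mono)
qed

text \<open>The quadratic forms of the semigroup are nonnegative and decrease in \<open>b\<close>,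
  hence converge; polarisation recovers the entries, real and imaginary part each as a difference of
  two forms. Monotone forms take the place of eigenvalues here.\<close>

lemma heat_entries_converge:
 assumes S: "finite S" and h: "herm S B" and pos: "!!v. 0 <= Re (ip S v (mapply S B v))"
  and xy: "x : S" "y : S"
 shows "EX l. ((%b. mexp S (- of_real b) B x y) \<longlongrightarrow> l) at_top"
proof -
 let ?E = "%b. mexp S (- of_real b) B"
 have conv: "EX l. ((%b. Re (ip S v (mapply S (?E b) v))) \<longlongrightarrow> l) at_top" for v
  by (rule antimono_tendsto_at_top) (use heat_antimono[OF S h pos] in blast, simp add: heat_form[OF S h])
 let ?v = "%c z. (if z = x then 1 else 0) + c * (if z = y then 1 else 0 :: complex)"
 let ?q = "%c b. Re (ip S (?v c) (mapply S (?E b) (?v c)))"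
 define l where "l = (%c. SOME l. ((%b. ?q c b) \<longlongrightarrow> l) at_top)"
 have l: "((%b. ?q c b) \<longlongrightarrow> l c) at_top" for c
  unfolding l_def by (rule someI_ex) (rule conv)
 have q: "?q c b = Re (?E b x x + c * ?E b x y + cnj c * (cnj (?E b x y) + c * ?E b y y))" for c b
 proof -
  have "?E b y x = cnj (?E b x y)"
   using herm_mexp[OF S h, of "- b"] xy unfolding herm_def of_real_minus by blast
  then show ?thesis unfolding polarization[OF S xy] by simp
 qed
 have re: "Re (?E b x y) = (?q 1 b - ?q (- 1) b) / 4" for b unfolding q by simp
 have im: "Im (?E b x y) = (?q (- \<i>) b - ?q \<i> b) / 4" for b unfolding q by simp
 have "((%b. Complex (Re (?E b x y)) (Im (?E b x y))) \<longlongrightarrow> Complex ((l 1 - l (- 1)) / 4) ((l (- \<i>) - l \<i>) / 4)) at_top"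
  unfolding re im by (intro tendsto_Complex tendsto_divide tendsto_diff l tendsto_const) auto
 then show ?thesis by auto
qed

text \<open>The exponential series without its constant term has a factor \<open>B\<close> on the
  right, so the exponential hardly moves a vector that \<open>B\<close> almost annihilates.\<close>

lemma mexp_minus_idm:
 assumes S: "finite S"
 shows "EX W. ALL x:S. ALL y:S. mexp S c B x y = idm x y + mmul S W B x y"
proof -
 define W where "W = (%x y. \<Sum>k. c ^ Suc k / of_nat (fact (Suc k)) * mpow S B k x y)"
 have sm: "summable (%k. c ^ Suc k / of_nat (fact (Suc k)) * mpow S B k x y)" if "x : S" "y : S" for x y
 proof (rule summable_norm_cancel, rule summable_comparison_test'[where N = 0])
  show "summable (%k. cmod c * cmod (c ^ k / of_nat (fact k) * mpow S B k x y))"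
   by (rule summable_mult[OF norm_summable_mexp[OF S that]])
  fix k
  have "1 / fact (Suc k) <= (1 / fact k :: real)" by (intro divide_left_mono fact_mono) auto
  then have "cmod c ^ Suc k * (1 / fact (Suc k)) * cmod (mpow S B k x y) <= cmod c ^ Suc k * (1 / fact k) * cmod (mpow S B k x y)"
   by (intro mult_left_mono mult_right_mono) auto
  moreover have "norm (cmod (c ^ Suc k / of_nat (fact (Suc k)) * mpow S B k x y)) = cmod c ^ Suc k * (1 / fact (Suc k)) * cmod (mpow S B k x y)"
   by (simp only: norm_mult norm_divide norm_power norm_of_nat of_nat_fact real_norm_def abs_norm_cancel) (simp del: fact_Suc power_Suc)
  moreover have "cmod c * cmod (c ^ k / of_nat (fact k) * mpow S B k x y) = cmod c ^ Suc k * (1 / fact k) * cmod (mpow S B k x y)"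
   by (simp only: norm_mult norm_divide norm_power norm_of_nat of_nat_fact power_Suc) simp
  ultimately show "norm (cmod (c ^ Suc k / of_nat (fact (Suc k)) * mpow S B k x y)) <= cmod c * cmod (c ^ k / of_nat (fact k) * mpow S B k x y)"
   by linarith
 qed
 have "mexp S c B x y = idm x y + mmul S W B x y" if xy: "x : S" "y : S" for x y
 proof -
  have "(%k. \<Sum>z\<in>S. (c ^ Suc k / of_nat (fact (Suc k)) * mpow S B k x z) * B z y) sums (\<Sum>z\<in>S. W x z * B z y)"
   unfolding W_def by (intro sums_sum sums_mult2 summable_sums sm xy)
  moreover have "(\<Sum>z\<in>S. (c ^ Suc k / of_nat (fact (Suc k)) * mpow S B k x z) * B z y) = c ^ Suc k / of_nat (fact (Suc k)) * mpow S B (Suc k) x y" for k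
   unfolding mpow_Suc_right[OF S xy] mmul_def sum_distrib_left by (simp only: mult.assoc)
  ultimately have "(%k. c ^ Suc k / of_nat (fact (Suc k)) * mpow S B (Suc k) x y) sums mmul S W B x y"
   by (simp only: mmul_def)
  then have "(%k. c ^ k / of_nat (fact k) * mpow S B k x y) sums (mmul S W B x y + c ^ 0 / of_nat (fact 0) * mpow S B 0 x y)"
   by (subst (asm) sums_Suc_iff) simp
  then have "mexp S c B x y = mmul S W B x y + c ^ 0 / of_nat (fact 0) * mpow S B 0 x y"
   by (rule sums_unique2[OF mexp_sums[OF S xy]])
  then show ?thesis by simp
 qed
 then show ?thesis by blast
qed

lemma hilbert_schmidt:
 "(vnorm S (mapply S K v))\<^sup>2 <= (\<Sum>x\<in>S. \<Sum>y\<in>S. (cmod (K x y))\<^sup>2) * (vnorm S v)\<^sup>2"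
proof -
 have "(cmod (mapply S K v x))\<^sup>2 <= (\<Sum>y\<in>S. (cmod (K x y))\<^sup>2) * (vnorm S v)\<^sup>2" for x
 proof -
  have "cmod (mapply S K v x) = cmod (ip S (%y. cnj (K x y)) v)" by (simp add: mapply_def ip_def)
  also have "... <= vnorm S (%y. cnj (K x y)) * vnorm S v" by (rule cauchy_schwarz)
  finally have "(cmod (mapply S K v x))\<^sup>2 <= (vnorm S (%y. cnj (K x y)) * vnorm S v)\<^sup>2" by (rule power_mono) simp
  then show ?thesis by (simp add: power_mult_distrib vnorm_sq)
 qed
 then show ?thesis unfolding vnorm_sq[of S "mapply S K v"] sum_distrib_right by (rule sum_mono)
qed

text \<open>By \<open>herm_opb\<close> an almost minimising vector \<open>v\<close> has small
  \<open>B v\<close>, so the operator at half the parameter hardly moves it. Its Hilbert-Schmidt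
  norm, whose square is the trace, is therefore at least \<open>1 - e\<close> for every
  \<open>e\<close>. Approximate minimisers suffice.\<close>

lemma heat_trace_ge_1:
 assumes S: "finite S" and h: "herm S B" and pos: "!!v. 0 <= Re (ip S v (mapply S B v))"
  and small: "!!e. 0 < e ==> EX v. vnorm S v = 1 & Re (ip S v (mapply S B v)) < e"
 shows "1 <= Re (mtrace S (mexp S (- of_real s) B))"
proof -
 let ?K = "mexp S (of_real (- (s / 2))) B"
 let ?t = "\<Sum>x\<in>S. \<Sum>y\<in>S. (cmod (?K x y))\<^sup>2"
 have tr: "mtrace S (mexp S (- of_real s) B) = of_real ?t"
  unfolding mtrace_square[OF S(1) herm_mexp[OF S(1) h], symmetric]
  by (rule mtrace_cong) (rule mexp_half[OF S(1)])
 obtain W where W: "!!x y. x : S ==> y : S ==> ?K x y = idm x y + mmul S W B x y"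
  using mexp_minus_idm[OF S, of "of_real (- (s / 2))" B] by blast
 obtain w where w: "opb S W w" using opb_exists[OF S] by blast
 obtain b where b: "opb S B b" using opb_exists[OF S] by blast
 have t0: "0 <= ?t" by (intro sum_nonneg) simp
 have "1 <= sqrt ?t + e" if e: "0 < e" for e
 proof -
  \<comment> \<open>Chosen so that \<open>(b + 1) * d\<close> is the square of
    \<open>e / (w + 1)\<close>; the added 1 keeps the denominators positive.\<close>
  define d where "d = (e / (w + 1))\<^sup>2 / (b + 1)"
  have w0: "0 <= w" and b0: "0 <= b" using opb_nonneg w b by blast+
  have d: "0 < d" unfolding d_def using e w0 b0 by simp
  obtain v where v: "vnorm S v = 1" "Re (ip S v (mapply S B v)) < d" using small[OF d] by blast
  have "(vnorm S (mapply S B v))\<^sup>2 <= b * Re (ip S v (mapply S B v))"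
   by (rule herm_opb(1)[OF h pos _ b0]) (use opb_form[OF b] in "simp add: abs_le_iff")
  also have "... <= (b + 1) * d" using v(2) b0 d by (intro mult_mono) (auto simp: pos)
  also have "... = (e / (w + 1))\<^sup>2" unfolding d_def using b0 by simp
  finally have Bv: "vnorm S (mapply S B v) <= e / (w + 1)" by (rule power2_le_imp_le) (use e w0 in simp)
  have "vnorm S (mapply S W (mapply S B v)) <= w * (e / (w + 1))"
   by (rule order_trans[OF opbD[OF w] mult_left_mono[OF Bv w0]])
  also have "... <= (w + 1) * (e / (w + 1))" by (intro mult_right_mono) (use e w0 in auto)
  also have "... = e" using w0 by simp
  finally have We: "vnorm S (mapply S W (mapply S B v)) <= e" .
  have "vnorm S v = vnorm S (%x. mapply S ?K v x + (- 1) * mapply S W (mapply S B v) x)"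
  proof (rule vnorm_cong)
   fix x assume x: "x : S"
   have "mapply S ?K v x = mapply S (%x y. idm x y + mmul S W B x y) v x" by (rule mapply_cong) (use W x in auto)
   also have "... = v x + mapply S W (mapply S B v) x" by (simp only: mapply_add mapply_idm[OF S x] mapply_mmul)
   finally show "v x = mapply S ?K v x + (- 1) * mapply S W (mapply S B v) x" by simp
  qed
  also have "... <= vnorm S (mapply S ?K v) + vnorm S (%x. (- 1) * mapply S W (mapply S B v) x)" by (rule vnorm_add)
  also have "vnorm S (%x. (- 1) * mapply S W (mapply S B v) x) = vnorm S (mapply S W (mapply S B v))"
   unfolding vnorm_scale by simp
  finally have "1 <= vnorm S (mapply S ?K v) + e" using v We by simp
  moreover have "vnorm S (mapply S ?K v) <= sqrt ?t" using hilbert_schmidt[of S ?K v] v by (simp add: real_le_rsqrt)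
  ultimately show ?thesis by simp
 qed
 then have "1 <= sqrt ?t" by (rule field_le_epsilon)
 then have "1 <= ?t" by simp
 then show ?thesis unfolding tr by simp
qed

text \<open>Shifting \<open>H\<close> by the infimum \<open>l\<close> of its form multiplies
  numerator and denominator by the same scalar. After the shift the entries converge and the trace
  stays at least 1, so the ratio has a limit.\<close>

theorem ground_state_limit:
 assumes S: "finite S" "S ~= {}" and h: "herm S H"
 shows "EX R. ALL x:S. ALL y:S. ((%b. mexp S (- of_real b) H x y / mtrace S (mexp S (- of_real b) H)) \<longlongrightarrow> R x y) at_top"
proof -
 obtain a where a: "opb S H a" using opb_exists[OF S(1)] by blast
 define V where "V = {v. vnorm S v = 1}"
 define f where "f = (%v. Re (ip S v (mapply S H v)))"
 define l where "l = Inf (f ` V)"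
 have bdd: "bdd_below (f ` V)"
 proof (rule bdd_belowI[of _ "- a"])
  fix z assume "z : f ` V"
  then show "- a <= z" using opb_form[OF a] by (auto simp: f_def V_def abs_le_iff) (metis mult.right_neutral one_power2 minus_le_iff)
 qed
 have ne: "V ~= {}"
 proof -
  obtain x where x: "x : S" using S by blast
  have "vnorm S (%z. if z = x then 1 else 0) = 1"
   using S x by (simp add: vnorm_unit)
  then show ?thesis unfolding V_def by blast
 qed
 define B where "B = (%x y. (if x = y then of_real (- l) else 0) + of_real 1 * H x y)"
 have hB: "herm S B" unfolding B_def by (rule herm_shift[OF h])
 have form: "Re (ip S v (mapply S B v)) = f v - l * (vnorm S v)\<^sup>2" for v
  unfolding B_def ip_shift[OF S(1)] f_def by simp
 have pos: "0 <= Re (ip S v (mapply S B v))" for v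
 proof (cases "vnorm S v = 0")
  case True
  have "\<bar>f v\<bar> <= a * 0\<^sup>2" unfolding f_def using opb_form[OF a, of v] True by simp
  then show ?thesis unfolding form using True by simp
 next
  case False
  then have n: "0 < vnorm S v" using vnorm_nonneg[of S v] by linarith
  let ?c = "of_real (1 / vnorm S v)" and ?w = "%x. of_real (1 / vnorm S v) * v x"
  have "vnorm S ?w = 1" unfolding vnorm_scale norm_of_real using n by simp
  then have "l <= f ?w" unfolding l_def by (intro cInf_lower bdd) (auto simp: V_def)
  also have "f ?w = f v / (vnorm S v)\<^sup>2"
   unfolding f_def mapply_scale_vec ip_scale_left ip_scale_right by (simp add: power2_eq_square)
  finally show ?thesis unfolding form using n by (simp add: field_simps)
 qed
 have small: "EX v. vnorm S v = 1 & Re (ip S v (mapply S B v)) < e" if e: "0 < e" for e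
 proof -
  have "EX z:f ` V. z < l + e" using e by (subst cInf_less_iff[symmetric, OF _ bdd]) (auto simp: ne l_def)
  then obtain v where "v : V" "f v < l + e" by blast
  then have "vnorm S v = 1" "f v - l * (vnorm S v)\<^sup>2 < e" by (auto simp: V_def)
  then show ?thesis unfolding form by blast
 qed
 let ?E = "%b. mexp S (- of_real b) B"
 define R where "R = (%x y. SOME l. ((%b. ?E b x y) \<longlongrightarrow> l) at_top)"
 have R: "((%b. ?E b x y) \<longlongrightarrow> R x y) at_top" if "x : S" "y : S" for x y
  unfolding R_def by (rule someI_ex) (rule heat_entries_converge[OF S(1) hB pos that])
 have tr: "((%b. mtrace S (?E b)) \<longlongrightarrow> mtrace S R) at_top" unfolding mtrace_def by (intro tendsto_sum R)
 have "1 <= Re (mtrace S R)"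
  by (rule tendsto_lowerbound[OF tendsto_Re[OF tr]]) (auto intro!: always_eventually heat_trace_ge_1[OF S(1) hB pos small])
 then have tr0: "mtrace S R ~= 0" by auto
 have H: "mexp S (- of_real b) H x y = exp (- of_real (b * l)) * ?E b x y" if xy: "x : S" "y : S" for x y b
 proof -
  have "mexp S (- of_real b) H x y = mexp S 1 (%x y. - of_real b * H x y) x y" by (simp only: mexp_scale mult_1)
  also have "... = exp (- of_real (b * l)) * mexp S 1 (%x y. (if x = y then of_real (b * l) else 0) + - of_real b * H x y) x y"
   by (rule mexp_shift[OF S(1) xy])
  also have "mexp S 1 (%x y. (if x = y then of_real (b * l) else 0) + - of_real b * H x y) x y
   = mexp S 1 (%x y. - of_real b * B x y) x y"
   by (rule mexp_cong[OF _ xy]) (simp add: B_def algebra_simps)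
  finally show ?thesis by (simp only: mexp_scale mult_1)
 qed
 have "mexp S (- of_real b) H x y / mtrace S (mexp S (- of_real b) H) = ?E b x y / mtrace S (?E b)" if xy: "x : S" "y : S" for x y b
 proof -
  have "mtrace S (mexp S (- of_real b) H) = exp (- of_real (b * l)) * mtrace S (?E b)"
   unfolding mtrace_def sum_distrib_left by (intro sum.cong refl H)
  then show ?thesis unfolding H[OF xy] by simp
 qed
 moreover have "((%b. ?E b x y / mtrace S (?E b)) \<longlongrightarrow> R x y / mtrace S R) at_top" if "x : S" "y : S" for x y
  by (intro tendsto_divide R tr tr0 that)
 ultimately show ?thesis by (intro exI[of _ "%x y. R x y / mtrace S R"]) simp
qed

section \<open>Operators on lattice configurations\<close>

definition ovr :: "'d site set => 'd cfg => 'd cfg => 'd cfg" where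
 "ovr B s t = (%i. if i : B then s i else t i)"

definition prodop :: "'d site set => ('d site => smat) => 'd op" where
 "prodop A f = (%s t. \<Prod>i\<in>A. f i (s i) (t i))"

lemma restr_confs: "s : confs m A ==> B \<subseteq> A ==> restr s B : confs m B"
 by (auto simp: confs_def restr_def)

lemma restr_id: "s : confs m A ==> restr s A = s"
 by (auto simp: confs_def restr_def)

lemma ovr_confs: "s : confs m B ==> t : confs m A ==> B \<subseteq> A ==> ovr B s t : confs m A"
 by (auto simp: confs_def ovr_def)

lemma ovr_confs': "s : confs m B ==> t : confs m (A - B) ==> B \<subseteq> A ==> ovr B s t : confs m A"
 by (auto simp: confs_def ovr_def)

lemma restr_ovr: "s : confs m B ==> restr (ovr B s t) B = s"
 by (auto simp: confs_def restr_def ovr_def)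

lemma restr_ovr_disjoint: "A Int B = {} ==> restr (ovr B s t) A = restr t A"
 by (auto simp: restr_def ovr_def fun_eq_iff)

lemma confs_eqI: "s : confs m A ==> t : confs m A ==> (!!i. i : A ==> s i = t i) ==> s = t"
proof
 fix i assume "s : confs m A" "t : confs m A" "!!i. i : A ==> s i = t i"
 then show "s i = t i" by (cases "i : A") (auto simp: confs_def)
qed

lemma confs_nonempty: "m \<ge> 1 ==> confs m A ~= {}"
proof -
 assume "m \<ge> 1"
 then have "(%_. 0) : confs m A" by (auto simp: confs_def)
 then show ?thesis by blast
qed

lemma sum_confs_split:
 assumes "B \<subseteq> A"
 shows "(\<Sum>p\<in>confs m A. F p) = (\<Sum>q\<in>confs m (A - B). \<Sum>p\<in>confs m B. F (ovr B p q))"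
proof -
 have "(\<Sum>p\<in>confs m A. F p) = (\<Sum>(q, p)\<in>confs m (A - B) \<times> confs m B. F (ovr B p q))"
 proof (rule sum.reindex_bij_witness[where i = "%(q, p). ovr B p q" and j = "%p. (restr p (A - B), restr p B)"])
  fix p assume s: "p : confs m A"
  show eq: "(case (restr p (A - B), restr p B) of (q, p) => ovr B p q) = p"
   using s assms by (auto simp: ovr_def restr_def confs_def fun_eq_iff)
  show "(restr p (A - B), restr p B) : confs m (A - B) \<times> confs m B"
   using restr_confs[OF s, of B] restr_confs[OF s, of "A - B"] assms by auto
  show "(case (restr p (A - B), restr p B) of (q, p) => F (ovr B p q)) = F p"
   using eq by simp
 next
  fix b assume b: "b : confs m (A - B) \<times> confs m B"
  obtain q p where [simp]: "b = (q, p)" by (cases b)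
  from b have rs: "q : confs m (A - B)" "p : confs m B" by auto
  show "(case b of (q, p) => ovr B p q) : confs m A" using ovr_confs'[OF rs(2,1) assms] by simp
  have "restr (ovr B p q) (A - B) = q"
   using rs by (auto simp: ovr_def restr_def confs_def fun_eq_iff)
  then show "(restr (case b of (q, p) => ovr B p q) (A - B), restr (case b of (q, p) => ovr B p q) B) = b"
   using restr_ovr[OF rs(2)] by simp
 qed
 then show ?thesis by (simp add: sum.cartesian_product)
qed

lemma sum_confs_fixed:
 assumes A: "finite A" "B \<subseteq> A" and s: "s : confs m A"
 shows "(\<Sum>p\<in>confs m A. if ALL i:A - B. s i = p i then F p else 0) = (\<Sum>p\<in>confs m B. (F (ovr B p s) :: complex))"
proof -
 have fin: "finite (confs m A)" by (rule finite_confs[OF A(1)])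
 have "(\<Sum>p\<in>confs m A. if ALL i:A - B. s i = p i then F p else 0) = (\<Sum>p\<in>{p\<in>confs m A. ALL i:A - B. s i = p i}. F p)"
  by (rule sum.inter_filter[OF fin, symmetric])
 also have "... = (\<Sum>p\<in>confs m B. F (ovr B p s))"
 proof (rule sum.reindex_bij_witness[where i = "%p. ovr B p s" and j = "%p. restr p B"])
  fix p assume r: "p : {p\<in>confs m A. ALL i:A - B. s i = p i}"
  show eq: "ovr B (restr p B) s = p"
  proof
   fix i show "ovr B (restr p B) s i = p i"
    using r s by (cases "i : A") (auto simp: ovr_def restr_def confs_def)
  qed
  show "restr p B : confs m B" using r A by (intro restr_confs) auto
  show "F (ovr B (restr p B) s) = F p" by (simp only: eq)
 next
  fix p assume r: "p : confs m B"
  show "restr (ovr B p s) B = p" by (rule restr_ovr[OF r])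
  show "ovr B p s : {p\<in>confs m A. ALL i:A - B. s i = p i}"
   using ovr_confs[OF r s A(2)] by (auto simp: ovr_def)
 qed
 finally show ?thesis .
qed

lemma sum_confs_prod:
 assumes A: "finite A"
 shows "(\<Sum>s\<in>confs m A. \<Prod>i\<in>A. F i (s i)) = (\<Prod>i\<in>A. \<Sum>k<m. (F i k :: complex))"
proof -
 have "(\<Sum>s\<in>confs m A. \<Prod>i\<in>A. F i (s i)) = (\<Sum>g\<in>PiE A (%_. {..<m}). \<Prod>i\<in>A. F i (g i))"
 proof (rule sum.reindex_bij_witness[where i = "%g. restr g A" and j = "%s. restrict s A"])
  fix g assume "g : PiE A (%_. {..<m})"
  then show "restrict (restr g A) A = g" "restr g A : confs m A"
   by (auto simp: restr_def confs_def fun_eq_iff PiE_def extensional_def restrict_def)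
 qed (auto simp: restr_def confs_def fun_eq_iff)
 then show ?thesis using A by (simp add: prod_sum_PiE)
qed

lemma embed_True: "ALL i:A - B. s i = t i ==> embed A B M s t = M (restr s B) (restr t B)"
 unfolding embed_def by (rule if_P)

lemma embed_False: "~ (ALL i:A - B. s i = t i) ==> embed A B M s t = 0"
 unfolding embed_def by (rule if_not_P)

lemma if_collapse: "(p & q) = r ==> (if p then if q then x else 0 else 0) = (if r then x else (0 :: complex))"
 by auto

lemma mult_if_conj: "r = (p & q) ==> x * (if r then y else 0) = (if p then if q then x * y else 0 else (0 :: complex))"
 by auto

lemma mmul_embed_left:
 assumes A: "finite A" "B \<subseteq> A" and s: "s : confs m A"
 shows "mmul (confs m A) (embed A B M) N s t = (\<Sum>p\<in>confs m B. M (restr s B) p * N (ovr B p s) t)"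
proof -
 have "mmul (confs m A) (embed A B M) N s t = (\<Sum>p\<in>confs m A. if ALL i:A - B. s i = p i then M (restr s B) (restr p B) * N p t else 0)"
  unfolding mmul_def embed_def by (intro sum.cong) auto
 also have "... = (\<Sum>p\<in>confs m B. M (restr s B) (restr (ovr B p s) B) * N (ovr B p s) t)"
  by (rule sum_confs_fixed[OF A s])
 also have "... = (\<Sum>p\<in>confs m B. M (restr s B) p * N (ovr B p s) t)"
  by (intro sum.cong refl) (simp add: restr_ovr)
 finally show ?thesis .
qed

lemma embed_mmul:
 assumes A: "finite A" "B \<subseteq> A" and s: "s : confs m A"
 shows "mmul (confs m A) (embed A B M) (embed A B N) s t = embed A B (mmul (confs m B) M N) s t"
proof -
 have "mmul (confs m A) (embed A B M) (embed A B N) s t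
  = (\<Sum>p\<in>confs m B. M (restr s B) p * embed A B N (ovr B p s) t)"
  by (rule mmul_embed_left[OF A s])
 also have "... = (\<Sum>p\<in>confs m B. if ALL i:A - B. s i = t i then M (restr s B) p * N p (restr t B) else 0)"
 proof (intro sum.cong refl)
  fix p assume "p : confs m B"
  then have "restr (ovr B p s) B = p" by (rule restr_ovr)
  moreover have "(ALL i:A - B. ovr B p s i = t i) \<longleftrightarrow> (ALL i:A - B. s i = t i)" by (auto simp: ovr_def)
  ultimately show "M (restr s B) p * embed A B N (ovr B p s) t = (if ALL i:A - B. s i = t i then M (restr s B) p * N p (restr t B) else 0)"
   by (simp add: embed_def)
 qed
 also have "... = embed A B (mmul (confs m B) M N) s t"
 proof (cases "ALL i:A - B. s i = t i")
  case True
  then show ?thesis unfolding embed_True[OF True] mmul_def by (simp only: if_P[OF True])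
 next
  case False
  then show ?thesis unfolding embed_False[OF False] by (simp only: if_not_P[OF False]) simp
 qed
 finally show ?thesis .
qed

lemma embed_eq_iff:
 assumes "B \<subseteq> A" "s : confs m A" "t : confs m A"
 shows "(ALL i:A - B. s i = t i) & restr s B = restr t B \<longleftrightarrow> s = t"
proof
 assume h: "(ALL i:A - B. s i = t i) & restr s B = restr t B"
 show "s = t"
 proof (rule confs_eqI[OF assms(2,3)])
  fix i assume i: "i : A"
  have "restr s B i = restr t B i" using h by simp
  then show "s i = t i" using h i by (cases "i : B") (auto simp: restr_def)
 qed
qed auto

lemma embed_idm:
 assumes "B \<subseteq> A" "s : confs m A" "t : confs m A"
 shows "embed A B idm s t = idm s t"
 using embed_eq_iff[OF assms] by (auto simp: embed_def)

lemma embed_cong: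
 assumes "B \<subseteq> A" "s : confs m A" "t : confs m A" "!!s t. s : confs m B ==> t : confs m B ==> M s t = N s t"
 shows "embed A B M s t = embed A B N s t"
 using assms(4)[OF restr_confs[OF assms(2,1)] restr_confs[OF assms(3,1)]] by (simp add: embed_def)

lemma embed_mpow:
 assumes A: "finite A" "B \<subseteq> A" and "s : confs m A" "t : confs m A"
 shows "mpow (confs m A) (embed A B M) k s t = embed A B (mpow (confs m B) M k) s t"
 using assms(3,4)
proof (induction k arbitrary: s t)
 case 0
 then show ?case using embed_idm[OF A(2) 0] by simp
next
 case (Suc k)
 have "mpow (confs m A) (embed A B M) (Suc k) s t = mmul (confs m A) (embed A B M) (embed A B (mpow (confs m B) M k)) s t"
  unfolding mpow.simps by (rule mmul_cong) (use Suc in auto)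
 also have "... = embed A B (mmul (confs m B) M (mpow (confs m B) M k)) s t" by (rule embed_mmul[OF A Suc.prems(1)])
 finally show ?case by simp
qed

lemma embed_mexp:
 assumes A: "finite A" "B \<subseteq> A" and st: "s : confs m A" "t : confs m A"
 shows "mexp (confs m A) c (embed A B M) s t = embed A B (mexp (confs m B) c M) s t"
proof (cases "ALL i:A - B. s i = t i")
 case True
 then show ?thesis unfolding mexp_def embed_mpow[OF assms] by (simp only: embed_True[OF True])
next
 case False
 then show ?thesis unfolding mexp_def embed_mpow[OF assms] by (simp only: embed_False[OF False] mult_zero_right suminf_zero)
qed

lemma embed_embed:
 assumes "a \<subseteq> B" "B \<subseteq> A"
 shows "embed A B (embed B a M) = embed A a M"
proof (intro ext)
 fix s t
 have "(ALL i:A - B. s i = t i) & (ALL i:B - a. restr s B i = restr t B i) \<longleftrightarrow> (ALL i:A - a. s i = t i)"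
  using assms by (auto simp: restr_def)
 moreover have rr: "restr (restr s B) a = restr s a" for s :: "'a cfg"
  using assms by (auto simp: restr_def fun_eq_iff)
 ultimately show "embed A B (embed B a M) s t = embed A a M s t"
  by (simp only: embed_def rr if_collapse)
qed

lemma embed_sum: "embed A B (%s t. \<Sum>i\<in>I. M i s t) = (%s t. \<Sum>i\<in>I. embed A B (M i) s t)"
proof (intro ext)
 fix s t
 show "embed A B (%s t. \<Sum>i\<in>I. M i s t) s t = (\<Sum>i\<in>I. embed A B (M i) s t)"
 proof (cases "ALL i:A - B. s i = t i")
  case True
  then show ?thesis by (simp only: embed_True[OF True])
 next
  case False
  then show ?thesis by (simp only: embed_False[OF False] sum.neutral_const)
 qed
qed

lemma embed_ham:
 assumes "B \<subseteq> A"
 shows "embed A B (ham \<Phi> B) = (%s t. \<Sum>a\<in>Pow B. embed A a (\<Phi> a) s t)"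
proof (intro ext)
 fix s t
 have "embed A B (ham \<Phi> B) s t = (\<Sum>a\<in>Pow B. embed A B (embed B a (\<Phi> a)) s t)"
  unfolding ham_def embed_sum ..
 also have "... = (\<Sum>a\<in>Pow B. embed A a (\<Phi> a) s t)"
  using assms by (intro sum.cong refl) (simp add: embed_embed)
 finally show "embed A B (ham \<Phi> B) s t = (\<Sum>a\<in>Pow B. embed A a (\<Phi> a) s t)" .
qed

text \<open>Matching off the supports leaves a single intermediate configuration, equal to
  \<open>t\<close> on \<open>B\<close> and to \<open>s\<close> elsewhere. Operators with disjoint
  supports therefore multiply like tensor factors, and commute.\<close>

lemma mmul_embed_disjoint:
 assumes A: "finite A" "B \<subseteq> A" "C \<subseteq> A" and d: "B Int C = {}" and st: "s : confs m A" "t : confs m A"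
 shows "mmul (confs m A) (embed A B M) (embed A C N) s t
  = (if ALL i:A - B - C. s i = t i then M (restr s B) (restr t B) * N (restr s C) (restr t C) else 0)"
proof -
 have rB: "restr t B : confs m B" by (rule restr_confs[OF st(2) A(2)])
 have fin: "finite (confs m B)" by (rule finite_confs[OF finite_subset[OF A(2,1)]])
 have "mmul (confs m A) (embed A B M) (embed A C N) s t
  = (\<Sum>p\<in>confs m B. M (restr s B) p * embed A C N (ovr B p s) t)"
  by (rule mmul_embed_left[OF A(1,2) st(1)])
 also have "... = (\<Sum>p\<in>confs m B. if p = restr t B then (if ALL i:A - B - C. s i = t i then M (restr s B) p * N (restr s C) (restr t C) else 0) else 0)"
 proof (intro sum.cong refl)
  fix p assume r: "p : confs m B"
  have "(ALL i:A - C. ovr B p s i = t i) \<longleftrightarrow> p = restr t B & (ALL i:A - B - C. s i = t i)"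
  proof
   assume h: "ALL i:A - C. ovr B p s i = t i"
   have "p = restr t B"
   proof (rule confs_eqI[OF r rB])
    fix i assume i: "i : B"
    then have "i : A - C" using A d by blast
    then show "p i = restr t B i" using bspec[OF h \<open>i : A - C\<close>] i by (simp add: ovr_def restr_def)
   qed
   moreover have "s i = t i" if "i : A - B - C" for i
    using h that by (force simp: ovr_def)
   ultimately show "p = restr t B & (ALL i:A - B - C. s i = t i)" by blast
  next
   assume h: "p = restr t B & (ALL i:A - B - C. s i = t i)"
   show "ALL i:A - C. ovr B p s i = t i" using h by (auto simp: ovr_def restr_def)
  qed
  moreover have rC: "restr (ovr B p s) C = restr s C" using d by (intro restr_ovr_disjoint) blast
  ultimately show "M (restr s B) p * embed A C N (ovr B p s) t
   = (if p = restr t B then (if ALL i:A - B - C. s i = t i then M (restr s B) p * N (restr s C) (restr t C) else 0) else 0)"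
   unfolding embed_def rC mult.assoc by (intro mult_if_conj)
 qed
 also have "... = (if ALL i:A - B - C. s i = t i then M (restr s B) (restr t B) * N (restr s C) (restr t C) else 0)"
  using sum.delta'[OF fin] rB by (simp only: sum.delta[OF fin] if_True)
 finally show ?thesis .
qed

lemma embed_commute:
 assumes A: "finite A" "B \<subseteq> A" "C \<subseteq> A" and d: "B Int C = {}" and st: "s : confs m A" "t : confs m A"
 shows "mmul (confs m A) (embed A B M) (embed A C N) s t = mmul (confs m A) (embed A C N) (embed A B M) s t"
proof -
 have e: "A - B - C = A - C - B" by blast
 show ?thesis
  unfolding mmul_embed_disjoint[OF A d st] mmul_embed_disjoint[OF A(1,3,2) d[unfolded Int_commute[of B C]] st] e
  by (simp add: mult.commute)
qed

lemma mmul_prodop: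
 assumes "finite A"
 shows "mmul (confs m A) (prodop A f) (prodop A g) = prodop A (%i. mmul {..<m} (f i) (g i))"
proof (intro ext)
 fix s t :: "'a cfg"
 have "mmul (confs m A) (prodop A f) (prodop A g) s t = (\<Sum>p\<in>confs m A. \<Prod>i\<in>A. f i (s i) (p i) * g i (p i) (t i))"
  by (simp add: mmul_def prodop_def prod.distrib)
 also have "... = (\<Prod>i\<in>A. \<Sum>k<m. f i (s i) k * g i k (t i))" by (rule sum_confs_prod[OF assms])
 finally show "mmul (confs m A) (prodop A f) (prodop A g) s t = prodop A (%i. mmul {..<m} (f i) (g i)) s t"
  by (simp add: mmul_def prodop_def)
qed

lemma prodop_cong:
 assumes "s : confs m A" "t : confs m A" "!!i x y. i : A ==> x < m ==> y < m ==> f i x y = g i x y"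
 shows "prodop A f s t = prodop A g s t"
 unfolding prodop_def using assms by (intro prod.cong) (auto simp: confs_def)

lemma prodop_eq_0: "finite A ==> i : A ==> f i (s i) (t i) = 0 ==> prodop A f s t = 0"
 unfolding prodop_def by auto

lemma embed_prodop:
 assumes A: "finite A" "B \<subseteq> A"
 shows "embed A B (prodop B f) = prodop A (%i. if i : B then f i else idm)"
proof (intro ext)
 fix s t :: "'a cfg"
 have "prodop A (%i. if i : B then f i else idm) s t
  = (\<Prod>i\<in>B. (if i : B then f i else idm) (s i) (t i)) * (\<Prod>i\<in>A - B. (if i : B then f i else idm) (s i) (t i))"
  unfolding prodop_def by (subst prod.subset_diff[OF A(2,1)]) (rule mult.commute)
 also have "(\<Prod>i\<in>B. (if i : B then f i else idm) (s i) (t i)) = prodop B f (restr s B) (restr t B)"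
  unfolding prodop_def by (intro prod.cong) (auto simp: restr_def)
 also have "(\<Prod>i\<in>A - B. (if i : B then f i else idm) (s i) (t i)) = (\<Prod>i\<in>A - B. idm (s i) (t i))"
  by (intro prod.cong) auto
 also have "... = (if ALL i:A - B. s i = t i then 1 else 0)"
  using A(1) by (auto intro: prod.neutral)
 finally show "embed A B (prodop B f) s t = prodop A (%i. if i : B then f i else idm) s t"
  by (simp add: embed_def)
qed

lemma prodop_idm:
 assumes "finite A" "s : confs m A" "t : confs m A"
 shows "prodop A (%_. idm) s t = idm s t"
proof -
 have "(ALL i:A. s i = t i) \<longleftrightarrow> s = t" using confs_eqI[OF assms(2,3)] by blast
 then show ?thesis unfolding prodop_def using assms(1) by (auto intro: prod.neutral)
qed

lemma prodop_off:
 assumes A: "finite A" "B \<subseteq> A" and f: "!!i. i : B ==> f i = idm"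
 shows "prodop A f = embed A (A - B) (prodop (A - B) f)"
 unfolding embed_prodop[OF A(1) Diff_subset] by (intro ext) (auto simp: prodop_def f intro!: prod.cong)

lemma mmul_embed_prodop:
 assumes A: "finite A" "B \<subseteq> A" and st: "s : confs m A" "t : confs m A" and f: "!!i. i : B ==> f i = idm"
 shows "mmul (confs m A) (embed A B M) (prodop A f) s t = M (restr s B) (restr t B) * (\<Prod>i\<in>A - B. f i (s i) (t i))"
proof -
 have "prodop A f = embed A (A - B) (prodop (A - B) f)" by (rule prodop_off[OF A]) (rule f)
 moreover have "prodop (A - B) f (restr s (A - B)) (restr t (A - B)) = (\<Prod>i\<in>A - B. f i (s i) (t i))"
  unfolding prodop_def by (rule prod.cong) (auto simp: restr_def)
 ultimately show ?thesis
  using mmul_embed_disjoint[OF A Diff_subset Diff_disjoint st] by simp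
qed

lemma mapply_embed:
 assumes A: "finite A" "B \<subseteq> A" and s: "p : confs m B" and r: "a : confs m (A - B)"
 shows "mapply (confs m A) (embed A B M) v (ovr B p a) = mapply (confs m B) M (%p. v (ovr B p a)) p"
proof -
 have c: "ovr B p a : confs m A" by (rule ovr_confs'[OF s r A(2)])
 have "mapply (confs m A) (embed A B M) v (ovr B p a)
  = (\<Sum>q\<in>confs m A. if ALL i:A - B. ovr B p a i = q i then M p (restr q B) * v q else 0)"
  unfolding mapply_def embed_def by (intro sum.cong) (auto simp: restr_ovr[OF s])
 also have "... = (\<Sum>q\<in>confs m B. M p (restr (ovr B q (ovr B p a)) B) * v (ovr B q (ovr B p a)))"
  by (rule sum_confs_fixed[OF A c])
 also have "... = (\<Sum>q\<in>confs m B. M p q * v (ovr B q a))"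
 proof (intro sum.cong refl)
  fix q assume t: "q : confs m B"
  have "ovr B q (ovr B p a) = ovr B q a" by (auto simp: ovr_def)
  then show "M p (restr (ovr B q (ovr B p a)) B) * v (ovr B q (ovr B p a)) = M p q * v (ovr B q a)"
   using restr_ovr[OF t] by simp
 qed
 finally show ?thesis by (simp add: mapply_def)
qed

text \<open>The configuration outside \<open>B\<close> is a spectator: the form is an orthogonal sum
  of copies of the form of \<open>M\<close>. Positivity lifts to larger volumes in this way.\<close>

lemma ip_embed:
 assumes A: "finite A" "B \<subseteq> A"
 shows "ip (confs m A) v (mapply (confs m A) (embed A B M) v)
  = (\<Sum>p\<in>confs m (A - B). ip (confs m B) (%s. v (ovr B s p)) (mapply (confs m B) M (%s. v (ovr B s p))))"
 unfolding ip_def sum_confs_split[OF A(2)] by (intro sum.cong refl) (simp add: mapply_embed[OF A])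

lemma psd_embed:
 assumes A: "finite A" "B \<subseteq> A" and M: "psd (confs m B) M"
 shows "psd (confs m A) (embed A B M)"
 using M unfolding psd_iff ip_embed[OF A] by (simp add: sum_nonneg)

lemma opb_embed:
 assumes A: "finite A" "B \<subseteq> A" and M: "opb (confs m B) M c"
 shows "opb (confs m A) (embed A B M) c"
 unfolding opb_def
proof (intro conjI allI opb_nonneg[OF M])
 fix v
 have split: "(vnorm (confs m A) w)\<^sup>2 = (\<Sum>p\<in>confs m (A - B). (vnorm (confs m B) (%s. w (ovr B s p)))\<^sup>2)" for w
  unfolding vnorm_sq sum_confs_split[OF A(2)] ..
 have "(vnorm (confs m A) (mapply (confs m A) (embed A B M) v))\<^sup>2
  = (\<Sum>p\<in>confs m (A - B). (vnorm (confs m B) (mapply (confs m B) M (%s. v (ovr B s p))))\<^sup>2)"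
  unfolding split
  by (intro sum.cong refl arg_cong[where f = "%x. x\<^sup>2"] vnorm_cong) (simp add: mapply_embed[OF A])
 also have "... <= (\<Sum>p\<in>confs m (A - B). (c * vnorm (confs m B) (%s. v (ovr B s p)))\<^sup>2)"
  by (intro sum_mono power_mono opbD[OF M]) simp
 also have "... = (c * vnorm (confs m A) v)\<^sup>2"
  unfolding power_mult_distrib split by (simp add: sum_distrib_left)
 finally show "vnorm (confs m A) (mapply (confs m A) (embed A B M) v) <= c * vnorm (confs m A) v"
  by (rule power2_le_imp_le) (simp add: opb_nonneg[OF M])
qed

lemma opb_opnorm:
 assumes S: "finite S"
 shows "opb S M (opnorm S M)"
proof -
 obtain c where c: "opb S M c" using opb_exists[OF S] by blast
 let ?I = "(%v. vnorm S (mapply S M v)) ` {v. vnorm S v <= 1}"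
 have bdd: "bdd_above ?I"
 proof (rule bdd_aboveI[of _ c])
  fix z assume "z : ?I"
  then obtain v where v: "z = vnorm S (mapply S M v)" "vnorm S v <= 1" by auto
  then show "z <= c" using opbD[OF c, of v] mult_left_mono[OF v(2) opb_nonneg[OF c]] by simp
 qed
 have le: "vnorm S (mapply S M v) <= opnorm S M" if "vnorm S v <= 1" for v
  unfolding opnorm_def by (intro cSup_upper bdd) (use that in auto)
 have nn: "0 <= opnorm S M"
  by (rule order_trans[OF vnorm_nonneg le[of "%_. 0"]]) (simp add: vnorm_def)
 have "vnorm S (mapply S M v) <= opnorm S M * vnorm S v" for v
 proof (cases "vnorm S v = 0")
  case True
  then show ?thesis using opbD[OF c, of v] by simp
 next
  case False
  then have n: "0 < vnorm S v" using vnorm_nonneg[of S v] by linarith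
  let ?w = "%x. of_real (1 / vnorm S v) * v x"
  have w: "vnorm S ?w = 1" unfolding vnorm_scale norm_of_real using n by simp
  have "vnorm S (mapply S M ?w) = 1 / vnorm S v * vnorm S (mapply S M v)"
   unfolding mapply_scale_vec vnorm_scale norm_of_real by simp
  then have "1 / vnorm S v * vnorm S (mapply S M v) <= opnorm S M" using le[of ?w] w by linarith
  then show ?thesis using n by (simp add: pos_divide_le_eq)
 qed
 then show ?thesis using nn by (simp add: opb_def)
qed

lemma mpow_reindex:
 assumes f: "bij_betw f S S'" and "x : S" "y : S"
 shows "mpow S (%x y. M (f x) (f y)) k x y = mpow S' M k (f x) (f y)"
 using assms(2,3)
proof (induction k arbitrary: x y)
 case 0
 then show ?case using f by (auto simp: bij_betw_def inj_on_eq_iff)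
next
 case (Suc k)
 have "mpow S (%x y. M (f x) (f y)) (Suc k) x y = (\<Sum>z\<in>S. M (f x) (f z) * mpow S' M k (f z) (f y))"
  using Suc by (simp add: mmul_def)
 also have "... = (\<Sum>z\<in>S'. M (f x) z * mpow S' M k z (f y))"
  by (rule sum.reindex_bij_betw[OF f])
 finally show ?case by (simp add: mmul_def)
qed

lemma mexp_reindex:
 assumes "bij_betw f S S'" "x : S" "y : S"
 shows "mexp S c (%x y. M (f x) (f y)) x y = mexp S' c M (f x) (f y)"
 unfolding mexp_def mpow_reindex[OF assms] ..

section \<open>Expansion of an exponential by the set of perturbation terms used\<close>

lemma sum_Pow_toggle:
 fixes f :: "'b => 'b set => 'c::comm_monoid_add"
 assumes B: "finite B"
 shows "(\<Sum>D\<in>Pow B. \<Sum>a\<in>D. f a D + f a (D - {a})) = (\<Sum>a\<in>B. \<Sum>D\<in>Pow B. f a D)"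
proof -
 have "(\<Sum>D\<in>Pow B. \<Sum>a\<in>D. f a D + f a (D - {a})) = (\<Sum>D\<in>Pow B. \<Sum>a\<in>B. if a : D then f a D + f a (D - {a}) else 0)"
 proof (rule sum.cong[OF refl])
  fix D assume "D : Pow B"
  then have "{a : B. a : D} = D" by blast
  then show "(\<Sum>a\<in>D. f a D + f a (D - {a})) = (\<Sum>a\<in>B. if a : D then f a D + f a (D - {a}) else 0)"
   using sum.inter_filter[OF B, of "%a. f a D + f a (D - {a})" "%a. a : D"] by simp
 qed
 also have "... = (\<Sum>a\<in>B. \<Sum>D\<in>Pow B. if a : D then f a D + f a (D - {a}) else 0)" by (rule sum.swap)
 also have "... = (\<Sum>a\<in>B. \<Sum>D\<in>Pow B. f a D)"
 proof (rule sum.cong[OF refl])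
  fix a assume a: "a : B"
  have fin: "finite (Pow B)" using B by simp
  have "(\<Sum>D\<in>Pow B. if a : D then f a D + f a (D - {a}) else 0)
   = (\<Sum>D\<in>{D\<in>Pow B. a : D}. f a D) + (\<Sum>D\<in>{D\<in>Pow B. a : D}. f a (D - {a}))"
   unfolding sum.inter_filter[OF fin, symmetric] by (rule sum.distrib)
  also have "(\<Sum>D\<in>{D\<in>Pow B. a : D}. f a (D - {a})) = (\<Sum>D\<in>{D\<in>Pow B. a ~: D}. f a D)"
   by (rule sum.reindex_bij_witness[where i = "insert a" and j = "%D. D - {a}"]) (use a in "auto simp: insert_absorb")
  also have "(\<Sum>D\<in>{D\<in>Pow B. a : D}. f a D) + (\<Sum>D\<in>{D\<in>Pow B. a ~: D}. f a D) = (\<Sum>D\<in>Pow B. f a D)"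
  proof -
   have e: "{D\<in>Pow B. a : D} Un {D\<in>Pow B. a ~: D} = Pow B" by blast
   have "sum (f a) ({D\<in>Pow B. a : D} Un {D\<in>Pow B. a ~: D}) = (\<Sum>D\<in>{D\<in>Pow B. a : D}. f a D) + (\<Sum>D\<in>{D\<in>Pow B. a ~: D}. f a D)"
    by (rule sum.union_disjoint) (use fin in auto)
   then show ?thesis unfolding e by (rule sym)
  qed
  finally show "(\<Sum>D\<in>Pow B. if a : D then f a D + f a (D - {a}) else 0) = (\<Sum>D\<in>Pow B. f a D)" .
 qed
 finally show ?thesis .
qed

text \<open>Total weight of the words of length \<open>k\<close> in the letters \<open>y\<close> and
  \<open>n a\<close> in which exactly the \<open>a\<close> in \<open>D\<close> occur. The two terms
  of the recursion distinguish whether the letter put in front already occurs in the rest of the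
  word.\<close>

fun maj :: "real => ('b => real) => nat => 'b set => real" where
 "maj y n 0 D = (if D = {} then 1 else 0)"
| "maj y n (Suc k) D = y * maj y n k D + (\<Sum>a\<in>D. n a * (maj y n k D + maj y n k (D - {a})))"

lemma maj_nonneg: "0 <= y ==> (!!a. a : D ==> 0 <= n a) ==> 0 <= maj y n k D"
proof (induction k arbitrary: D)
 case (Suc k)
 have "0 <= maj y n k D" by (rule Suc.IH[OF Suc.prems])
 moreover have "0 <= maj y n k (D - {a})" for a by (rule Suc.IH) (use Suc.prems in auto)
 ultimately show ?case using Suc.prems by (auto intro!: add_nonneg_nonneg mult_nonneg_nonneg sum_nonneg)
qed simp

lemma sum_maj:
 assumes B: "finite B"
 shows "(\<Sum>D\<in>Pow B. maj y n k D) = (y + (\<Sum>a\<in>B. n a)) ^ k"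
proof (induction k)
 case 0
 then show ?case using B by (simp add: sum.delta')
next
 case (Suc k)
 have "(\<Sum>D\<in>Pow B. maj y n (Suc k) D) = y * (\<Sum>D\<in>Pow B. maj y n k D) + (\<Sum>D\<in>Pow B. \<Sum>a\<in>D. n a * maj y n k D + n a * maj y n k (D - {a}))"
  by (simp add: sum.distrib sum_distrib_left distrib_left)
 also have "(\<Sum>D\<in>Pow B. \<Sum>a\<in>D. n a * maj y n k D + n a * maj y n k (D - {a})) = (\<Sum>a\<in>B. \<Sum>D\<in>Pow B. n a * maj y n k D)"
  by (rule sum_Pow_toggle[OF B])
 also have "... = (\<Sum>a\<in>B. n a) * (\<Sum>D\<in>Pow B. maj y n k D)"
  by (simp add: sum_distrib_left[symmetric] sum_distrib_right)
 finally show ?case by (simp add: Suc distrib_right)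
qed

text \<open>The words over all subsets of \<open>D\<close> sum to a plain power, hence to an
  exponential. Induction over proper subsets isolates those that use all of \<open>D\<close>, and
  writing each \<open>exp (n a)\<close> as \<open>(exp (n a) - 1) + 1\<close> expands the
  exponential in the same way.\<close>

lemma maj_sums:
 assumes "finite D"
 shows "(%k. maj y n k D / fact k) sums (exp y * (\<Prod>a\<in>D. exp (n a) - 1))"
 using assms
proof (induction D rule: finite_psubset_induct)
 case (psubset D)
 have D: "finite (Pow D - {D})" "D : Pow D" using psubset.hyps by auto
 have "(%k. (y + (\<Sum>a\<in>D. n a)) ^ k / fact k) sums exp (y + (\<Sum>a\<in>D. n a))"
  using exp_converges[of "y + (\<Sum>a\<in>D. n a)"] by (simp add: divide_inverse mult.commute)
 moreover have "(%k. \<Sum>D'\<in>Pow D - {D}. maj y n k D' / fact k) sums (\<Sum>D'\<in>Pow D - {D}. exp y * (\<Prod>a\<in>D'. exp (n a) - 1))"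
  by (intro sums_sum psubset.IH) auto
 ultimately have s: "(%k. (y + (\<Sum>a\<in>D. n a)) ^ k / fact k - (\<Sum>D'\<in>Pow D - {D}. maj y n k D' / fact k)) sums
   (exp (y + (\<Sum>a\<in>D. n a)) - (\<Sum>D'\<in>Pow D - {D}. exp y * (\<Prod>a\<in>D'. exp (n a) - 1)))"
  by (rule sums_diff)
 have "(y + (\<Sum>a\<in>D. n a)) ^ k / fact k - (\<Sum>D'\<in>Pow D - {D}. maj y n k D' / fact k) = maj y n k D / fact k" for k
 proof -
  have "(\<Sum>D'\<in>Pow D. maj y n k D') = maj y n k D + (\<Sum>D'\<in>Pow D - {D}. maj y n k D')"
   by (rule sum.remove) (use psubset.hyps in auto)
  then show ?thesis unfolding sum_maj[OF psubset.hyps(1)] by (simp add: sum_divide_distrib[symmetric] add_divide_distrib)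
 qed
 moreover have "exp (y + (\<Sum>a\<in>D. n a)) - (\<Sum>D'\<in>Pow D - {D}. exp y * (\<Prod>a\<in>D'. exp (n a) - 1)) = exp y * (\<Prod>a\<in>D. exp (n a) - 1)"
 proof -
  have "exp (y + (\<Sum>a\<in>D. n a)) = exp y * (\<Prod>a\<in>D. (exp (n a) - 1) + 1)"
   by (simp add: exp_add exp_sum psubset.hyps)
  also have "... = (\<Sum>D'\<in>Pow D. exp y * (\<Prod>a\<in>D'. exp (n a) - 1))"
   unfolding prod_add[OF psubset.hyps(1)] by (simp add: sum_distrib_left)
  also have "... = exp y * (\<Prod>a\<in>D. exp (n a) - 1) + (\<Sum>D'\<in>Pow D - {D}. exp y * (\<Prod>a\<in>D'. exp (n a) - 1))"
   by (rule sum.remove) (use psubset.hyps in auto)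
  finally show ?thesis by simp
 qed
 ultimately show ?case using s by simp
qed

text \<open>The operator analogue of \<open>maj\<close>, applied to a vector: the part of the
  \<open>k\<close>-th power of \<open>Y\<close> plus perturbations in which exactly the
  perturbations in \<open>D\<close> occur. The order of the factors is kept, and no integrals over
  intermediate times arise.\<close>

fun word :: "'a set => ('a => 'a => complex) => ('b => 'a => 'a => complex) => nat => 'b set => ('a => complex) => 'a => complex" where
 "word S Y N 0 D v = (%x. if D = {} then v x else 0)"
| "word S Y N (Suc k) D v = (%x. mapply S Y (word S Y N k D v) x
  + (\<Sum>a\<in>D. mapply S (N a) (word S Y N k D v) x + mapply S (N a) (word S Y N k (D - {a}) v) x))"

lemma mapply_sum_vec: "mapply S A (%x. \<Sum>i\<in>I. v i x) = (%x. \<Sum>i\<in>I. mapply S A (v i) x)"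
 unfolding mapply_def sum_distrib_left by (intro ext sum.swap)

lemma mapply_sum: "mapply S (%x y. \<Sum>i\<in>I. A i x y) v = (%x. \<Sum>i\<in>I. mapply S (A i) v x)"
 unfolding mapply_def sum_distrib_right by (intro ext sum.swap)

lemma word_sum: "word S Y N k D (%x. \<Sum>i\<in>I. v i x) = (%x. \<Sum>i\<in>I. word S Y N k D (v i) x)"
proof (induction k arbitrary: D)
 case 0
 then show ?case by auto
next
 case (Suc k)
 show ?case unfolding word.simps Suc mapply_sum_vec sum.distrib
  by (intro ext arg_cong2[where f = "(+)"] refl sum.swap)
qed

text \<open>\<open>sum_Pow_toggle\<close> fits the recursion: for a fixed letter \<open>a\<close>,
  the sets \<open>D - {a}\<close> with \<open>a\<close> in \<open>D\<close> run through the sets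
  without \<open>a\<close>.\<close>

lemma sum_word:
 assumes S: "finite S" and B: "finite B" and x: "x : S"
 shows "(\<Sum>D\<in>Pow B. word S Y N k D v x) = mapply S (mpow S (%x y. Y x y + (\<Sum>a\<in>B. N a x y)) k) v x"
 using x
proof (induction k arbitrary: x)
 case 0
 have "(\<Sum>D\<in>Pow B. word S Y N 0 D v x) = v x" using B by (simp add: sum.delta')
 then show ?case using mapply_idm[OF S 0] by simp
next
 case (Suc k)
 let ?M = "%x y. Y x y + (\<Sum>a\<in>B. N a x y)" and ?w = "word S Y N k"
 have "(\<Sum>D\<in>Pow B. word S Y N (Suc k) D v x) = (\<Sum>D\<in>Pow B. mapply S Y (?w D v) x)
   + (\<Sum>D\<in>Pow B. \<Sum>a\<in>D. mapply S (N a) (?w D v) x + mapply S (N a) (?w (D - {a}) v) x)"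
  by (simp add: sum.distrib)
 also have "(\<Sum>D\<in>Pow B. \<Sum>a\<in>D. mapply S (N a) (?w D v) x + mapply S (N a) (?w (D - {a}) v) x)
  = (\<Sum>a\<in>B. \<Sum>D\<in>Pow B. mapply S (N a) (?w D v) x)"
  by (rule sum_Pow_toggle[OF B])
 also have "(\<Sum>D\<in>Pow B. mapply S Y (?w D v) x) + ...
  = mapply S Y (%x. \<Sum>D\<in>Pow B. ?w D v x) x + (\<Sum>a\<in>B. mapply S (N a) (%x. \<Sum>D\<in>Pow B. ?w D v x) x)"
  unfolding mapply_sum_vec ..
 also have "... = mapply S ?M (%x. \<Sum>D\<in>Pow B. ?w D v x) x"
  unfolding mapply_add mapply_sum ..
 also have "... = mapply S ?M (mapply S (mpow S ?M k) v) x"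
  by (rule mapply_cong) (use Suc in auto)
 also have "... = mapply S (mpow S ?M (Suc k)) v x" by (simp add: mapply_mmul)
 finally show ?case .
qed

text \<open>Membership in the range of a projection \<open>P\<close>.\<close>

definition fixed :: "'a set => ('a => 'a => complex) => ('a => complex) => bool" where
 "fixed S P v \<longleftrightarrow> (ALL x:S. mapply S P v x = v x)"

definition commute :: "'a set => ('a => 'a => complex) => ('a => 'a => complex) => bool" where
 "commute S A B \<longleftrightarrow> (ALL x:S. ALL y:S. mmul S A B x y = mmul S B A x y)"

lemma fixed_mapply:
 assumes c: "commute S Y P" and v: "fixed S P v"
 shows "fixed S P (mapply S Y v)"
 unfolding fixed_def
proof
 fix x assume x: "x : S"
 have "mapply S P (mapply S Y v) x = mapply S (mmul S P Y) v x" by (simp only: mapply_mmul)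
 also have "... = mapply S (mmul S Y P) v x" by (rule mapply_cong) (use c x in "auto simp: commute_def")
 also have "... = mapply S Y (mapply S P v) x" by (simp only: mapply_mmul)
 also have "... = mapply S Y v x" by (rule mapply_cong) (use v in "auto simp: fixed_def")
 finally show "mapply S P (mapply S Y v) x = mapply S Y v x" .
qed

lemma fixed_add: "fixed S P v ==> fixed S P w ==> fixed S P (%x. v x + w x)"
 by (simp add: fixed_def mapply_add_vec)

lemma fixed_sum: "(!!i. i : I ==> fixed S P (v i)) ==> fixed S P (%x. \<Sum>i\<in>I. v i x)"
 unfolding fixed_def mapply_sum_vec by (intro ballI sum.cong) auto

lemma fixed_zero: "fixed S P (%x. 0)"
 by (simp add: fixed_def mapply_def)

lemma fixed_word:
 assumes Y: "commute S Y P" and N: "!!a. a : D ==> commute S (N a) P" and v: "fixed S P v"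
 shows "fixed S P (word S Y N k D v)"
 using N
proof (induction k arbitrary: D)
 case 0
 show ?case using v fixed_zero by (cases "D = {}") auto
next
 case (Suc k)
 have 1: "fixed S P (word S Y N k D v)" by (rule Suc.IH[OF Suc.prems])
 have 2: "fixed S P (word S Y N k (D - {a}) v)" for a by (rule Suc.IH) (use Suc.prems in auto)
 show ?case unfolding word.simps
  by (intro fixed_add fixed_sum fixed_mapply[OF Y 1] fixed_mapply[OF Suc.prems 1] fixed_mapply[OF Suc.prems 2])
qed

text \<open>If all letters preserve the range of \<open>P\<close>, only the action of
  \<open>Y\<close> on that range matters. This makes a word insensitive to a far site in the
  Hamiltonian.\<close>

lemma word_cong:
 assumes Y: "commute S Y P" and N: "!!a. a : D ==> commute S (N a) P" and v: "fixed S P v"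
  and eq: "!!v x. fixed S P v ==> x : S ==> mapply S Y v x = mapply S Y' v x" and "x : S"
 shows "word S Y N k D v x = word S Y' N k D v x"
 using N \<open>x : S\<close>
proof (induction k arbitrary: D x)
 case 0
 show ?case by simp
next
 case (Suc k)
 have IH1: "word S Y N k D v x = word S Y' N k D v x" if "x : S" for x
  by (rule Suc.IH) (use Suc.prems that in auto)
 have IH2: "word S Y N k (D - {a}) v x = word S Y' N k (D - {a}) v x" if "x : S" for x a
  by (rule Suc.IH) (use Suc.prems that in auto)
 have "mapply S Y (word S Y N k D v) x = mapply S Y' (word S Y N k D v) x"
  by (rule eq[OF fixed_word[OF Y _ v] Suc.prems(2)]) (rule Suc.prems)
 also have "... = mapply S Y' (word S Y' N k D v) x" by (rule mapply_cong) (auto simp: IH1)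
 finally have 1: "mapply S Y (word S Y N k D v) x = mapply S Y' (word S Y' N k D v) x" .
 have 2: "mapply S (N a) (word S Y N k D v) x = mapply S (N a) (word S Y' N k D v) x" for a
  by (rule mapply_cong) (auto simp: IH1)
 have 3: "mapply S (N a) (word S Y N k (D - {a}) v) x = mapply S (N a) (word S Y' N k (D - {a}) v) x" for a
  by (rule mapply_cong) (auto simp: IH2)
 show ?case by (simp only: word.simps 1 2 3)
qed

lemma vnorm_sum: "finite I ==> vnorm S (%x. \<Sum>i\<in>I. v i x) <= (\<Sum>i\<in>I. vnorm S (v i))"
proof (induction I rule: finite_induct)
 case empty
 then show ?case by (simp add: vnorm_def)
next
 case (insert i I)
 then show ?case using vnorm_add[of S "v i" "%x. \<Sum>i\<in>I. v i x"] by simp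
qed

text \<open>Every letter is estimated where it acts: \<open>Y\<close> on the range of
  \<open>P\<close>, where the gap is available, the perturbations by their norm on the whole space.
  The bounds obey the recursion of \<open>maj\<close>.\<close>

lemma vnorm_word:
 assumes Y: "commute S Y P" and v: "fixed S P v"
  and Yb: "!!v. fixed S P v ==> vnorm S (mapply S Y v) <= y * vnorm S v" and y: "0 <= y"
  and D: "finite D" "!!a. a : D ==> commute S (N a) P" "!!a. a : D ==> opb S (N a) (n a)"
 shows "vnorm S (word S Y N k D v) <= maj y n k D * vnorm S v"
 using D
proof (induction k arbitrary: D)
 case 0
 show ?case by (simp add: vnorm_def)
next
 case (Suc k)
 let ?w = "%D. word S Y N k D v"
 have 1: "vnorm S (?w D) <= maj y n k D * vnorm S v" by (rule Suc.IH[OF Suc.prems])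
 have 2: "vnorm S (?w (D - {a})) <= maj y n k (D - {a}) * vnorm S v" for a
  by (rule Suc.IH) (use Suc.prems in auto)
 have "vnorm S (word S Y N (Suc k) D v) <= vnorm S (mapply S Y (?w D))
  + vnorm S (%x. \<Sum>a\<in>D. mapply S (N a) (?w D) x + mapply S (N a) (?w (D - {a})) x)"
  unfolding word.simps by (rule vnorm_add)
 also have "vnorm S (mapply S Y (?w D)) <= y * vnorm S (?w D)"
  by (rule Yb[OF fixed_word[OF Y _ v]]) (rule Suc.prems)
 also have "y * vnorm S (?w D) <= y * (maj y n k D * vnorm S v)" by (rule mult_left_mono[OF 1 y])
 also have "vnorm S (%x. \<Sum>a\<in>D. mapply S (N a) (?w D) x + mapply S (N a) (?w (D - {a})) x)
  <= (\<Sum>a\<in>D. vnorm S (%x. mapply S (N a) (?w D) x + mapply S (N a) (?w (D - {a})) x))"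
  by (rule vnorm_sum[OF Suc.prems(1)])
 also have "... <= (\<Sum>a\<in>D. n a * (maj y n k D + maj y n k (D - {a})) * vnorm S v)"
 proof (rule sum_mono)
  fix a assume a: "a : D"
  note N = Suc.prems(3)[OF a]
  have "vnorm S (%x. mapply S (N a) (?w D) x + mapply S (N a) (?w (D - {a})) x)
   <= vnorm S (mapply S (N a) (?w D)) + vnorm S (mapply S (N a) (?w (D - {a})))" by (rule vnorm_add)
  also have "... <= n a * vnorm S (?w D) + n a * vnorm S (?w (D - {a}))"
   by (intro add_mono opbD[OF N])
  also have "... <= n a * (maj y n k D * vnorm S v) + n a * (maj y n k (D - {a}) * vnorm S v)"
   by (intro add_mono mult_left_mono 1 2 opb_nonneg[OF N])
  finally show "vnorm S (%x. mapply S (N a) (?w D) x + mapply S (N a) (?w (D - {a})) x)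
   <= n a * (maj y n k D + maj y n k (D - {a})) * vnorm S v" by (simp add: algebra_simps)
 qed
 finally have "vnorm S (word S Y N (Suc k) D v)
  <= y * (maj y n k D * vnorm S v) + (\<Sum>a\<in>D. n a * (maj y n k D + maj y n k (D - {a})) * vnorm S v)" by simp
 also have "... = maj y n (Suc k) D * vnorm S v" by (simp add: distrib_right sum_distrib_right)
 finally show ?case .
qed

lemma projection_opb:
 assumes h: "herm S P" and i: "!!x y. x : S ==> y : S ==> mmul S P P x y = P x y"
 shows "ip S v (mapply S P v) = of_real ((vnorm S (mapply S P v))\<^sup>2)" "vnorm S (mapply S P v) <= vnorm S v"
proof -
 have "ip S v (mapply S P v) = ip S v (mapply S (mmul S P P) v)"
  by (intro ip_cong mapply_cong) (auto simp: i)
 also have "... = ip S (mapply S P v) (mapply S P v)" unfolding mapply_mmul by (rule ip_herm[OF h])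
 finally show 1: "ip S v (mapply S P v) = of_real ((vnorm S (mapply S P v))\<^sup>2)" by (simp only: ip_self)
 have "vnorm S (mapply S P v) * vnorm S (mapply S P v) = cmod (ip S v (mapply S P v))"
  unfolding 1 norm_of_real by (simp add: power2_eq_square)
 also have "... <= vnorm S v * vnorm S (mapply S P v)" by (rule cauchy_schwarz)
 finally show "vnorm S (mapply S P v) <= vnorm S v"
  by (cases "vnorm S (mapply S P v) = 0") (use vnorm_nonneg[of S "mapply S P v"] in "auto simp: mult_le_cancel_right")
qed

lemma fixed_projection:
 assumes i: "!!x y. x : S ==> y : S ==> mmul S P P x y = P x y"
 shows "fixed S P (mapply S P v)"
 unfolding fixed_def mapply_mmul[symmetric] by (auto intro!: mapply_cong i)

text \<open>The form bounds on \<open>Y\<close> are available on the range of \<open>P\<close> only.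
  The product of \<open>Y\<close> and \<open>P\<close> is self-adjoint since the two commute, and
  its form is that of \<open>Y\<close> on the range, so \<open>herm_opb\<close> applies to the
  product.\<close>

lemma restricted_opb:
 assumes hY: "herm S Y" and hP: "herm S P" and i: "!!x y. x : S ==> y : S ==> mmul S P P x y = P x y"
  and c: "commute S Y P"
  and pos: "!!w. fixed S P w ==> 0 <= Re (ip S w (mapply S Y w))"
  and le: "!!w. fixed S P w ==> Re (ip S w (mapply S Y w)) <= s * (vnorm S w)\<^sup>2" and s: "0 <= s"
  and v: "fixed S P v"
 shows "vnorm S (mapply S Y v) <= s * vnorm S v"
proof -
 let ?A = "mmul S Y P"
 have hA: "herm S ?A"
  unfolding herm_def
 proof (intro ballI)
  fix x y assume xy: "x : S" "y : S"
  have "mmul S Y P x y = cnj (mmul S P Y y x)" by (rule herm_mmul_cnj[OF hY hP xy])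
  also have "mmul S P Y y x = mmul S Y P y x" using c xy unfolding commute_def by simp
  finally show "mmul S Y P x y = cnj (mmul S Y P y x)" .
 qed
 have form: "ip S v (mapply S ?A v) = ip S (mapply S P v) (mapply S Y (mapply S P v))" for v
 proof -
  have "fixed S P (mapply S Y (mapply S P v))" by (rule fixed_mapply[OF c fixed_projection[OF i]])
  then have "ip S v (mapply S ?A v) = ip S v (mapply S P (mapply S Y (mapply S P v)))"
   unfolding mapply_mmul by (intro ip_cong) (auto simp: fixed_def)
  then show ?thesis using ip_herm[OF hP] by simp
 qed
 have "opb S ?A s"
 proof (rule herm_opb(2)[OF hA _ _ s])
  fix v
  have f: "fixed S P (mapply S P v)" by (rule fixed_projection[OF i])
  show "0 <= Re (ip S v (mapply S ?A v))" unfolding form by (rule pos[OF f])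
  have "Re (ip S v (mapply S ?A v)) <= s * (vnorm S (mapply S P v))\<^sup>2" unfolding form by (rule le[OF f])
  also have "... <= s * (vnorm S v)\<^sup>2" by (intro mult_left_mono power_mono projection_opb[OF hP i] s) auto
  finally show "Re (ip S v (mapply S ?A v)) <= s * (vnorm S v)\<^sup>2" .
 qed
 then have "vnorm S (mapply S ?A v) <= s * vnorm S v" by (rule opbD)
 also have "vnorm S (mapply S ?A v) = vnorm S (mapply S Y v)"
  unfolding mapply_mmul by (intro vnorm_cong mapply_cong) (use v in "auto simp: fixed_def")
 finally show ?thesis .
qed

text \<open>Pairing \<open>B\<close> with \<open>insert i B\<close> changes the sign but not the
  term.\<close>

lemma toggle_sum_zero:
 fixes F :: "'b set => complex"
 assumes A: "finite A" and i: "i : A" "i ~: U" and F: "!!B. B \<subseteq> A ==> U \<subseteq> B ==> i ~: B ==> F (insert i B) = F B"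
 shows "(\<Sum>B\<in>{B\<in>Pow A. U \<subseteq> B}. (-1) ^ card (A - B) * F B) = 0"
proof -
 let ?I = "{B\<in>Pow A. U \<subseteq> B & i : B}" and ?O = "{B\<in>Pow A. U \<subseteq> B & i ~: B}"
 have e: "?I Un ?O = {B\<in>Pow A. U \<subseteq> B}" by blast
 have fin: "finite (Pow A)" using A by simp
 have "(\<Sum>B\<in>?I Un ?O. (-1) ^ card (A - B) * F B) = (\<Sum>B\<in>?I. (-1) ^ card (A - B) * F B) + (\<Sum>B\<in>?O. (-1) ^ card (A - B) * F B)"
  by (rule sum.union_disjoint) (use A in auto)
 also have "(\<Sum>B\<in>?I. (-1) ^ card (A - B) * F B) = (\<Sum>B\<in>?O. - ((-1) ^ card (A - B) * F B))"
 proof (rule sum.reindex_bij_witness[where i = "insert i" and j = "%B. B - {i}"])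
  fix B assume B: "B : ?I"
  have "A - (B - {i}) = insert i (A - B)" using i B by blast
  then have "card (A - (B - {i})) = Suc (card (A - B))" using B A by simp
  moreover have "F (insert i (B - {i})) = F (B - {i})" by (rule F) (use B i in auto)
  moreover have "insert i (B - {i}) = B" using B by blast
  ultimately show "- ((-1) ^ card (A - (B - {i})) * F (B - {i})) = (-1) ^ card (A - B) * F B" by simp
 qed (use i in auto)
 finally show ?thesis unfolding e by (simp add: sum_negf)
qed

lemma word_vcong:
 assumes "!!x. x : S ==> v x = w x" "x : S"
 shows "word S Y N k D v x = word S Y N k D w x"
 using assms(2)
proof (induction k arbitrary: D x)
 case 0
 then show ?case using assms(1) by simp
next
 case (Suc k)
 have "mapply S M (word S Y N k D v) x = mapply S M (word S Y N k D w) x" for M D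
  by (rule mapply_cong) (auto simp: Suc.IH)
 then show ?case by (simp only: word.simps)
qed

lemma embed_cnj:
 assumes "M (restr s B) (restr t B) = cnj (M (restr t B) (restr s B))"
 shows "embed A B M s t = cnj (embed A B M t s)"
proof (cases "ALL i:A - B. s i = t i")
 case True
 then have "ALL i:A - B. t i = s i" by auto
 then show ?thesis using embed_True[OF True, of M] embed_True[of A B t s M] assms by simp
next
 case False
 then have "~ (ALL i:A - B. t i = s i)" by (metis (no_types))
 then show ?thesis using embed_False[OF False, of M] embed_False[of A B t s M] by simp
qed

lemma ham_herm:
 assumes "interaction m \<Phi>" "finite B"
 shows "herm (confs m B) (ham \<Phi> B)"
 unfolding herm_def
proof (intro ballI)
 fix s t assume st: "s : confs m B" "t : confs m B"
 show "ham \<Phi> B s t = cnj (ham \<Phi> B t s)"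
  unfolding ham_def cnj_sum
 proof (rule sum.cong[OF refl])
  fix a assume a: "a : Pow B"
  have "\<Phi> a (restr s a) (restr t a) = cnj (\<Phi> a (restr t a) (restr s a))"
   using assms(1) restr_confs[OF st(1)] restr_confs[OF st(2)] a unfolding interaction_def by blast
  then show "embed B a (\<Phi> a) s t = cnj (embed B a (\<Phi> a) t s)" by (rule embed_cnj)
 qed
qed

lemma embed_herm:
 assumes "herm (confs m B) M" "B \<subseteq> A"
 shows "herm (confs m A) (embed A B M)"
 unfolding herm_def
proof (intro ballI)
 fix s t assume st: "s : confs m A" "t : confs m A"
 have "M (restr s B) (restr t B) = cnj (M (restr t B) (restr s B))"
  using assms(1) restr_confs[OF st(1) assms(2)] restr_confs[OF st(2) assms(2)] unfolding herm_def by blast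
 then show "embed A B M s t = cnj (embed A B M t s)" by (rule embed_cnj)
qed

text \<open>Multiplying out \<open>P + perp P\<close>, which is the identity, at every site of
  \<open>W\<close>.\<close>

lemma sum_prodop:
 assumes A: "finite A" "W \<subseteq> A"
 shows "(\<Sum>T\<in>Pow W. prodop A (%i. if i : W then if i : T then perp P else P else f i) s t)
  = prodop A (%i. if i : W then idm else f i) s t"
proof -
 have split: "prodop A h s t = (\<Prod>i\<in>W. h i (s i) (t i)) * (\<Prod>i\<in>A - W. h i (s i) (t i))" for h
  unfolding prodop_def by (subst prod.subset_diff[OF A(2,1)]) (rule mult.commute)
 have W: "finite W" using finite_subset[OF A(2,1)] .
 have "(\<Sum>T\<in>Pow W. prodop A (%i. if i : W then if i : T then perp P else P else f i) s t)
  = (\<Sum>T\<in>Pow W. ((\<Prod>i\<in>T. perp P (s i) (t i)) * (\<Prod>i\<in>W - T. P (s i) (t i))) * (\<Prod>i\<in>A - W. f i (s i) (t i)))"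
 proof (rule sum.cong[OF refl])
  fix T assume T: "T : Pow W"
  have "(\<Prod>i\<in>W. (if i : W then if i : T then perp P else P else f i) (s i) (t i))
   = (\<Prod>i\<in>W - T. (if i : W then if i : T then perp P else P else f i) (s i) (t i))
    * (\<Prod>i\<in>T. (if i : W then if i : T then perp P else P else f i) (s i) (t i))"
   by (rule prod.subset_diff) (use T W in auto)
  also have "... = (\<Prod>i\<in>W - T. P (s i) (t i)) * (\<Prod>i\<in>T. perp P (s i) (t i))"
   by (intro arg_cong2[where f = times] prod.cong refl) (use T in auto)
  finally show "prodop A (%i. if i : W then if i : T then perp P else P else f i) s t
   = ((\<Prod>i\<in>T. perp P (s i) (t i)) * (\<Prod>i\<in>W - T. P (s i) (t i))) * (\<Prod>i\<in>A - W. f i (s i) (t i))"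
   unfolding split by (simp add: mult.commute)
 qed
 also have "... = (\<Prod>i\<in>W. perp P (s i) (t i) + P (s i) (t i)) * (\<Prod>i\<in>A - W. f i (s i) (t i))"
  unfolding prod_add[OF W] sum_distrib_right ..
 also have "... = prodop A (%i. if i : W then idm else f i) s t"
  unfolding split by (intro arg_cong2[where f = times] prod.cong refl) (auto simp: perp_def)
 finally show ?thesis .
qed

lemma psd_add: "psd S A ==> psd S B ==> psd S (%x y. A x y + B x y)"
 unfolding psd_iff mapply_add ip_add_right by simp

lemma psd_scale: "psd S A ==> 0 <= c ==> psd S (%x y. of_real c * A x y)"
 unfolding psd_iff mapply_scale ip_scale_right by simp

lemma psd_sum: "finite I ==> (!!i. i : I ==> psd S (A i)) ==> psd S (%x y. \<Sum>i\<in>I. A i x y)"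
proof (induction I rule: finite_induct)
 case empty
 then show ?case by (simp add: psd_iff mapply_def ip_def)
next
 case (insert i I)
 then show ?case by (simp add: psd_add)
qed

lemma psd_cong: "psd S A ==> (!!x y. x : S ==> y : S ==> A x y = B x y) ==> psd S B"
proof -
 assume A: "psd S A" and e: "!!x y. x : S ==> y : S ==> A x y = B x y"
 have "ip S v (mapply S B v) = ip S v (mapply S A v)" for v
  by (intro ip_cong mapply_cong) (simp_all add: e)
 then show ?thesis using A unfolding psd_iff by simp
qed

text \<open>Sites in \<open>V\<close> are free, those in \<open>T\<close> outside \<open>V\<close>
  are excited, and all others are in the vacuum. In the expansion \<open>V\<close> is the union of
  the supports of the perturbations used; leaving it free makes the projection commute with
  them.\<close>

definition proj :: "smat => 'd site set => 'd site set => 'd site set => 'd op" where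
 "proj P A V T = prodop A (%i. if i : V then idm else if i : T then perp P else P)"

lemma PL_prodop:
 assumes "finite A" "T \<subseteq> A"
 shows "PL P A T = prodop A (%i. if i : T then perp P else P)"
proof (intro ext)
 fix s t :: "'a cfg"
 have "prodop A (%i. if i : T then perp P else P) s t
  = (\<Prod>i\<in>A - T. (if i : T then perp P else P) (s i) (t i)) * (\<Prod>i\<in>T. (if i : T then perp P else P) (s i) (t i))"
  unfolding prodop_def by (rule prod.subset_diff[OF assms(2,1)])
 also have "... = (\<Prod>i\<in>A - T. P (s i) (t i)) * (\<Prod>i\<in>T. perp P (s i) (t i))"
  by (intro arg_cong2[where f = times] prod.cong refl) auto
 finally show "PL P A T s t = prodop A (%i. if i : T then perp P else P) s t"
  by (simp add: PL_def mult.commute)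
qed

section \<open>Resolution of the identity into vacuum and excited sites\<close>

locale site_projection =
 fixes m :: nat and P :: smat and u :: "nat => complex"
 assumes u: "(\<Sum>i<m. (cmod (u i))\<^sup>2) = 1" and P: "!!i j. i < m ==> j < m ==> P i j = u i * cnj (u j)"
begin

lemma m_pos: "m \<ge> 1"
 using u by (cases m) auto

lemma P_idem: "x < m ==> y < m ==> mmul {..<m} P P x y = P x y"
proof -
 assume xy: "x < m" "y < m"
 have "mmul {..<m} P P x y = (\<Sum>k<m. u x * cnj (u y) * (cnj (u k) * u k))"
  unfolding mmul_def using xy by (intro sum.cong refl) (simp add: P)
 also have "... = u x * cnj (u y) * of_real (\<Sum>i<m. (cmod (u i))\<^sup>2)"
  unfolding sum_distrib_left[symmetric] by (simp only: of_real_sum complex_norm_square mult.commute)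
 finally show ?thesis using u P xy by simp
qed

lemma P_herm: "x < m ==> y < m ==> P x y = cnj (P y x)"
 by (simp add: P)

lemma perp_herm: "x < m ==> y < m ==> perp P x y = cnj (perp P y x)"
 by (simp add: P perp_def)

lemma perp_eq: "perp P = (%x y. idm x y + (- 1) * P x y)"
 by (simp add: perp_def fun_eq_iff)

lemma P_perp: "x < m ==> y < m ==> mmul {..<m} P (perp P) x y = 0"
 unfolding perp_eq mmul_add_right mmul_scale_right by (simp add: mmul_idm_right P_idem)

lemma perp_idem: "x < m ==> y < m ==> mmul {..<m} (perp P) (perp P) x y = perp P x y"
proof -
 assume xy: "x < m" "y < m"
 have "mmul {..<m} (perp P) (perp P) x y = mmul {..<m} (%x y. idm x y + (- 1) * P x y) (perp P) x y"
  by (simp only: perp_eq)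
 also have "... = mmul {..<m} idm (perp P) x y + (- 1) * mmul {..<m} P (perp P) x y"
  unfolding mmul_add_left mmul_scale_left ..
 finally show ?thesis using xy by (simp add: mmul_idm_left P_perp)
qed

lemma idm_mult: "x < m ==> mmul {..<m} idm M x y = M x y" "y < m ==> mmul {..<m} M idm x y = M x y"
 by (simp_all add: mmul_idm_left mmul_idm_right)

lemma prodop_herm:
 assumes "!!i x y. i : A ==> x < m ==> y < m ==> f i x y = cnj (f i y x)"
 shows "herm (confs m A) (prodop A f)"
 unfolding herm_def
proof (intro ballI)
 fix s t assume st: "s : confs m A" "t : confs m A"
 show "prodop A f s t = cnj (prodop A f t s)"
  unfolding prodop_def cnj_prod
 proof (rule prod.cong[OF refl])
  fix i assume "i : A"
  then show "f i (s i) (t i) = cnj (f i (t i) (s i))" using st by (intro assms) (auto simp: confs_def)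
 qed
qed

lemma prodop_mult_cong:
 assumes A: "finite A" and st: "s : confs m A" "t : confs m A"
  and "!!i x y. i : A ==> x < m ==> y < m ==> mmul {..<m} (f i) (g i) x y = h i x y"
 shows "mmul (confs m A) (prodop A f) (prodop A g) s t = prodop A h s t"
 unfolding mmul_prodop[OF A] by (rule prodop_cong[OF st]) (rule assms(4))

lemma proj_herm: "herm (confs m A) (proj P A V T)"
 unfolding proj_def by (rule prodop_herm) (auto intro: P_herm perp_herm)

lemma proj_idem:
 assumes "finite A" "s : confs m A" "t : confs m A"
 shows "mmul (confs m A) (proj P A V T) (proj P A V T) s t = proj P A V T s t"
 unfolding proj_def by (rule prodop_mult_cong[OF assms]) (auto simp: idm_mult P_idem perp_idem)

lemma sum_proj:
 assumes A: "finite A" "V \<subseteq> A" and st: "s : confs m A" "t : confs m A"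
 shows "(\<Sum>T\<in>Pow (A - V). proj P A V T s t) = idm s t"
proof -
 have "(\<Sum>T\<in>Pow (A - V). proj P A V T s t)
  = (\<Sum>T\<in>Pow (A - V). prodop A (%i. if i : A - V then if i : T then perp P else P else idm) s t)"
  unfolding proj_def by (intro sum.cong refl prodop_cong[OF st]) auto
 also have "... = prodop A (%i. if i : A - V then idm else idm) s t"
  by (rule sum_prodop) (use A in auto)
 also have "... = idm s t" using prodop_idm[OF A(1) st] by simp
 finally show ?thesis .
qed

text \<open>A site of \<open>T\<close> outside \<open>B\<close> meets the vacuum projection there
  and gives 0; on all other sites one of the two factors is absorbed by the other.\<close>

lemma proj_vacuum_mult:
 assumes A: "finite A" and st: "s : confs m A" "t : confs m A" and VB: "V \<subseteq> B" and T: "T \<subseteq> A - V"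
 shows "mmul (confs m A) (proj P A B {}) (proj P A V T) s t = (if T \<subseteq> B then proj P A V T s t else 0)"
proof (cases "T \<subseteq> B")
 case True
 then show ?thesis
  unfolding proj_def by (simp, intro prodop_mult_cong[OF A st]) (use VB in "auto simp: idm_mult P_idem")
next
 case False
 then obtain i where i: "i : T" "i ~: B" by blast
 then have iA: "i : A" "i ~: V" using T by auto
 then have "s i < m" "t i < m" using st by (auto simp: confs_def)
 then have "mmul (confs m A) (proj P A B {}) (proj P A V T) s t = 0"
  unfolding proj_def mmul_prodop[OF A] by (intro prodop_eq_0[OF A iA(1)]) (simp add: i iA P_perp)
 then show ?thesis using False by simp
qed

lemma embed_proj_mult:
 assumes A: "finite A" "J \<subseteq> A" and st: "s : confs m A" "t : confs m A"
 shows "mmul (confs m A) (embed A J (proj P J V T)) (proj P A V T) s t = proj P A V T s t"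
 unfolding proj_def embed_prodop[OF A]
 by (rule prodop_mult_cong[OF A(1) st]) (auto simp: idm_mult P_idem perp_idem)

lemma proj_factor:
 assumes A: "finite A" "B \<subseteq> A" and st: "s : confs m A" "t : confs m A" and VT: "V \<subseteq> B" "T \<subseteq> B"
 shows "proj P A V T s t = mmul (confs m A) (embed A B (proj P B V T)) (proj P A B {}) s t"
 unfolding proj_def embed_prodop[OF A]
 by (rule prodop_mult_cong[OF A(1) st, symmetric]) (use VT in "auto simp: idm_mult")

text \<open>Splitting the identity on the free sites into vacuum and excitation leads back to the
  projections \<open>PL\<close>, for which the gap is assumed.\<close>

lemma proj_sum_PL:
 assumes B: "finite B" "V \<subseteq> B" "T \<subseteq> B - V"
 shows "proj P B V T p t = (\<Sum>T'\<in>Pow V. PL P B (T Un T') p t)"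
proof -
 have "proj P B V T p t = (\<Sum>T'\<in>Pow V. prodop B (%i. if i : V then if i : T' then perp P else P else if i : T then perp P else P) p t)"
  unfolding proj_def sum_prodop[OF B(1,2)] ..
 also have "... = (\<Sum>T'\<in>Pow V. PL P B (T Un T') p t)"
 proof (rule sum.cong[OF refl])
  fix T' assume T': "T' : Pow V"
  then have s: "T Un T' \<subseteq> B" using B by blast
  have "(%i. if i : V then if i : T' then perp P else P else if i : T then perp P else P)
   = (%i. if i : T Un T' then perp P else P)" using T' B(3) by (intro ext) auto
  then show "prodop B (%i. if i : V then if i : T' then perp P else P else if i : T then perp P else P) p t = PL P B (T Un T') p t"
   unfolding PL_prodop[OF B(1) s] by (rule arg_cong[where f = "%f. prodop B f p t"])
 qed
 finally show ?thesis .
qed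

lemma psd_PL:
 assumes B: "finite B" "T \<subseteq> B"
 shows "psd (confs m B) (PL P B T)"
proof -
 have e: "PL P B T = proj P B {} T" unfolding PL_prodop[OF B] proj_def by simp
 have "ip (confs m B) v (mapply (confs m B) (proj P B {} T) v) = of_real ((vnorm (confs m B) (mapply (confs m B) (proj P B {} T) v))\<^sup>2)" for v
  by (rule projection_opb(1)[OF proj_herm]) (rule proj_idem[OF B(1)])
 then show ?thesis unfolding psd_iff e by simp
qed

end

lemma commute_mmul:
 assumes B: "commute S A B" and C: "commute S A C"
 shows "commute S A (mmul S B C)"
 unfolding commute_def
proof (intro ballI)
 fix x y assume xy: "x : S" "y : S"
 have "mmul S A (mmul S B C) x y = mmul S (mmul S A B) C x y" by (simp only: mmul_assoc)
 also have "... = mmul S (mmul S B A) C x y" by (rule mmul_cong) (use B xy in "auto simp: commute_def")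
 also have "... = mmul S B (mmul S A C) x y" by (simp only: mmul_assoc)
 also have "... = mmul S B (mmul S C A) x y" by (rule mmul_cong) (use C xy in "auto simp: commute_def")
 finally show "mmul S A (mmul S B C) x y = mmul S (mmul S B C) A x y" by (simp only: mmul_assoc)
qed

lemma commute_cong_right:
 assumes B: "commute S A B" and e: "!!x y. x : S ==> y : S ==> B x y = B' x y"
 shows "commute S A B'"
 unfolding commute_def
proof (intro ballI)
 fix x y assume xy: "x : S" "y : S"
 have "mmul S A B' x y = mmul S A B x y" by (rule mmul_cong) (use e xy in auto)
 also have "... = mmul S B A x y" using B xy by (simp add: commute_def)
 also have "... = mmul S B' A x y" by (rule mmul_cong) (use e xy in auto)
 finally show "mmul S A B' x y = mmul S B' A x y" .
qed

lemma commute_scale_left: "commute S A B ==> commute S (%x y. c * A x y) B"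
 by (simp add: commute_def mmul_scale_left mmul_scale_right)

lemma commute_shift_left:
 assumes S: "finite S" and "commute S A B"
 shows "commute S (%x y. (if x = y then c else 0) + A x y) B"
 unfolding commute_def
proof (intro ballI)
 fix x y assume xy: "x : S" "y : S"
 have "mmul S (%x y. (if x = y then c else 0)) B x y = c * B x y" "mmul S B (%x y. (if x = y then c else 0)) x y = c * B x y"
  using S xy by (simp_all add: mmul_def if_mult cong: if_cong)
 then show "mmul S (%x y. (if x = y then c else 0) + A x y) B x y = mmul S B (%x y. (if x = y then c else 0) + A x y) x y"
  unfolding mmul_add_left mmul_add_right using assms(2) xy by (simp add: commute_def)
qed

lemma commute_embed:
 assumes A: "finite A" "B \<subseteq> A" and c: "commute (confs m B) M N"
 shows "commute (confs m A) (embed A B M) (embed A B N)"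
 unfolding commute_def
proof (intro ballI)
 fix s t assume st: "s : confs m A" "t : confs m A"
 show "mmul (confs m A) (embed A B M) (embed A B N) s t = mmul (confs m A) (embed A B N) (embed A B M) s t"
  unfolding embed_mmul[OF A st(1)] by (rule embed_cong[OF A(2) st]) (use c in "auto simp: commute_def")
qed

lemma commute_embed_prodop:
 assumes A: "finite A" "B \<subseteq> A" and f: "!!i. i : B ==> f i = idm"
 shows "commute (confs m A) (embed A B M) (prodop A f)"
proof -
 have "prodop A f = embed A (A - B) (prodop (A - B) f)" by (rule prodop_off[OF A]) (rule f)
 then show ?thesis
  unfolding commute_def using embed_commute[OF A Diff_subset Diff_disjoint, of _ m] by simp
qed

lemma embed_zero_on:
 assumes "B \<subseteq> A" "s : confs m A" "t : confs m A" "!!s t. s : confs m B ==> t : confs m B ==> M s t = 0"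
 shows "embed A B M s t = 0"
 using assms(4)[OF restr_confs[OF assms(2,1)] restr_confs[OF assms(3,1)]] by (simp add: embed_def)

lemma embed_add: "embed A B (%s t. M s t + N s t) s t = embed A B M s t + embed A B N s t"
 by (cases "ALL i:A - B. s i = t i") (simp_all only: embed_True embed_False not_False_eq_True add_0)

lemma embed_scale: "embed A B (%s t. c * M s t) s t = c * embed A B M s t"
 by (cases "ALL i:A - B. s i = t i") (simp_all only: embed_True embed_False not_False_eq_True mult_zero_right)

lemma sum_Pow_insert:
 fixes f :: "'b set => 'c::comm_monoid_add"
 assumes "finite B" "i ~: B"
 shows "(\<Sum>a\<in>Pow (insert i B). f a) = (\<Sum>a\<in>Pow B. f a) + (\<Sum>a\<in>Pow B. f (insert i a))"
proof -
 have "(\<Sum>a\<in>insert i ` Pow B. f a) = (\<Sum>a\<in>Pow B. f (insert i a))"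
 proof (subst sum.reindex)
  show "inj_on (insert i) (Pow B)" unfolding inj_on_def using assms(2) by (metis PowD insert_ident subsetD)
 qed simp
 then show ?thesis unfolding Pow_insert
  by (subst sum.union_disjoint) (use assms in auto)
qed

section \<open>The unperturbed Hamiltonian between projections\<close>

locale gapped_model = site_projection m P u
 for m P u +
 fixes \<Phi>0 \<Upsilon> :: "'d::finite site set => 'd op" and r g :: real
 assumes int0: "interaction m \<Phi>0" and intU: "interaction m \<Upsilon>" and range: "finite_range r \<Phi>0"
  and comm: "!!L T. finite L ==> T \<subseteq> L ==> commute (confs m L) (ham \<Phi>0 L) (PL P L T)"
  and vac: "!!L s t. finite L ==> s : confs m L ==> t : confs m L ==> mmul (confs m L) (ham \<Phi>0 L) (PL P L {}) s t = 0"
  and g: "g > 0"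
  and gap: "!!L T. finite L ==> T \<subseteq> L ==>
    psd (confs m L) (%s t. mmul (confs m L) (ham \<Phi>0 L) (PL P L T) s t - complex_of_real (g * real (card T)) * PL P L T s t)"
begin

abbreviation hB :: "'d site set => 'd site set => 'd op" where
 "hB A B \<equiv> embed A B (ham \<Phi>0 B)"

lemma commute_embed_proj:
 assumes "finite A" "a \<subseteq> V" "V \<subseteq> A"
 shows "commute (confs m A) (embed A a M) (proj P A V T)"
 unfolding proj_def by (rule commute_embed_prodop) (use assms in auto)

lemma commute_ham_proj:
 assumes B: "finite B" "V \<subseteq> B" "T \<subseteq> B - V"
 shows "commute (confs m B) (ham \<Phi>0 B) (proj P B V T)"
 unfolding commute_def
proof (intro ballI)
 fix s t assume st: "s : confs m B" "t : confs m B"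
 have e: "proj P B V T = (%s t. \<Sum>T'\<in>Pow V. PL P B (T Un T') s t)"
  by (intro ext) (rule proj_sum_PL[OF B])
 show "mmul (confs m B) (ham \<Phi>0 B) (proj P B V T) s t = mmul (confs m B) (proj P B V T) (ham \<Phi>0 B) s t"
  unfolding e mmul_sum_right mmul_sum_left
 proof (rule sum.cong[OF refl])
  fix T' assume "T' : Pow V"
  then have "T Un T' \<subseteq> B" using B by blast
  from comm[OF B(1) this] st show "mmul (confs m B) (ham \<Phi>0 B) (PL P B (T Un T')) s t = mmul (confs m B) (PL P B (T Un T')) (ham \<Phi>0 B) s t"
   by (simp add: commute_def)
 qed
qed

lemma commute_hB_proj:
 assumes A: "finite A" "B \<subseteq> A" and VT: "V \<subseteq> B" "T \<subseteq> B - V"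
 shows "commute (confs m A) (hB A B) (proj P A V T)"
proof (rule commute_cong_right)
 show "commute (confs m A) (hB A B) (mmul (confs m A) (embed A B (proj P B V T)) (proj P A B {}))"
  by (intro commute_mmul commute_embed[OF A] commute_ham_proj[OF finite_subset[OF A(2,1)] VT] commute_embed_proj[OF A(1) subset_refl A(2)])
 fix s t assume st: "s : confs m A" "t : confs m A"
 show "mmul (confs m A) (embed A B (proj P B V T)) (proj P A B {}) s t = proj P A V T s t"
  by (rule proj_factor[OF A st, symmetric]) (use VT in auto)
qed

text \<open>Additional excitations \<open>T'\<close> among the free sites only raise the lower
  bound, since \<open>card (T Un T')\<close> is at least \<open>card T\<close> and \<open>g\<close>
  is positive. Summing the gap inequalities over \<open>T'\<close> therefore keeps
  \<open>g * card T\<close>.\<close>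

lemma gap_psd:
 assumes B: "finite B" "V \<subseteq> B" "T \<subseteq> B - V"
 shows "psd (confs m B) (%p t. mmul (confs m B) (ham \<Phi>0 B) (proj P B V T) p t + of_real (- (g * card T)) * proj P B V T p t)"
proof (rule psd_cong)
 let ?h = "ham \<Phi>0 B" and ?Q = "%T'. PL P B (T Un T')" and ?S = "confs m B"
 show "psd ?S (%p t. \<Sum>T'\<in>Pow V. (mmul ?S ?h (?Q T') p t - complex_of_real (g * real (card (T Un T'))) * ?Q T' p t)
   + of_real (g * (real (card (T Un T')) - real (card T))) * ?Q T' p t)"
 proof (intro psd_sum psd_add psd_scale)
  fix T' assume "T' : Pow V"
  then have s: "T Un T' \<subseteq> B" using B by blast
  show "psd ?S (%p t. mmul ?S ?h (?Q T') p t - complex_of_real (g * real (card (T Un T'))) * ?Q T' p t)" by (rule gap[OF B(1) s])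
  show "psd ?S (?Q T')" by (rule psd_PL[OF B(1) s])
  have "card T <= card (T Un T')" by (rule card_mono) (use finite_subset[OF s B(1)] in auto)
  then show "0 <= g * (real (card (T Un T')) - real (card T))" using g by simp
 next
  show "finite (Pow V)" using finite_subset[OF B(2,1)] by simp
 qed
 fix p t
 have e: "proj P B V T = (%p t. \<Sum>T'\<in>Pow V. PL P B (T Un T') p t)"
  by (intro ext) (rule proj_sum_PL[OF B])
 show "(\<Sum>T'\<in>Pow V. (mmul ?S ?h (?Q T') p t - complex_of_real (g * real (card (T Un T'))) * ?Q T' p t)
   + of_real (g * (real (card (T Un T')) - real (card T))) * ?Q T' p t)
  = mmul ?S ?h (proj P B V T) p t + of_real (- (g * card T)) * proj P B V T p t"
  unfolding e mmul_sum_right sum_distrib_left sum.distrib[symmetric]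
  by (intro sum.cong refl) (simp add: algebra_simps)
qed

lemma fixed_embed_proj:
 assumes A: "finite A" "J \<subseteq> A" and v: "fixed (confs m A) (proj P A V T) v" and x: "x : confs m A"
 shows "mapply (confs m A) (embed A J (proj P J V T)) v x = v x"
proof -
 let ?S = "confs m A" and ?E = "embed A J (proj P J V T)" and ?P = "proj P A V T"
 have "mapply ?S ?E v x = mapply ?S ?E (mapply ?S ?P v) x" by (rule mapply_cong) (use v in "auto simp: fixed_def")
 also have "... = mapply ?S (mmul ?S ?E ?P) v x" by (simp only: mapply_mmul)
 also have "... = mapply ?S ?P v x" by (rule mapply_cong) (auto intro: embed_proj_mult[OF A x])
 also have "... = v x" using v x by (simp add: fixed_def)
 finally show ?thesis .
qed

lemma mapply_hB_fixed:
 assumes A: "finite A" "J \<subseteq> A" and v: "fixed (confs m A) (proj P A V T) v" and x: "x : confs m A"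
 shows "mapply (confs m A) (embed A J (mmul (confs m J) (ham \<Phi>0 J) (proj P J V T))) v x = mapply (confs m A) (hB A J) v x"
proof -
 let ?S = "confs m A" and ?E = "embed A J (proj P J V T)"
 have "mapply ?S (embed A J (mmul (confs m J) (ham \<Phi>0 J) (proj P J V T))) v x = mapply ?S (mmul ?S (hB A J) ?E) v x"
  by (rule mapply_cong) (simp_all only: embed_mmul[OF A x])
 also have "... = mapply ?S (hB A J) (mapply ?S ?E v) x" by (simp only: mapply_mmul)
 also have "... = mapply ?S (hB A J) v x" by (rule mapply_cong) (auto intro: fixed_embed_proj[OF A v])
 finally show ?thesis .
qed

lemma gap_form:
 assumes A: "finite A" "B \<subseteq> A" and VT: "V \<subseteq> B" "T \<subseteq> B - V" and v: "fixed (confs m A) (proj P A V T) v"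
 shows "g * card T * (vnorm (confs m A) v)\<^sup>2 <= Re (ip (confs m A) v (mapply (confs m A) (hB A B) v))"
proof -
 let ?S = "confs m A" and ?c = "complex_of_real (- (g * card T))"
 let ?M = "%s t. mmul (confs m B) (ham \<Phi>0 B) (proj P B V T) s t + ?c * proj P B V T s t"
 have "psd ?S (embed A B ?M)" by (rule psd_embed[OF A gap_psd[OF finite_subset[OF A(2,1)] VT]])
 then have pos: "0 <= Re (ip ?S v (mapply ?S (embed A B ?M) v))" by (simp add: psd_iff)
 have "mapply ?S (embed A B ?M) v x = mapply ?S (hB A B) v x + ?c * v x" if x: "x : ?S" for x
 proof -
  have "mapply ?S (embed A B ?M) v x = mapply ?S (%s t. embed A B (mmul (confs m B) (ham \<Phi>0 B) (proj P B V T)) s t + ?c * embed A B (proj P B V T) s t) v x"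
   by (rule mapply_cong) (simp_all only: embed_add embed_scale)
  then show ?thesis unfolding mapply_add mapply_scale mapply_hB_fixed[OF A v x] fixed_embed_proj[OF A v x] .
 qed
 then have "ip ?S v (mapply ?S (embed A B ?M) v) = ip ?S v (%x. mapply ?S (hB A B) v x + ?c * v x)"
  by (intro ip_cong) auto
 then show ?thesis using pos unfolding ip_add_right ip_scale_right ip_self by simp
qed

text \<open>Off \<open>V\<close> and \<open>T\<close> the vector is in the vacuum, which the
  unperturbed Hamiltonian of every finite region annihilates.\<close>

lemma vacuum_zero:
 assumes A: "finite A" "J \<subseteq> A" and J: "J Int (V Un T) = {}" and v: "fixed (confs m A) (proj P A V T) v" and x: "x : confs m A"
 shows "mapply (confs m A) (hB A J) v x = 0"
proof -
 have fJ: "finite J" by (rule finite_subset[OF A(2,1)])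
 have e: "proj P J V T = PL P J {}"
  unfolding PL_prodop[OF fJ empty_subsetI] proj_def prodop_def
  by (intro ext prod.cong refl) (use J in auto)
 have "mapply (confs m A) (hB A J) v x = mapply (confs m A) (embed A J (mmul (confs m J) (ham \<Phi>0 J) (proj P J V T))) v x"
  by (rule mapply_hB_fixed[OF A v x, symmetric])
 also have "... = mapply (confs m A) (%x y. 0) v x"
  unfolding e by (rule mapply_cong) (auto intro!: embed_zero_on[OF A(2) x] vac[OF fJ])
 finally show ?thesis by (simp add: mapply_def)
qed

text \<open>An interaction term that contains \<open>i\<close> lies within distance \<open>r\<close>
  of it, so the terms that \<open>i\<close> adds to \<open>B\<close> are those it adds to the part
  of \<open>B\<close> close to \<open>i\<close>. Sums on both sides avoid subtraction.\<close>

lemma hB_insert: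
 assumes A: "finite A" "insert i B \<subseteq> A" and i: "i ~: B"
 shows "hB A (insert i B) s t + hB A {j\<in>B. l1dist i j <= r} s t = hB A B s t + hB A (insert i {j\<in>B. l1dist i j <= r}) s t"
proof -
 let ?J = "{j\<in>B. l1dist i j <= r}" and ?f = "%a. embed A a (\<Phi>0 a) s t"
 have sub: "B \<subseteq> A" "?J \<subseteq> A" "insert i ?J \<subseteq> A" using A(2) by blast+
 have fB: "finite B" by (rule finite_subset[OF sub(1) A(1)])
 have fJ: "finite ?J" "i ~: ?J" using fB i by simp_all
 have "(\<Sum>a\<in>Pow B. ?f (insert i a)) = (\<Sum>a\<in>Pow ?J. ?f (insert i a))"
 proof (rule sum.mono_neutral_right)
  show "ALL a:Pow B - Pow ?J. ?f (insert i a) = 0"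
  proof
   fix a assume "a : Pow B - Pow ?J"
   then obtain j where j: "j : a" "~ l1dist i j <= r" by auto
   have "EX x:insert i a. EX y:insert i a. real_of_int (l1dist x y) > r"
    by (rule bexI[of _ i], rule bexI[of _ j]) (use j in simp_all)
   then have "\<Phi>0 (insert i a) = (%_ _. 0)" by (rule spec[OF range[unfolded finite_range_def], THEN mp])
   then show "?f (insert i a) = 0" by (simp add: embed_def)
  qed
 qed (use fB in auto)
 then show ?thesis
  unfolding embed_ham[OF A(2)] embed_ham[OF sub(1)] embed_ham[OF sub(2)] embed_ham[OF sub(3)]
   sum_Pow_insert[OF fB i] sum_Pow_insert[OF fJ] by simp
qed

text \<open>The local Hamiltonians near \<open>i\<close>, with and without \<open>i\<close>, both
  act on vacuum sites and vanish; so adding \<open>i\<close> does not change the action on the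
  vector.\<close>

lemma hB_far:
 assumes A: "finite A" "insert i B \<subseteq> A" and i: "i ~: B" and VT: "V Un T \<subseteq> B"
  and far: "!!j. j : V Un T ==> ~ l1dist i j <= r"
  and v: "fixed (confs m A) (proj P A V T) v" and x: "x : confs m A"
 shows "mapply (confs m A) (hB A (insert i B)) v x = mapply (confs m A) (hB A B) v x"
proof -
 let ?J = "{j\<in>B. l1dist i j <= r}" and ?S = "confs m A"
 have "mapply ?S (hB A (insert i B)) v x + mapply ?S (hB A ?J) v x = mapply ?S (hB A B) v x + mapply ?S (hB A (insert i ?J)) v x"
  unfolding mapply_add[symmetric, THEN fun_cong] by (rule mapply_cong) (auto intro: hB_insert[OF A i])
 moreover have "mapply ?S (hB A ?J) v x = 0" by (rule vacuum_zero[OF A(1) _ _ v x]) (use A far in auto)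
 moreover have "mapply ?S (hB A (insert i ?J)) v x = 0" by (rule vacuum_zero[OF A(1) _ _ v x]) (use A far VT i in auto)
 ultimately show ?thesis by simp
qed

end

section \<open>Smallness of the slab kernels\<close>

definition slabK :: "nat => ('d site set => 'd op) => smat => real => 'd site set => 'd op" where
 "slabK m \<Phi> P t A = (%s q. \<Sum>B\<in>Pow A. (-1) ^ card (A - B) *
  (mexp (confs m B) (- of_real t) (ham \<Phi> B) (restr s B) (restr q B) * (\<Prod>i\<in>A - B. P (s i) (q i))))"

lemma ham_add: "ham (%A s t. \<Phi> A s t + \<Psi> A s t) B = (%s t. ham \<Phi> B s t + ham \<Psi> B s t)"
 unfolding ham_def embed_add sum.distrib ..

lemma mapply_mexp_sums:
 assumes S: "finite S" and x: "x : S"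
 shows "(%k. mapply S (mpow S M k) w x / fact k) sums mapply S (mexp S 1 M) w x"
proof -
 have "(%k. \<Sum>y\<in>S. 1 ^ k / of_nat (fact k) * mpow S M k x y * w y) sums (\<Sum>y\<in>S. mexp S 1 M x y * w y)"
  by (intro sums_sum sums_mult2 mexp_sums S x)
 then show ?thesis by (simp add: mapply_def sum_divide_distrib)
qed

lemma norm_sums_le:
 fixes f :: "nat => complex"
 assumes "f sums s" "g sums t" "!!k. norm (f k) <= g k"
 shows "norm s <= t"
 using norm_suminf_le[of f g] assms by (simp add: sums_iff)

context gapped_model
begin

definition near :: "'d site set => 'd site set => bool" where
 "near A U \<longleftrightarrow> (ALL i:A - U. EX j:U. l1dist i j <= r)"

abbreviation nU :: "real => 'd site set => real" where
 "nU t a \<equiv> t * opnorm (confs m a) (\<Upsilon> a)"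

text \<open>\<open>D\<close> is the family of supports of the perturbations used, \<open>T\<close>
  the set of excited sites outside them.\<close>

abbreviation pairs :: "'d site set => ('d site set set \<times> 'd site set) set" where
 "pairs A \<equiv> (SIGMA D:Pow (Pow A). Pow (A - \<Union>D))"

text \<open>After adding \<open>c\<close>, the exponent is \<open>Y B\<close> plus perturbations.
  Words are sorted by the family \<open>D\<close> of perturbations, the vector by its excited sites
  \<open>T\<close>, and every letter preserves this sector. For a pair \<open>(D, T)\<close> the
  alternating sum over \<open>B\<close> vanishes unless \<open>near\<close> holds. Otherwise
  \<open>Y B\<close> is bounded by \<open>c - t * g * card T\<close>, and the gap factor remains
  once \<open>exp c\<close> has cancelled; the number of sets \<open>B\<close> gives
  \<open>2 ^ card A\<close>.\<close>

theorem slab_bound: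
 assumes A: "finite A" and t: "0 <= t" and st: "s : confs m A" "\<tau> : confs m A"
 shows "cmod (slabK m (%A s \<tau>. \<Phi>0 A s \<tau> + \<Upsilon> A s \<tau>) P t A s \<tau>)
  <= 2 ^ card A * (\<Sum>(D, T)\<in>{(D, T)\<in>pairs A. near A (\<Union>D Un T)}. exp (- (t * g * card T)) * (\<Prod>a\<in>D. exp (nU t a) - 1))"
proof -
 let ?\<Phi> = "%A s \<tau>. \<Phi>0 A s \<tau> + \<Upsilon> A s \<tau>"
 define S where "S = confs m A"
 have S: "finite S" unfolding S_def by (rule finite_confs[OF A])
 have sS: "s : S" "\<tau> : S" using st by (simp_all add: S_def)
 have fPA: "finite (Pow A)" "finite (Pow (Pow A))" using A by auto
 obtain b where b: "!!B. B : Pow A ==> opb S (hB A B) b"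
 proof -
  define f where "f = (%B. SOME b. opb S (hB A B) b)"
  have f: "opb S (hB A B) (f B)" for B unfolding f_def by (rule someI_ex[OF opb_exists[OF S]])
  show ?thesis
  proof (rule that)
   fix B assume "B : Pow A"
   then have "f B <= (\<Sum>B\<in>Pow A. f B)" by (intro member_le_sum opb_nonneg[OF f] fPA)
   then show "opb S (hB A B) (\<Sum>B\<in>Pow A. f B)" by (rule opb_mono[OF f])
  qed
 qed
 have b0: "0 <= b" using opb_nonneg[OF b[of "{}"]] by simp
 \<comment> \<open>\<open>t * b\<close> makes the form of \<open>Y B\<close> nonnegative, and
   \<open>t * g * card A\<close> keeps \<open>c - t * g * card T\<close> nonnegative for every
   \<open>T\<close>.\<close>
 define c where "c = t * b + t * g * card A"
 define N where "N = (%a s \<tau>. of_real (- t) * embed A a (\<Upsilon> a) s \<tau>)"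
 define Y where "Y = (%B s \<tau>. (if s = \<tau> then of_real c else 0) + of_real (- t) * hB A B s \<tau>)"
 define M where "M = (%B x y. Y B x y + (\<Sum>a\<in>Pow B. N a x y))"
 \<comment> \<open>A unit vector, so that matrix entries in the column \<open>\<tau>\<close> become
   components of vectors.\<close>
 define v where "v = (%z. if z = \<tau> then 1 else 0 :: complex)"
 define w where "w = (%B. mapply S (proj P A B {}) v)"
 define q where "q = (%V T. mapply S (proj P A V T) v)"
 have w: "w B x = proj P A B {} x \<tau>" for B x
  unfolding w_def v_def using mapply_unit[OF S sS(2)] by simp
 have idem: "mmul S (proj P A V T) (proj P A V T) x y = proj P A V T x y" if "x : S" "y : S" for V T x y
  using proj_idem[OF A] that by (simp add: S_def)
 have herm: "herm S (proj P A V T)" for V T unfolding S_def by (rule proj_herm)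
 have fixq: "fixed S (proj P A V T) (q V T)" for V T
  unfolding q_def by (rule fixed_projection[OF idem])
 have vn: "vnorm S (q V T) <= 1" for V T
 proof -
  have "vnorm S v = 1" unfolding v_def
   using S sS by (simp add: vnorm_unit)
  then show ?thesis unfolding q_def using projection_opb(2)[OF herm idem, of V T v] by simp
 qed
 have cYP: "commute S (Y B) (proj P A V T)" if "B \<subseteq> A" "V \<subseteq> B" "T \<subseteq> B - V" for B V T
  unfolding Y_def using commute_hB_proj[OF A that]
  by (intro commute_shift_left[OF S] commute_scale_left) (simp add: S_def)
 have cNP: "commute S (N a) (proj P A V T)" if "a \<subseteq> V" "V \<subseteq> A" for a V T
  unfolding N_def using commute_embed_proj[OF A that] by (intro commute_scale_left) (simp add: S_def)
 have opN: "opb S (N a) (nU t a)" if "a \<subseteq> A" for a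
 proof -
  have "opb S (embed A a (\<Upsilon> a)) (opnorm (confs m a) (\<Upsilon> a))"
   unfolding S_def by (rule opb_embed[OF A that opb_opnorm[OF finite_confs[OF finite_subset[OF that A]]]])
  from opb_scale[OF this, of "of_real (- t)"] show ?thesis unfolding N_def norm_of_real using t by simp
 qed
 have n0: "0 <= nU t a" if "a \<subseteq> A" for a by (rule opb_nonneg[OF opN[OF that]])
 have YB: "vnorm S (mapply S (Y B) z) <= (c - t * g * card T) * vnorm S z"
  if B: "B \<subseteq> A" "V \<subseteq> B" "T \<subseteq> B - V" and z: "fixed S (proj P A V T) z" for B V T z
 proof -
  have cT: "t * g * card T <= t * g * card A"
   using g t card_mono[OF A, of T] B by (intro mult_left_mono) auto
  have formY: "Re (ip S w (mapply S (Y B) w)) = c * (vnorm S w)\<^sup>2 - t * Re (ip S w (mapply S (hB A B) w))" for w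
   unfolding Y_def ip_shift[OF S] mapply_scale ip_scale_right by simp
  have hY: "herm S (Y B)"
   unfolding Y_def S_def
   by (intro herm_shift embed_herm ham_herm[OF int0] finite_subset[OF B(1) A] B(1))
  show ?thesis
  proof (rule restricted_opb[OF hY herm idem cYP[OF B] _ _ _ z])
   fix w assume w: "fixed S (proj P A V T) w"
   have "Re (ip S w (mapply S (hB A B) w)) <= b * (vnorm S w)\<^sup>2"
    using opb_form[OF b, of B w] B(1) by simp
   then have "t * Re (ip S w (mapply S (hB A B) w)) <= t * (b * (vnorm S w)\<^sup>2)" by (rule mult_left_mono[OF _ t])
   also have "... <= c * (vnorm S w)\<^sup>2"
    unfolding c_def mult.assoc[symmetric] using t g by (intro mult_right_mono) auto
   finally show "0 <= Re (ip S w (mapply S (Y B) w))" unfolding formY by simp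
   have "g * card T * (vnorm S w)\<^sup>2 <= Re (ip S w (mapply S (hB A B) w))"
    using gap_form[OF A B] w by (simp add: S_def)
   from mult_left_mono[OF this t] show "Re (ip S w (mapply S (Y B) w)) <= (c - t * g * card T) * (vnorm S w)\<^sup>2"
    unfolding formY by (simp add: algebra_simps)
  next
   show "0 <= c - t * g * card T" unfolding c_def using cT t b0 by (simp add: add_increasing)
  qed
 qed
 have expM: "mexp (confs m B) (- of_real t) (ham ?\<Phi> B) (restr s B) (restr \<tau> B) * (\<Prod>i\<in>A - B. P (s i) (\<tau> i))
  = exp (- of_real c) * mapply S (mexp S 1 (M B)) (w B) s" if B: "B : Pow A" for B
 proof -
  have BA: "B \<subseteq> A" using B by simp
  let ?Y = "%x y. (if x = y then of_real c else 0) + - of_real t * embed A B (ham ?\<Phi> B) x y"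
  let ?X = "mexp (confs m B) (- of_real t) (ham ?\<Phi> B)"
  have "mmul S (embed A B ?X) (proj P A B {}) s \<tau> = ?X (restr s B) (restr \<tau> B) * (\<Prod>i\<in>A - B. (if i : B then idm else if i : {} then perp P else P) (s i) (\<tau> i))"
   unfolding S_def proj_def by (rule mmul_embed_prodop[OF A BA st]) simp
  also have "(\<Prod>i\<in>A - B. (if i : B then idm else if i : {} then perp P else P) (s i) (\<tau> i)) = (\<Prod>i\<in>A - B. P (s i) (\<tau> i))"
   by (rule prod.cong) auto
  finally have "?X (restr s B) (restr \<tau> B) * (\<Prod>i\<in>A - B. P (s i) (\<tau> i)) = mapply S (embed A B ?X) (w B) s"
   unfolding mapply_def w mmul_def by simp
  also have "... = mapply S (%x y. exp (- of_real c) * mexp S 1 (M B) x y) (w B) s"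
  proof (rule mapply_cong[OF _ refl])
   fix y assume y: "y : S"
   have "embed A B ?X s y = mexp S (- of_real t) (embed A B (ham ?\<Phi> B)) s y"
    unfolding S_def using embed_mexp[OF A BA st(1), of y] y by (simp add: S_def)
   also have "... = mexp S 1 (%x y. - of_real t * embed A B (ham ?\<Phi> B) x y) s y" by (simp only: mexp_scale mult_1)
   also have "... = exp (- of_real c) * mexp S 1 ?Y s y"
    by (rule mexp_shift[OF S sS(1) y])
   also have "mexp S 1 ?Y s y = mexp S 1 (M B) s y"
   proof (rule mexp_cong[OF _ sS(1) y])
    fix x y
    have "embed A B (ham ?\<Phi> B) x y = hB A B x y + (\<Sum>a\<in>Pow B. embed A a (\<Upsilon> a) x y)"
     unfolding ham_add embed_add embed_ham[OF BA, of \<Upsilon>] ..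
    then show "(if x = y then of_real c else 0) + - of_real t * embed A B (ham ?\<Phi> B) x y = M B x y"
     unfolding M_def Y_def N_def by (simp add: algebra_simps sum_distrib_left)
   qed
   finally show "embed A B ?X s y = exp (- of_real c) * mexp S 1 (M B) s y" .
  qed
  finally show ?thesis unfolding mapply_scale .
 qed
 let ?w = "%B k D T. word S (Y B) N k D (q (\<Union>D) T) s" and ?e = "%B. (-1) ^ card (A - B) :: complex"
 let ?m = "%k D T. maj (c - t * g * card T) (nU t) k D"
 define Z where "Z = (%k. \<Sum>B\<in>Pow A. ?e B * mapply S (mpow S (M B) k) (w B) s)"
 define K where "K = slabK m ?\<Phi> P t A s \<tau>"
 have "(%k. \<Sum>B\<in>Pow A. ?e B * (mapply S (mpow S (M B) k) (w B) s / fact k)) sums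
  (\<Sum>B\<in>Pow A. ?e B * mapply S (mexp S 1 (M B)) (w B) s)"
  by (intro sums_sum sums_mult mapply_mexp_sums S sS)
 moreover have "(\<Sum>B\<in>Pow A. ?e B * mapply S (mexp S 1 (M B)) (w B) s) = exp (of_real c) * K"
 proof -
  have "K = exp (- of_real c) * (\<Sum>B\<in>Pow A. ?e B * mapply S (mexp S 1 (M B)) (w B) s)"
   unfolding K_def slabK_def sum_distrib_left
  proof (rule sum.cong[OF refl])
   fix B assume B: "B : Pow A"
   show "?e B * (mexp (confs m B) (- of_real t) (ham ?\<Phi> B) (restr s B) (restr \<tau> B) * (\<Prod>i\<in>A - B. P (s i) (\<tau> i)))
    = exp (- of_real c) * (?e B * mapply S (mexp S 1 (M B)) (w B) s)"
    unfolding expM[OF B] by (simp only: mult.left_commute)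
  qed
  then show ?thesis by (simp add: mult.assoc[symmetric] exp_minus_inverse)
 qed
 ultimately have Zs: "(%k. Z k / fact k) sums (exp (of_real c) * K)"
  unfolding Z_def sum_divide_distrib by simp
 define W where "W = (%k D T. \<Sum>B\<in>{B\<in>Pow A. \<Union>D Un T \<subseteq> B}. ?e B * ?w B k D T)"
 have Zk: "Z k = (\<Sum>(D, T)\<in>pairs A. W k D T)" for k
 proof -
  have 1: "mapply S (mpow S (M B) k) (w B) s = (\<Sum>(D, T)\<in>pairs A. if \<Union>D Un T \<subseteq> B then ?w B k D T else 0)"
   if B: "B : Pow A" for B
  proof -
   have fB: "finite (Pow B)" using B finite_subset[OF _ A] by auto
   have "mapply S (mpow S (M B) k) (w B) s = (\<Sum>D\<in>Pow (Pow B). word S (Y B) N k D (w B) s)"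
    unfolding M_def by (rule sum_word[OF S fB sS(1), symmetric])
   also have "... = (\<Sum>D\<in>Pow (Pow A). if \<Union>D \<subseteq> B then word S (Y B) N k D (w B) s else 0)"
   proof -
    have "{D : Pow (Pow A). \<Union>D \<subseteq> B} = Pow (Pow B)" using B by auto
    then show ?thesis using sum.inter_filter[OF fPA(2), of "%D. word S (Y B) N k D (w B) s" "%D. \<Union>D \<subseteq> B"] by simp
   qed
   also have "... = (\<Sum>D\<in>Pow (Pow A). \<Sum>T\<in>Pow (A - \<Union>D). if \<Union>D Un T \<subseteq> B then ?w B k D T else 0)"
   proof (rule sum.cong[OF refl])
    fix D assume D: "D : Pow (Pow A)"
    have DA: "\<Union>D \<subseteq> A" using D by blast
    show "(if \<Union>D \<subseteq> B then word S (Y B) N k D (w B) s else 0)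
     = (\<Sum>T\<in>Pow (A - \<Union>D). if \<Union>D Un T \<subseteq> B then ?w B k D T else 0)"
    proof (cases "\<Union>D \<subseteq> B")
     case True
     \<comment> \<open>The identity is resolved into the sectors \<open>T\<close> outside the
       supports, and the vacuum projection outside \<open>B\<close> removes those with an excited
       site outside \<open>B\<close>.\<close>
     have wq: "w B x = (\<Sum>T\<in>Pow (A - \<Union>D). if T \<subseteq> B then q (\<Union>D) T x else 0)" if x: "x : S" for x
     proof -
      have xA: "x : confs m A" using x by (simp add: S_def)
      have "w B x = mapply S (proj P A B {}) v x" by (simp add: w_def)
      also have "... = mapply S (proj P A B {}) (%x. \<Sum>T\<in>Pow (A - \<Union>D). q (\<Union>D) T x) x"
      proof (rule mapply_cong[OF refl])
       fix y assume y: "y : S"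
       have "(\<Sum>T\<in>Pow (A - \<Union>D). q (\<Union>D) T y) = mapply S (%x y. \<Sum>T\<in>Pow (A - \<Union>D). proj P A (\<Union>D) T x y) v y"
        unfolding q_def mapply_sum ..
       also have "... = mapply S idm v y"
        unfolding S_def by (intro mapply_cong sum_proj[OF A DA]) (use y in "auto simp: S_def")
       finally show "v y = (\<Sum>T\<in>Pow (A - \<Union>D). q (\<Union>D) T y)" using mapply_idm[OF S y] by simp
      qed
      also have "... = (\<Sum>T\<in>Pow (A - \<Union>D). mapply S (mmul S (proj P A B {}) (proj P A (\<Union>D) T)) v x)"
       unfolding mapply_sum_vec q_def mapply_mmul ..
      also have "... = (\<Sum>T\<in>Pow (A - \<Union>D). if T \<subseteq> B then q (\<Union>D) T x else 0)"
      proof (rule sum.cong[OF refl])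
       fix T assume T: "T : Pow (A - \<Union>D)"
       have "mapply S (mmul S (proj P A B {}) (proj P A (\<Union>D) T)) v x
        = mapply S (%x y. if T \<subseteq> B then proj P A (\<Union>D) T x y else 0) v x"
        unfolding S_def
        by (intro mapply_cong proj_vacuum_mult[OF A] refl) (use T True xA in auto)
       then show "mapply S (mmul S (proj P A B {}) (proj P A (\<Union>D) T)) v x = (if T \<subseteq> B then q (\<Union>D) T x else 0)"
        unfolding q_def by (cases "T \<subseteq> B") (simp_all add: mapply_def)
      qed
      finally show ?thesis .
     qed
     have "word S (Y B) N k D (w B) s = word S (Y B) N k D (%x. \<Sum>T\<in>Pow (A - \<Union>D). if T \<subseteq> B then q (\<Union>D) T x else 0) s"
      by (rule word_vcong[OF wq sS(1)])
     also have "... = word S (Y B) N k D (%x. \<Sum>T\<in>{T\<in>Pow (A - \<Union>D). T \<subseteq> B}. q (\<Union>D) T x) s"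
      using A by (subst sum.inter_filter) auto
     also have "... = (\<Sum>T\<in>{T\<in>Pow (A - \<Union>D). T \<subseteq> B}. ?w B k D T)"
      unfolding word_sum ..
     also have "... = (\<Sum>T\<in>Pow (A - \<Union>D). if T \<subseteq> B then ?w B k D T else 0)"
      using A by (intro sum.inter_filter) auto
     finally show ?thesis using True by simp
    next
     case False
     then show ?thesis by simp
    qed
   qed
   also have "... = (\<Sum>(D, T)\<in>pairs A. if \<Union>D Un T \<subseteq> B then ?w B k D T else 0)"
    by (rule sum.Sigma) (use A in auto)
   finally show ?thesis .
  qed
  let ?g = "%B x. case x of (D, T) => if \<Union>D Un T \<subseteq> B then ?e B * ?w B k D T else 0"
  have "Z k = (\<Sum>B\<in>Pow A. \<Sum>x\<in>pairs A. ?g B x)"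
   unfolding Z_def
  proof (rule sum.cong[OF refl])
   fix B assume B: "B : Pow A"
   show "?e B * mapply S (mpow S (M B) k) (w B) s
    = (\<Sum>x\<in>pairs A. ?g B x)"
    unfolding 1[OF B] sum_distrib_left by (intro sum.cong refl) auto
  qed
  also have "... = (\<Sum>x\<in>pairs A. \<Sum>B\<in>Pow A. ?g B x)"
   by (rule sum.swap)
  also have "... = (\<Sum>(D, T)\<in>pairs A. W k D T)"
  proof (rule sum.cong[OF refl])
   fix x assume "x : pairs A"
   obtain D T where x: "x = (D, T)" by (cases x)
   show "(\<Sum>B\<in>Pow A. ?g B x) = (case x of (D, T) => W k D T)"
    unfolding x W_def prod.case by (rule sum.inter_filter[OF fPA(1), symmetric])
  qed
  finally show ?thesis .
 qed
 \<comment> \<open>The cancellation: a far site \<open>i\<close> can be added to \<open>B\<close>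
   without changing \<open>Y B\<close> on the sector, and no letter in \<open>D\<close> involves
   \<open>i\<close>.\<close>
 have W0: "W k D T = 0" if DT: "(D, T) : pairs A" and far: "~ near A (\<Union>D Un T)" for k D T
 proof -
  from far obtain i where i: "i : A" "i ~: \<Union>D Un T" "!!j. j : \<Union>D Un T ==> ~ l1dist i j <= r"
   unfolding near_def by blast
  show ?thesis unfolding W_def
  proof (rule toggle_sum_zero[OF A i(1,2)])
   fix B assume B: "B \<subseteq> A" "\<Union>D Un T \<subseteq> B" "i ~: B"
   have iB: "insert i B \<subseteq> A" using B i by blast
   have VT: "\<Union>D \<subseteq> B" "T \<subseteq> B - \<Union>D" "\<Union>D \<subseteq> insert i B" "T \<subseteq> insert i B - \<Union>D" using B DT by auto
   show "?w (insert i B) k D T = ?w B k D T"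
   proof (rule word_cong[OF cYP[OF iB VT(3,4)] _ fixq _ sS(1)])
    fix a assume "a : D"
    then show "commute S (N a) (proj P A (\<Union>D) T)" using B by (intro cNP) auto
   next
    fix z x assume z: "fixed S (proj P A (\<Union>D) T) z" "x : S"
    have "mapply S (hB A (insert i B)) z x = mapply S (hB A B) z x"
     unfolding S_def by (rule hB_far[OF A iB B(3,2) i(3)]) (use z in "auto simp: S_def")
    then show "mapply S (Y (insert i B)) z x = mapply S (Y B) z x"
     unfolding Y_def mapply_shift[OF S z(2)] mapply_scale by simp
   qed
  qed
 qed
 have Wb: "cmod (W k D T) <= 2 ^ card A * ?m k D T" if DT: "(D, T) : pairs A" for k D T
 proof -
  have TA: "T \<subseteq> A" using DT by auto
  have fD: "finite D" using DT fPA by (auto intro: finite_subset)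
  have y0: "0 <= c - t * g * card T"
  proof -
   have "t * g * card T <= t * g * card A" using g t card_mono[OF A TA] by (intro mult_left_mono) auto
   then show ?thesis unfolding c_def using t b0 by (simp add: add_increasing)
  qed
  have m0: "0 <= ?m k D T"
   by (rule maj_nonneg[OF y0]) (use DT n0 in auto)
  have "cmod (W k D T) <= (\<Sum>B\<in>{B\<in>Pow A. \<Union>D Un T \<subseteq> B}. cmod (?e B * ?w B k D T))"
   unfolding W_def by (rule norm_sum)
  also have "... <= (\<Sum>B\<in>{B\<in>Pow A. \<Union>D Un T \<subseteq> B}. ?m k D T)"
  proof (rule sum_mono)
   fix B assume "B : {B\<in>Pow A. \<Union>D Un T \<subseteq> B}"
   then have B: "B \<subseteq> A" "\<Union>D \<subseteq> B" "T \<subseteq> B - \<Union>D" using DT by auto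
   have "cmod (?e B * ?w B k D T) = cmod (?w B k D T)"
    by (simp add: norm_mult norm_power)
   also have "... <= vnorm S (word S (Y B) N k D (q (\<Union>D) T))" by (rule norm_le_vnorm[OF S sS(1)])
   also have "... <= ?m k D T * vnorm S (q (\<Union>D) T)"
   proof (rule vnorm_word[OF cYP[OF B] fixq _ y0 fD])
    show "vnorm S (mapply S (Y B) z) <= (c - t * g * card T) * vnorm S z" if "fixed S (proj P A (\<Union>D) T) z" for z
     by (rule YB[OF B that])
   qed (use DT in "auto intro!: cNP opN")
   also have "... <= ?m k D T * 1" by (rule mult_left_mono[OF vn m0])
   finally show "cmod (?e B * ?w B k D T) <= ?m k D T" by simp
  qed
  also have "... = card {B\<in>Pow A. \<Union>D Un T \<subseteq> B} * ?m k D T" by simp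
  also have "... <= real (2 ^ card A) * ?m k D T"
  proof (rule mult_right_mono[OF _ m0])
   have "card {B\<in>Pow A. \<Union>D Un T \<subseteq> B} <= card (Pow A)" by (rule card_mono[OF fPA(1)]) auto
   then show "real (card {B\<in>Pow A. \<Union>D Un T \<subseteq> B}) <= real (2 ^ card A)" unfolding card_Pow[OF A] by (rule of_nat_mono)
  qed
  finally show ?thesis by simp
 qed
 let ?I = "{(D, T)\<in>pairs A. near A (\<Union>D Un T)}"
 have fI: "finite (pairs A)" using A by auto
 have Zb: "norm (Z k / fact k) <= (\<Sum>x\<in>?I. 2 ^ card A * (?m k (fst x) (snd x) / fact k))" for k
 proof -
  have "Z k = (\<Sum>(D, T)\<in>?I. W k D T)"
   unfolding Zk by (rule sum.mono_neutral_right[OF fI]) (use W0 in auto)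
  then have "cmod (Z k) <= (\<Sum>x\<in>?I. cmod (W k (fst x) (snd x)))" by (simp add: case_prod_beta' norm_sum)
  also have "... <= (\<Sum>x\<in>?I. 2 ^ card A * ?m k (fst x) (snd x))"
   by (rule sum_mono) (use Wb in auto)
  finally have "cmod (Z k) / fact k <= (\<Sum>x\<in>?I. 2 ^ card A * ?m k (fst x) (snd x)) / fact k"
   by (rule divide_right_mono) simp
  then show ?thesis by (simp add: norm_divide sum_divide_distrib)
 qed
 have "(%k. \<Sum>x\<in>?I. 2 ^ card A * (?m k (fst x) (snd x) / fact k)) sums
  (\<Sum>x\<in>?I. 2 ^ card A * (exp (c - t * g * card (snd x)) * (\<Prod>a\<in>fst x. exp (nU t a) - 1)))"
 proof (intro sums_sum sums_mult maj_sums)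
  fix x assume "x : ?I"
  then have "fst x \<subseteq> Pow A" by auto
  then show "finite (fst x)" by (rule finite_subset[OF _ fPA(1)])
 qed
 from norm_sums_le[OF Zs this Zb]
 have "exp c * cmod K <= (\<Sum>x\<in>?I. 2 ^ card A * (exp (c - t * g * card (snd x)) * (\<Prod>a\<in>fst x. exp (nU t a) - 1)))"
  by (simp add: norm_mult norm_exp_eq_Re)
 also have "... = exp c * (2 ^ card A * (\<Sum>(D, T)\<in>?I. exp (- (t * g * card T)) * (\<Prod>a\<in>D. exp (nU t a) - 1)))"
  unfolding sum_distrib_left case_prod_beta'
  by (intro sum.cong refl) (simp add: exp_diff exp_minus field_simps)
 finally show ?thesis unfolding K_def by simp
qed

end

section \<open>Covariance, factorisation and inversion of the slab kernels\<close>

lemma opnorm_le: "opb S M c ==> opnorm S M <= c"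
proof -
 assume M: "opb S M c"
 have "vnorm S (%_. 0) <= 1" by (simp add: vnorm_def)
 then have ne: "{v. vnorm S v <= 1} ~= {}" by blast
 show ?thesis unfolding opnorm_def
 proof (rule cSup_least)
  show "(%v. vnorm S (mapply S M v)) ` {v. vnorm S v <= 1} ~= {}" using ne by simp
  fix z assume "z : (%v. vnorm S (mapply S M v)) ` {v. vnorm S v <= 1}"
  then obtain v where v: "z = vnorm S (mapply S M v)" "vnorm S v <= 1" by auto
  then show "z <= c" using opbD[OF M, of v] mult_left_mono[OF v(2) opb_nonneg[OF M]] by simp
 qed
qed

lemma opb_reindex:
 assumes f: "bij_betw f S S'" and M: "!!x y. x : S ==> y : S ==> M x y = M' (f x) (f y)" and c: "opb S' M' c"
 shows "opb S M c"
 unfolding opb_def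
proof (intro conjI allI opb_nonneg[OF c])
 fix v :: "'a => complex"
 define v' where "v' = (%z. v (inv_into S f z))"
 have v: "v' (f y) = v y" if "y : S" for y using f that by (simp add: v'_def bij_betw_inv_into_left)
 have "(\<Sum>x\<in>S. (cmod (v x))\<^sup>2) = (\<Sum>x\<in>S. (cmod (v' (f x)))\<^sup>2)" by (intro sum.cong) (auto simp: v)
 also have "... = (\<Sum>x\<in>S'. (cmod (v' x))\<^sup>2)" by (rule sum.reindex_bij_betw[OF f])
 finally have n: "vnorm S v = vnorm S' v'" by (simp add: vnorm_def)
 have ap: "mapply S M v x = mapply S' M' v' (f x)" if x: "x : S" for x
 proof -
  have "mapply S M v x = (\<Sum>y\<in>S. M' (f x) (f y) * v' (f y))"
   unfolding mapply_def by (intro sum.cong) (auto simp: M x v)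
  also have "... = (\<Sum>y\<in>S'. M' (f x) y * v' y)" by (rule sum.reindex_bij_betw[OF f])
  finally show ?thesis by (simp add: mapply_def)
 qed
 have "(\<Sum>x\<in>S. (cmod (mapply S M v x))\<^sup>2) = (\<Sum>x\<in>S. (cmod (mapply S' M' v' (f x)))\<^sup>2)" by (intro sum.cong) (auto simp: ap)
 also have "... = (\<Sum>x\<in>S'. (cmod (mapply S' M' v' x))\<^sup>2)" by (rule sum.reindex_bij_betw[OF f])
 finally have "vnorm S (mapply S M v) = vnorm S' (mapply S' M' v')" by (simp add: vnorm_def)
 then show "vnorm S (mapply S M v) <= c * vnorm S v" using opbD[OF c, of v'] n by simp
qed

lemma bij_confs_shift: "bij_betw (%p. p o shift s) (confs m (shift s ` B)) (confs m B)"
proof (rule bij_betwI[where g = "%p. p o shift (%k. - s k)"])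
 show "(%p. p o shift s) : confs m (shift s ` B) \<rightarrow> confs m B"
 proof
  fix p assume "p : confs m (shift s ` B)"
  then show "p o shift s : confs m B"
   using inj_image_mem_iff[OF inj_shift[of s]] by (auto simp: confs_def)
 qed
 show "(%p. p o shift (%k. - s k)) : confs m B \<rightarrow> confs m (shift s ` B)"
 proof
  fix p assume s: "p : confs m B"
  show "p o shift (%k. - s k) : confs m (shift s ` B)"
   unfolding confs_def
  proof (intro CollectI conjI ballI allI impI)
   fix i assume "i : shift s ` B"
   then show "(p o shift (%k. - s k)) i < m" using s by (auto simp: confs_def)
  next
   fix i assume "i ~: shift s ` B"
   then have "shift (%k. - s k) i ~: B" by (metis image_eqI shift_inverse(2))
   then show "(p o shift (%k. - s k)) i = 0" using s by (auto simp: confs_def)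
  qed
 qed
qed (auto simp: fun_eq_iff)

lemma restr_shift: "restr p (shift s ` B) o shift s = restr (p o shift s) B"
 using inj_image_mem_iff[OF inj_shift[of s]] by (auto simp: restr_def fun_eq_iff)

lemma sum_Pow_shift: "(\<Sum>C\<in>Pow (shift s ` B). f C) = (\<Sum>C\<in>Pow B. f (shift s ` C))"
 unfolding image_Pow_surj[OF refl, symmetric]
 by (subst sum.reindex) (auto intro: inj_on_subset[OF inj_on_image_Pow[OF inj_shift]] simp: inj_on_def inj_image_eq_iff[OF inj_shift])

lemma interaction_empty: "interaction m \<Phi> ==> \<Phi> {} = (%_ _. 0)"
 by (auto simp: interaction_def connected_Zd_def)

lemma ham_shift:
 assumes \<Phi>: "interaction m \<Phi>" and st: "p : confs m (shift s ` B)" "t : confs m (shift s ` B)"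
 shows "ham \<Phi> (shift s ` B) p t = ham \<Phi> B (p o shift s) (t o shift s)"
 unfolding ham_def sum_Pow_shift
proof (rule sum.cong[OF refl])
 fix a assume a: "a : Pow B"
 have iff: "(ALL i:shift s ` B - shift s ` a. p i = t i) \<longleftrightarrow> (ALL i:B - a. (p o shift s) i = (t o shift s) i)"
  unfolding image_set_diff[OF inj_shift, symmetric] by auto
 have sub: "shift s ` a \<subseteq> shift s ` B" using a by blast
 have "\<Phi> (shift s ` a) (restr p (shift s ` a)) (restr t (shift s ` a))
  = \<Phi> a (restr p (shift s ` a) o shift s) (restr t (shift s ` a) o shift s)"
  using \<Phi> restr_confs[OF st(1) sub] restr_confs[OF st(2) sub] unfolding interaction_def by blast
 then show "embed (shift s ` B) (shift s ` a) (\<Phi> (shift s ` a)) p t = embed B a (\<Phi> a) (p o shift s) (t o shift s)"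
  unfolding embed_def iff restr_shift by simp
qed

lemma mexp_shift_ham:
 assumes \<Phi>: "interaction m \<Phi>" and st: "p : confs m (shift s ` B)" "t : confs m (shift s ` B)"
 shows "mexp (confs m (shift s ` B)) c (ham \<Phi> (shift s ` B)) p t = mexp (confs m B) c (ham \<Phi> B) (p o shift s) (t o shift s)"
proof -
 have "mexp (confs m (shift s ` B)) c (ham \<Phi> (shift s ` B)) p t
  = mexp (confs m (shift s ` B)) c (%p t. ham \<Phi> B (p o shift s) (t o shift s)) p t"
  by (rule mexp_cong[OF _ st]) (rule ham_shift[OF \<Phi>])
 also have "... = mexp (confs m B) c (ham \<Phi> B) (p o shift s) (t o shift s)"
  by (rule mexp_reindex[OF bij_confs_shift st])
 finally show ?thesis .
qed

lemma slabK_shift: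
 assumes \<Phi>: "interaction m \<Phi>" and st: "p : confs m (shift s ` A)" "q : confs m (shift s ` A)"
 shows "slabK m \<Phi> P t (shift s ` A) p q = slabK m \<Phi> P t A (p o shift s) (q o shift s)"
 unfolding slabK_def sum_Pow_shift
proof (rule sum.cong[OF refl])
 fix B assume B: "B : Pow A"
 then have sub: "shift s ` B \<subseteq> shift s ` A" by blast
 have d: "shift s ` A - shift s ` B = shift s ` (A - B)" by (rule image_set_diff[OF inj_shift, symmetric])
 have "card (shift s ` (A - B)) = card (A - B)" by (intro card_image inj_on_subset[OF inj_shift]) simp
 moreover have "(\<Prod>i\<in>shift s ` (A - B). P (p i) (q i)) = (\<Prod>i\<in>A - B. P ((p o shift s) i) ((q o shift s) i))"
  by (subst prod.reindex) (auto intro: inj_on_subset[OF inj_shift])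
 moreover have "mexp (confs m (shift s ` B)) (- of_real t) (ham \<Phi> (shift s ` B)) (restr p (shift s ` B)) (restr q (shift s ` B))
  = mexp (confs m B) (- of_real t) (ham \<Phi> B) (restr (p o shift s) B) (restr (q o shift s) B)"
  using mexp_shift_ham[OF \<Phi> restr_confs[OF st(1) sub] restr_confs[OF st(2) sub]] unfolding restr_shift .
 ultimately show "(-1) ^ card (shift s ` A - shift s ` B) * (mexp (confs m (shift s ` B)) (- of_real t) (ham \<Phi> (shift s ` B)) (restr p (shift s ` B)) (restr q (shift s ` B))
   * (\<Prod>i\<in>shift s ` A - shift s ` B. P (p i) (q i)))
  = (-1) ^ card (A - B) * (mexp (confs m B) (- of_real t) (ham \<Phi> B) (restr (p o shift s) B) (restr (q o shift s) B)
   * (\<Prod>i\<in>A - B. P ((p o shift s) i) ((q o shift s) i)))"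
  unfolding d by simp
qed

lemma mexp_zero_matrix: "mexp S c (%_ _. 0) x y = idm x y"
 using mexp_scale[of S c 0 "%_ _. 0" x y] mexp_zero[of S "%_ _. 0" x y] by simp

lemma ham_empty: "interaction m \<Phi> ==> ham \<Phi> {} = (%_ _. 0)"
 unfolding ham_def by (intro ext) (simp add: interaction_empty embed_def)

lemma slabK_empty: "interaction m \<Phi> ==> slabK m \<Phi> P t {} (%_. 0) (%_. 0) = 1"
 unfolding slabK_def by (simp add: ham_empty mexp_zero_matrix restr_def)

lemma connected_separated:
 assumes c: "connected_Zd a" and a: "a \<subseteq> A Un B" and sep: "!!x y. x : A ==> y : B ==> l1dist x y ~= 1" and d: "A Int B = {}"
 shows "a \<subseteq> A \<or> a \<subseteq> B"
proof (rule ccontr)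
 assume "~ ?thesis"
 then obtain x y where xy: "x : a" "x : A" "y : a" "y ~: A" using a by blast
 have "(x, y) : {(u, v). u : a & v : a & l1dist u v = 1}\<^sup>*" using c xy unfolding connected_Zd_def by blast
 then have "y : A"
 proof (induction rule: rtrancl_induct)
  case base
  show ?case by (rule xy(2))
 next
  case (step y z)
  then have "z : A Un B" "l1dist y z = 1" using a by blast+
  then show ?case using sep[OF step.IH] by blast
 qed
 then show False using xy by blast
qed

text \<open>An interaction term across two separated regions would have a disconnected support, and
  there the interaction vanishes.\<close>

lemma ham_Un:
 assumes \<Phi>: "interaction m \<Phi>" and fin: "finite A" "finite B" and d: "A Int B = {}"
  and sep: "!!x y. x : A ==> y : B ==> l1dist x y ~= 1"
 shows "ham \<Phi> (A Un B) s t = embed (A Un B) A (ham \<Phi> A) s t + embed (A Un B) B (ham \<Phi> B) s t"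
proof -
 let ?f = "%a. embed (A Un B) a (\<Phi> a) s t"
 have "(\<Sum>a\<in>Pow (A Un B). ?f a) = (\<Sum>a\<in>Pow A Un Pow B. ?f a)"
 proof (rule sum.mono_neutral_right)
  show "ALL a:Pow (A Un B) - (Pow A Un Pow B). ?f a = 0"
  proof
   fix a assume a: "a : Pow (A Un B) - (Pow A Un Pow B)"
   then have "~ connected_Zd a" using connected_separated[of a A B] sep d by blast
   then have "\<Phi> a = (%_ _. 0)" using \<Phi> unfolding interaction_def by blast
   then show "?f a = 0" by (simp add: embed_def)
  qed
 qed (use fin in auto)
 also have "... = (\<Sum>a\<in>Pow A. ?f a) + (\<Sum>a\<in>Pow B. ?f a)"
 proof (rule sum.union_inter_neutral)
  show "ALL x:Pow A Int Pow B. ?f x = 0"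
  proof
   fix x assume "x : Pow A Int Pow B"
   then have "x = {}" using d by blast
   then show "?f x = 0" using interaction_empty[OF \<Phi>] by (simp add: embed_def)
  qed
 qed (use fin in auto)
 finally show ?thesis
  unfolding embed_ham[OF Un_upper1] embed_ham[OF Un_upper2] by (simp add: ham_def)
qed

lemma mexp_Un:
 assumes \<Phi>: "interaction m \<Phi>" and fin: "finite A" "finite B" and d: "A Int B = {}"
  and sep: "!!x y. x : A ==> y : B ==> l1dist x y ~= 1"
  and st: "s : confs m (A Un B)" "t : confs m (A Un B)"
 shows "mexp (confs m (A Un B)) c (ham \<Phi> (A Un B)) s t
  = mexp (confs m A) c (ham \<Phi> A) (restr s A) (restr t A) * mexp (confs m B) c (ham \<Phi> B) (restr s B) (restr t B)"
proof -
 let ?S = "confs m (A Un B)" and ?a = "embed (A Un B) A (ham \<Phi> A)" and ?b = "embed (A Un B) B (ham \<Phi> B)"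
 have S: "finite ?S" using fin by (intro finite_confs) simp
 have f: "finite (A Un B)" using fin by simp
 have "mexp ?S c (ham \<Phi> (A Un B)) s t = mexp ?S 1 (%s t. c * ham \<Phi> (A Un B) s t) s t" by (simp only: mexp_scale mult_1)
 also have "... = mexp ?S 1 (%s t. c * ?a s t + c * ?b s t) s t"
  by (rule mexp_cong[OF _ st]) (simp only: ham_Un[OF \<Phi> fin d sep] distrib_left)
 also have "... = mmul ?S (mexp ?S 1 (%s t. c * ?a s t)) (mexp ?S 1 (%s t. c * ?b s t)) s t"
 proof (rule mexp_add_commuting[OF S _ st])
  fix x y assume "x : ?S" "y : ?S"
  then have "mmul ?S ?a ?b x y = mmul ?S ?b ?a x y" by (intro embed_commute[OF f _ _ d]) auto
  then show "mmul ?S (%s t. c * ?a s t) (%s t. c * ?b s t) x y = mmul ?S (%s t. c * ?b s t) (%s t. c * ?a s t) x y"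
   by (simp only: mmul_scale_left mmul_scale_right)
 qed
 also have "... = mmul ?S (mexp ?S c ?a) (mexp ?S c ?b) s t" unfolding mmul_def by (simp only: mexp_scale mult_1)
 also have "... = mmul ?S (embed (A Un B) A (mexp (confs m A) c (ham \<Phi> A))) (embed (A Un B) B (mexp (confs m B) c (ham \<Phi> B))) s t"
  by (rule mmul_cong) (use embed_mexp[OF f Un_upper1] embed_mexp[OF f Un_upper2] st in blast)+
 also have "... = (if ALL i:A Un B - A - B. s i = t i then mexp (confs m A) c (ham \<Phi> A) (restr s A) (restr t A) * mexp (confs m B) c (ham \<Phi> B) (restr s B) (restr t B) else 0)"
  by (rule mmul_embed_disjoint[OF f Un_upper1 Un_upper2 d st])
 also have "A Un B - A - B = {}" by blast
 finally show ?thesis by simp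
qed

lemma sum_Pow_Un:
 assumes "A Int B = {}"
 shows "(\<Sum>C\<in>Pow (A Un B). f C) = (\<Sum>(C, D)\<in>Pow A \<times> Pow B. f (C Un D))"
 by (rule sum.reindex_bij_witness[where i = "%(C, D). C Un D" and j = "%C. (C Int A, C Int B)"])
  (use assms in "auto simp: Int_Un_distrib[symmetric] Int_absorb2")

text \<open>For separated sets the exponential on \<open>C Un D\<close> is a product, and so are the
  sign and the projections on the complement; hence the sum over pairs \<open>C\<close>,
  \<open>D\<close> factorises.\<close>

lemma slabK_Un:
 assumes \<Phi>: "interaction m \<Phi>" and fin: "finite A" "finite B" and d: "A Int B = {}"
  and sep: "!!x y. x : A ==> y : B ==> l1dist x y ~= 1"
  and st: "s : confs m (A Un B)" "q : confs m (A Un B)"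
 shows "slabK m \<Phi> P t (A Un B) s q = slabK m \<Phi> P t A (restr s A) (restr q A) * slabK m \<Phi> P t B (restr s B) (restr q B)"
proof -
 let ?T = "%C. mexp (confs m C) (- of_real t) (ham \<Phi> C) (restr s C) (restr q C)"
 let ?g = "%A C. (-1) ^ card (A - C) * (?T C * (\<Prod>i\<in>A - C. P (s i) (q i)))"
 have red: "slabK m \<Phi> P t A (restr s A) (restr q A) = (\<Sum>C\<in>Pow A. ?g A C)" for A
  unfolding slabK_def
 proof (rule sum.cong[OF refl])
  fix C assume C: "C : Pow A"
  then have "A Int C = C" by blast
  then have rr: "restr (restr p A) C = restr p C" for p :: "'a cfg" using C by (auto simp: restr_def fun_eq_iff)
  have "(\<Prod>i\<in>A - C. P (restr s A i) (restr q A i)) = (\<Prod>i\<in>A - C. P (s i) (q i))"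
   by (intro prod.cong) (auto simp: restr_def)
  then show "(-1) ^ card (A - C) * (mexp (confs m C) (- of_real t) (ham \<Phi> C) (restr (restr s A) C) (restr (restr q A) C) * (\<Prod>i\<in>A - C. P (restr s A i) (restr q A i))) = ?g A C"
   unfolding rr by simp
 qed
 have "slabK m \<Phi> P t (A Un B) s q = (\<Sum>(C, D)\<in>Pow A \<times> Pow B. ?g (A Un B) (C Un D))"
  unfolding slabK_def by (rule sum_Pow_Un[OF d])
 also have "... = (\<Sum>(C, D)\<in>Pow A \<times> Pow B. ?g A C * ?g B D)"
 proof (rule sum.cong[OF refl], clarify)
  fix C D assume CD: "C \<subseteq> A" "D \<subseteq> B"
  have CD': "C Int D = {}" using CD d by blast
  have fCD: "finite C" "finite D" using CD fin finite_subset by blast+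
  have e: "A Un B - (C Un D) = (A - C) Un (B - D)" using CD d by blast
  have dd: "(A - C) Int (B - D) = {}" using d by blast
  have sub: "C Un D \<subseteq> A Un B" using CD by blast
  have "card (A Un B - (C Un D)) = card (A - C) + card (B - D)" unfolding e by (rule card_Un_disjoint) (use fin dd in auto)
  moreover have "(\<Prod>i\<in>A Un B - (C Un D). P (s i) (q i)) = (\<Prod>i\<in>A - C. P (s i) (q i)) * (\<Prod>i\<in>B - D. P (s i) (q i))"
   unfolding e by (rule prod.union_disjoint) (use fin dd in auto)
  moreover have "?T (C Un D) = ?T C * ?T D"
  proof -
   have rr: "restr (restr p (C Un D)) C = restr p C" "restr (restr p (C Un D)) D = restr p D" for p :: "'a cfg"
    by (auto simp: restr_def)
   show ?thesis
    using mexp_Un[OF \<Phi> fCD CD' _ restr_confs[OF st(1) sub] restr_confs[OF st(2) sub], of "- of_real t"] CD sep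
    unfolding rr by blast
  qed
  ultimately show "?g (A Un B) (C Un D) = ?g A C * ?g B D" by (simp add: power_add)
 qed
 also have "... = (\<Sum>C\<in>Pow A. ?g A C) * (\<Sum>D\<in>Pow B. ?g B D)"
  by (simp only: sum_product sum.cartesian_product)
 finally show ?thesis unfolding red .
qed

text \<open>Moebius inversion at fixed \<open>s\<close> and \<open>q\<close>, with the projection on
  \<open>L - B\<close> included in the transformed function.\<close>

lemma slab_decomposition:
 assumes L: "finite L" and st: "s : confs m L" "q : confs m L"
 shows "mexp (confs m L) (- of_real t) (ham \<Phi> L) s q
  = (\<Sum>A\<in>Pow L. slabK m \<Phi> P t A (restr s A) (restr q A) * (\<Prod>i\<in>L - A. P (s i) (q i)))"
proof -
 define f where "f = (%B. mexp (confs m B) (- of_real t) (ham \<Phi> B) (restr s B) (restr q B) * (\<Prod>i\<in>L - B. P (s i) (q i)))"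
 have "slabK m \<Phi> P t A (restr s A) (restr q A) * (\<Prod>i\<in>L - A. P (s i) (q i)) = mob f A" if A: "A : Pow L" for A
  unfolding slabK_def mob_def sum_distrib_right
 proof (rule sum.cong[OF refl])
  fix B assume B: "B : Pow A"
  have rr: "restr (restr p A) B = restr p B" for p :: "'a cfg" using B by (auto simp: restr_def fun_eq_iff)
  have "(\<Prod>i\<in>L - B. P (s i) (q i)) = (\<Prod>i\<in>(A - B) Un (L - A). P (s i) (q i))" by (rule prod.cong) (use A B in auto)
  also have "... = (\<Prod>i\<in>A - B. P (s i) (q i)) * (\<Prod>i\<in>L - A. P (s i) (q i))"
   by (rule prod.union_disjoint) (use L A finite_subset[OF _ L, of A] in auto)
  also have "(\<Prod>i\<in>A - B. P (s i) (q i)) = (\<Prod>i\<in>A - B. P (restr s A i) (restr q A i))"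
   by (rule prod.cong) (auto simp: restr_def)
  finally show "(-1) ^ card (A - B) * (mexp (confs m B) (- of_real t) (ham \<Phi> B) (restr (restr s A) B) (restr (restr q A) B)
    * (\<Prod>i\<in>A - B. P (restr s A i) (restr q A i))) * (\<Prod>i\<in>L - A. P (s i) (q i)) = (-1) ^ card (A - B) * f B"
   unfolding f_def rr by simp
 qed
 then have "(\<Sum>A\<in>Pow L. slabK m \<Phi> P t A (restr s A) (restr q A) * (\<Prod>i\<in>L - A. P (s i) (q i))) = sum (mob f) (Pow L)"
  by (rule sum.cong[OF refl])
 also have "... = f L" by (rule sum_mob[OF L])
 finally show ?thesis unfolding f_def using restr_id[OF st(1)] restr_id[OF st(2)] by simp
qed

lemma interaction_add:
 fixes \<Phi> \<Psi> :: "'d::finite site set => 'd op"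
 assumes "interaction m \<Phi>" "interaction m \<Psi>"
 shows "interaction m (%A s t. \<Phi> A s t + \<Psi> A s t)"
 unfolding interaction_def
proof (intro conjI allI ballI impI)
 fix A :: "'d site set" and s t assume "s : confs m A" "t : confs m A"
 then have "\<Phi> A s t = cnj (\<Phi> A t s)" "\<Psi> A s t = cnj (\<Psi> A t s)" using assms unfolding interaction_def by blast+
 then show "\<Phi> A s t + \<Psi> A s t = cnj (\<Phi> A t s + \<Psi> A t s)" by simp
next
 fix A :: "'d site set" and a s t assume "s : confs m (shift a ` A)" "t : confs m (shift a ` A)"
 then have "\<Phi> (shift a ` A) s t = \<Phi> A (s o shift a) (t o shift a)" "\<Psi> (shift a ` A) s t = \<Psi> A (s o shift a) (t o shift a)"
  using assms unfolding interaction_def by blast+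
 then show "\<Phi> (shift a ` A) s t + \<Psi> (shift a ` A) s t = \<Phi> A (s o shift a) (t o shift a) + \<Psi> A (s o shift a) (t o shift a)"
  by simp
next
 fix A :: "'d site set" assume "~ (finite A & connected_Zd A)"
 then have "\<Phi> A = (%_ _. 0)" "\<Psi> A = (%_ _. 0)" using assms unfolding interaction_def by blast+
 then show "(%s t. \<Phi> A s t + \<Psi> A s t) = (%_ _. 0)" by simp
qed

lemma opnorm_shift_le:
 assumes \<Phi>: "interaction m \<Phi>" and "finite a"
 shows "opnorm (confs m a) (\<Phi> a) <= opnorm (confs m (shift s ` a)) (\<Phi> (shift s ` a))"
proof (rule opnorm_le)
 let ?s = "%k. - s k" and ?b = "shift s ` a"
 have a: "shift ?s ` ?b = a" by (simp add: image_image)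
 have "opb (confs m (shift ?s ` ?b)) (\<Phi> (shift ?s ` ?b)) (opnorm (confs m ?b) (\<Phi> ?b))"
 proof (rule opb_reindex[OF bij_confs_shift])
  show "opb (confs m ?b) (\<Phi> ?b) (opnorm (confs m ?b) (\<Phi> ?b))" using assms(2) by (intro opb_opnorm finite_confs) simp
  fix x y assume "x : confs m (shift ?s ` ?b)" "y : confs m (shift ?s ` ?b)"
  then show "\<Phi> (shift ?s ` ?b) x y = \<Phi> ?b (x o shift ?s) (y o shift ?s)"
   using \<Phi> unfolding interaction_def by blast
 qed
 then show "opb (confs m a) (\<Phi> a) (opnorm (confs m ?b) (\<Phi> ?b))" unfolding a .
qed

text \<open>The norm is defined by sets through the origin. Translation by \<open>- i\<close> moves
  the sets through \<open>i\<close> there injectively, and a finite part of the sum is at most the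
  whole.\<close>

lemma int_norm_sum:
 assumes \<Phi>: "interaction m \<Phi>" and n: "int_norm m \<kappa> \<Phi> <= 1" and A: "finite A"
 shows "(\<Sum>a\<in>{a\<in>Pow A. i : a}. exp (\<kappa> * real (card a)) * opnorm (confs m a) (\<Phi> a)) <= 1"
proof -
 let ?s = "%k. - i k" and ?f = "%a. exp (\<kappa> * real (card a)) * opnorm (confs m a) (\<Phi> a)"
 let ?I = "{a\<in>Pow A. i : a}"
 have fI: "finite ?I" using A by auto
 have fa: "finite a" if "a : ?I" for a using that finite_subset[OF _ A] by auto
 have inj: "inj_on ((`) (shift ?s)) ?I" by (auto simp: inj_on_def inj_image_eq_iff[OF inj_shift])
 have nn: "0 <= ?f a" if "finite a" for a
  by (intro mult_nonneg_nonneg opb_nonneg[OF opb_opnorm] finite_confs that) simp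
 have "(\<Sum>a\<in>?I. ?f a) <= (\<Sum>a\<in>?I. ?f (shift ?s ` a))"
 proof (rule sum_mono)
  fix a assume a: "a : ?I"
  have "card (shift ?s ` a) = card a" by (intro card_image inj_on_subset[OF inj_shift]) simp
  then show "?f a <= ?f (shift ?s ` a)" using opnorm_shift_le[OF \<Phi> fa[OF a], of ?s] by simp
 qed
 also have "... = (\<Sum>a\<in>(`) (shift ?s) ` ?I. ?f a)" by (subst sum.reindex[OF inj]) (simp only: o_def)
 finally have le: "(\<Sum>a\<in>?I. ?f a) <= (\<Sum>a\<in>(`) (shift ?s) ` ?I. ?f a)" .
 have "ennreal (\<Sum>a\<in>(`) (shift ?s) ` ?I. ?f a) = (\<Sum>a\<in>(`) (shift ?s) ` ?I. ennreal (?f a))"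
  by (rule sum_ennreal[symmetric]) (use fa nn in auto)
 also have "... <= int_norm m \<kappa> \<Phi>"
  unfolding int_norm_def
  by (subst nonneg_infsum_complete) (use fI fa in "auto intro!: SUP_upper simp: shift_def origin_def fun_eq_iff image_iff")
 finally have "ennreal (\<Sum>a\<in>(`) (shift ?s) ` ?I. ?f a) <= ennreal 1" using n order_trans by fastforce
 then have "(\<Sum>a\<in>(`) (shift ?s) ` ?I. ?f a) <= 1" by (subst (asm) ennreal_le_iff) simp_all
 then show ?thesis using le by linarith
qed

text \<open>\<open>Suc\<close> pays for the centre, which the ball misses when \<open>r\<close> is
  negative; the range comes without a sign condition.\<close>

definition ball_bound :: "'d::finite itself => real => nat" where
 "ball_bound _ r = Suc (card {j :: 'd site. real_of_int (l1dist origin j) <= r})"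

lemma l1dist_commute: "l1dist i j = l1dist j i"
 by (simp add: l1dist_def abs_minus_commute)

lemma finite_ball: "finite {j :: 'd::finite site. real_of_int (l1dist i j) <= r}"
proof -
 have "{j :: 'd site. real_of_int (l1dist i j) <= r} = {j. l1dist i j <= \<lfloor>r\<rfloor>}" by (auto simp: le_floor_iff)
 then show ?thesis by (simp add: finite_l1_ball)
qed

lemma card_ball: "Suc (card {j :: 'd::finite site. real_of_int (l1dist i j) <= r}) = ball_bound TYPE('d) r"
proof -
 have "{j. real_of_int (l1dist i j) <= r} = shift i ` {j. real_of_int (l1dist origin j) <= r}"
 proof (intro equalityI subsetI)
  fix j assume j: "j : {j. real_of_int (l1dist i j) <= r}"
  have "shift (%k. - i k) i = origin" by (auto simp: shift_def origin_def)
  then have "l1dist origin (shift (%k. - i k) j) = l1dist i j" using l1dist_shift[of "%k. - i k" i j] by simp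
  then show "j : shift i ` {j. real_of_int (l1dist origin j) <= r}"
   using j by (intro image_eqI[of _ _ "shift (%k. - i k) j"]) auto
 next
  fix j assume "j : shift i ` {j. real_of_int (l1dist origin j) <= r}"
  then obtain j' where "j = shift i j'" "real_of_int (l1dist origin j') <= r" by auto
  moreover have "shift i origin = i" by (auto simp: shift_def origin_def)
  ultimately show "j : {j. real_of_int (l1dist i j) <= r}" using l1dist_shift[of i origin j'] by simp
 qed
 then show ?thesis unfolding ball_bound_def
  by (simp add: card_image inj_on_subset[OF inj_shift])
qed

lemma exp_minus_one_le: "0 <= x ==> x <= 1 ==> exp x - 1 <= 2 * (x :: real)"
proof -
 assume x: "0 <= x" "x <= 1"
 have "x\<^sup>2 <= x" using x by (simp add: power2_eq_square mult_left_le)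
 then show ?thesis using exp_bound[OF x] by simp
qed

section \<open>Smallness of the kernels in the size of their support\<close>

context gapped_model
begin

text \<open>The balls of radius \<open>r\<close> around the sites of \<open>U\<close>, with their
  centres, cover \<open>A\<close>.\<close>

lemma near_card:
 assumes A: "finite A" and U: "U \<subseteq> A" and near: "near A U"
 shows "card A <= ball_bound TYPE('d) r * card U"
proof -
 have fU: "finite U" by (rule finite_subset[OF U A])
 let ?b = "%j. insert j {i. real_of_int (l1dist j i) <= r}"
 have "A \<subseteq> (\<Union>j\<in>U. ?b j)"
 proof
  fix i assume "i : A"
  show "i : (\<Union>j\<in>U. ?b j)"
  proof (cases "i : U")
   case True
   then show ?thesis by blast
  next
   case False
   then obtain j where "j : U" "real_of_int (l1dist i j) <= r" using near \<open>i : A\<close> unfolding near_def by blast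
   then show ?thesis using l1dist_commute[of i j] by auto
  qed
 qed
 then have "card A <= card (\<Union>j\<in>U. ?b j)" by (rule card_mono[rotated]) (use fU finite_ball in auto)
 also have "... <= (\<Sum>j\<in>U. card (?b j))" by (rule card_UN_le[OF fU])
 also have "... <= (\<Sum>j\<in>U. ball_bound TYPE('d) r)"
 proof (rule sum_mono)
  fix j :: "'d site"
  show "card (?b j) <= ball_bound TYPE('d) r"
  proof -
   have "card (?b j) <= Suc (card {i. real_of_int (l1dist j i) <= r})"
    using finite_ball[of j r] by (simp add: card_insert_if)
   then show ?thesis by (simp only: card_ball)
  qed
 qed
 finally show ?thesis by (simp add: mult.commute)
qed

text \<open>As \<open>card A\<close> is at most \<open>ball_bound\<close> times the number of
  excited and perturbed sites, a factor \<open>exp (- L * card A)\<close> can be taken from the gap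
  factors and, through the weights \<open>z\<close>, from the decay of the perturbation. The weights
  \<open>z\<close> still sum to at most \<open>card A\<close>, so the families \<open>D\<close>
  contribute \<open>exp (card A)\<close>; the choices of \<open>B\<close> and of \<open>T\<close>
  give \<open>2 ^ card A\<close> each.\<close>

theorem slabK_bound:
 assumes n: "int_norm m \<kappa> \<Upsilon> <= 1" and A: "finite A" and t: "0 <= t" and L: "0 <= L"
  and tg: "real (ball_bound TYPE('d) r) * L <= t * g" and \<kappa>: "real (ball_bound TYPE('d) r) * L <= \<kappa>"
  and t\<kappa>: "2 * t <= exp (\<kappa> - real (ball_bound TYPE('d) r) * L)"
  and st: "s : confs m A" "q : confs m A"
 shows "cmod (slabK m (%A s q. \<Phi>0 A s q + \<Upsilon> A s q) P t A s q) <= (4 * exp (1 - L)) ^ card A"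
proof -
 define b where "b = real (ball_bound TYPE('d) r)"
 define N where "N = card A"
 \<comment> \<open>The factor of a perturbation in \<open>slab_bound\<close>, enlarged by the share
   of \<open>exp (L * card A)\<close> that is charged to its support.\<close>
 define z where "z = (%a. (exp (nU t a) - 1) * exp (b * L * card a))"
 have b0: "0 <= b" by (simp add: b_def)
 have w0: "0 <= opnorm (confs m a) (\<Upsilon> a)" if "finite a" for a
  by (rule opb_nonneg[OF opb_opnorm[OF finite_confs[OF that]]])
 have fa: "finite a" if "a : Pow A" for a using that finite_subset[OF _ A] by auto
 have z0: "0 <= z a" if "a : Pow A" for a
  unfolding z_def using w0[OF fa[OF that]] t by simp
 have zle: "z a <= 2 * t * exp (- (\<kappa> - b * L)) * (exp (\<kappa> * card a) * opnorm (confs m a) (\<Upsilon> a))"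
  if a: "a : Pow A" "a ~= {}" for a
 proof -
  let ?w = "opnorm (confs m a) (\<Upsilon> a)"
  have ca: "1 <= real (card a)" using a fa[OF a(1)] by (simp add: Suc_le_eq card_gt_0_iff)
  obtain i where i: "i : a" using a by blast
  have "exp (\<kappa> * card a) * ?w <= (\<Sum>a\<in>{a\<in>Pow A. i : a}. exp (\<kappa> * real (card a)) * opnorm (confs m a) (\<Upsilon> a))"
   by (rule member_le_sum) (use a i A fa w0 in auto)
  also have "... <= 1" by (rule int_norm_sum[OF intU n A])
  finally have w1: "exp (\<kappa> * card a) * ?w <= 1" .
  have k0: "0 <= \<kappa>" using \<kappa> L b0 by (simp add: b_def) (meson mult_nonneg_nonneg of_nat_0_le_iff order_trans)
  have "?w * exp \<kappa> <= ?w * exp (\<kappa> * card a)"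
   by (rule mult_left_mono[OF _ w0[OF fa[OF a(1)]]]) (use k0 ca mult_left_mono[of 1 "real (card a)" \<kappa>] in simp)
  then have w2: "?w * exp \<kappa> <= 1" using w1 by (simp add: mult.commute)
  have "2 * t <= exp \<kappa>"
   by (rule order_trans[OF t\<kappa>]) (use mult_nonneg_nonneg[OF b0 L] in "simp add: b_def")
  then have "2 * t * ?w <= exp \<kappa> * ?w" by (rule mult_right_mono[OF _ w0[OF fa[OF a(1)]]])
  \<comment> \<open>Smallness of \<open>nU\<close> permits the linear bound
    \<open>exp x - 1 <= 2 * x\<close>; it comes from the norm and from the relation between
    \<open>t\<close> and \<open>\<kappa>\<close>.\<close>
  then have n1: "nU t a <= 1" using w2 by (simp add: mult.commute)
  have "z a <= 2 * nU t a * exp (b * L * card a)"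
   unfolding z_def by (intro mult_right_mono exp_minus_one_le n1) (use t w0[OF fa[OF a(1)]] in auto)
  also have "... <= 2 * nU t a * (exp (- (\<kappa> - b * L)) * exp (\<kappa> * card a))"
  proof (rule mult_left_mono)
   have "(\<kappa> - b * L) * 1 <= (\<kappa> - b * L) * card a" using \<kappa> ca by (intro mult_left_mono) (auto simp: b_def)
   then have "b * L * card a <= - (\<kappa> - b * L) + \<kappa> * card a" by (simp add: algebra_simps)
   then show "exp (b * L * card a) <= exp (- (\<kappa> - b * L)) * exp (\<kappa> * card a)" by (simp add: exp_add[symmetric])
  qed (use t w0[OF fa[OF a(1)]] in auto)
  finally show ?thesis by (simp only: mult_ac)
 qed
 have sumz: "(\<Sum>a\<in>Pow A. z a) <= N"
 proof -
  let ?c = "2 * t * exp (- (\<kappa> - b * L))" and ?f = "%a. exp (\<kappa> * card a) * opnorm (confs m a) (\<Upsilon> a)"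
  have c1: "?c <= 1"
  proof -
   have "2 * t * exp (- (\<kappa> - b * L)) <= exp (\<kappa> - b * L) * exp (- (\<kappa> - b * L))"
    using t\<kappa> by (intro mult_right_mono) (auto simp: b_def)
   also have "... = 1" by (rule exp_minus_inverse)
   finally show ?thesis .
  qed
  have zE: "z {} = 0"
  proof -
   have "opb (confs m {}) (\<Upsilon> {}) 0"
    unfolding interaction_empty[OF intU] by (rule opb_zero)
   then have "opnorm (confs m {}) (\<Upsilon> {}) <= 0" by (rule opnorm_le)
   then show ?thesis using w0[of "{}"] by (simp add: z_def)
  qed
  have "(\<Sum>a\<in>Pow A. z a) <= real (card A) * 1"
  proof (rule sum_le_by_sites[OF A _ z0])
   fix i
   have "(\<Sum>a\<in>{a\<in>Pow A. i : a}. z a) <= (\<Sum>a\<in>{a\<in>Pow A. i : a}. ?c * ?f a)"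
    by (rule sum_mono) (use zle in auto)
   also have "... = ?c * (\<Sum>a\<in>{a\<in>Pow A. i : a}. ?f a)" by (simp only: sum_distrib_left)
   also have "... <= 1 * 1"
    by (rule mult_mono[OF c1 int_norm_sum[OF intU n A]]) (use fa w0 in "auto intro!: sum_nonneg")
   finally show "(\<Sum>a\<in>{a\<in>Pow A. i : a}. z a) <= 1" by simp
  qed (use A zE in "auto simp: Int_absorb2")
  then show ?thesis by (simp add: N_def)
 qed
 let ?I = "{(D, T)\<in>pairs A. near A (\<Union>D Un T)}"
 have term_le: "exp (- (t * g * card T)) * (\<Prod>a\<in>D. exp (nU t a) - 1) <= exp (- L * N) * (\<Prod>a\<in>D. z a)"
  if DT: "(D, T) : pairs A" "near A (\<Union>D Un T)" for D T
 proof -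
  have D: "finite D" "!!a. a : D ==> a : Pow A" using DT A by (auto intro: finite_subset[of D "Pow A"])
  have fT: "finite T" using DT A by (auto intro: finite_subset)
  have "card (\<Union>D Un T) <= card (\<Union>D) + card T" by (rule card_Un_le)
  also have "... <= (\<Sum>a\<in>D. card a) + card T" using card_Union_le_sum_card[of D] by simp
  finally have cU: "real (card (\<Union>D Un T)) <= (\<Sum>a\<in>D. real (card a)) + card T" by (simp add: of_nat_sum[symmetric] del: of_nat_sum)
  have "real N <= b * card (\<Union>D Un T)"
   unfolding N_def b_def of_nat_mult[symmetric] of_nat_le_iff by (rule near_card[OF A _ DT(2)]) (use DT in auto)
  also have "... <= b * ((\<Sum>a\<in>D. real (card a)) + card T)" by (rule mult_left_mono[OF cU b0])
  finally have "L * N <= L * (b * ((\<Sum>a\<in>D. real (card a)) + card T))" by (rule mult_left_mono[OF _ L])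
  also have "... = b * L * (\<Sum>a\<in>D. real (card a)) + b * L * card T" by (simp add: algebra_simps)
  also have "b * L * card T <= t * g * card T" using tg by (intro mult_right_mono) (auto simp: b_def)
  finally have "- (t * g * card T) <= - L * N + (\<Sum>a\<in>D. b * L * card a)" by (simp add: sum_distrib_left)
  then have e: "exp (- (t * g * card T)) <= exp (- L * N) * (\<Prod>a\<in>D. exp (b * L * card a))"
   using D(1) by (simp add: exp_add[symmetric] exp_sum[symmetric])
  have "exp (- (t * g * card T)) * (\<Prod>a\<in>D. exp (nU t a) - 1) <= exp (- L * N) * (\<Prod>a\<in>D. exp (b * L * card a)) * (\<Prod>a\<in>D. exp (nU t a) - 1)"
   by (rule mult_right_mono[OF e]) (use D w0 fa t in "auto intro!: prod_nonneg")
  also have "... = exp (- L * N) * (\<Prod>a\<in>D. z a)"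
   unfolding z_def prod.distrib by (simp only: mult_ac)
  finally show ?thesis .
 qed
 have "cmod (slabK m (%A s q. \<Phi>0 A s q + \<Upsilon> A s q) P t A s q)
  <= 2 ^ N * (\<Sum>(D, T)\<in>?I. exp (- (t * g * card T)) * (\<Prod>a\<in>D. exp (nU t a) - 1))"
  unfolding N_def by (rule slab_bound[OF A t st])
 also have "... <= 2 ^ N * (\<Sum>(D, T)\<in>?I. exp (- L * N) * (\<Prod>a\<in>D. z a))"
  by (rule mult_left_mono[OF sum_mono]) (use term_le in auto)
 also have "... <= 2 ^ N * (\<Sum>(D, T)\<in>pairs A. exp (- L * N) * (\<Prod>a\<in>D. z a))"
  by (rule mult_left_mono[OF sum_mono2]) (use A z0 in "auto intro!: mult_nonneg_nonneg prod_nonneg")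
 also have "(\<Sum>(D, T)\<in>pairs A. exp (- L * N) * (\<Prod>a\<in>D. z a)) = (\<Sum>D\<in>Pow (Pow A). \<Sum>T\<in>Pow (A - \<Union>D). exp (- L * N) * (\<Prod>a\<in>D. z a))"
  by (rule sum.Sigma[symmetric]) (use A in auto)
 also have "... <= (\<Sum>D\<in>Pow (Pow A). 2 ^ N * (exp (- L * N) * (\<Prod>a\<in>D. z a)))"
 proof (rule sum_mono)
  fix D assume D: "D : Pow (Pow A)"
  have "card (Pow (A - \<Union>D)) <= card (Pow A)" by (rule card_mono) (use A in auto)
  then have "real (card (Pow (A - \<Union>D))) <= 2 ^ N" unfolding N_def card_Pow[OF A] using of_nat_mono by fastforce
  then show "(\<Sum>T\<in>Pow (A - \<Union>D). exp (- L * N) * (\<Prod>a\<in>D. z a)) <= 2 ^ N * (exp (- L * N) * (\<Prod>a\<in>D. z a))"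
   unfolding sum_constant by (rule mult_right_mono) (use D z0 in "auto intro!: mult_nonneg_nonneg prod_nonneg")
 qed
 also have "... = 2 ^ N * exp (- L * N) * (\<Sum>D\<in>Pow (Pow A). \<Prod>a\<in>D. z a)" by (simp only: sum_distrib_left mult.assoc)
 also have "(\<Sum>D\<in>Pow (Pow A). \<Prod>a\<in>D. z a) = (\<Prod>a\<in>Pow A. z a + 1)"
  using prod_add[of "Pow A" z "%_. 1"] A by simp
 also have "... <= (\<Prod>a\<in>Pow A. exp (z a))"
  by (rule prod_mono) (use z0 exp_ge_add_one_self in "auto simp: add.commute")
 also have "... = exp (\<Sum>a\<in>Pow A. z a)" using A by (simp add: exp_sum)
 also have "... <= exp N" using sumz by simp
 finally have "cmod (slabK m (%A s q. \<Phi>0 A s q + \<Upsilon> A s q) P t A s q) <= 2 ^ N * (2 ^ N * exp (- L * N) * exp N)"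
  by (simp add: mult_left_mono)
 also have "... = (4 * exp (1 - L)) ^ N"
 proof -
  have "exp (- L * N) * exp N = exp (1 - L) ^ N"
   unfolding exp_of_nat_mult[symmetric] exp_add[symmetric] by (simp add: algebra_simps)
  moreover have "(2::real) ^ N * 2 ^ N = 4 ^ N" by (simp add: power_mult_distrib[symmetric])
  ultimately show ?thesis unfolding power_mult_distrib by (simp add: mult.assoc[symmetric])
 qed
 finally show ?thesis unfolding N_def .
qed

end

section \<open>Classical restriction of the equilibrium and ground states\<close>

locale observable = site_projection m P u
 for m P u +
 fixes spX :: "real set" and Q :: "real => smat"
 assumes spX: "finite spX" "spX ~= {}"
  and Q_herm: "!!x i j. x : spX ==> i < m ==> j < m ==> Q x i j = cnj (Q x j i)"
  and Q_idem: "!!x i j. x : spX ==> i < m ==> j < m ==> (\<Sum>k<m. Q x i k * Q x k j) = Q x i j"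
  and Q_sum: "!!i j. i < m ==> j < m ==> (\<Sum>x\<in>spX. Q x i j) = (if i = j then 1 else 0)"
  and Q_pos: "!!x. x : spX ==> Re (\<Sum>i<m. \<Sum>j<m. Q x i j * P j i) > 0"
begin

definition Ob :: "real option => smat" where
 "Ob y = (case y of None => idm | Some x => Q x)"

text \<open>By \<open>Ob_u\<close> this is the expectation of \<open>Ob y\<close> in
  \<open>u\<close>. Its positivity permits the division in the site weights.\<close>

definition wt :: "real option => real" where
 "wt y = (case y of None => 1 | Some x => Re (\<Sum>i<m. \<Sum>j<m. Q x i j * P j i))"

abbreviation outs :: "real option set" where
 "outs \<equiv> insert None (Some ` spX)"

text \<open>A sum over all outcomes and entries serves as a common bound for the single ratios; the
  summand 1 ensures \<open>1 <= CO\<close>.\<close>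

definition CO :: real where
 "CO = 1 + (\<Sum>y\<in>outs. \<Sum>a<m. \<Sum>b<m. cmod (Ob y a b) / wt y)"

lemma wt_pos: "y : outs ==> 0 < wt y"
 using Q_pos by (auto simp: wt_def)

lemma finite_outs: "finite outs"
 using spX by simp

lemma Ob_herm: "y : outs ==> i < m ==> j < m ==> Ob y i j = cnj (Ob y j i)"
 unfolding Ob_def by (auto intro: Q_herm)

lemma Ob_idem: "y : outs ==> i < m ==> j < m ==> mmul {..<m} (Ob y) (Ob y) i j = Ob y i j"
 unfolding Ob_def by (auto simp: idm_mult) (simp add: mmul_def Q_idem)

lemma complex_of_real_Re_iff: "Im z = 0 ==> z = of_real (Re z)"
 by (simp add: complex_eq_iff)

lemma Ob_u: "y : outs ==> (\<Sum>a<m. \<Sum>b<m. cnj (u a) * Ob y a b * u b) = of_real (wt y)"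
proof -
 assume y: "y : outs"
 let ?z = "\<Sum>a<m. \<Sum>b<m. cnj (u a) * Ob y a b * u b"
 have "cnj ?z = (\<Sum>a<m. \<Sum>b<m. cnj (u b) * Ob y b a * u a)"
  unfolding cnj_sum
 proof (intro sum.cong refl)
  fix a b assume "a : {..<m}" "b : {..<m}"
  then have "cnj (Ob y a b) = Ob y b a" using Ob_herm[OF y, of b a] by simp
  then show "cnj (cnj (u a) * Ob y a b * u b) = cnj (u b) * Ob y b a * u a" by (simp add: mult_ac)
 qed
 also have "... = ?z" by (rule sum.swap)
 finally have c: "cnj ?z = ?z" .
 have "Im z = 0" if "cnj z = z" for z :: complex using that by (simp add: complex_eq_iff)
 from this[OF c] have real: "?z = of_real (Re ?z)" by (rule complex_of_real_Re_iff)
 have "Re ?z = wt y"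
 proof (cases y)
  case None
  have "?z = (\<Sum>a<m. cnj (u a) * u a)"
   unfolding Ob_def None
   by (intro sum.cong refl) (simp add: if_mult cong: if_cong)
  also have "... = of_real (\<Sum>i<m. (cmod (u i))\<^sup>2)" by (simp only: of_real_sum complex_norm_square mult.commute)
  finally have "?z = 1" using u by simp
  then show ?thesis using None by (simp add: wt_def)
 next
  case (Some x)
  have "?z = (\<Sum>a<m. \<Sum>b<m. Q x a b * P b a)"
   unfolding Ob_def Some by (intro sum.cong refl) (simp add: P)
  then show ?thesis by (simp add: wt_def Some)
 qed
 then show ?thesis using real by simp
qed

lemma CO_ge_1: "1 <= CO"
proof -
 have "0 <= (\<Sum>y\<in>outs. \<Sum>a<m. \<Sum>b<m. cmod (Ob y a b) / wt y)"
  by (intro sum_nonneg divide_nonneg_pos wt_pos) auto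
 then show ?thesis by (simp add: CO_def)
qed

lemma Ob_bound: "y : outs ==> a < m ==> b < m ==> cmod (Ob y a b) <= CO * wt y"
proof -
 assume y: "y : outs" and ab: "a < m" "b < m"
 have nn: "0 <= cmod (Ob y' a b) / wt y'" if "y' : outs" for y' a b using wt_pos[OF that] by simp
 have "cmod (Ob y a b) / wt y <= (\<Sum>b<m. cmod (Ob y a b) / wt y)"
  by (rule member_le_sum) (use ab nn[OF y] in auto)
 also have "... <= (\<Sum>a<m. \<Sum>b<m. cmod (Ob y a b) / wt y)"
  by (rule member_le_sum) (use ab nn[OF y] in "auto intro: sum_nonneg")
 also have "... <= (\<Sum>y\<in>outs. \<Sum>a<m. \<Sum>b<m. cmod (Ob y a b) / wt y)"
  by (rule member_le_sum[OF y]) (use nn finite_outs in "auto intro!: sum_nonneg")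
 also have "... <= CO" by (simp add: CO_def)
 finally show ?thesis using wt_pos[OF y] by (simp add: divide_le_eq)
qed

end

text \<open>Set to 0 on infinite sets, where the alternating sum has no meaning. Both potentials, at
  finite and at infinite inverse temperature, have this form, so locality and shift invariance are
  shown for it once.\<close>

definition fmob :: "('d site set => ('d site => 'y) => real) => 'd site set => ('d site => 'y) => real" where
 "fmob h B y = (if finite B then mob (%D. h D y) B else 0)"

lemma fmob_cong: "(!!D. D \<subseteq> B ==> h D y = k D y') ==> fmob h B y = fmob k B y'"
 unfolding fmob_def by (auto intro: mob_cong)

lemma fmob_0: "(!!D. finite D ==> h D y = 0) ==> fmob h B y = 0"
 unfolding fmob_def mob_def by (auto intro!: sum.neutral dest: finite_subset)

lemma fmob_shift:
 assumes "!!D. finite D ==> h (shift a ` D) y = h D (y o shift a)"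
 shows "fmob h (shift a ` B) y = fmob h B (y o shift a)"
proof -
 have "finite (shift a ` B) \<longleftrightarrow> finite B" by (rule finite_image_iff) (rule inj_on_subset[OF inj_shift subset_UNIV])
 then show ?thesis
  unfolding fmob_def mob_image[OF inj_shift] by (auto intro!: mob_cong assms dest: finite_subset)
qed

text \<open>\<open>\<beta>0\<close> is the least slab thickness. Thicknesses up to
  \<open>2 * \<beta>0\<close> occur, so \<open>Lg\<close> needs the gap at the lower end and
  \<open>bk\<close> the smallness of the perturbation at the upper one, whence 4 instead of
  2.\<close>

locale restricted_state = gapped_model m P u \<Phi>0 \<Upsilon> r g + observable m P u spX Q
 for m P u and \<Phi>0 \<Upsilon> :: "'d::finite site set => 'd op" and r g spX Q +
 fixes \<kappa> \<beta>0 L :: real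
 assumes norm: "int_norm m \<kappa> \<Upsilon> <= 1" and L: "0 <= L" and \<beta>0: "0 < \<beta>0"
  and Lg: "real (ball_bound TYPE('d) r) * L <= \<beta>0 * g" and L\<kappa>: "real (ball_bound TYPE('d) r) * L <= \<kappa>"
  and bk: "4 * \<beta>0 <= exp (\<kappa> - real (ball_bound TYPE('d) r) * L)"
  and small: "4 * exp (1 - L) * CO * real m ^ 4 * 4 ^ 2 * 2 ^ (2 * (site_degree TYPE('d) + 4) + 2) <= 1"
begin

definition \<Phi> :: "'d site set => 'd op" where
 "\<Phi> = (%A s t. \<Phi>0 A s t + \<Upsilon> A s t)"

lemma int\<Phi>: "interaction m \<Phi>"
 unfolding \<Phi>_def by (rule interaction_add[OF int0 intU])

lemma spacetime:
 assumes n: "1 <= n" and t: "\<beta>0 <= t" "t <= 2 * \<beta>0"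
 shows "spacetime_small m u n (slabK m \<Phi> P t) (4 * exp (1 - L)) Ob wt outs CO"
proof
 show "cmod (slabK m \<Phi> P t A s q) <= (4 * exp (1 - L)) ^ card A"
  if "finite A" "s : confs m A" "q : confs m A" for A s q
  unfolding \<Phi>_def
 proof (rule slabK_bound[OF norm that(1) _ L _ L\<kappa> _ that(2,3)])
  have "\<beta>0 * g <= t * g" using t g by simp
  then show "real (ball_bound TYPE('d) r) * L <= t * g" using Lg by linarith
 qed (use t \<beta>0 bk in auto)
 show "slabK m \<Phi> P t (A Un B) s q = slabK m \<Phi> P t A (restr s A) (restr q A) * slabK m \<Phi> P t B (restr s B) (restr q B)"
  if "finite A" "finite B" "A Int B = {}" "!!a b. a : A ==> b : B ==> l1dist a b ~= 1" "s : confs m (A Un B)" "q : confs m (A Un B)" for A B s q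
  by (rule slabK_Un[OF int\<Phi> that])
 show "slabK m \<Phi> P t (shift a ` A) s q = slabK m \<Phi> P t A (s o shift a) (q o shift a)"
  if "finite A" "s : confs m (shift a ` A)" "q : confs m (shift a ` A)" for a A s q
  by (rule slabK_shift[OF int\<Phi> that(2,3)])
 show "slabK m \<Phi> P t {} (%_. 0) (%_. 0) = 1" by (rule slabK_empty[OF int\<Phi>])
qed (use u n finite_outs wt_pos Ob_u Ob_bound CO_ge_1 small in auto)

definition OL :: "'d site set => ('d site => real option) => 'd op" where
 "OL D y = prodop D (%i. Ob (y i))"

definition E :: "real => 'd site set => 'd op" where
 "E b D = mexp (confs m D) (- of_real b) (ham \<Phi> D)"

definition tr :: "real => 'd site set => ('d site => real option) => complex" where
 "tr b D y = mtrace (confs m D) (mmul (confs m D) (E b D) (OL D y))"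

text \<open>The probability of the outcomes relative to the product vacuum state. It equals the
  ratio of the polymer partition functions with and without labels.\<close>

definition wgt :: "real => 'd site set => ('d site => real option) => real" where
 "wgt b D y = Re (tr b D y / mtrace (confs m D) (E b D)) / (\<Prod>i\<in>D. wt (y i))"

definition lw :: "real => 'd site set => ('d site => real option) => real" where
 "lw b D y = ln (wgt b D y)"

definition GG :: "real => 'd site set => ('d site => real option) => real" where
 "GG b B y = (if finite B then mob (%D. lw b D y) B else 0)"

lemma tr_eq: "tr b D y = (\<Sum>s\<in>confs m D. \<Sum>t\<in>confs m D. E b D s t * (\<Prod>i\<in>D. Ob (y i) (t i) (s i)))"
 by (simp add: tr_def mtrace_def mmul_def OL_def prodop_def)

lemma tr_local: "(!!i. i : D ==> y i = y' i) ==> tr b D y = tr b D y'"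
 unfolding tr_eq by (simp cong: prod.cong)

lemma wgt_local: "(!!i. i : D ==> y i = y' i) ==> wgt b D y = wgt b D y'"
 unfolding wgt_def using tr_local[of D y y' b] by (simp cong: prod.cong)

lemma tr_None:
 assumes "finite D"
 shows "tr b D (%_. None) = mtrace (confs m D) (E b D)"
 unfolding tr_def
proof (rule mtrace_cong)
 fix p assume s: "p : confs m D"
 have "mmul (confs m D) (E b D) (OL D (%_. None)) p p = mmul (confs m D) (E b D) idm p p"
 proof (rule mmul_cong[OF refl])
  fix q assume t: "q : confs m D"
  show "OL D (%_. None) q p = idm q p" unfolding OL_def using prodop_idm[OF assms t s] by (simp add: Ob_def)
 qed
 also have "... = E b D p p" by (rule mmul_idm_right[OF finite_confs[OF assms] s])
 finally show "mmul (confs m D) (E b D) (OL D (%_. None)) p p = E b D p p" .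
qed

lemma ham\<Phi>_herm: "finite D ==> herm (confs m D) (ham \<Phi> D)"
 by (rule ham_herm[OF int\<Phi>])

lemma trE:
 assumes "finite D"
 shows "0 < Re (mtrace (confs m D) (E b D))" "Im (mtrace (confs m D) (E b D)) = 0"
 unfolding E_def
 by (rule mtrace_mexp_pos[OF finite_confs[OF assms] confs_nonempty[OF m_pos] ham\<Phi>_herm[OF assms]])+

lemma trE_real: "finite D ==> mtrace (confs m D) (E b D) = of_real (Re (mtrace (confs m D) (E b D)))"
 by (rule complex_of_real_Re_iff[OF trE(2)])

lemma OL_herm: "ALL i. y i : outs ==> herm (confs m D) (OL D y)"
 unfolding OL_def by (rule prodop_herm) (rule Ob_herm, blast)

text \<open>The Gibbs operator is the square of \<open>?K\<close> and the measured operator is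
  idempotent, so the trace is a squared Hilbert-Schmidt norm.\<close>

lemma tr_nonneg:
 assumes D: "finite D" and y: "ALL i. y i : outs"
 shows "0 <= Re (tr b D y)" "Im (tr b D y) = 0"
proof -
 let ?S = "confs m D" and ?K = "mexp (confs m D) (of_real (- (b / 2))) (ham \<Phi> D)"
 have S: "finite ?S" by (rule finite_confs[OF D])
 have "tr b D y = mtrace ?S (mmul ?S (mmul ?S ?K ?K) (mmul ?S (OL D y) (OL D y)))"
  unfolding tr_def
 proof (rule mtrace_cong, rule mmul_cong)
  fix x z assume x: "x : ?S" "z : ?S"
  show "E b D x z = mmul ?S ?K ?K x z" unfolding E_def by (rule mexp_half[OF S x])
  show "OL D y z x = mmul ?S (OL D y) (OL D y) z x"
   unfolding OL_def by (rule prodop_mult_cong[OF D x(2,1), symmetric]) (rule Ob_idem[OF spec[OF y]])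
 qed
 also have "... = of_real (\<Sum>x\<in>?S. \<Sum>z\<in>?S. (cmod (mmul ?S ?K (OL D y) x z))\<^sup>2)"
  by (rule mtrace_squares[OF herm_mexp[OF S ham\<Phi>_herm[OF D]] OL_herm[OF y]])
 finally have e: "tr b D y = of_real (\<Sum>x\<in>?S. \<Sum>z\<in>?S. (cmod (mmul ?S ?K (OL D y) x z))\<^sup>2)" .
 show "0 <= Re (tr b D y)" unfolding e by (simp add: sum_nonneg)
 show "Im (tr b D y) = 0" unfolding e by simp
qed

lemma wgt_real:
 assumes D: "finite D" and y: "ALL i. y i : outs"
 shows "wgt b D y = Re (tr b D y) / Re (mtrace (confs m D) (E b D)) / (\<Prod>i\<in>D. wt (y i))"
proof -
 have "tr b D y = of_real (Re (tr b D y))" by (rule complex_of_real_Re_iff[OF tr_nonneg(2)[OF D y]])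
 then have "tr b D y / mtrace (confs m D) (E b D) = of_real (Re (tr b D y) / Re (mtrace (confs m D) (E b D)))"
  using trE_real[OF D, of b] by (metis of_real_divide)
 then show ?thesis unfolding wgt_def by simp
qed

lemma wt_prod_pos: "ALL i. y i : outs ==> 0 < (\<Prod>i\<in>D. wt (y i))"
 by (intro prod_pos wt_pos) blast

text \<open>With \<open>n\<close> the integer part of \<open>b / \<beta>0\<close>, the thickness
  \<open>b / n\<close> lies between \<open>\<beta>0\<close> and \<open>2 * \<beta>0\<close>. The
  constants of the gas thus serve all larger \<open>b\<close> at once.\<close>

lemma slices:
 assumes "\<beta>0 <= b"
 obtains n t where "1 <= n" "\<beta>0 <= t" "t <= 2 * \<beta>0" "b = real n * t"
proof -
 define n where "n = nat \<lfloor>b / \<beta>0\<rfloor>"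
 have b1: "1 <= b / \<beta>0" using assms \<beta>0 by simp
 then have f1: "1 <= \<lfloor>b / \<beta>0\<rfloor>" by (simp add: le_floor_iff)
 then have n1: "1 <= n" by (simp add: n_def nat_le_iff le_nat_iff)
 have rn: "real n = of_int \<lfloor>b / \<beta>0\<rfloor>" using f1 by (simp add: n_def)
 have "real n <= b / \<beta>0" "b / \<beta>0 < real n + 1" unfolding rn by linarith+
 then have le: "real n * \<beta>0 <= b" "b <= (real n + 1) * \<beta>0" using \<beta>0 by (simp_all add: field_simps)
 have "(real n + 1) * \<beta>0 <= 2 * real n * \<beta>0" using n1 \<beta>0 by (intro mult_right_mono) auto
 then show ?thesis using n1 le
  by (intro that[of n "b / real n"]) (auto simp: field_simps)
qed

lemma ZZ_tr:
 assumes n: "1 <= n" and t: "\<beta>0 <= t" "t <= 2 * \<beta>0" and D: "finite D" and y: "ALL i. y i : outs"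
 shows "spacetime.ZZ m u n (slabK m \<Phi> P t) Ob wt (D \<times> {..<n}) y = tr (real n * t) D y / of_real (\<Prod>i\<in>D. wt (y i))"
proof -
 interpret spacetime_small m u n "slabK m \<Phi> P t" "4 * exp (1 - L)" Ob wt outs CO by (rule spacetime[OF n t])
 let ?S = "confs m D" and ?T = "E t D"
 have S: "finite ?S" by (rule finite_confs[OF D])
 have "ZZ (D \<times> {..<n}) y = (\<Sum>s\<in>?S. \<Sum>q\<in>?S. mpow ?S ?T n s q * (\<Prod>i\<in>D. Ob (y i) (q i) (s i))) / (\<Prod>i\<in>D. of_real (wt (y i)))"
  unfolding ZZ_def
 proof (rule sum_poly[OF D spec[OF y]])
  fix s q assume st: "s : ?S" "q : ?S"
  have "?T s q = (\<Sum>A\<in>Pow D. slabK m \<Phi> P t A (restr s A) (restr q A) * (\<Prod>i\<in>D - A. P (s i) (q i)))"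
   unfolding E_def by (rule slab_decomposition[OF D st])
  also have "... = (\<Sum>A\<in>Pow D. slabK m \<Phi> P t A (restr s A) (restr q A) * (\<Prod>i\<in>D - A. u (s i) * cnj (u (q i))))"
   by (intro sum.cong refl arg_cong2[where f = times] prod.cong P) (use st in "auto simp: confs_def")
  finally show "?T s q = (\<Sum>A\<in>Pow D. slabK m \<Phi> P t A (restr s A) (restr q A) * (\<Prod>i\<in>D - A. u (s i) * cnj (u (q i))))" .
 qed
 also have "(\<Sum>s\<in>?S. \<Sum>q\<in>?S. mpow ?S ?T n s q * (\<Prod>i\<in>D. Ob (y i) (q i) (s i))) = tr (real n * t) D y"
  unfolding tr_eq
 proof (intro sum.cong refl arg_cong2[where f = times])
  fix s q assume st: "s : ?S" "q : ?S"
  have "mexp ?S (of_nat n * (- of_real t)) (ham \<Phi> D) s q = mpow ?S (mexp ?S (- of_real t) (ham \<Phi> D)) n s q"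
   by (rule mexp_power[OF S st])
  moreover have "of_nat n * (- of_real t) = (- of_real (real n * t) :: complex)" by simp
  ultimately show "mpow ?S ?T n s q = E (real n * t) D s q" unfolding E_def by (simp only:)
 qed
 finally show ?thesis by (simp only: of_real_prod)
qed

text \<open>Nonnegativity comes from the square form of the trace, nonvanishing from the convergent
  expansion.\<close>

lemma tr_pos:
 assumes b: "\<beta>0 <= b" and D: "finite D" and y: "ALL i. y i : outs"
 shows "0 < Re (tr b D y)"
proof -
 obtain n t where nt: "1 <= n" "\<beta>0 <= t" "t <= 2 * \<beta>0" "b = real n * t" by (rule slices[OF b])
 interpret spacetime_small m u n "slabK m \<Phi> P t" "4 * exp (1 - L)" Ob wt outs CO by (rule spacetime[OF nt(1-3)])
 let ?y = "%i. if i : D then y i else None"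
 have y': "ALL i. ?y i : outs" using y by simp
 have "?y : fields outs D" using y by (auto simp: fields_def)
 then have "ZZ (D \<times> {..<n}) ?y ~= 0" using D by (intro ZZ_nonzero) auto
 then have "tr b D ?y ~= 0" unfolding ZZ_tr[OF nt(1-3) D y'] nt(4) by auto
 moreover have "tr b D ?y = tr b D y" by (rule tr_local) simp
 ultimately have "tr b D y ~= 0" by simp
 then have "Re (tr b D y) ~= 0" using tr_nonneg(2)[OF D y] by (auto simp: complex_eq_iff)
 then show ?thesis using tr_nonneg(1)[OF D y, of b] by linarith
qed

lemma wgt_pos:
 assumes b: "\<beta>0 <= b" and D: "finite D" and y: "ALL i. y i : outs"
 shows "0 < wgt b D y"
 unfolding wgt_real[OF D y] using tr_pos[OF assms] trE(1)[OF D] wt_prod_pos[OF y] by simp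

text \<open>For the chosen slicing of \<open>b\<close>, the logarithm \<open>g\<close> of the gas
  coincides with \<open>lw\<close>. So \<open>g_bound\<close> applies with its constant 16, which
  depends neither on \<open>b\<close> nor on the volume.\<close>

lemma GG_bound:
 assumes b: "\<beta>0 <= b" and D: "finite D" and y: "!!B i. yB B i : outs"
 shows "(\<Sum>B | B \<subseteq> D & i : B. 2 ^ card B * \<bar>GG b B (yB B)\<bar>) <= 16"
proof -
 obtain n t where nt: "1 <= n" "\<beta>0 <= t" "t <= 2 * \<beta>0" "b = real n * t" by (rule slices[OF b])
 interpret S: spacetime_small m u n "slabK m \<Phi> P t" "4 * exp (1 - L)" Ob wt outs CO by (rule spacetime[OF nt(1-3)])
 have g: "S.g B y = lw b B y" if B: "finite B" and y: "ALL i. y i : outs" for B y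
 proof -
  have c: "cmod (S.ZZ (B \<times> {..<n}) y) = Re (tr b B y) / (\<Prod>i\<in>B. wt (y i))" if y: "ALL i. y i : outs" for y
  proof -
   have "tr b B y = of_real (Re (tr b B y))" by (rule complex_of_real_Re_iff[OF tr_nonneg(2)[OF B y]])
   then have "cmod (tr b B y) = Re (tr b B y)" using tr_nonneg(1)[OF B y] by (metis abs_of_nonneg norm_of_real)
   then show ?thesis
    unfolding ZZ_tr[OF nt(1-3) B y] nt(4)[symmetric] norm_divide norm_of_real using wt_prod_pos[OF y, of B] by simp
  qed
  have N: "cmod (S.ZZ (B \<times> {..<n}) (%_. None)) = Re (mtrace (confs m B) (E b B))"
   by (subst c) (simp_all add: tr_None[OF B] wt_def)
  show ?thesis
   unfolding S.g_def N c[OF y] lw_def wgt_real[OF B y]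
   using tr_pos[OF b B y] trE(1)[OF B, of b] wt_prod_pos[OF y, of B] by (simp add: ln_div ln_mult)
 qed
 have "GG b B (yB B) = mob (%D. S.g D (yB B)) B" if "B \<subseteq> D" for B
 proof -
  have B: "finite B" by (rule finite_subset[OF that D])
  have "mob (%D. S.g D (yB B)) B = mob (%D. lw b D (yB B)) B"
  proof (rule mob_cong)
   fix D' assume "D' \<subseteq> B"
   then have D': "finite D'" by (rule finite_subset[OF _ B])
   show "S.g D' (yB B) = lw b D' (yB B)" by (rule g[OF D']) (use y in blast)
  qed
  then show ?thesis by (simp add: GG_def B)
 qed
 then have "(\<Sum>B | B \<subseteq> D & i : B. 2 ^ card B * \<bar>GG b B (yB B)\<bar>) = (\<Sum>B | B \<subseteq> D & i : B. 2 ^ card B * \<bar>mob (%D. S.g D (yB B)) B\<bar>)"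
  by (intro sum.cong) auto
 also have "... <= 16" by (rule S.g_bound[OF D y])
 finally show ?thesis .
qed

lemma lw_local: "(!!i. i : D ==> y i = y' i) ==> lw b D y = lw b D y'"
 unfolding lw_def using wgt_local[of D y y' b] by simp

lemma lw_None: "finite D ==> lw b D (%_. None) = 0"
 unfolding lw_def wgt_def using trE(1)[of D b] by (auto simp: tr_None wt_def)

lemma tr_shift: "tr b (shift a ` D) y = tr b D (y o shift a)"
proof -
 let ?S = "confs m (shift a ` D)" and ?f = "%s. s o shift a"
 let ?h = "%s t. E b D s t * (\<Prod>i\<in>D. Ob ((y o shift a) i) (t i) (s i))"
 have "tr b (shift a ` D) y = (\<Sum>s\<in>?S. \<Sum>t\<in>?S. ?h (?f s) (?f t))"
  unfolding tr_eq
 proof (intro sum.cong refl arg_cong2[where f = times])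
  fix s t assume "s : ?S" "t : ?S"
  then show "E b (shift a ` D) s t = E b D (?f s) (?f t)" unfolding E_def by (rule mexp_shift_ham[OF int\<Phi>])
  show "(\<Prod>i\<in>shift a ` D. Ob (y i) (t i) (s i)) = (\<Prod>i\<in>D. Ob ((y o shift a) i) (?f t i) (?f s i))"
   by (subst prod.reindex) (auto intro: inj_on_subset[OF inj_shift])
 qed
 also have "... = (\<Sum>s\<in>?S. \<Sum>t\<in>confs m D. ?h (?f s) t)"
  by (intro sum.cong refl sum.reindex_bij_betw[OF bij_confs_shift])
 also have "... = (\<Sum>s\<in>confs m D. \<Sum>t\<in>confs m D. ?h s t)"
  by (rule sum.reindex_bij_betw[OF bij_confs_shift])
 finally show ?thesis unfolding tr_eq .
qed

lemma lw_shift: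
 assumes D: "finite D"
 shows "lw b (shift a ` D) y = lw b D (y o shift a)"
proof -
 have sD: "finite (shift a ` D)" using D by simp
 have "tr b D ((%_. None) o shift a) = tr b D (%_. None)" by (rule tr_local) simp
 then have "mtrace (confs m (shift a ` D)) (E b (shift a ` D)) = mtrace (confs m D) (E b D)"
  using tr_shift[of b a D "%_. None"] by (simp only: tr_None[OF D] tr_None[OF sD])
 moreover have "(\<Prod>i\<in>shift a ` D. wt (y i)) = (\<Prod>i\<in>D. wt ((y o shift a) i))"
  by (subst prod.reindex) (auto intro: inj_on_subset[OF inj_shift])
 ultimately show ?thesis unfolding lw_def wgt_def tr_shift by (simp only:)
qed

lemma sum_GG: "finite D ==> (\<Sum>B\<in>Pow D. GG b B y) = lw b D y"
proof -
 assume D: "finite D"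
 have "(\<Sum>B\<in>Pow D. GG b B y) = (\<Sum>B\<in>Pow D. mob (%D. lw b D y) B)"
  by (intro sum.cong refl) (auto simp: GG_def finite_subset[OF _ D])
 then show ?thesis using sum_mob[OF D, of "%D. lw b D y"] by simp
qed

lemma QV_OL:
 assumes V: "V \<subseteq> D" "finite D"
 shows "QV Q V e D s t = OL D (fld V e) s t"
proof -
 have "OL D (fld V e) = prodop D (%i. if i : V then Q (e i) else idm)"
  unfolding OL_def by (rule arg_cong[where f = "prodop D"]) (auto simp: fld_def Ob_def)
 also have "... = embed D V (prodop V (%i. Q (e i)))" by (rule embed_prodop[OF V(2,1), symmetric])
 finally have "OL D (fld V e) s t = embed D V (prodop V (%i. Q (e i))) s t" by simp
 moreover have "prodop V (%i. Q (e i)) (restr s V) (restr t V) = (\<Prod>i\<in>V. Q (e i) (s i) (t i))"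
  unfolding prodop_def by (intro prod.cong) (auto simp: restr_def)
 ultimately show ?thesis unfolding QV_def embed_def by simp
qed

abbreviation c :: "real => real" where "c x \<equiv> wt (Some x)"

text \<open>Sites outside \<open>V\<close> contribute the identity operator and the weight 1;
  exponentiating the Moebius inversion of \<open>lw\<close> gives the product form.\<close>

lemma mu_fin_fvw:
 assumes b: "\<beta>0 <= b" and V: "V \<subseteq> D" "finite D" and e: "!!j. j : V ==> e j : spX"
 shows "mu_fin m \<Phi> Q b D V e = fvw c (GG b) D V e"
proof -
 have y: "ALL i. fld V e i : outs" using e by (auto simp: fld_def)
 have "mtrace (confs m D) (mmul (confs m D) (E b D) (QV Q V e D)) = tr b D (fld V e)"
  unfolding tr_def by (intro mtrace_cong mmul_cong refl) (rule QV_OL[OF V])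
 then have 1: "mu_fin m \<Phi> Q b D V e = Re (tr b D (fld V e) / mtrace (confs m D) (E b D))"
  unfolding mu_fin_def gibbs_state_def Let_def E_def[symmetric] by simp
 have "(\<Prod>i\<in>D. wt (fld V e i)) = (\<Prod>i\<in>V. wt (fld V e i))"
  by (rule prod.mono_neutral_right) (use V in "auto simp: fld_def wt_def")
 also have "... = (\<Prod>i\<in>V. c (e i))" by (rule prod.cong) (auto simp: fld_def)
 finally have 2: "(\<Prod>i\<in>D. wt (fld V e i)) = (\<Prod>i\<in>V. c (e i))" .
 have "fvw c (GG b) D V e = (\<Prod>i\<in>V. c (e i)) * wgt b D (fld V e)"
  unfolding fvw_def sum_GG[OF V(2)] lw_def using wgt_pos[OF b V(2) y] by simp
 also have "... = Re (tr b D (fld V e) / mtrace (confs m D) (E b D))"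
  unfolding wgt_def 2[symmetric] using wt_prod_pos[OF y, of D] by simp
 finally show ?thesis using 1 by simp
qed

lemma sum_QV:
 assumes V: "finite D" "V \<subseteq> D" "i : D" "i ~: V" and st: "s : confs m D" "t : confs m D"
 shows "(\<Sum>a\<in>spX. QV Q (insert i V) (e(i := a)) D s t) = QV Q V e D s t"
proof -
 have fV: "finite V" by (rule finite_subset[OF V(2,1)])
 let ?p = "\<Prod>j\<in>V. Q (e j) (s j) (t j)" and ?d = "if ALL j:D - insert i V. s j = t j then 1 else 0 :: complex"
 have "QV Q (insert i V) (e(i := a)) D s t = Q a (s i) (t i) * (?p * ?d)" for a
 proof -
  have "(\<Prod>j\<in>insert i V. Q ((e(i := a)) j) (s j) (t j)) = Q a (s i) (t i) * ?p"
   using fV V(4) by (subst prod.insert) (auto intro!: prod.cong)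
  then show ?thesis unfolding QV_def by (simp only: mult.assoc)
 qed
 then have "(\<Sum>a\<in>spX. QV Q (insert i V) (e(i := a)) D s t) = (\<Sum>a\<in>spX. Q a (s i) (t i)) * (?p * ?d)"
  by (simp only: sum_distrib_right)
 also have "(\<Sum>a\<in>spX. Q a (s i) (t i)) = (if s i = t i then 1 else 0)"
  by (rule Q_sum) (use st V(3) in "auto simp: confs_def")
 also have "(if s i = t i then 1 else 0) * (?p * ?d) = ?p * (if ALL j:D - V. s j = t j then 1 else 0)"
 proof -
  have "(ALL j:D - V. s j = t j) \<longleftrightarrow> s i = t i & (ALL j:D - insert i V. s j = t j)" using V by auto
  then show ?thesis by simp
 qed
 finally show ?thesis by (simp add: QV_def)
qed

text \<open>The spectral projections at the site \<open>i\<close> sum to the identity there.\<close>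

lemma mu_fin_cons:
 assumes V: "finite D" "V \<subseteq> D" "i : D" "i ~: V"
 shows "(\<Sum>a\<in>spX. mu_fin m \<Phi> Q b D (insert i V) (e(i := a))) = mu_fin m \<Phi> Q b D V e"
proof -
 let ?S = "confs m D"
 have "(\<Sum>a\<in>spX. mtrace ?S (mmul ?S (E b D) (QV Q (insert i V) (e(i := a)) D)))
  = mtrace ?S (mmul ?S (E b D) (%s t. \<Sum>a\<in>spX. QV Q (insert i V) (e(i := a)) D s t))"
  unfolding mmul_sum_right mtrace_def by (rule sum.swap)
 also have "... = mtrace ?S (mmul ?S (E b D) (QV Q V e D))"
  by (intro mtrace_cong mmul_cong refl sum_QV[OF V])
 finally show ?thesis
  unfolding mu_fin_def gibbs_state_def Let_def E_def[symmetric] by (simp only: Re_sum[symmetric] sum_divide_distrib[symmetric])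
qed

theorem gibbs_data_beta:
 assumes b: "\<beta>0 <= b"
 shows "gibbs_data spX c (GG b) 16"
proof
 show "finite spX" "spX ~= {}" by (rule spX)+
 show "0 < c a" if "a : spX" for a using that by (intro wt_pos) simp
 have G: "GG b = fmob (lw b)" by (intro ext) (simp add: GG_def fmob_def)
 show "GG b B y = GG b B y'" if "!!i. i : B ==> y i = y' i" for B y y'
  unfolding G by (intro fmob_cong lw_local) (use that in blast)
 show "GG b B (%_. None) = 0" for B unfolding G by (intro fmob_0 lw_None)
 show "GG b (shift a ` B) y = GG b B (y o shift a)" for a B y unfolding G by (intro fmob_shift lw_shift)
 show "(\<Sum>B | B \<subseteq> L & i : B. 2 ^ card B * \<bar>GG b B (yB B)\<bar>) <= 16"
  if "finite L" "!!B j. yB B j : outs" for L i yB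
  by (rule GG_bound[OF b that])
 show "(\<Sum>a\<in>spX. fvw c (GG b) L (insert i V) (e(i := a))) = fvw c (GG b) L V e"
  if V: "finite L" "V \<subseteq> L" "i : L" "i ~: V" and e: "!!j. j : V ==> e j : spX" for L i V e
 proof -
  have "fvw c (GG b) L (insert i V) (e(i := a)) = mu_fin m \<Phi> Q b L (insert i V) (e(i := a))" if "a : spX" for a
   by (rule mu_fin_fvw[OF b _ V(1), symmetric]) (use V e that in auto)
  then have "(\<Sum>a\<in>spX. fvw c (GG b) L (insert i V) (e(i := a))) = (\<Sum>a\<in>spX. mu_fin m \<Phi> Q b L (insert i V) (e(i := a)))"
   by (intro sum.cong refl)
  also have "... = mu_fin m \<Phi> Q b L V e" by (rule mu_fin_cons[OF V])
  also have "... = fvw c (GG b) L V e" by (rule mu_fin_fvw[OF b V(2,1)]) (use e in blast)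
  finally show ?thesis .
 qed
qed

lemma mu_fin_lim:
 assumes b: "\<beta>0 <= b" and V: "finite V" and e: "!!j. j : V ==> e j : spX"
 shows "((%D. mu_fin m \<Phi> Q b D V e) \<longlongrightarrow> gibbs_data.ivw c (GG b) V e) at_volume"
proof -
 interpret gibbs_data spX c "GG b" 16 by (rule gibbs_data_beta[OF b])
 have "eventually (%D. fvw c (GG b) D V e = mu_fin m \<Phi> Q b D V e) at_volume"
  by (rule eventually_mono[OF finite_subsets_at_top_superset[OF V]]) (use mu_fin_fvw[OF b] e in auto)
 with w_lim[of V e, OF V e] show ?thesis by (rule Lim_transform_eventually)
qed

theorem equilibrium_gibbsian:
 assumes b: "\<beta>0 <= b"
 shows "\<exists>\<mu>. classical_restriction_eq m \<Phi> spX Q b \<mu> & gibbsian spX \<mu>"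
proof -
 interpret gibbs_data spX c "GG b" 16 by (rule gibbs_data_beta[OF b])
 obtain \<mu> where \<mu>: "is_prob_on_Omega spX \<mu>" "gibbsian spX \<mu>"
  "!!V e. finite V ==> e : PiE V (%_. spX) ==> measure \<mu> (cyl spX V e) = ivw V e"
  using ex_gibbsian by blast
 have "((%D. mu_fin m \<Phi> Q b D V e) \<longlongrightarrow> measure \<mu> (cyl spX V e)) at_volume"
  if V: "finite V" "e : PiE V (%_. spX)" for V e
  unfolding \<mu>(3)[OF V] by (rule mu_fin_lim[OF b V(1)]) (use V in auto)
 then have "classical_restriction_eq m \<Phi> spX Q b \<mu>" using \<mu>(1) by (simp add: classical_restriction_eq_def)
 then show ?thesis using \<mu>(2) by blast
qed

end

section \<open>The zero temperature limit\<close>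

lemma weighted_tail:
 fixes h :: "'b => real" and s :: "'b => nat"
 assumes b: "!!F. finite F ==> F \<subseteq> T ==> (\<Sum>B\<in>F. 2 ^ s B * \<bar>h B\<bar>) <= C"
  and z: "!!B. B : T ==> B ~: K ==> h B = 0"
  and fin: "finite {B\<in>T Int K. s B <= R}"
 shows "\<bar>infsum h T - sum h {B\<in>T Int K. s B <= R}\<bar> <= C / 2 ^ R"
proof -
 let ?T = "{B\<in>T Int K. s B <= R}"
 have abs: "(%B. \<bar>h B\<bar>) summable_on T"
 proof (rule nonneg_bdd_above_summable_on)
  show "bdd_above (sum (%B. \<bar>h B\<bar>) ` {F. F \<subseteq> T & finite F})"
  proof (rule bdd_aboveI2)
   fix F assume F: "F : {F. F \<subseteq> T & finite F}"
   have "(\<Sum>B\<in>F. \<bar>h B\<bar>) <= (\<Sum>B\<in>F. 2 ^ s B * \<bar>h B\<bar>)"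
    by (intro sum_mono) (simp add: mult_le_cancel_right1)
   also have "... <= C" using b F by blast
   finally show "(\<Sum>B\<in>F. \<bar>h B\<bar>) <= C" .
  qed
 qed simp
 have sub: "?T \<subseteq> T" by blast
 have "(%B. norm (h B)) summable_on T" using abs by simp
 then have sh: "h summable_on T" by (rule abs_summable_summable)
 have absd: "(%B. \<bar>h B\<bar>) summable_on T - ?T" by (rule summable_on_subset_banach[OF abs]) blast
 have "infsum h T - sum h ?T = infsum h (T - ?T)"
  using infsum_Diff[OF sh _ sub] fin by (simp add: summable_on_finite)
 also have "\<bar>infsum h (T - ?T)\<bar> <= infsum (%B. \<bar>h B\<bar>) (T - ?T)"
  using norm_infsum_bound[of h "T - ?T"] absd by simp
 also have "... <= C / 2 ^ R"
 proof (rule infsum_le_finite_sums[OF absd])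
  fix F assume F: "finite F" "F \<subseteq> T - ?T"
  have "2 ^ R * (\<Sum>B\<in>F. \<bar>h B\<bar>) <= (\<Sum>B\<in>F. 2 ^ s B * \<bar>h B\<bar>)"
   unfolding sum_distrib_left
  proof (rule sum_mono)
   fix B assume B: "B : F"
   show "2 ^ R * \<bar>h B\<bar> <= 2 ^ s B * \<bar>h B\<bar>"
   proof (cases "B : K")
    case True
    then have "R <= s B" using B F by force
    then show ?thesis by (intro mult_right_mono power_increasing) auto
   next
    case False
    then have "h B = 0" using z B F by blast
    then show ?thesis by simp
   qed
  qed
  also have "... <= C" using b F by blast
  finally show "(\<Sum>B\<in>F. \<bar>h B\<bar>) <= C / 2 ^ R" by (simp add: field_simps)
 qed
 finally show ?thesis .
qed

text \<open>Dominated convergence for unordered sums: by the weight \<open>2 ^ s B\<close>, the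
  indices with \<open>s B\<close> above \<open>R\<close> contribute at most \<open>C / 2 ^ R\<close>
  for all parameters. Vanishing off \<open>K\<close> is what leaves a finite sum.\<close>

lemma infsum_limit:
 fixes f :: "real => 'b => real" and s :: "'b => nat"
 assumes lim: "!!B. B : T ==> ((%\<beta>. f \<beta> B) \<longlongrightarrow> l B) at_top"
  and b: "!!\<beta> F. bmin <= \<beta> ==> finite F ==> F \<subseteq> T ==> (\<Sum>B\<in>F. 2 ^ s B * \<bar>f \<beta> B\<bar>) <= C"
  and z: "!!\<beta> B. bmin <= \<beta> ==> B : T ==> B ~: K ==> f \<beta> B = 0"
  and fin: "!!R. finite {B\<in>T Int K. s B <= R}"
 shows "((%\<beta>. infsum (f \<beta>) T) \<longlongrightarrow> infsum l T) at_top"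
proof -
 have ev: "eventually (%\<beta>. bmin <= \<beta>) at_top" by (rule eventually_ge_at_top)
 have bl: "(\<Sum>B\<in>F. 2 ^ s B * \<bar>l B\<bar>) <= C" if F: "finite F" "F \<subseteq> T" for F
 proof (rule tendsto_upperbound)
  show "((%\<beta>. \<Sum>B\<in>F. 2 ^ s B * \<bar>f \<beta> B\<bar>) \<longlongrightarrow> (\<Sum>B\<in>F. 2 ^ s B * \<bar>l B\<bar>)) at_top"
   using F(2) by (intro tendsto_sum tendsto_mult_left tendsto_rabs lim) blast
  show "eventually (%\<beta>. (\<Sum>B\<in>F. 2 ^ s B * \<bar>f \<beta> B\<bar>) <= C) at_top"
   using ev by eventually_elim (rule b[OF _ F])
 qed simp
 have zl: "l B = 0" if "B : T" "B ~: K" for B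
 proof (rule tendsto_unique[OF _ lim[OF that(1)]])
  have "eventually (%\<beta>. 0 = f \<beta> B) at_top" using ev by eventually_elim (simp add: z that)
  then show "((%\<beta>. f \<beta> B) \<longlongrightarrow> 0) at_top" by (rule Lim_transform_eventually[OF tendsto_const])
 qed simp
 have C0: "0 <= C" using bl[of "{}"] by simp
 show ?thesis
 proof (rule tendstoI)
  fix e :: real assume e: "0 < e"
  obtain R :: nat where R: "3 * C / e < 2 ^ R" using real_arch_pow[of 2 "3 * C / e"] by auto
  then have CR: "C / 2 ^ R < e / 3" using e by (simp add: field_simps)
  let ?T = "{B\<in>T Int K. s B <= R}"
  have "((%\<beta>. sum (f \<beta>) ?T) \<longlongrightarrow> sum l ?T) at_top" by (intro tendsto_sum lim) blast
  then have "eventually (%\<beta>. dist (sum (f \<beta>) ?T) (sum l ?T) < e / 3) at_top" by (rule tendstoD) (use e in simp)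
  then show "eventually (%\<beta>. dist (infsum (f \<beta>) T) (infsum l T) < e) at_top"
   using ev
  proof eventually_elim
   case (elim \<beta>)
   have "\<bar>infsum (f \<beta>) T - sum (f \<beta>) ?T\<bar> <= C / 2 ^ R"
    by (rule weighted_tail[OF b[OF elim(2)] z[OF elim(2)] fin])
   moreover have "\<bar>infsum l T - sum l ?T\<bar> <= C / 2 ^ R"
    by (rule weighted_tail[OF bl zl fin])
   ultimately show ?case using elim(1) CR unfolding dist_real_def by linarith
  qed
 qed
qed

lemma l1dist_triangle: "l1dist i k <= l1dist i j + l1dist j k"
 unfolding l1dist_def sum.distrib[symmetric] by (intro sum_mono) simp

text \<open>Along a path of nearest neighbours in \<open>B\<close> the distance to \<open>i\<close>
  grows by at most one per step, so on points of \<open>B\<close> it takes every value from 0 to the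
  distance of \<open>j\<close>.\<close>

lemma connected_l1dist:
 assumes B: "finite B" "connected_Zd B" and ij: "i : B" "j : B"
 shows "l1dist i j < int (card B)"
proof -
 have "(i, j) : {(u, v). u : B & v : B & l1dist u v = 1}\<^sup>*" using B ij unfolding connected_Zd_def by blast
 then have "{0..l1dist i j} \<subseteq> l1dist i ` B"
 proof (induction rule: rtrancl_induct)
  case base
  have "l1dist i i = 0" by (simp add: l1dist_def)
  then show ?case using ij(1) by (auto intro!: image_eqI[of _ _ i])
 next
  case (step y z)
  then have yz: "z : B" "l1dist y z = 1" by auto
  then have "l1dist i z <= l1dist i y + 1" using l1dist_triangle[of i z y] by simp
  then have "{0..l1dist i z} \<subseteq> insert (l1dist i z) {0..l1dist i y}" by auto
  then show ?case using step.IH yz(1) by auto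
 qed
 then have "card {0..l1dist i j} <= card (l1dist i ` B)" using B(1) by (intro card_mono) auto
 also have "... <= card B" by (rule card_image_le[OF B(1)])
 finally show ?thesis by simp
qed

lemma finite_connected: "finite {B :: 'd::finite site set. finite B & connected_Zd B & i : B & card B <= R}"
proof (rule finite_subset)
 show "{B. finite B & connected_Zd B & i : B & card B <= R} \<subseteq> Pow {j. l1dist i j <= int R}"
  using connected_l1dist[of _ i] by fastforce
 show "finite (Pow {j :: 'd site. l1dist i j <= int R})" by (simp add: finite_l1_ball)
qed

lemma sum_confs_product:
 assumes d: "A Int B = {}"
 shows "(\<Sum>s\<in>confs m (A Un B). f (restr s A) * h (restr s B)) = (\<Sum>s\<in>confs m A. f s) * (\<Sum>s\<in>confs m B. (h s :: complex))"
proof -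
 have e: "A Un B - A = B" using d by blast
 have "(\<Sum>s\<in>confs m (A Un B). f (restr s A) * h (restr s B)) = (\<Sum>p\<in>confs m B. \<Sum>s\<in>confs m A. f (restr (ovr A s p) A) * h (restr (ovr A s p) B))"
  unfolding sum_confs_split[OF Un_upper1[of A B]] e ..
 also have "... = (\<Sum>p\<in>confs m B. \<Sum>s\<in>confs m A. f s * h p)"
 proof (intro sum.cong refl)
  fix p s assume r: "p : confs m B" "s : confs m A"
  have "restr (ovr A s p) B = restr p B" by (rule restr_ovr_disjoint) (use d in blast)
  then show "f (restr (ovr A s p) A) * h (restr (ovr A s p) B) = f s * h p"
   using restr_ovr[OF r(2)] restr_id[OF r(1)] by simp
 qed
 also have "... = (\<Sum>s\<in>confs m A. f s) * (\<Sum>s\<in>confs m B. h s)" by (simp only: sum_product sum.swap[of _ "confs m B"])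
 finally show ?thesis .
qed

lemma mob_zero:
 assumes B: "finite B" "x : B" and f: "!!D. D \<subseteq> B - {x} ==> f (insert x D) = f D"
 shows "mob f B = 0"
proof -
 have "mob f (insert x (B - {x})) = mob (%D. f (insert x D) - f D) (B - {x})" by (rule mob_insert) (use B in auto)
 also have "... = mob (%D. 0) (B - {x})" by (rule mob_cong) (simp add: f)
 also have "insert x (B - {x}) = B" using B by blast
 finally show ?thesis by (simp add: mob_def)
qed

lemma disconnected_split:
 assumes B: "B ~= {}" "~ connected_Zd B"
 obtains B1 B2 where "B = B1 Un B2" "B1 Int B2 = {}" "B1 ~= {}" "B2 ~= {}" "!!x y. x : B1 ==> y : B2 ==> l1dist x y ~= 1"
proof -
 let ?r = "{(u, v). u : B & v : B & l1dist u v = 1}"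
 obtain x y where xy: "x : B" "y : B" "(x, y) ~: ?r\<^sup>*" using B unfolding connected_Zd_def by blast
 define B1 where "B1 = {z\<in>B. (x, z) : ?r\<^sup>*}"
 show ?thesis
 proof (rule that[of B1 "B - B1"])
  fix z w assume z: "z : B1" and w: "w : B - B1"
  show "l1dist z w ~= 1"
  proof
   assume "l1dist z w = 1"
   then have "(z, w) : ?r" using z w by (auto simp: B1_def)
   then have "(x, w) : ?r\<^sup>*" using z unfolding B1_def by (auto intro: rtrancl_into_rtrancl)
   then show False using w by (auto simp: B1_def)
  qed
 qed (use xy in "auto simp: B1_def")
qed

context restricted_state
begin

lemma tr_Un:
 assumes AB: "finite A" "finite B" "A Int B = {}" "!!x y. x : A ==> y : B ==> l1dist x y ~= 1"
 shows "tr b (A Un B) y = tr b A y * tr b B y"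
proof -
 let ?S = "confs m (A Un B)"
 let ?f = "%A s t. E b A s t * (\<Prod>i\<in>A. Ob (y i) (t i) (s i))"
 have "?f (A Un B) s t = ?f A (restr s A) (restr t A) * ?f B (restr s B) (restr t B)" if st: "s : ?S" "t : ?S" for s t
 proof -
  have 1: "(\<Prod>i\<in>A Un B. Ob (y i) (t i) (s i)) = (\<Prod>i\<in>A. Ob (y i) (t i) (s i)) * (\<Prod>i\<in>B. Ob (y i) (t i) (s i))"
   by (rule prod.union_disjoint[OF AB(1-3)])
  have 2: "(\<Prod>i\<in>C. Ob (y i) (restr t C i) (restr s C i)) = (\<Prod>i\<in>C. Ob (y i) (t i) (s i))" for C
   by (rule prod.cong) (auto simp: restr_def)
  have 3: "E b (A Un B) s t = E b A (restr s A) (restr t A) * E b B (restr s B) (restr t B)"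
   unfolding E_def by (rule mexp_Un[OF int\<Phi> AB st])
  show ?thesis unfolding 1 2 3 by (simp only: mult_ac)
 qed
 then have "tr b (A Un B) y = (\<Sum>s\<in>?S. \<Sum>t\<in>?S. ?f A (restr s A) (restr t A) * ?f B (restr s B) (restr t B))"
  unfolding tr_eq by (intro sum.cong refl)
 also have "... = (\<Sum>s\<in>?S. (\<Sum>t\<in>confs m A. ?f A (restr s A) t) * (\<Sum>t\<in>confs m B. ?f B (restr s B) t))"
  by (intro sum.cong refl sum_confs_product[OF AB(3)])
 also have "... = tr b A y * tr b B y"
  unfolding tr_eq by (rule sum_confs_product[OF AB(3)])
 finally show ?thesis .
qed

lemma lw_Un:
 assumes b: "\<beta>0 <= b" and AB: "finite A" "finite B" "A Int B = {}" "!!x y. x : A ==> y : B ==> l1dist x y ~= 1"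
  and y: "ALL i. y i : outs"
 shows "lw b (A Un B) y = lw b A y + lw b B y"
proof -
 have f: "finite (A Un B)" using AB by simp
 have "mtrace (confs m (A Un B)) (E b (A Un B)) = mtrace (confs m A) (E b A) * mtrace (confs m B) (E b B)"
  using tr_Un[OF AB, of b "%_. None"] by (simp only: tr_None AB(1,2) f)
 then have "Re (mtrace (confs m (A Un B)) (E b (A Un B))) = Re (mtrace (confs m A) (E b A)) * Re (mtrace (confs m B) (E b B))"
  using trE(2)[OF AB(1), of b] by simp
 moreover have "Re (tr b (A Un B) y) = Re (tr b A y) * Re (tr b B y)"
 proof -
  have "tr b (A Un B) y = tr b A y * tr b B y" by (rule tr_Un[OF AB])
  then show ?thesis using tr_nonneg(2)[OF AB(1) y, of b] by simp
 qed
 moreover have "(\<Prod>i\<in>A Un B. wt (y i)) = (\<Prod>i\<in>A. wt (y i)) * (\<Prod>i\<in>B. wt (y i))"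
  by (rule prod.union_disjoint[OF AB(1-3)])
 ultimately have "wgt b (A Un B) y = wgt b A y * wgt b B y"
  unfolding wgt_real[OF f y] wgt_real[OF AB(1) y] wgt_real[OF AB(2) y] by simp
 then show ?thesis
  unfolding lw_def using wgt_pos[OF b AB(1) y] wgt_pos[OF b AB(2) y] by (simp add: ln_mult)
qed

text \<open>For separated parts the weights multiply, so \<open>lw\<close> is a sum of two
  functions, each blind to one part. In the zero temperature limit this leaves connected sets, of
  which only finitely many of bounded size pass through a given site.\<close>

lemma GG_disconnected:
 assumes b: "\<beta>0 <= b" and B: "finite B" "B ~= {}" "~ connected_Zd B" and y: "ALL i. y i : outs"
 shows "GG b B y = 0"
proof -
 obtain B1 B2 where s: "B = B1 Un B2" "B1 Int B2 = {}" "B1 ~= {}" "B2 ~= {}" "!!x y. x : B1 ==> y : B2 ==> l1dist x y ~= 1"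
  by (rule disconnected_split[OF B(2,3)]) blast
 have fin: "finite B1" "finite B2" using B s(1) by auto
 have "mob (%D. lw b D y) B = mob (%D. lw b (D Int B1) y + lw b (D Int B2) y) B"
 proof (rule mob_cong)
  fix D assume "D \<subseteq> B"
  then have "D = (D Int B1) Un (D Int B2)" using s by blast
  then have "lw b D y = lw b ((D Int B1) Un (D Int B2)) y" by simp
  also have "... = lw b (D Int B1) y + lw b (D Int B2) y"
   by (rule lw_Un[OF b _ _ _ _ y]) (use fin s in auto)
  finally show "lw b D y = lw b (D Int B1) y + lw b (D Int B2) y" .
 qed
 also have "... = mob (%D. lw b (D Int B1) y) B + mob (%D. lw b (D Int B2) y) B" by (rule mob_add)
 also have "mob (%D. lw b (D Int B1) y) B = 0"
 proof -
  obtain x where x: "x : B2" using s by blast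
  have "insert x D Int B1 = D Int B1" for D using x s by blast
  then show ?thesis by (intro mob_zero[OF B(1), of x]) (use x s in simp_all)
 qed
 also have "mob (%D. lw b (D Int B2) y) B = 0"
 proof -
  obtain x where x: "x : B1" using s by blast
  have "insert x D Int B2 = D Int B2" for D using x s by blast
  then show ?thesis by (intro mob_zero[OF B(1), of x]) (use x s in simp_all)
 qed
 finally show ?thesis by (simp add: GG_def B)
qed

text \<open>A bound uniform in \<open>b\<close> keeps the weights away from 0, so that their limit
  is positive and the logarithms converge as well.\<close>

lemma lw_abs:
 assumes b: "\<beta>0 <= b" and D: "finite D" and y: "ALL i. y i : outs"
 shows "\<bar>lw b D y\<bar> <= 16 * card D"
proof -
 have E0: "GG b {} y = 0"
 proof -
  have "lw b {} y = lw b {} (%_. None)" by (rule lw_local) simp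
  then show ?thesis by (simp add: GG_def mob_def lw_None)
 qed
 have "\<bar>lw b D y\<bar> <= (\<Sum>B\<in>Pow D. \<bar>GG b B y\<bar>)"
  unfolding sum_GG[OF D, symmetric] by (rule sum_abs)
 also have "... <= (\<Sum>B\<in>Pow D. 2 ^ card B * \<bar>GG b B y\<bar>)"
  by (intro sum_mono) (simp add: mult_le_cancel_right1)
 also have "... <= real (card D) * 16"
 proof (rule sum_le_by_sites[OF D])
  fix i show "(\<Sum>B | B : Pow D & i : B. 2 ^ card B * \<bar>GG b B y\<bar>) <= 16"
   using GG_bound[OF b D, of "%_. y" i] y by simp
 qed (use D E0 in "auto simp: Int_absorb2")
 finally show ?thesis by simp
qed

lemma wgt_converges:
 assumes D: "finite D"
 shows "EX l. ((%b. wgt b D y) \<longlongrightarrow> l) at_top"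
proof -
 let ?S = "confs m D" and ?tr = "%b. mtrace (confs m D) (E b D)"
 obtain R where R: "!!s t. s : ?S ==> t : ?S ==> ((%b. E b D s t / ?tr b) \<longlongrightarrow> R s t) at_top"
  using ground_state_limit[OF finite_confs[OF D] confs_nonempty[OF m_pos] ham\<Phi>_herm[OF D]] unfolding E_def by blast
 have "((%b. Re (\<Sum>s\<in>?S. \<Sum>t\<in>?S. E b D s t / ?tr b * (\<Prod>i\<in>D. Ob (y i) (t i) (s i))) / (\<Prod>i\<in>D. wt (y i)))
  \<longlongrightarrow> Re (\<Sum>s\<in>?S. \<Sum>t\<in>?S. R s t * (\<Prod>i\<in>D. Ob (y i) (t i) (s i))) * inverse (\<Prod>i\<in>D. wt (y i))) at_top"
  unfolding divide_inverse[of "Re _"] by (intro tendsto_mult_right tendsto_Re tendsto_sum R)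
 moreover have "wgt b D y = Re (\<Sum>s\<in>?S. \<Sum>t\<in>?S. E b D s t / ?tr b * (\<Prod>i\<in>D. Ob (y i) (t i) (s i))) / (\<Prod>i\<in>D. wt (y i))" for b
  unfolding wgt_def tr_eq sum_divide_distrib by (simp only: times_divide_eq_left)
 ultimately show ?thesis by auto
qed

definition lwi :: "'d site set => ('d site => real option) => real" where
 "lwi D y = Lim at_top (%b. lw b D y)"

definition GGi :: "'d site set => ('d site => real option) => real" where
 "GGi B y = (if finite B then mob (%D. lwi D y) B else 0)"

lemma lw_lim:
 assumes D: "finite D" and y: "ALL i. y i : outs"
 shows "((%b. lw b D y) \<longlongrightarrow> lwi D y) at_top"
proof -
 obtain l where l: "((%b. wgt b D y) \<longlongrightarrow> l) at_top" using wgt_converges[OF D] by blast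
 have "exp (- (16 * real (card D))) <= l"
 proof (rule tendsto_lowerbound[OF l])
  show "eventually (%b. exp (- (16 * real (card D))) <= wgt b D y) at_top"
   using eventually_ge_at_top[of \<beta>0]
  proof eventually_elim
   case (elim b)
   have "exp (- (16 * real (card D))) <= exp (lw b D y)" using lw_abs[OF elim D y] by simp
   then show ?case unfolding lw_def using wgt_pos[OF elim D y] by simp
  qed
 qed simp
 then have "0 < l" using exp_gt_zero less_le_trans by blast
 then have "((%b. lw b D y) \<longlongrightarrow> ln l) at_top" unfolding lw_def by (intro tendsto_ln l) simp
 then show ?thesis unfolding lwi_def using tendsto_Lim[OF trivial_limit_at_top_linorder] by metis
qed

lemma GG_lim:
 assumes B: "finite B" and y: "ALL i. y i : outs"
 shows "((%b. GG b B y) \<longlongrightarrow> GGi B y) at_top"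
 unfolding GG_def GGi_def mob_def
 using B by (auto intro!: tendsto_sum tendsto_mult_left lw_lim[OF finite_subset[OF _ B] y])

lemma fvw_lim:
 assumes D: "finite D" and e: "!!j. j : V ==> e j : spX"
 shows "((%b. fvw c (GG b) D V e) \<longlongrightarrow> fvw c GGi D V e) at_top"
 unfolding fvw_def
 by (intro tendsto_mult_left tendsto_exp tendsto_sum GG_lim) (use e finite_subset[OF _ D] in "auto simp: fld_def")

text \<open>Every condition involves finitely many sets at a time and is closed under pointwise
  limits, so it passes from \<open>GG b\<close> to \<open>GGi\<close> with the same constant
  16.\<close>

theorem gibbs_data_inf: "gibbs_data spX c GGi 16"
proof
 show "finite spX" "spX ~= {}" by (rule spX)+
 show "0 < c a" if "a : spX" for a using that by (intro wt_pos) simp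
 have loc: "lwi D y = lwi D y'" if "!!i. i : D ==> y i = y' i" for D y y'
  unfolding lwi_def using lw_local[of D y y'] that by simp
 have none: "lwi D (%_. None) = 0" if "finite D" for D
  unfolding lwi_def lw_None[OF that] by (rule tendsto_Lim) simp_all
 have sh: "lwi (shift a ` D) y = lwi D (y o shift a)" if "finite D" for a D y
  unfolding lwi_def lw_shift[OF that] ..
 have G: "GGi = fmob lwi" by (intro ext) (simp add: GGi_def fmob_def)
 show "GGi B y = GGi B y'" if "!!i. i : B ==> y i = y' i" for B y y'
  unfolding G by (intro fmob_cong loc) (use that in blast)
 show "GGi B (%_. None) = 0" for B unfolding G by (intro fmob_0 none)
 show "GGi (shift a ` B) y = GGi B (y o shift a)" for a B y unfolding G by (intro fmob_shift sh)
 show "(\<Sum>B | B \<subseteq> L & i : B. 2 ^ card B * \<bar>GGi B (yB B)\<bar>) <= 16"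
  if L: "finite L" and y: "!!B j. yB B j : outs" for L i yB
 proof (rule tendsto_upperbound)
  show "((%b. \<Sum>B | B \<subseteq> L & i : B. 2 ^ card B * \<bar>GG b B (yB B)\<bar>) \<longlongrightarrow> (\<Sum>B | B \<subseteq> L & i : B. 2 ^ card B * \<bar>GGi B (yB B)\<bar>)) at_top"
   by (intro tendsto_sum tendsto_mult_left tendsto_rabs GG_lim) (use y finite_subset[OF _ L] in auto)
  show "eventually (%b. (\<Sum>B | B \<subseteq> L & i : B. 2 ^ card B * \<bar>GG b B (yB B)\<bar>) <= 16) at_top"
   using eventually_ge_at_top[of \<beta>0] by eventually_elim (rule GG_bound[OF _ L y])
 qed simp
 show "(\<Sum>a\<in>spX. fvw c GGi L (insert i V) (e(i := a))) = fvw c GGi L V e"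
  if V: "finite L" "V \<subseteq> L" "i : L" "i ~: V" and e: "!!j. j : V ==> e j : spX" for L i V e
 proof (rule tendsto_unique)
  show "((%b. \<Sum>a\<in>spX. fvw c (GG b) L (insert i V) (e(i := a))) \<longlongrightarrow> (\<Sum>a\<in>spX. fvw c GGi L (insert i V) (e(i := a)))) at_top"
   by (intro tendsto_sum fvw_lim[OF V(1)]) (use e in auto)
  have "eventually (%b. fvw c (GG b) L V e = (\<Sum>a\<in>spX. fvw c (GG b) L (insert i V) (e(i := a)))) at_top"
   using eventually_ge_at_top[of \<beta>0]
  proof eventually_elim
   case (elim b)
   show ?case by (rule gibbs_data.cons[OF gibbs_data_beta[OF elim] V, symmetric]) (use e in blast)
  qed
  with fvw_lim[OF V(1), of V e] e
  show "((%b. \<Sum>a\<in>spX. fvw c (GG b) L (insert i V) (e(i := a))) \<longlongrightarrow> fvw c GGi L V e) at_top"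
   by (blast intro: Lim_transform_eventually)
 qed simp
qed

text \<open>The ground state is the limit of infinite-volume states, whereas \<open>GGi\<close> is
  built from limits in finite volume. The exchange is \<open>infsum_limit\<close> with the size of a
  set as weight and the connected sets as \<open>K\<close>.\<close>

lemma ivw_lim:
 assumes V: "finite V" and e: "!!j. j : V ==> e j : spX"
 shows "((%b. gibbs_data.ivw c (GG b) V e) \<longlongrightarrow> gibbs_data.ivw c GGi V e) at_top"
proof -
 let ?y = "fld V e"
 have y: "ALL i. ?y i : outs" using e by (auto simp: fld_def)
 have "((%b. infsum (%B. GG b B ?y) (touching V)) \<longlongrightarrow> infsum (%B. GGi B ?y) (touching V)) at_top"
 proof (rule infsum_limit[where bmin = \<beta>0 and s = card and C = "real (card V) * 16" and K = "Collect connected_Zd"])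
  show "((%b. GG b B ?y) \<longlongrightarrow> GGi B ?y) at_top" if "B : touching V" for B
   using that by (intro GG_lim y) (simp add: touching_def)
  show "(\<Sum>B\<in>F. 2 ^ card B * \<bar>GG b B ?y\<bar>) <= real (card V) * 16" if b: "\<beta>0 <= b" and F: "finite F" "F \<subseteq> touching V" for b F
  proof -
   interpret gibbs_data spX c "GG b" 16 by (rule gibbs_data_beta[OF b])
   have "(\<Sum>B\<in>F. 2 ^ card B * \<bar>GG b B ?y\<bar>) <= (\<Sum>B\<in>F. 2 ^ card B * sG B)"
    by (intro sum_mono mult_left_mono G_le) (use F y in "auto simp: touching_def")
   also have "... <= real (card V) * 16" by (rule sum_sG_le[OF V F])
   finally show ?thesis .
  qed
  show "GG b B ?y = 0" if "\<beta>0 <= b" "B : touching V" "B ~: Collect connected_Zd" for b B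
   by (rule GG_disconnected[OF that(1) _ _ _ y]) (use that in "auto simp: touching_def")
  show "finite {B : touching V Int Collect connected_Zd. card B <= R}" for R
  proof (rule finite_subset)
   show "{B : touching V Int Collect connected_Zd. card B <= R} \<subseteq> (\<Union>i\<in>V. {B. finite B & connected_Zd B & i : B & card B <= R})"
    by (auto simp: touching_def)
   show "finite (\<Union>i\<in>V. {B. finite B & connected_Zd B & i : B & card B <= R})" using V finite_connected by blast
  qed
 qed
 then have lim: "((%b. (\<Prod>i\<in>V. c (e i)) * exp (infsum (%B. GG b B ?y) (touching V))) \<longlongrightarrow> gibbs_data.ivw c GGi V e) at_top"
  unfolding gibbs_data.ivw_def[OF gibbs_data_inf] by (intro tendsto_mult_left tendsto_exp)
 have "eventually (%b. (\<Prod>i\<in>V. c (e i)) * exp (infsum (%B. GG b B ?y) (touching V)) = gibbs_data.ivw c (GG b) V e) at_top"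
  using eventually_ge_at_top[of \<beta>0]
 proof eventually_elim
  case (elim b)
  show ?case by (rule gibbs_data.ivw_def[OF gibbs_data_beta[OF elim], symmetric])
 qed
 with lim show ?thesis by (rule Lim_transform_eventually)
qed

theorem ground_gibbsian: "\<exists>\<mu>. classical_restriction_gs m \<Phi> spX Q \<mu> & gibbsian spX \<mu>"
proof -
 interpret gibbs_data spX c GGi 16 by (rule gibbs_data_inf)
 obtain \<mu> where \<mu>: "is_prob_on_Omega spX \<mu>" "gibbsian spX \<mu>"
  "!!V e. finite V ==> e : PiE V (%_. spX) ==> measure \<mu> (cyl spX V e) = ivw V e"
  using ex_gibbsian by blast
 have "((%b. mu_lim m \<Phi> Q b V e) \<longlongrightarrow> measure \<mu> (cyl spX V e)) at_top"
  if V: "finite V" "e : PiE V (%_. spX)" for V e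
 proof -
  have e: "e j : spX" if "j : V" for j using V that by auto
  have "eventually (%b. gibbs_data.ivw c (GG b) V e = mu_lim m \<Phi> Q b V e) at_top"
   using eventually_ge_at_top[of \<beta>0]
  proof eventually_elim
   case (elim b)
   show ?case unfolding mu_lim_def
    by (rule tendsto_Lim[symmetric, OF _ mu_fin_lim[OF elim V(1) e]]) simp_all
  qed
  with ivw_lim[of V e, OF V(1) e] show ?thesis unfolding \<mu>(3)[OF V] by (rule Lim_transform_eventually)
 qed
 then have "classical_restriction_gs m \<Phi> spX Q \<mu>" using \<mu>(1) by (simp add: classical_restriction_gs_def)
 then show ?thesis using \<mu>(2) by blast
qed

end

theorem theorem2:
  fixes m :: nat and \<Phi>0 :: "'d::finite site set \<Rightarrow> 'd op" and P X :: smat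
    and spX :: "real set" and Q :: "real \<Rightarrow> smat"
  assumes A1: "assumption1 m \<Phi>0 P"
    and A2: "assumption2 m X spX Q P"
  shows "\<exists>\<kappa>min>0. \<exists>\<beta>min>0. \<forall>\<kappa> \<Upsilon>.
           \<kappa> \<ge> \<kappa>min \<and> interaction m \<Upsilon> \<and> int_norm m \<kappa> \<Upsilon> \<le> 1 \<longrightarrow>
             (\<forall>\<beta>\<ge>\<beta>min. \<exists>\<mu>. classical_restriction_eq m (\<lambda>A. \<lambda>\<sigma> \<tau>. \<Phi>0 A \<sigma> \<tau> + \<Upsilon> A \<sigma> \<tau>) spX Q \<beta> \<mu>
                              \<and> gibbsian spX \<mu>) \<and>
             (\<exists>\<mu>. classical_restriction_gs m (\<lambda>A. \<lambda>\<sigma> \<tau>. \<Phi>0 A \<sigma> \<tau> + \<Upsilon> A \<sigma> \<tau>) spX Q \<mu>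
                   \<and> gibbsian spX \<mu>)"
proof -
 note A = A1[unfolded assumption1_def]
 have "proj1 m P" using A by (elim conjE)
 then obtain u where u: "(\<Sum>i<m. (cmod (u i))\<^sup>2) = 1" "\<forall>i<m. \<forall>j<m. P i j = u i * cnj (u j)"
  unfolding proj1_def by (elim exE conjE)
 have "EX r. finite_range r \<Phi>0" using A by (elim conjE)
 then obtain r where r: "finite_range r \<Phi>0" ..
 have "\<exists>g>0. ALL L S. finite L --> S \<subseteq> L -->
    psd (confs m L) (%\<sigma> \<tau>. mmul (confs m L) (ham \<Phi>0 L) (PL P L S) \<sigma> \<tau> - complex_of_real (g * real (card S)) * PL P L S \<sigma> \<tau>)"
  using A by (elim conjE)
 then obtain g where g: "g > 0" "ALL L S. finite L --> S \<subseteq> L -->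
    psd (confs m L) (%\<sigma> \<tau>. mmul (confs m L) (ham \<Phi>0 L) (PL P L S) \<sigma> \<tau> - complex_of_real (g * real (card S)) * PL P L S \<sigma> \<tau>)"
  by (elim exE conjE)
 have int0: "interaction m \<Phi>0" using A by (elim conjE)
 have comm: "ALL L S. finite L --> S \<subseteq> L --> (\<forall>\<sigma>\<in>confs m L. \<forall>\<tau>\<in>confs m L.
   mmul (confs m L) (ham \<Phi>0 L) (PL P L S) \<sigma> \<tau> = mmul (confs m L) (PL P L S) (ham \<Phi>0 L) \<sigma> \<tau>)"
  using A by (elim conjE)
 have vac: "ALL L. finite L --> (\<forall>\<sigma>\<in>confs m L. \<forall>\<tau>\<in>confs m L. mmul (confs m L) (ham \<Phi>0 L) (PL P L {}) \<sigma> \<tau> = 0)"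
  using A by (elim conjE)
 have sd: "spectral_decomp m X spX Q" using A2[unfolded assumption2_def] ..
 have pos: "ALL x:spX. Re (\<Sum>i<m. \<Sum>j<m. Q x i j * P j i) > 0" using A2[unfolded assumption2_def] ..
 note sd = sd[unfolded spectral_decomp_def]
 have Qx: "ALL x:spX. (\<forall>i<m. \<forall>j<m. Q x i j = cnj (Q x j i)) & (\<forall>i<m. \<forall>j<m. (\<Sum>k<m. Q x i k * Q x k j) = Q x i j)
   & (\<exists>i<m. \<exists>j<m. Q x i j ~= 0)"
  using sd by (elim conjE)
 have Qsum: "\<forall>i<m. \<forall>j<m. (\<Sum>x\<in>spX. Q x i j) = (if i = j then 1 else 0)" using sd by (elim conjE)
 interpret observable m P u spX Q
 proof
  show "Q x i j = cnj (Q x j i)" if "x : spX" "i < m" "j < m" for x i j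
   using bspec[OF Qx that(1)] that(2,3) by blast
  show "(\<Sum>k<m. Q x i k * Q x k j) = Q x i j" if "x : spX" "i < m" "j < m" for x i j
   using bspec[OF Qx that(1)] that(2,3) by blast
  show "(\<Sum>x\<in>spX. Q x i j) = (if i = j then 1 else 0)" if "i < m" "j < m" for i j
   using Qsum that by blast
  show "finite spX" using sd by (elim conjE)
  show "spX ~= {}" using sd by (elim conjE)
 qed (use u pos in auto)
 define b where "b = real (ball_bound TYPE('d) r)"
 define K where "K = CO * real m ^ 4 * 4 ^ 2 * 2 ^ (2 * (site_degree TYPE('d) + 4) + 2)"
 \<comment> \<open>Solves \<open>4 * exp (1 - L) * K = 1\<close>, the smallness condition of the
   gas.\<close>
 define L where "L = 1 + ln (4 * K)"
 \<comment> \<open>Thick enough slabs: the gap factor of an excited site has to supply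
   \<open>exp (- b * L)\<close>. The lower bound 1 keeps \<open>ln (4 * \<beta>min)\<close>
   nonnegative.\<close>
 define \<beta>min where "\<beta>min = max 1 (b * L / g)"
 \<comment> \<open>Solves \<open>4 * \<beta>min <= exp (\<kappa> - b * L)\<close> for
   \<open>\<kappa>\<close>; the added 1 gives strict positivity.\<close>
 define \<kappa>min where "\<kappa>min = b * L + ln (4 * \<beta>min) + 1"
 have K: "1 <= K"
 proof -
  have "1 * 1 * 1 * 1 <= K" unfolding K_def
   by (intro mult_mono CO_ge_1) (use m_pos CO_ge_1 in "auto simp: one_le_power")
  then show ?thesis by simp
 qed
 have b: "0 <= b" by (simp add: b_def)
 have L: "1 <= L" unfolding L_def using K by simp
 have \<beta>: "1 <= \<beta>min" "b * L / g <= \<beta>min" by (auto simp: \<beta>min_def)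
 have l4: "0 <= ln (4 * \<beta>min)" using \<beta>(1) by simp
 have \<kappa>: "0 < \<kappa>min" unfolding \<kappa>min_def using b L l4 mult_nonneg_nonneg[of b L] by linarith
 have small: "4 * exp (1 - L) * K <= 1"
  using K by (simp add: L_def exp_minus)
 have main: "restricted_state m P u \<Phi>0 \<Upsilon> r g spX Q \<kappa> \<beta>min L"
  if \<Upsilon>: "\<kappa>min <= \<kappa>" "interaction m \<Upsilon>" "int_norm m \<kappa> \<Upsilon> <= 1" for \<kappa> \<Upsilon>
 proof
  show "real (ball_bound TYPE('d) r) * L <= \<beta>min * g"
   using \<beta>(2) g(1) by (simp add: b_def divide_le_eq)
  show "real (ball_bound TYPE('d) r) * L <= \<kappa>"
   using \<Upsilon>(1) l4 unfolding \<kappa>min_def b_def by linarith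
  have "ln (4 * \<beta>min) <= \<kappa> - real (ball_bound TYPE('d) r) * L"
   using \<Upsilon>(1) unfolding \<kappa>min_def b_def by linarith
  then have "exp (ln (4 * \<beta>min)) <= exp (\<kappa> - real (ball_bound TYPE('d) r) * L)" by (simp only: exp_le_cancel_iff)
  then show "4 * \<beta>min <= exp (\<kappa> - real (ball_bound TYPE('d) r) * L)" using \<beta>(1) by simp
  show "4 * exp (1 - L) * CO * real m ^ 4 * 4 ^ 2 * 2 ^ (2 * (site_degree TYPE('d) + 4) + 2) <= 1"
   using small unfolding K_def by (simp only: mult.assoc)
  show "psd (confs m D) (%\<sigma> \<tau>. mmul (confs m D) (ham \<Phi>0 D) (PL P D T) \<sigma> \<tau> - complex_of_real (g * real (card T)) * PL P D T \<sigma> \<tau>)"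
   if "finite D" "T \<subseteq> D" for D T using g(2) that by blast
  show "commute (confs m D) (ham \<Phi>0 D) (PL P D T)" if "finite D" "T \<subseteq> D" for D T
   unfolding commute_def using comm that by blast
  show "mmul (confs m D) (ham \<Phi>0 D) (PL P D {}) \<sigma> \<tau> = 0" if "finite D" "\<sigma> : confs m D" "\<tau> : confs m D" for D \<sigma> \<tau>
   using vac that by blast
 qed (use \<Upsilon> int0 r g(1) L \<beta>(1) in simp_all)
 show ?thesis
 proof (rule exI[of _ \<kappa>min], rule conjI[OF \<kappa>], rule exI[of _ \<beta>min], intro conjI allI impI)
  fix \<kappa> and \<Upsilon> :: "'d site set => 'd op"
  assume h: "\<kappa>min <= \<kappa> & interaction m \<Upsilon> & int_norm m \<kappa> \<Upsilon> <= 1"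
  then interpret rs: restricted_state m P u \<Phi>0 \<Upsilon> r g spX Q \<kappa> \<beta>min L by (intro main) auto
  show "\<exists>\<mu>. classical_restriction_eq m (%A \<sigma> \<tau>. \<Phi>0 A \<sigma> \<tau> + \<Upsilon> A \<sigma> \<tau>) spX Q \<beta> \<mu> & gibbsian spX \<mu>"
   if "\<beta>min <= \<beta>" for \<beta>
   using rs.equilibrium_gibbsian[OF that] unfolding rs.\<Phi>_def .
  show "\<exists>\<mu>. classical_restriction_gs m (%A \<sigma> \<tau>. \<Phi>0 A \<sigma> \<tau> + \<Upsilon> A \<sigma> \<tau>) spX Q \<mu> & gibbsian spX \<mu>"
   using rs.ground_gibbsian unfolding rs.\<Phi>_def .
 qed (use \<kappa> \<beta> in auto)
qed

end
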